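(* Let $1\le p<r\le\infty$. The Schlumprecht type space $S_{p,r}$ and its dual $S_{p,r}^*$ are not near Hilbert. In particular, $S_{p,r}$ and $S_{p,r}^*$ are ergodic.
   Context: Schlumprecht space $S$: the completion of $c_{00}$ (finitely supported scalar sequences) under the unique norm satisfying $$\|x\|_S=\max\Big\{\|x\|_\infty,\ \sup_{n\ge2}\ \sup_{E_1<\dots<E_n}\frac1{\log_2(n+1)}\sum_{i=1}^n\|E_ix\|_S\Big\},$$ where $E_1<\dots<E_n$ ranges over successive finite subsets (intervals) of $\mathbb N$ and $E_ix$ is the restriction of $x$ to $E_i$. If $X,Y$ are Banach spaces defined by lattice norms on $c_{00}$ and $0<\theta<1$, then $X^{1-\theta}Y^\theta$ is the space defined by the norm $\|z\|=\inf\{\|x\|_X^{1-\theta}\|y\|_Y^\theta:\ |z|=|x|^{1-\theta}|y|^\theta\}$ on $c_{00}$ (operations are coordinatewise). For $1\le p<r\le\infty$, the Schlumprecht type space is $S_{p,r}=\ell_t^{1-\theta}S^\theta$, where $\theta=\frac1p-\frac1r$ and $t=(1-\theta)r$ (with $1/\infty=0$, and $t=\infty$ if $r=\infty$ and $\theta<1$); in the case $p=1$, $r=\infty$ (so $\theta=1$), $S_{1,\infty}=S$. Near Hilbert: for a Banach space $X$ let $p(X)=\sup\{p: X \text{ has type } p\}$ and $q(X)=\inf\{q: X\text{ has cotype } q\}$. $X$ is near Hilbert if $p(X)=q(X)=2$. Ergodic: for a separable Banach space $X$, $\mathcal{SB}(X)$ is the set of infinite-dimensional closed linear subspaces of $X$,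 equipped with the (relative) Effros Borel structure, i.e. the $\sigma$-algebra generated by the sets $\{F: F\cap U\neq\emptyset\}$, $U\subseteq X$ open. $E_0$ is the equivalence relation on $2^{\mathbb N}$ given by $xE_0y$ iff there is $N$ with $x(n)=y(n)$ for all $n\ge N$. A separable Banach space $X$ is ergodic if there is a Borel map $\phi:2^{\mathbb N}\to\mathcal{SB}(X)$ such that for all $x,y$: $xE_0y$ iff $\phi(x)$ is (linearly) isomorphic to $\phi(y)$. *)

theory Defs
  imports "HOL-Analysis.Analysis" "HOL-Library.Function_Algebras"
begin

section \<open>Normed spaces of scalar-valued functions\<close>

text \<open>
  The space \<open>S\<^sub>p\<^sub>,\<^sub>r\<close> depends on the parameters \<open>p\<close> and \<open>r\<close>, so it is given by a carrier set
  rather than by a type. All spaces involved consist of scalar-valued functions with pointwise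
  operations: sequences for \<open>S\<^sub>p\<^sub>,\<^sub>r\<close>, functionals on sequences for its dual. The scalar type
  \<open>'k\<close> is kept generic in order to cover the types \<open>real\<close> and \<open>complex\<close> at once.
\<close>

record ('i, 'k) fspace =
  vecs :: "('i \<Rightarrow> 'k) set"
  nrm :: "('i \<Rightarrow> 'k) \<Rightarrow> real"

definition fscale :: "'k::times \<Rightarrow> ('i \<Rightarrow> 'k) \<Rightarrow> 'i \<Rightarrow> 'k"
  where "fscale a x = (\<lambda>i. a * x i)"

definition is_norm_on :: "('i \<Rightarrow> 'k::real_normed_field) set \<Rightarrow> (('i \<Rightarrow> 'k) \<Rightarrow> real) \<Rightarrow> bool"
  where "is_norm_on V N \<longleftrightarrow>
    (\<forall>x\<in>V. 0 \<le> N x \<and> (N x = 0 \<longleftrightarrow> x = 0)) \<and>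
    (\<forall>x\<in>V. \<forall>a. N (fscale a x) = norm a * N x) \<and>
    (\<forall>x\<in>V. \<forall>y\<in>V. N (x + y) \<le> N x + N y)"

text \<open>The value \<open>0\<close> outside \<open>V\<close> is there because the locale \<open>Metric_space\<close> requires a distance to be
  nonnegative and symmetric on the whole type.\<close>

definition norm_dist ::
    "('i \<Rightarrow> 'k::real_normed_field) set \<Rightarrow> (('i \<Rightarrow> 'k) \<Rightarrow> real) \<Rightarrow> ('i \<Rightarrow> 'k) \<Rightarrow> ('i \<Rightarrow> 'k) \<Rightarrow> real"
  where "norm_dist V N x y = (if x \<in> V \<and> y \<in> V then N (x - y) else 0)"

definition norm_topology :: "('i, 'k::real_normed_field) fspace \<Rightarrow> ('i \<Rightarrow> 'k) topology"
  where "norm_topology X = Metric_space.mtopology (vecs X) (norm_dist (vecs X) (nrm X))"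

text \<open>Functionals are extended by \<open>0\<close> outside the carrier, so that equality of functionals
  is equality on the space.\<close>

definition dual_space :: "('i, 'k::real_normed_field) fspace \<Rightarrow> ('i \<Rightarrow> 'k, 'k) fspace"
  where "dual_space X =
    \<lparr>vecs = {f. (\<forall>x. x \<notin> vecs X \<longrightarrow> f x = 0) \<and>
                (\<forall>x\<in>vecs X. \<forall>y\<in>vecs X. f (x + y) = f x + f y) \<and>
                (\<forall>x\<in>vecs X. \<forall>a. f (fscale a x) = a * f x) \<and>
                (\<exists>C. \<forall>x\<in>vecs X. norm (f x) \<le> C * nrm X x)},
     nrm = (\<lambda>f. Sup {norm (f x) | x. x \<in> vecs X \<and> nrm X x \<le> 1})\<rparr>"


section \<open>Type, cotype and near Hilbert spaces\<close>

text \<open>Type and cotype compare with \<open>(E \<parallel>\<Sum> \<epsilon>\<^sub>i x\<^sub>i\<parallel>\<^sup>s)\<^sup>1\<^sup>/\<^sup>s\<close> for independent uniform signs; by Kahane's inequality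
  any other exponent in this mean gives the same notions.\<close>

definition sign_mean ::
    "real \<Rightarrow> ('i, 'k::real_normed_field) fspace \<Rightarrow> nat \<Rightarrow> (nat \<Rightarrow> 'i \<Rightarrow> 'k) \<Rightarrow> real"
  where "sign_mean s X n x =
    ((\<Sum>\<epsilon>\<in>{..<n} \<rightarrow>\<^sub>E {-1, 1}. nrm X (\<Sum>i<n. fscale (\<epsilon> i) (x i)) powr s) / 2 ^ n) powr (1 / s)"

definition has_type :: "('i, 'k::real_normed_field) fspace \<Rightarrow> real \<Rightarrow> bool"
  where "has_type X s \<longleftrightarrow> 1 \<le> s \<and> s \<le> 2 \<and>
    (\<exists>C. \<forall>n x. (\<forall>i<n. x i \<in> vecs X) \<longrightarrow>
      sign_mean s X n x \<le> C * (\<Sum>i<n. nrm X (x i) powr s) powr (1 / s))"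

definition has_cotype :: "('i, 'k::real_normed_field) fspace \<Rightarrow> real \<Rightarrow> bool"
  where "has_cotype X s \<longleftrightarrow> 2 \<le> s \<and>
    (\<exists>C. \<forall>n x. (\<forall>i<n. x i \<in> vecs X) \<longrightarrow>
      (\<Sum>i<n. nrm X (x i) powr s) powr (1 / s) \<le> C * sign_mean s X n x)"

text \<open>Extended reals are used because \<open>Inf {} = \<infinity>\<close> is the right value for a space without
  finite cotype.\<close>

definition type_index :: "('i, 'k::real_normed_field) fspace \<Rightarrow> ereal"
  where "type_index X = Sup (ereal ` {s. has_type X s})"

definition cotype_index :: "('i, 'k::real_normed_field) fspace \<Rightarrow> ereal"
  where "cotype_index X = Inf (ereal ` {s. has_cotype X s})"

definition near_hilbert :: "('i, 'k::real_normed_field) fspace \<Rightarrow> bool"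
  where "near_hilbert X \<longleftrightarrow> type_index X = 2 \<and> cotype_index X = 2"


section \<open>Ergodic spaces\<close>

definition SB :: "('i, 'k::real_normed_field) fspace \<Rightarrow> ('i \<Rightarrow> 'k) set set"
  where "SB X = {Y. Y \<subseteq> vecs X \<and> module.subspace fscale Y \<and> closedin (norm_topology X) Y \<and>
                   \<not> (\<exists>B. finite B \<and> Y \<subseteq> module.span fscale B)}"

definition effros :: "('i, 'k::real_normed_field) fspace \<Rightarrow> ('i \<Rightarrow> 'k) set measure"
  where "effros X = sigma (SB X) {{F \<in> SB X. F \<inter> U \<noteq> {}} | U. openin (norm_topology X) U}"

definition isomorphic_subspaces ::
    "('i, 'k::real_normed_field) fspace \<Rightarrow> ('i \<Rightarrow> 'k) set \<Rightarrow> ('i \<Rightarrow> 'k) set \<Rightarrow> bool"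
  where "isomorphic_subspaces X Y Z \<longleftrightarrow>
    (\<exists>T. bij_betw T Y Z \<and>
         (\<forall>x\<in>Y. \<forall>y\<in>Y. T (x + y) = T x + T y) \<and>
         (\<forall>x\<in>Y. \<forall>a. T (fscale a x) = fscale a (T x)) \<and>
         (\<exists>C. \<forall>x\<in>Y. nrm X (T x) \<le> C * nrm X x \<and> nrm X x \<le> C * nrm X (T x)))"

definition E0 :: "(nat \<Rightarrow> bool) \<Rightarrow> (nat \<Rightarrow> bool) \<Rightarrow> bool"
  where "E0 x y \<longleftrightarrow> (\<exists>N. \<forall>n\<ge>N. x n = y n)"

definition ergodic :: "('i, 'k::real_normed_field) fspace \<Rightarrow> bool"
  where "ergodic X \<longleftrightarrow> separable_space (norm_topology X) \<and>
    (\<exists>\<phi> \<in> borel \<rightarrow>\<^sub>M effros X. \<forall>x y. E0 x y \<longleftrightarrow> isomorphic_subspaces X (\<phi> x) (\<phi> y))"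


section \<open>Completions of norms on finitely supported sequences\<close>

definition c00 :: "(nat \<Rightarrow> 'k::zero) set"
  where "c00 = {x. finite {n. x n \<noteq> 0}}"

text \<open>
  For a lattice norm \<open>N\<close> on \<open>c00\<close>, every \<open>N\<close>-Cauchy sequence in \<open>c00\<close> converges coordinatewise,
  and if its coordinatewise limit is \<open>0\<close> then it is \<open>N\<close>-null. Hence the completion of \<open>(c00, N)\<close>
  is the space of coordinatewise limits of \<open>N\<close>-Cauchy sequences, and the norm of such a limit is
  the limit of the norms, whichever Cauchy sequence is used.
\<close>

definition represents ::
    "((nat \<Rightarrow> 'k::real_normed_field) \<Rightarrow> real) \<Rightarrow> (nat \<Rightarrow> nat \<Rightarrow> 'k) \<Rightarrow> (nat \<Rightarrow> 'k) \<Rightarrow> bool"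
  where "represents N u x \<longleftrightarrow>
    Metric_space.MCauchy c00 (norm_dist c00 N) u \<and> (\<forall>n. (\<lambda>k. u k n) \<longlonglongrightarrow> x n)"

definition completion :: "((nat \<Rightarrow> 'k::real_normed_field) \<Rightarrow> real) \<Rightarrow> (nat, 'k) fspace"
  where "completion N =
    \<lparr>vecs = {x. \<exists>u. represents N u x},
     nrm = (\<lambda>x. THE l. \<forall>u. represents N u x \<longrightarrow> (\<lambda>k. N (u k)) \<longlonglongrightarrow> l)\<rparr>"


section \<open>Schlumprecht type spaces\<close>

definition sup_norm :: "(nat \<Rightarrow> 'k::real_normed_field) \<Rightarrow> real"
  where "sup_norm x = (SUP n. norm (x n))"

definition ell_norm :: "ereal \<Rightarrow> (nat \<Rightarrow> 'k::real_normed_field) \<Rightarrow> real"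
  where "ell_norm t x =
    (if t = \<infinity> then sup_norm x
     else (\<Sum>n | x n \<noteq> 0. norm (x n) powr real_of_ereal t) powr (1 / real_of_ereal t))"

definition restr :: "nat set \<Rightarrow> (nat \<Rightarrow> 'k::zero) \<Rightarrow> nat \<Rightarrow> 'k"
  where "restr E x = (\<lambda>n. if n \<in> E then x n else 0)"

definition successive :: "nat \<Rightarrow> (nat \<Rightarrow> nat set) \<Rightarrow> bool"
  where "successive n E \<longleftrightarrow>
    (\<forall>i<n. finite (E i)) \<and> (\<forall>i j. i < j \<and> j < n \<longrightarrow> (\<forall>a\<in>E i. \<forall>b\<in>E j. a < b))"

definition satisfies_schlumprecht_eq :: "((nat \<Rightarrow> 'k::real_normed_field) \<Rightarrow> real) \<Rightarrow> bool"
  where "satisfies_schlumprecht_eq N \<longleftrightarrow>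
    (\<forall>x\<in>c00. N x = max (sup_norm x)
      (SUP (n, E) \<in> {(n, E). 2 \<le> n \<and> successive n E}.
        1 / log 2 (real n + 1) * (\<Sum>i<n. N (restr (E i) x))))"

text \<open>The value \<open>0\<close> outside \<open>c00\<close> only serves to make the function unique.\<close>

definition schlumprecht_norm :: "(nat \<Rightarrow> 'k::real_normed_field) \<Rightarrow> real"
  where "schlumprecht_norm =
    (THE N. is_norm_on c00 N \<and> satisfies_schlumprecht_eq N \<and> (\<forall>x. x \<notin> c00 \<longrightarrow> N x = 0))"

definition calderon_norm ::
    "real \<Rightarrow> ((nat \<Rightarrow> 'k::real_normed_field) \<Rightarrow> real) \<Rightarrow> ((nat \<Rightarrow> 'k) \<Rightarrow> real) \<Rightarrow>
      (nat \<Rightarrow> 'k) \<Rightarrow> real"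
  where "calderon_norm \<theta> N\<^sub>1 N\<^sub>2 z =
    Inf {N\<^sub>1 x powr (1 - \<theta>) * N\<^sub>2 y powr \<theta> | x y. x \<in> c00 \<and> y \<in> c00 \<and>
         (\<forall>n. norm (z n) = norm (x n) powr (1 - \<theta>) * norm (y n) powr \<theta>)}"

definition schlumprecht_type_norm :: "ereal \<Rightarrow> ereal \<Rightarrow> (nat \<Rightarrow> 'k::real_normed_field) \<Rightarrow> real"
  where "schlumprecht_type_norm p r =
    (if p = 1 \<and> r = \<infinity> then schlumprecht_norm
     else let \<theta> = real_of_ereal (1 / p - 1 / r); t = ereal (1 - \<theta>) * r
          in calderon_norm \<theta> (ell_norm t) schlumprecht_norm)"

definition schlumprecht_type_space :: "ereal \<Rightarrow> ereal \<Rightarrow> (nat, 'k::real_normed_field) fspace"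
  where "schlumprecht_type_space p r = completion (schlumprecht_type_norm p r)"

end

(*
Far out, the Schlumprecht type space contains finite systems of vectors with biorthogonal functionals
that behave like the unit vectors of l_q for a fixed q other than 2. In S itself, long flat vectors give
l_1-systems and interleaved flat vectors of rapidly increasing lengths give l_infinity-systems (Kutzarova
and Lin); the Calderon product with l_t turns them into systems with 1/q = 1/p, or 1/q = 1/r if p = 2.
Such systems contradict type and cotype close to 2. Since S has no l_1 block sequences (an argument of
James together with averages of increasing lengths), neither has the Calderon product, so the coordinate
functionals span the dual, which then has such systems with the conjugate exponent.

For ergodicity, Rademacher averages of these systems give, for every level of the binary tree, two
disjoint copies of a family of vectors indexed by strings, to which Szankowski's construction of a space
without the approximation property applies. A point of the Cantor space selects one copy at each
level and thereby a subspace Y. Points that agree from some level on give subspaces that differ by a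
finite rank perturbation of the identity. If two points split late, then an average of biorthogonal
coefficients is small for every operator of given norm from one subspace to the other, because its values
at consecutive levels differ by the terms of a convergent series. Hence the pairs of points with isomorphic
subspaces form a meager set, and E_0 reduces to any meager relation that contains it.
*)

theory Submission
  imports Defs
begin

section \<open>Inequalities\<close>

text \<open>The ergodic part rests on a competition of two exponents. Over m strings of a fibre,
  signed sums of the functionals grow like m^p, and signed sums of the vectors that occur like m^q.
  Averaging over signs bounds the sum of m diagonal coefficients of a bounded operator by a multiple
  of m^(p+q), which beats the trivial bound m only if p + q < 1. Hilbert space gives p = q = 1/2,
  with no gain. A system of exponent other than 2 has 1 - \<sigma> < 1/2 on one side, and the
  Rademacher averages put 1/2 on the other side, so p + q = 3/2 - \<sigma> < 1. The bound m^q is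
  available although the strings form a fibre, because the generators are so built that the vectors
  in a difference of neighbouring ones belong to strings that are spread. Fibres are exponentially
  large in the level, so the gains m^(p+q-1) are summable over the levels.

  All of this is done for an abstract space with an unconditional basis: the space and its dual are
  both of this kind, and duality only exchanges vectors and functionals.\<close>

lemma hoelder_sum:
 fixes a b :: "'i => real"
 assumes "!!i. i \<in> F ==> 0 \<le> a i" "!!i. i \<in> F ==> 0 \<le> b i" "0 \<le> \<theta>" "\<theta> \<le> 1"
 shows "(\<Sum>i\<in>F. a i powr (1 - \<theta>) * b i powr \<theta>) \<le> (\<Sum>i\<in>F. a i) powr (1 - \<theta>) * (\<Sum>i\<in>F. b i) powr \<theta>"
proof (cases "finite F \<and> (\<Sum>i\<in>F. a i) > 0 \<and> (\<Sum>i\<in>F. b i) > 0")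
 case False
 \<comment> \<open>If one of the two sums vanishes, every term does, also at the endpoints \<theta>
   = 0 and \<theta> = 1, because \<open>0 powr 0 = 0\<close>.\<close>
 have "(\<Sum>i\<in>F. a i powr (1 - \<theta>) * b i powr \<theta>) = 0"
 proof (cases "finite F")
  case True
  hence "(\<Sum>i\<in>F. a i) = 0 \<or> (\<Sum>i\<in>F. b i) = 0"
   using False True assms(1,2) sum_nonneg[of F a] sum_nonneg[of F b] by fastforce
  hence "(\<forall>i\<in>F. a i = 0) \<or> (\<forall>i\<in>F. b i = 0)"
   using True assms(1,2) by (auto simp: sum_nonneg_eq_0_iff)
  thus ?thesis by auto
 qed simp
 thus ?thesis by simp
next
 case True
 define A where "A = (\<Sum>i\<in>F. a i)"
 define B where "B = (\<Sum>i\<in>F. b i)"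
 have pos: "A > 0" "B > 0" using True by (auto simp: A_def B_def)
 have "a i powr (1 - \<theta>) * b i powr \<theta> \<le> A powr (1 - \<theta>) * B powr \<theta> * ((1 - \<theta>) * (a i / A) + \<theta> * (b i / B))"
  if "i \<in> F" for i
 proof (cases "a i = 0 \<or> b i = 0")
  case True
  thus ?thesis using assms pos that by (auto intro!: mult_nonneg_nonneg)
 next
  case False
  hence p: "a i > 0" "b i > 0" using assms(1,2)[OF that] by auto
  have "(a i / A) powr (1 - \<theta>) * (b i / B) powr \<theta> \<le> (1 - \<theta>) * (a i / A) + \<theta> * (b i / B)"
   using Youngs_inequality_0[of "1 - \<theta>" \<theta> "a i / A" "b i / B"] p pos assms(3,4) by simp
  hence "A powr (1 - \<theta>) * B powr \<theta> * ((a i / A) powr (1 - \<theta>) * (b i / B) powr \<theta>)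
    \<le> A powr (1 - \<theta>) * B powr \<theta> * ((1 - \<theta>) * (a i / A) + \<theta> * (b i / B))"
   by (intro mult_left_mono) auto
  moreover have "A powr (1 - \<theta>) * B powr \<theta> * ((a i / A) powr (1 - \<theta>) * (b i / B) powr \<theta>)
    = a i powr (1 - \<theta>) * b i powr \<theta>"
   using p pos by (simp add: powr_divide)
  ultimately show ?thesis by simp
 qed
 hence "(\<Sum>i\<in>F. a i powr (1 - \<theta>) * b i powr \<theta>)
   \<le> (\<Sum>i\<in>F. A powr (1 - \<theta>) * B powr \<theta> * ((1 - \<theta>) * (a i / A) + \<theta> * (b i / B)))"
  by (rule sum_mono)
 also have "... = A powr (1 - \<theta>) * B powr \<theta> * ((1 - \<theta>) * ((\<Sum>i\<in>F. a i) / A) + \<theta> * ((\<Sum>i\<in>F. b i) / B))"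
  by (simp add: sum_distrib_left sum_divide_distrib sum.distrib algebra_simps)
 also have "... = A powr (1 - \<theta>) * B powr \<theta>"
  using pos by (simp add: A_def[symmetric] B_def[symmetric])
 finally show ?thesis by (simp add: A_def B_def)
qed

lemma hoelder_two:
 fixes a b c d :: real
 assumes "0 \<le> a" "0 \<le> b" "0 \<le> c" "0 \<le> d" "0 \<le> \<theta>" "\<theta> \<le> 1"
 shows "a powr (1 - \<theta>) * b powr \<theta> + c powr (1 - \<theta>) * d powr \<theta> \<le> (a + c) powr (1 - \<theta>) * (b + d) powr \<theta>"
 using hoelder_sum[of "{False, True}" "%i. if i then a else c" "%i. if i then b else d" \<theta>] assms
 by (simp add: add.commute)

lemma minkowski_sum:
 fixes a b :: "'i => real"
 assumes "!!i. i \<in> F ==> 0 \<le> a i" "!!i. i \<in> F ==> 0 \<le> b i" "1 \<le> t"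
 shows "(\<Sum>i\<in>F. (a i + b i) powr t) powr (1 / t) \<le> (\<Sum>i\<in>F. a i powr t) powr (1 / t) + (\<Sum>i\<in>F. b i powr t) powr (1 / t)"
proof -
 define M where "M = (\<Sum>i\<in>F. (a i + b i) powr t)"
 have M0: "M \<ge> 0" by (simp add: M_def sum_nonneg)
 \<comment> \<open>In this form Hoelder's inequality with the exponents 1 - 1/t and 1/t applies to
   each of the two halves of the sum.\<close>
 have split: "c powr t = (c powr t) powr (1 - 1 / t) * c" if "c \<ge> 0" for c :: real
  using assms(3) that by (cases "c = 0") (auto simp: powr_powr algebra_simps powr_mult_base powr_diff divide_simps)
 have part: "(\<Sum>i\<in>F. ((a i + b i) powr t) powr (1 - 1 / t) * c i) \<le> M powr (1 - 1 / t) * (\<Sum>i\<in>F. c i powr t) powr (1 / t)"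
  if "!!i. i \<in> F ==> 0 \<le> c i" for c
 proof -
  have "(\<Sum>i\<in>F. ((a i + b i) powr t) powr (1 - 1 / t) * c i) = (\<Sum>i\<in>F. ((a i + b i) powr t) powr (1 - 1 / t) * (c i powr t) powr (1 / t))"
   using assms(3) that by (intro sum.cong) (auto simp: powr_powr)
  also have "... \<le> M powr (1 - 1 / t) * (\<Sum>i\<in>F. c i powr t) powr (1 / t)"
   unfolding M_def using assms(3) by (intro hoelder_sum) auto
  finally show ?thesis .
 qed
 show ?thesis
 proof (cases "M = 0")
  case True
  thus ?thesis by (simp add: M_def)
 next
  case False
  have "M = (\<Sum>i\<in>F. ((a i + b i) powr t) powr (1 - 1 / t) * (a i + b i))"
   unfolding M_def using assms(1,2) by (intro sum.cong refl split) (auto intro: add_nonneg_nonneg)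
  also have "... = (\<Sum>i\<in>F. ((a i + b i) powr t) powr (1 - 1 / t) * a i) + (\<Sum>i\<in>F. ((a i + b i) powr t) powr (1 - 1 / t) * b i)"
   by (simp add: algebra_simps sum.distrib)
  also have "... \<le> M powr (1 - 1 / t) * ((\<Sum>i\<in>F. a i powr t) powr (1 / t) + (\<Sum>i\<in>F. b i powr t) powr (1 / t))"
   using part[of a] part[of b] assms(1,2) by (simp add: algebra_simps)
  finally have "M powr (1 - 1 / t) * M powr (1 / t) \<le> M powr (1 - 1 / t) * ((\<Sum>i\<in>F. a i powr t) powr (1 / t) + (\<Sum>i\<in>F. b i powr t) powr (1 / t))"
   using False M0 by (simp add: powr_add[symmetric])
  thus ?thesis using False by (simp add: M_def)
 qed
qed

lemma power_mean_sum:
 fixes a :: "'i => real"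
 assumes "!!i. i \<in> B ==> 0 \<le> a i" "1 / 2 < \<mu>"
 shows "(\<Sum>i\<in>B. a i powr (1 / \<mu>)) powr \<mu> \<le> real (card B) powr (\<mu> - 1 / 2) * sqrt (\<Sum>i\<in>B. (a i)\<^sup>2)"
proof -
 define \<theta> where "\<theta> = 1 / (2 * \<mu>)"
 have \<theta>: "0 \<le> \<theta>" "\<theta> \<le> 1" "2 * \<theta> = 1 / \<mu>" "\<theta> * \<mu> = 1 / 2" "(1 - \<theta>) * \<mu> = \<mu> - 1 / 2"
  using assms(2) by (auto simp: \<theta>_def divide_simps algebra_simps)
 have "(\<Sum>i\<in>B. a i powr (1 / \<mu>)) = (\<Sum>i\<in>B. 1 powr (1 - \<theta>) * ((a i)\<^sup>2) powr \<theta>)"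
 proof (intro sum.cong refl)
  fix i assume "i \<in> B"
  hence "(a i)\<^sup>2 = a i powr 2" using assms(1)[of i] by simp
  thus "a i powr (1 / \<mu>) = 1 powr (1 - \<theta>) * ((a i)\<^sup>2) powr \<theta>"
   using \<theta>(3) by (simp add: powr_powr del: powr_numeral)
 qed
 also have "... \<le> (\<Sum>i\<in>B. 1) powr (1 - \<theta>) * (\<Sum>i\<in>B. (a i)\<^sup>2) powr \<theta>"
  using \<theta> by (intro hoelder_sum) auto
 finally have "(\<Sum>i\<in>B. a i powr (1 / \<mu>)) powr \<mu> \<le> (real (card B) powr (1 - \<theta>) * (\<Sum>i\<in>B. (a i)\<^sup>2) powr \<theta>) powr \<mu>"
  using assms(2) by (intro powr_mono2) (auto simp: sum_nonneg)
 also have "... = real (card B) powr (\<mu> - 1 / 2) * sqrt (\<Sum>i\<in>B. (a i)\<^sup>2)"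
  by (simp add: powr_mult powr_powr \<theta> powr_half_sqrt sum_nonneg)
 finally show ?thesis .
qed

text \<open>The weight of the norm equation. The estimates live on its being concave on [0,
  \<infinity>) and submultiplicative on [1, \<infinity>).\<close>

definition slog :: "real => real"
 where "slog x = log 2 (x + 1)"

lemma slog_mono: "0 \<le> x ==> x \<le> y ==> slog x \<le> slog y"
 by (simp add: slog_def)

lemma slog_ge_1: "1 \<le> x ==> 1 \<le> slog x"
 using log_le_cancel_iff[of 2 2 "x + 1"] by (simp add: slog_def del: log_le_cancel_iff)

lemma slog_pos: "0 < x ==> 0 < slog x"
 by (simp add: slog_def)

text \<open>From 2^(3/2) = sqrt 8 \<le> 3. A bound above 1 says that every splitting costs a
  definite factor; this forces uniqueness of the norm and lets inductions over nested splittings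
  end.\<close>

lemma slog_ge_3_2: "2 \<le> x ==> 3 / 2 \<le> slog x"
proof -
 assume x: "2 \<le> x"
 have "2 powr (3 / 2 :: real) = sqrt 8"
  using powr_half_sqrt_powr[of 2 3] by (simp add: powr_numeral)
 also have "... \<le> 3" by (rule real_le_lsqrt) auto
 finally have "(2::real) powr (3 / 2) \<le> x + 1" using x by simp
 thus ?thesis using x le_log_iff[of 2 "x + 1" "3 / 2"] unfolding slog_def by simp
qed

text \<open>Convexity of \<open>x powr v\<close> at the point 2 = (1 - 1/a) * 1 + (1/a) * (1 + a).
  For 2 powr v = 1 + b it becomes the submultiplicativity of \<open>slog\<close>.\<close>

lemma powr_bernoulli:
 fixes a v :: real
 assumes "1 \<le> a" "1 \<le> v"
 shows "1 + a * (2 powr v - 1) \<le> (1 + a) powr v"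
proof -
 have "(%x. x powr v) ((1 - 1 / a) *\<^sub>R 1 + (1 / a) *\<^sub>R (1 + a)) \<le> (1 - 1 / a) * 1 powr v + (1 / a) * (1 + a) powr v"
  using assms by (intro convex_onD[OF powr_convex]) auto
 moreover have "(1 - 1 / a) *\<^sub>R 1 + (1 / a) *\<^sub>R (1 + a) = 2"
  using assms by (simp add: field_simps)
 ultimately have "2 powr v \<le> (1 - 1 / a) + (1 / a) * (1 + a) powr v" by (simp only: powr_one_eq_one) simp
 hence "a * 2 powr v \<le> a * ((1 - 1 / a) + (1 / a) * (1 + a) powr v)"
  using assms by (intro mult_left_mono) auto
 also have "... = a - 1 + (1 + a) powr v" using assms by (simp add: field_simps)
 finally show ?thesis by (simp add: algebra_simps)
qed

lemma slog_mult:
 assumes "1 \<le> a" "1 \<le> b"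
 shows "slog (a * b) \<le> slog a * slog b"
proof -
 have "2 powr slog b = b + 1" using assms by (simp add: slog_def)
 hence "1 + a * b \<le> (1 + a) powr slog b"
  using powr_bernoulli[OF assms(1) slog_ge_1[OF assms(2)]] by simp
 hence "slog (a * b) \<le> log 2 ((1 + a) powr slog b)"
  using assms by (simp add: slog_def add.commute add_pos_nonneg)
 thus ?thesis using assms by (simp add: slog_def log_powr add.commute mult.commute)
qed

lemma slog_tangent:
 assumes "0 \<le> x" "0 \<le> m"
 shows "slog x \<le> slog m + (x - m) / ((1 + m) * ln 2)"
proof -
 have "ln ((1 + x) / (1 + m)) \<le> (1 + x) / (1 + m) - 1"
  using assms by (intro ln_le_minus_one) (auto simp: divide_simps)
 also have "... = (x - m) / (1 + m)" using assms by (simp add: field_simps)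
 finally have "ln (1 + x) - ln (1 + m) \<le> (x - m) / (1 + m)" using assms by (simp add: ln_div)
 hence "(ln (1 + x) - ln (1 + m)) / ln 2 \<le> (x - m) / (1 + m) / ln 2"
  by (intro divide_right_mono) auto
 thus ?thesis by (simp add: slog_def log_def diff_divide_distrib add.commute)
qed

lemma slog_le_self:
 assumes "1 \<le> x" shows "slog x \<le> x"
proof -
 have "slog x \<le> slog 1 + (x - 1) / ((1 + 1) * ln 2)" using assms by (intro slog_tangent) auto
 also have "... \<le> slog 1 + (x - 1) / 1" using assms ln2_ge_two_thirds by (intro add_left_mono divide_left_mono) auto
 also have "... = x" by (simp add: slog_def)
 finally show ?thesis .
qed

lemma div_slog_mono:
 assumes "1 \<le> x" "x \<le> y" shows "x / slog x \<le> y / slog y"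
proof -
 have p: "slog x > 0" "slog y > 0" using assms by (auto intro!: slog_pos)
 have "slog y = slog (x * (y / x))" using assms by simp
 also have "... \<le> slog x * slog (y / x)" using assms by (intro slog_mult) auto
 also have "... \<le> slog x * (y / x)" using assms p by (intro mult_left_mono slog_le_self) auto
 finally show ?thesis using p assms by (simp add: field_simps)
qed

text \<open>Write f for \<open>slog\<close>. For a part n of the total s, submultiplicativity gives
  n/f(n) \<le> n f(s/n)/f(s); the tangent to f at m then bounds the sum of all n f(s/n) by s f(m),
  as there are at most m parts. So the bound n/f(n) reproduces itself under the norm equation, and
  it bounds the norm of a sum of n unit vectors.\<close>

lemma sum_div_slog:
 fixes n :: "'i => nat"
 assumes "finite I" "card I \<le> m" "1 \<le> m"
 shows "(\<Sum>l\<in>I. n l / slog (n l)) \<le> slog m * ((\<Sum>l\<in>I. n l) / slog (\<Sum>l\<in>I. n l))"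
proof -
 define J where "J = {l\<in>I. n l > 0}"
 define s where "s = (\<Sum>l\<in>J. n l)"
 have J: "finite J" "card J \<le> m" using assms card_mono[of I J] by (auto simp: J_def)
 have e1: "(\<Sum>l\<in>I. n l / slog (n l)) = (\<Sum>l\<in>J. n l / slog (n l))"
  using assms by (intro sum.mono_neutral_right) (auto simp: J_def)
 have e2: "(\<Sum>l\<in>I. n l) = s"
  unfolding s_def using assms by (intro sum.mono_neutral_right) (auto simp: J_def)
 show ?thesis
 proof (cases "J = {}")
  case True
  thus ?thesis using e1 e2 by (simp add: s_def)
 next
  case False
  have le: "n l \<le> s" if "l \<in> J" for l
   unfolding s_def using J that by (intro member_le_sum) auto
  have s: "1 \<le> s" using False le by (force simp: J_def)
  have pos: "slog s > 0" using s by (intro slog_pos) auto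
  have "n l / slog (n l) \<le> (n l * slog (s / n l)) / slog s" if "l \<in> J" for l
  proof -
   have "1 \<le> real (n l)" "1 \<le> s / real (n l)" using that le[OF that] by (auto simp: J_def divide_simps)
   hence "slog s \<le> slog (n l) * slog (s / n l)" "slog (n l) > 0"
    using slog_mult[of "n l" "s / n l"] slog_pos[of "n l"] by auto
   hence "n l * slog s \<le> n l * (slog (n l) * slog (s / n l))" by (intro mult_left_mono) auto
   thus ?thesis using pos \<open>slog (n l) > 0\<close> by (simp add: divide_simps mult_ac)
  qed
  hence "(\<Sum>l\<in>J. n l / slog (n l)) \<le> (\<Sum>l\<in>J. n l * slog (s / n l)) / slog s"
   unfolding sum_divide_distrib by (rule sum_mono)
  also have "(\<Sum>l\<in>J. n l * slog (s / n l)) \<le> (\<Sum>l\<in>J. n l * (slog m + (s / n l - m) / ((1 + real m) * ln 2)))"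
   by (rule sum_mono, rule mult_left_mono, rule slog_tangent) auto
  also have "... = (\<Sum>l\<in>J. n l * slog m + (real s - real (n l) * real m) / ((1 + real m) * ln 2))"
  proof (intro sum.cong refl)
   fix l assume "l \<in> J"
   hence "real (n l) * (s / n l - m) = real s - real (n l) * real m" by (simp add: J_def field_simps)
   thus "n l * (slog m + (s / n l - m) / ((1 + real m) * ln 2)) = n l * slog m + (real s - real (n l) * real m) / ((1 + real m) * ln 2)"
    by (metis distrib_left times_divide_eq_right)
  qed
  also have "... = s * slog m + (\<Sum>l\<in>J. real s - real (n l) * real m) / ((1 + real m) * ln 2)"
   by (simp add: s_def sum.distrib sum_distrib_right sum_divide_distrib)
  also have "(\<Sum>l\<in>J. real s - real (n l) * real m) = s * (real (card J) - m)"
   by (simp add: sum_subtractf s_def algebra_simps sum_distrib_left)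
  also have "... \<le> 0" using J by (intro mult_nonneg_nonpos) auto
  finally have "(\<Sum>l\<in>J. n l / slog (n l)) \<le> s * slog m / slog s"
   using pos by (simp add: divide_right_mono)
  thus ?thesis using e1 e2 by (simp add: mult.commute)
 qed
qed

section \<open>Lattice norms on finitely supported sequences\<close>

definition unitv :: "nat => nat => 'k::zero_neq_one"
 where "unitv n = (%m. if m = n then 1 else 0)"

lemma unitv_same [simp]: "unitv n n = 1"
 by (simp add: unitv_def)

lemma unitv_neq [simp]: "m \<noteq> n ==> unitv n m = 0"
 by (simp add: unitv_def)

lemma fun_sum: "(\<Sum>i\<in>I. x i) = (%n. \<Sum>i\<in>I. x i n)"
 by (induction I rule: infinite_finite_induct) auto

lemma c00_supp: "(!!n. x n \<noteq> 0 ==> n \<in> F) ==> finite F ==> x \<in> c00"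
 unfolding c00_def by (auto intro: finite_subset)

lemma c00_mono:
 fixes x :: "nat => 'k::real_normed_field" and y :: "nat => 'l::real_normed_field"
 shows "y \<in> c00 ==> (!!n. norm (x n) \<le> norm (y n)) ==> x \<in> c00"
proof (rule c00_supp[of _ "{n. y n \<noteq> 0}"])
 assume *: "!!n. norm (x n) \<le> norm (y n)"
 show "n \<in> {n. y n \<noteq> 0}" if "x n \<noteq> 0" for n using *[of n] that by auto
qed (simp add: c00_def)

lemma c00_finite: "x \<in> c00 ==> finite {n. x n \<noteq> 0}"
 by (simp add: c00_def)

lemma c00_zero [simp]: "0 \<in> c00" "(%n. 0) \<in> c00"
 by (auto simp: c00_def)

lemma c00_unitv [simp]: "unitv n \<in> c00"
 by (auto simp: c00_def unitv_def)

lemma c00_add [simp]: "x \<in> c00 ==> y \<in> c00 ==> x + y \<in> c00"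
 for x y :: "nat => 'k::real_normed_field"
 by (rule c00_supp[of _ "{n. x n \<noteq> 0} \<union> {n. y n \<noteq> 0}"]) (auto simp: c00_def)

lemma c00_fscale [simp]: "x \<in> c00 ==> fscale a x \<in> c00"
 for x :: "nat => 'k::real_normed_field"
 by (rule c00_supp[of _ "{n. x n \<noteq> 0}"]) (auto simp: c00_def fscale_def)

lemma c00_mult [simp]: "x \<in> c00 ==> (%n. a * x n) \<in> c00"
 for x :: "nat => 'k::real_normed_field"
 using c00_fscale[of x a] by (simp add: fscale_def)

lemma c00_diff [simp]: "x \<in> c00 ==> y \<in> c00 ==> x - y \<in> c00"
 for x y :: "nat => 'k::real_normed_field"
 by (rule c00_supp[of _ "{n. x n \<noteq> 0} \<union> {n. y n \<noteq> 0}"]) (auto simp: c00_def)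

lemma c00_restr [simp]: "x \<in> c00 ==> restr E x \<in> c00"
 by (rule c00_supp[of _ "{n. x n \<noteq> 0}"]) (auto simp: c00_def restr_def split: if_splits)

lemma c00_restr_finite: "finite E ==> restr E x \<in> c00"
 by (rule c00_supp[of _ E]) (auto simp: restr_def split: if_splits)

lemma c00_sum [simp]: "(!!i. i \<in> I ==> x i \<in> c00) ==> (%n. \<Sum>i\<in>I. x i n) \<in> c00"
 for x :: "'i => nat => 'k::real_normed_field"
proof (induction I rule: infinite_finite_induct)
 case (insert i I)
 hence "x i + (%n. \<Sum>i\<in>I. x i n) \<in> c00" by (intro c00_add) auto
 thus ?case using insert by (simp add: plus_fun_def)
qed auto

lemma restr_restr: "restr E (restr F x) = restr (E \<inter> F) x"
 by (auto simp: restr_def)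

lemma restr_add: "restr E (x + y) = restr E x + restr E (y :: nat => 'k::real_normed_field)"
 by (auto simp: restr_def)

lemma restr_fscale: "restr E (fscale a x) = fscale a (restr E (x :: nat => 'k::real_normed_field))"
 by (auto simp: restr_def fscale_def)

lemma restr_supp: "(!!n. x n \<noteq> 0 ==> n \<in> E) ==> restr E x = x"
 unfolding restr_def by (rule ext) auto

definition lattice_norm :: "((nat => 'k::real_normed_field) => real) => bool"
 where "lattice_norm N \<longleftrightarrow> is_norm_on c00 N \<and>
  (\<forall>x\<in>c00. \<forall>y\<in>c00. (\<forall>n. norm (x n) \<le> norm (y n)) --> N x \<le> N y) \<and> (\<forall>n. N (unitv n) = 1)"

text \<open>Inequalities suffice: scaling by \<open>inverse a\<close> reverses the scaling
  inequality, and the coordinate bound gives definiteness and the lower half of the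
  normalisation.\<close>

lemma lattice_normI:
 fixes N :: "(nat => 'k::real_normed_field) => real"
 assumes coord: "!!x n. x \<in> c00 ==> norm (x n) \<le> N x"
  and scale: "!!a x. x \<in> c00 ==> N (fscale a x) \<le> norm a * N x"
  and triangle: "!!x y. x \<in> c00 ==> y \<in> c00 ==> N (x + y) \<le> N x + N y"
  and mono: "!!x y. x \<in> c00 ==> y \<in> c00 ==> (!!n. norm (x n) \<le> norm (y n)) ==> N x \<le> N y"
  and unit: "!!n. N (unitv n) \<le> 1"
 shows "lattice_norm N"
proof -
 have nonneg: "0 \<le> N x" if "x \<in> c00" for x using norm_ge_zero coord[OF that, of 0] by (rule order_trans)
 have zero: "N x = 0 \<longleftrightarrow> x = 0" if x: "x \<in> c00" for x
 proof
  assume "N x = 0"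
  thus "x = 0" using coord[OF x] by (auto simp: fun_eq_iff)
 next
  assume "x = 0"
  hence "fscale 0 x = x" by (simp add: fscale_def fun_eq_iff)
  thus "N x = 0" using scale[OF x, of 0] nonneg[OF x] by simp
 qed
 have scale_eq: "N (fscale a x) = norm a * N x" if x: "x \<in> c00" for a x
 proof (cases "a = 0")
  case True
  hence "fscale a x = 0" by (auto simp: fscale_def)
  thus ?thesis using zero[of 0] True by simp
 next
  case False
  have "x = fscale (inverse a) (fscale a x)" using False by (auto simp: fscale_def)
  hence "N x \<le> norm (inverse a) * N (fscale a x)" using scale[of "fscale a x" "inverse a"] x by simp
  hence "norm a * N x \<le> norm a * (norm (inverse a) * N (fscale a x))" by (intro mult_left_mono) auto
  also have "... = N (fscale a x)" using False by (simp add: norm_inverse)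
  finally show ?thesis using scale[OF x, of a] by simp
 qed
 have "N (unitv n) = 1" for n using unit[of n] coord[of "unitv n" n] by simp
 thus ?thesis using nonneg zero scale_eq triangle mono by (simp add: lattice_norm_def is_norm_on_def)
qed

abbreviation pieces :: "((nat => 'k::zero) => real) => nat => (nat => nat set) => (nat => 'k) => real"
 where "pieces N m E x \<equiv> \<Sum>l<m. N (restr (E l) x)"

lemma norm_on_triangle: "is_norm_on c00 N ==> x \<in> c00 ==> y \<in> c00 ==> N (x + y) \<le> N x + N y"
 by (auto simp: is_norm_on_def)

lemma norm_on_sum:
 fixes x :: "'i => nat => 'k::real_normed_field"
 assumes "is_norm_on c00 N" "!!i. i \<in> I ==> x i \<in> c00"
 shows "N (%n. \<Sum>i\<in>I. x i n) \<le> (\<Sum>i\<in>I. N (x i))"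
 using assms(2)
proof (induction I rule: infinite_finite_induct)
 case (insert i I)
 have "N (x i + (%n. \<Sum>i\<in>I. x i n)) \<le> N (x i) + N (%n. \<Sum>i\<in>I. x i n)"
  using insert by (intro norm_on_triangle[OF assms(1)] c00_sum) auto
 thus ?case using insert by (auto simp: plus_fun_def)
next
 case empty
 have "N (0 :: nat => 'k) = 0" using assms(1) c00_zero(1) unfolding is_norm_on_def by blast
 thus ?case by (simp add: zero_fun_def)
next
 case (infinite I)
 have "N (0 :: nat => 'k) = 0" using assms(1) c00_zero(1) unfolding is_norm_on_def by blast
 thus ?case using infinite by (simp add: zero_fun_def)
qed

lemma lat_is_norm: "lattice_norm N ==> is_norm_on c00 N"
 by (simp add: lattice_norm_def)

lemma lat_nonneg: "lattice_norm N ==> x \<in> c00 ==> 0 \<le> N x"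
 by (auto simp: lattice_norm_def is_norm_on_def)

lemma lat_eq_0: "lattice_norm N ==> x \<in> c00 ==> N x = 0 \<longleftrightarrow> x = 0"
 unfolding lattice_norm_def is_norm_on_def by blast

lemma lat_zero: "lattice_norm N ==> N 0 = 0" "lattice_norm N ==> N (%n. 0) = 0"
 using lat_eq_0[of N 0] by (auto simp: zero_fun_def)

lemma lat_scale: "lattice_norm N ==> x \<in> c00 ==> N (%n. a * x n) = norm a * N x"
 unfolding lattice_norm_def is_norm_on_def fscale_def by blast

lemma lat_mono:
 "lattice_norm N ==> y \<in> c00 ==> (!!n. norm (x n) \<le> norm (y n)) ==> N x \<le> N y"
 using c00_mono[of y x] unfolding lattice_norm_def by blast

lemma lat_restr: "lattice_norm N ==> x \<in> c00 ==> N (restr E x) \<le> N x"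
 by (rule lat_mono) (auto simp: restr_def)

lemma lat_triangle: "lattice_norm N ==> x \<in> c00 ==> y \<in> c00 ==> N (x + y) \<le> N x + N y"
 by (rule norm_on_triangle) (auto simp: lattice_norm_def)

lemma lat_sum:
 "lattice_norm N ==> (!!i. i \<in> I ==> x i \<in> c00) ==> N (%n. \<Sum>i\<in>I. x i n) \<le> (\<Sum>i\<in>I. N (x i))"
 by (rule norm_on_sum) (auto simp: lattice_norm_def)

lemma lat_coord:
 assumes "lattice_norm N" "x \<in> c00"
 shows "norm (x n) \<le> N x"
proof -
 have "norm (x n) = N (%m. x n * unitv n m)"
  using lat_scale[OF assms(1), of "unitv n" "x n"] assms(1) by (simp add: lattice_norm_def)
 also have "... \<le> N x" by (rule lat_mono[OF assms]) (auto simp: unitv_def)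
 finally show ?thesis .
qed

lemma successive_less: "successive m E ==> i < j ==> j < m ==> a \<in> E i ==> b \<in> E j ==> a < b"
 unfolding successive_def by blast

lemma successive_finite: "successive m E ==> i < m ==> finite (E i)"
 unfolding successive_def by blast

lemma successiveI:
 "(!!i. i < m ==> finite (E i)) ==> (!!i j a b. i < j ==> j < m ==> a \<in> E i ==> b \<in> E j ==> a < b) ==> successive m E"
 unfolding successive_def by blast

lemma successive_disjoint: "successive m E ==> i < m ==> j < m ==> i \<noteq> j ==> E i \<inter> E j = {}"
proof -
 assume *: "successive m E" "i < m" "j < m" "i \<noteq> j"
 have "False" if a: "a \<in> E i" "a \<in> E j" for a
 proof (cases "i < j")
  case True
  thus False using successive_less[OF *(1) True *(3) a] by simp
 next
  case False
  hence "j < i" using *(4) by simp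
  thus False using successive_less[OF *(1) _ *(2) a(2,1)] by blast
 qed
 thus "E i \<inter> E j = {}" by blast
qed

lemma successive_inter: "successive m E ==> successive m (%l. E l \<inter> F)"
 by (rule successiveI) (blast intro: successive_finite successive_less)+

lemma successive_sum_le:
 fixes g :: "nat => real"
 assumes "successive m E" "finite F" "!!n. n \<in> F ==> 0 \<le> g n"
 shows "(\<Sum>l<m. \<Sum>n\<in>E l \<inter> F. g n) \<le> (\<Sum>n\<in>F. g n)"
proof -
 have "(\<Sum>l<m. \<Sum>n\<in>E l \<inter> F. g n) = (\<Sum>n\<in>(\<Union>l<m. E l \<inter> F). g n)"
  using assms(2) successive_disjoint[OF assms(1)] by (subst sum.UNION_disjoint) auto
 also have "... \<le> (\<Sum>n\<in>F. g n)" using assms(2,3) by (intro sum_mono2) auto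
 finally show ?thesis .
qed

lemma norm_on_le_sum:
 fixes N :: "(nat => 'k::real_normed_field) => real"
 assumes "is_norm_on c00 N" "finite F"
 shows "N (restr F x) \<le> (\<Sum>n\<in>F. N (restr {n} x))"
proof -
 have "restr F x = (%m. \<Sum>n\<in>F. restr {n} x m)"
  using assms(2) by (auto simp: restr_def)
 thus ?thesis using norm_on_sum[OF assms(1), of F "%n. restr {n} x"] by (simp add: c00_restr_finite)
qed

section \<open>The Schlumprecht norm\<close>

text \<open>The bound does not depend on the splitting, so the supremum in the norm equation is
  finite. Later it also controls splittings into very many sets.\<close>

lemma successive_norm_bound:
 fixes N :: "(nat => 'k::real_normed_field) => real"
 assumes "is_norm_on c00 N" "x \<in> c00" "successive m E"
 shows "pieces N m E x \<le> (\<Sum>n | x n \<noteq> 0. N (restr {n} x))"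
proof -
 let ?F = "{n. x n \<noteq> 0}"
 have "N (restr (E l) x) \<le> (\<Sum>n\<in>E l \<inter> ?F. N (restr {n} x))" for l
 proof -
  have "restr (E l) x = restr (E l \<inter> ?F) x" by (auto simp: restr_def)
  thus ?thesis using norm_on_le_sum[OF assms(1), of "E l \<inter> ?F" x] c00_finite[OF assms(2)] by simp
 qed
 hence "pieces N m E x \<le> (\<Sum>l<m. \<Sum>n\<in>E l \<inter> ?F. N (restr {n} x))" by (intro sum_mono)
 also have "... \<le> (\<Sum>n\<in>?F. N (restr {n} x))"
 proof (rule successive_sum_le[OF assms(3)])
  fix n show "0 \<le> N (restr {n} x)"
   using assms(1) c00_restr_finite[of "{n}" x] unfolding is_norm_on_def by blast
 qed (use assms(2) c00_finite in auto)
 finally show ?thesis .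
qed

abbreviation succ_terms :: "((nat => 'k::real_normed_field) => real) => (nat => 'k) => real set"
 where "succ_terms N x \<equiv> (%(n, E). 1 / log 2 (real n + 1) * pieces N n E x) `
  {(n, E). 2 \<le> n \<and> successive n E}"

lemma succ_termsI:
 "2 \<le> m ==> successive m E ==> 1 / log 2 (real m + 1) * pieces N m E x \<in> succ_terms N x"
 by (rule image_eqI[of _ _ "(m, E)"]) auto

lemma succ_terms_bdd:
 assumes "is_norm_on c00 N" "x \<in> c00"
 shows "bdd_above (succ_terms N x)"
proof (rule bdd_aboveI)
 fix y assume "y \<in> succ_terms N x"
 then obtain m E where m: "2 \<le> m" "successive m E" "y = 1 / slog m * pieces N m E x"
  by (auto simp: slog_def)
 have s: "0 \<le> pieces N m E x"
  using assms unfolding is_norm_on_def by (intro sum_nonneg) simp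
 have "1 / slog m \<le> 1" using m(1) slog_ge_1[of m] by simp
 hence "y \<le> 1 * pieces N m E x" unfolding m(3) using s by (intro mult_right_mono) auto
 thus "y \<le> (\<Sum>n | x n \<noteq> 0. N (restr {n} x))"
  using successive_norm_bound[OF assms m(2)] by simp
qed

lemma schlumprecht_eqD:
 "satisfies_schlumprecht_eq N ==> x \<in> c00 ==> N x = max (sup_norm x) (Sup (succ_terms N x))"
 unfolding satisfies_schlumprecht_eq_def by blast

lemma succ_term_le:
 assumes "is_norm_on c00 N" "satisfies_schlumprecht_eq N" "x \<in> c00" "2 \<le> m" "successive m E"
 shows "pieces N m E x \<le> slog m * N x"
proof -
 have "1 / log 2 (real m + 1) * pieces N m E x \<le> Sup (succ_terms N x)"
  by (rule cSup_upper[OF succ_termsI[OF assms(4,5)] succ_terms_bdd[OF assms(1,3)]])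
 also have "... \<le> N x" unfolding schlumprecht_eqD[OF assms(2,3)] by (rule max.cobounded2)
 finally have "1 / slog m * pieces N m E x \<le> N x" by (simp add: slog_def)
 thus ?thesis using slog_pos[of m] assms(4) by (simp add: field_simps)
qed

lemma sup_norm_le: "(!!n. norm (x n) \<le> B) ==> sup_norm x \<le> B"
 unfolding sup_norm_def by (rule cSUP_least) auto

lemma c00_bdd:
 fixes x :: "nat => 'k::real_normed_field"
 assumes "x \<in> c00" shows "bdd_above (range (%n. norm (x n)))"
proof -
 have "range (%n. norm (x n)) \<subseteq> insert 0 ((%n. norm (x n)) ` {n. x n \<noteq> 0})" by auto
 thus ?thesis using c00_finite[OF assms] by (intro bdd_above_mono[OF bdd_above_finite]) auto
qed

lemma le_sup_norm: "x \<in> c00 ==> norm (x n) \<le> sup_norm x" for x :: "nat => 'k::real_normed_field"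
 unfolding sup_norm_def by (rule cSUP_upper) (auto simp: c00_bdd)

lemma schlumprecht_eq_le:
 assumes "satisfies_schlumprecht_eq N" "x \<in> c00" "!!n. norm (x n) \<le> B"
  "!!m E. 2 \<le> m ==> successive m E ==> pieces N m E x \<le> slog m * B"
 shows "N x \<le> B"
proof -
 have "Sup (succ_terms N x) \<le> B"
 proof (rule cSup_least)
  have "(2, %_. {}) \<in> {(n, E). 2 \<le> n \<and> successive n E}" by (auto simp: successive_def)
  thus "succ_terms N x \<noteq> {}" by blast
  fix y assume "y \<in> succ_terms N x"
  then obtain m E where m: "2 \<le> m" "successive m E" "y = 1 / slog m * pieces N m E x"
   by (auto simp: slog_def)
  show "y \<le> B" using assms(4)[OF m(1,2)] slog_pos[of m] m(1) unfolding m(3) by (simp add: field_simps)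
 qed
 thus ?thesis unfolding schlumprecht_eqD[OF assms(1,2)] using sup_norm_le[OF assms(3)] by (rule max.boundedI[rotated])
qed

text \<open>A splitting that does not keep the support in one set has pieces of smaller support,
  where the norms agree by hypothesis. One that does keep it leaves \<open>N x\<close> undivided,
  and \<open>slog m \<ge> 3 / 2\<close> yields at most 2/3 of it. So \<open>N x\<close> is at most
  the maximum of \<open>N' x\<close> and two thirds of itself.\<close>

lemma schlumprecht_unique_le:
 fixes N N' :: "(nat => 'k::real_normed_field) => real"
 assumes N: "is_norm_on c00 N" "satisfies_schlumprecht_eq N"
  and N': "is_norm_on c00 N'" "satisfies_schlumprecht_eq N'"
  and x: "x \<in> c00"
  and IH: "!!y. y \<in> c00 ==> card {n. y n \<noteq> 0} < card {n. x n \<noteq> 0} ==> N y = N' y"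
 shows "N x \<le> N' x"
proof (rule ccontr)
 assume less: "\<not> N x \<le> N' x"
 let ?B = "max (N' x) (2 / 3 * N x)"
 have 0: "0 \<le> N' x" using N'(1) x by (auto simp: is_norm_on_def)
 have N0: "N (0 :: nat => 'k) = 0" using N(1) c00_zero(1) unfolding is_norm_on_def by blast
 have "N x \<le> ?B"
 proof (rule schlumprecht_eq_le[OF N(2) x])
  fix n
  have "norm (x n) \<le> sup_norm x" by (rule le_sup_norm[OF x])
  also have "... \<le> N' x" unfolding schlumprecht_eqD[OF N'(2) x] by (rule max.cobounded1)
  finally show "norm (x n) \<le> ?B" by simp
 next
  fix m :: nat and E assume m: "2 \<le> m" "successive m E"
  show "pieces N m E x \<le> slog m * ?B"
  proof (cases "\<exists>k<m. {n. x n \<noteq> 0} \<subseteq> E k")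
   case True
   then obtain k where k: "k < m" "{n. x n \<noteq> 0} \<subseteq> E k" by blast
   have "restr (E k) x = x" using k by (intro restr_supp) auto
   moreover have "restr (E l) x = 0" if "l < m" "l \<noteq> k" for l
    using successive_disjoint[OF m(2) that(1) k(1) that(2)] k(2) by (auto simp: restr_def fun_eq_iff)
   ultimately have "pieces N m E x = (\<Sum>l<m. if l = k then N x else 0)"
    using N0 by (intro sum.cong) auto
   also have "... = N x" using k by simp
   also have "... = (3 / 2) * (2 / 3 * N x)" by simp
   also have "... \<le> slog m * ?B" using slog_ge_3_2[of m] m(1) 0 less by (intro mult_mono) auto
   finally show ?thesis .
  next
   case False
   have "N (restr (E l) x) = N' (restr (E l) x)" if "l < m" for l
   proof (rule IH)
    have "{n. restr (E l) x n \<noteq> 0} \<subset> {n. x n \<noteq> 0}"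
     using False that by (auto simp: restr_def)
    thus "card {n. restr (E l) x n \<noteq> 0} < card {n. x n \<noteq> 0}"
     using c00_finite[OF x] by (intro psubset_card_mono)
   qed (use x in auto)
   hence "pieces N m E x = pieces N' m E x" by simp
   also have "... \<le> slog m * N' x" by (rule succ_term_le[OF N' x m])
   also have "... \<le> slog m * ?B" using slog_pos[of m] m by (intro mult_left_mono) auto
   finally show ?thesis .
  qed
 qed
 thus False using less 0 by auto
qed

lemma schlumprecht_unique:
 fixes N N' :: "(nat => 'k::real_normed_field) => real"
 assumes "is_norm_on c00 N" "satisfies_schlumprecht_eq N"
  and "is_norm_on c00 N'" "satisfies_schlumprecht_eq N'" and "x \<in> c00"
 shows "N x = N' x"
 using assms(5)
proof (induction "card {n. x n \<noteq> 0}" arbitrary: x rule: less_induct)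
 case less
 show ?case
  using schlumprecht_unique_le[OF assms(1-4) less.prems] schlumprecht_unique_le[OF assms(3,4,1,2) less.prems]
   less.hyps by (metis order_antisym)
qed

section \<open>Existence of the norm through a norming set\<close>

inductive norming :: "(nat => real) => bool" where
 norming_unit: "norming (unitv n)"
| norming_comb: "2 \<le> m ==> successive m E ==> (!!l. l < m ==> norming (\<phi> l)) ==>
  norming (%j. (\<Sum>l<m. restr (E l) (\<phi> l) j) / slog m)"

abbreviation weight :: "(nat => real) => (nat => 'k::real_normed_field) => real"
 where "weight \<phi> x \<equiv> \<Sum>n | x n \<noteq> 0. \<phi> n * norm (x n)"

text \<open>Existence without a limit process: \<open>norming\<close> is the least set of
  coefficient sequences closed under the operations of the norm equation, so the supremum over it
  solves that equation. The sequences are nonnegative and act on moduli, which makes the supremum a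
  lattice norm. Outside \<open>c00\<close> the value is the 0 that \<open>schlumprecht_norm\<close>
  prescribes.\<close>

definition snorm :: "(nat => 'k::real_normed_field) => real"
 where "snorm x = (if x \<in> c00 then Sup {\<Sum>n | x n \<noteq> 0. \<phi> n * norm (x n) | \<phi>. norming \<phi>} else 0)"

lemma norming_range: "norming \<phi> ==> 0 \<le> \<phi> j \<and> \<phi> j \<le> 1"
proof (induction arbitrary: j rule: norming.induct)
 case (norming_comb m E \<phi>)
 have s: "1 \<le> slog m" using norming_comb(1) by (intro slog_ge_1) auto
 have 0: "0 \<le> (\<Sum>l<m. restr (E l) (\<phi> l) j)"
  using norming_comb by (intro sum_nonneg) (auto simp: restr_def)
 have "(\<Sum>l<m. restr (E l) (\<phi> l) j) \<le> 1"
 proof (cases "\<exists>k<m. j \<in> E k")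
  case True
  then obtain k where k: "k < m" "j \<in> E k" by blast
  have "(\<Sum>l<m. restr (E l) (\<phi> l) j) = (\<Sum>l<m. if l = k then \<phi> k j else 0)"
   using successive_disjoint[OF norming_comb(2)] k by (intro sum.cong) (auto simp: restr_def)
  thus ?thesis using k norming_comb by simp
 next
  case False
  hence "(\<Sum>l<m. restr (E l) (\<phi> l) j) = 0" by (intro sum.neutral) (auto simp: restr_def)
  thus ?thesis by simp
 qed
 hence "(\<Sum>l<m. restr (E l) (\<phi> l) j) \<le> slog m" using s by linarith
 thus ?case using 0 s by simp
qed (auto simp: unitv_def)

lemma ev_mono_set:
 "finite F ==> {n. x n \<noteq> 0} \<subseteq> F ==> weight \<phi> x = (\<Sum>n\<in>F. \<phi> n * norm (x n))"
 for x :: "nat => 'k::real_normed_field" and \<phi> :: "nat => real"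
 by (rule sum.mono_neutral_left) auto

lemma snorm_bdd:
 fixes x :: "nat => 'k::real_normed_field"
 shows "bdd_above {\<Sum>n | x n \<noteq> 0. \<phi> n * norm (x n) | \<phi>. norming \<phi>}"
proof (rule bdd_aboveI)
 fix y assume "y \<in> {\<Sum>n | x n \<noteq> 0. \<phi> n * norm (x n) | \<phi>. norming \<phi>}"
 then obtain \<phi> where "norming \<phi>" "y = weight \<phi> x" by blast
 thus "y \<le> (\<Sum>n | x n \<noteq> 0. 1 * norm (x n))"
  using norming_range[of \<phi>] by (auto intro!: sum_mono mult_right_mono)
qed

lemma snorm_upper:
 fixes x :: "nat => 'k::real_normed_field"
 assumes "x \<in> c00" "norming \<phi>" "finite F" "{n. x n \<noteq> 0} \<subseteq> F"
 shows "(\<Sum>n\<in>F. \<phi> n * norm (x n)) \<le> snorm x"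
proof -
 have "weight \<phi> x \<le> Sup {\<Sum>n | x n \<noteq> 0. \<phi> n * norm (x n) | \<phi>. norming \<phi>}"
  using assms(2) by (intro cSup_upper snorm_bdd) blast
 thus ?thesis using assms(1) ev_mono_set[OF assms(3,4), of \<phi>] by (simp add: snorm_def)
qed

lemma snorm_least:
 fixes x :: "nat => 'k::real_normed_field"
 assumes "x \<in> c00" "!!\<phi>. norming \<phi> ==> weight \<phi> x \<le> B"
 shows "snorm x \<le> B"
 using assms norming_unit by (auto simp: snorm_def intro!: cSup_least)

lemma snorm_attain:
 fixes x :: "nat => 'k::real_normed_field"
 assumes "x \<in> c00" "e > 0"
 obtains \<phi> where "norming \<phi>" "snorm x - e < weight \<phi> x"
proof -
 have "snorm x - e < Sup {\<Sum>n | x n \<noteq> 0. \<phi> n * norm (x n) | \<phi>. norming \<phi>}"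
  using assms by (simp add: snorm_def)
 thus ?thesis using less_cSup_iff[OF _ snorm_bdd[of x]] norming_unit that by blast
qed

lemma snorm_coord: "x \<in> c00 ==> norm (x n) \<le> snorm x" for x :: "nat => 'k::real_normed_field"
proof -
 assume x: "x \<in> c00"
 have "(\<Sum>m\<in>insert n {n. x n \<noteq> 0}. unitv n m * norm (x m)) \<le> snorm x"
  using c00_finite[OF x] by (intro snorm_upper[OF x norming_unit]) auto
 moreover have "(\<Sum>m\<in>insert n {n. x n \<noteq> 0}. unitv n m * norm (x m)) = (\<Sum>m\<in>{n}. unitv n m * norm (x m))"
  using c00_finite[OF x] by (intro sum.mono_neutral_right) (auto simp: unitv_def)
 ultimately show ?thesis by (simp add: unitv_def)
qed

lemma snorm_lattice: "lattice_norm (snorm :: (nat => 'k::real_normed_field) => real)"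
proof -
 have scale_le: "snorm (fscale a x) \<le> norm a * snorm x" if "x \<in> c00" for x :: "nat => 'k" and a
 proof (rule snorm_least)
  fix \<phi> assume \<phi>: "norming \<phi>"
  have "weight \<phi> (fscale a x) = (\<Sum>n | x n \<noteq> 0. \<phi> n * norm (fscale a x n))"
   using c00_finite[OF that] by (intro ev_mono_set) (auto simp: fscale_def)
  also have "... = norm a * weight \<phi> x"
   by (simp add: fscale_def norm_mult sum_distrib_left mult.left_commute)
  also have "... \<le> norm a * snorm x"
   using snorm_upper[OF that \<phi> c00_finite[OF that]] by (intro mult_left_mono) auto
  finally show "weight \<phi> (fscale a x) \<le> norm a * snorm x" .
 qed (use that in auto)
 have triangle: "snorm (x + y) \<le> snorm x + snorm y" if "x \<in> c00" "y \<in> c00" for x y :: "nat => 'k"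
 proof (rule snorm_least)
  fix \<phi> assume \<phi>: "norming \<phi>"
  let ?F = "{n. x n \<noteq> 0} \<union> {n. y n \<noteq> 0}"
  have F: "finite ?F" using that c00_finite by blast
  have "weight \<phi> (x + y) = (\<Sum>n\<in>?F. \<phi> n * norm ((x + y) n))"
   by (rule ev_mono_set[OF F]) auto
  also have "... \<le> (\<Sum>n\<in>?F. \<phi> n * norm (x n) + \<phi> n * norm (y n))"
   using norming_range[OF \<phi>] by (intro sum_mono) (auto simp flip: distrib_left intro!: mult_left_mono norm_triangle_ineq)
  also have "... \<le> snorm x + snorm y"
   using snorm_upper[OF that(1) \<phi> F] snorm_upper[OF that(2) \<phi> F] by (auto simp: sum.distrib)
  finally show "weight \<phi> (x + y) \<le> snorm x + snorm y" .
 qed (use that in auto)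
 have mono: "snorm x \<le> snorm y" if "x \<in> c00" "y \<in> c00" "!!n. norm (x n) \<le> norm (y n)" for x y :: "nat => 'k"
 proof (rule snorm_least[OF that(1)])
  fix \<phi> assume \<phi>: "norming \<phi>"
  have F: "finite {n. y n \<noteq> 0}" "{n. x n \<noteq> 0} \<subseteq> {n. y n \<noteq> 0}"
   using c00_finite[OF that(2)] apply simp using that(3) by (auto, metis norm_le_zero_iff norm_zero)
  have "weight \<phi> x = (\<Sum>n | y n \<noteq> 0. \<phi> n * norm (x n))"
   by (rule ev_mono_set[OF F])
  also have "... \<le> weight \<phi> y"
   using norming_range[OF \<phi>] that(3) by (intro sum_mono mult_left_mono) auto
  also have "... \<le> snorm y" by (rule snorm_upper[OF that(2) \<phi> F(1)]) auto
  finally show "weight \<phi> x \<le> snorm y" .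
 qed
 have unit: "snorm (unitv n :: nat => 'k) \<le> 1" for n
 proof (rule snorm_least[OF c00_unitv])
  have s: "{m. (unitv n :: nat => 'k) m \<noteq> 0} = {n}" by (auto simp: unitv_def)
  fix \<phi> assume "norming \<phi>"
  thus "(\<Sum>m | (unitv n :: nat => 'k) m \<noteq> 0. \<phi> m * norm ((unitv n :: nat => 'k) m)) \<le> 1"
   unfolding s using norming_range[of \<phi> n] by simp
 qed
 show ?thesis by (rule lattice_normI[OF snorm_coord scale_le triangle mono unit])
qed

lemmas snorm_is_norm = lat_is_norm[OF snorm_lattice]

lemma ev_comb:
 fixes x :: "nat => 'k::real_normed_field"
 assumes "x \<in> c00"
 shows "(\<Sum>n | x n \<noteq> 0. (\<Sum>l<m. restr (E l) (\<phi> l) n) / s * norm (x n))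
  = (\<Sum>l<m. \<Sum>n | restr (E l) x n \<noteq> 0. \<phi> l n * norm (restr (E l) x n)) / s"
proof -
 have "weight (\<phi> l) (restr (E l) x) = (\<Sum>n | x n \<noteq> 0. restr (E l) (\<phi> l) n * norm (x n))" for l
 proof -
  have "weight (\<phi> l) (restr (E l) x) = (\<Sum>n | x n \<noteq> 0. \<phi> l n * norm (restr (E l) x n))"
   using c00_finite[OF assms] by (intro ev_mono_set) (auto simp: restr_def)
  also have "... = (\<Sum>n | x n \<noteq> 0. restr (E l) (\<phi> l) n * norm (x n))"
   by (intro sum.cong) (auto simp: restr_def)
  finally show ?thesis .
 qed
 hence "(\<Sum>l<m. \<Sum>n | restr (E l) x n \<noteq> 0. \<phi> l n * norm (restr (E l) x n))
  = (\<Sum>n | x n \<noteq> 0. \<Sum>l<m. restr (E l) (\<phi> l) n * norm (x n))" by (simp add: sum.swap[of _ "{..<m}"])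
 thus ?thesis by (simp add: sum_divide_distrib sum_distrib_right)
qed

lemma snorm_succ:
 fixes x :: "nat => 'k::real_normed_field"
 assumes x: "x \<in> c00" and m: "2 \<le> m" "successive m E"
 shows "pieces snorm m E x \<le> slog m * snorm x"
proof (rule field_le_epsilon)
 fix e :: real assume e: "e > 0"
 \<comment> \<open>Sequences that attain each piece up to \<open>e / m\<close> combine to a single
   member of \<open>norming\<close>; the m errors add up to \<open>e\<close>.\<close>
 have "\<exists>\<phi>. norming \<phi> \<and> snorm (restr (E l) x) - e / m < weight \<phi> (restr (E l) x)" for l
  using snorm_attain[of "restr (E l) x" "e / m"] x e m(1) by auto
 then obtain \<phi> where \<phi>: "!!l. norming (\<phi> l)"
  "!!l. snorm (restr (E l) x) - e / m < weight (\<phi> l) (restr (E l) x)"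
  by metis
 have s: "slog m > 0" using m(1) by (intro slog_pos) auto
 have "pieces snorm m E x \<le> (\<Sum>l<m. weight (\<phi> l) (restr (E l) x) + e / m)"
  using \<phi>(2) by (intro sum_mono) (simp add: algebra_simps less_imp_le)
 also have "... = (\<Sum>l<m. \<Sum>n | restr (E l) x n \<noteq> 0. \<phi> l n * norm (restr (E l) x n)) + e"
  using m(1) by (simp add: sum.distrib)
 also have "... = slog m * (\<Sum>n | x n \<noteq> 0. (\<Sum>l<m. restr (E l) (\<phi> l) n) / slog m * norm (x n)) + e"
  unfolding ev_comb[OF x] using s by simp
 also have "... \<le> slog m * snorm x + e"
  using snorm_upper[OF x norming_comb[OF m \<phi>(1)] c00_finite[OF x]] s by (intro add_right_mono mult_left_mono) auto
 finally show "pieces snorm m E x \<le> slog m * snorm x + e" .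
qed

lemma snorm_eq: "satisfies_schlumprecht_eq (snorm :: (nat => 'k::real_normed_field) => real)"
 unfolding satisfies_schlumprecht_eq_def
proof
 fix x :: "nat => 'k" assume x: "x \<in> c00"
 show "snorm x = max (sup_norm x) (Sup (succ_terms snorm x))"
 proof (rule antisym)
  show "snorm x \<le> max (sup_norm x) (Sup (succ_terms snorm x))"
  proof (rule snorm_least[OF x])
   fix \<phi> assume "norming \<phi>"
   thus "weight \<phi> x \<le> max (sup_norm x) (Sup (succ_terms snorm x))"
   proof cases
    case (norming_unit n)
    have "(\<Sum>m | x m \<noteq> 0. \<phi> m * norm (x m)) = (\<Sum>m\<in>insert n {n. x n \<noteq> 0}. \<phi> m * norm (x m))"
     using c00_finite[OF x] by (intro ev_mono_set) auto
    also have "... = (\<Sum>m\<in>{n}. \<phi> m * norm (x m))"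
     using c00_finite[OF x] by (intro sum.mono_neutral_right) (auto simp: unitv_def norming_unit)
    also have "... \<le> sup_norm x" using le_sup_norm[OF x] by (simp add: norming_unit unitv_def)
    finally show ?thesis by simp
   next
    case (norming_comb m E \<psi>)
    have s: "slog m > 0" using norming_comb(2) by (intro slog_pos) auto
    have "weight \<phi> x = (\<Sum>l<m. \<Sum>n | restr (E l) x n \<noteq> 0. \<psi> l n * norm (restr (E l) x n)) / slog m"
     unfolding norming_comb(1) by (rule ev_comb[OF x])
    also have "... \<le> pieces snorm m E x / slog m"
     using s norming_comb(4) x by (intro divide_right_mono sum_mono snorm_upper) (auto intro!: c00_finite)
    also have "... = 1 / log 2 (real m + 1) * pieces snorm m E x"
     by (simp add: slog_def)
    also have "... \<le> Sup (succ_terms snorm x)"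
     by (rule cSup_upper[OF succ_termsI[OF norming_comb(2,3)] succ_terms_bdd[OF snorm_is_norm x]])
    finally show ?thesis by simp
   qed
  qed
  have "Sup (succ_terms snorm x) \<le> snorm x"
  proof (rule cSup_least)
   have "(2, %_. {}) \<in> {(n, E). 2 \<le> n \<and> successive n E}" by (auto simp: successive_def)
   thus "succ_terms snorm x \<noteq> {}" by blast
   fix y assume "y \<in> succ_terms snorm x"
   then obtain m E where m: "2 \<le> m" "successive m E" "y = 1 / slog m * pieces snorm m E x"
    by (auto simp: slog_def)
   show "y \<le> snorm x" using snorm_succ[OF x m(1,2)] slog_pos[of m] m(1) unfolding m(3) by (simp add: field_simps)
  qed
  thus "max (sup_norm x) (Sup (succ_terms snorm x)) \<le> snorm x"
   using sup_norm_le[OF snorm_coord[OF x]] by simp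
 qed
qed

lemma schlumprecht_norm_eq: "schlumprecht_norm = (snorm :: (nat => 'k::real_normed_field) => real)"
 unfolding schlumprecht_norm_def
proof (rule the_equality)
 show "is_norm_on c00 snorm \<and> satisfies_schlumprecht_eq snorm \<and> (\<forall>x. x \<notin> c00 --> snorm (x :: nat => 'k) = 0)"
  using snorm_is_norm snorm_eq by (auto simp: snorm_def)
 fix N :: "(nat => 'k) => real"
 assume N: "is_norm_on c00 N \<and> satisfies_schlumprecht_eq N \<and> (\<forall>x. x \<notin> c00 --> N x = 0)"
 show "N = snorm"
 proof
  fix x show "N x = snorm x"
   using N schlumprecht_unique[OF _ _ snorm_is_norm snorm_eq, of N x] by (cases "x \<in> c00") (auto simp: snorm_def)
 qed
qed

lemma snorm_le:
 fixes x :: "nat => 'k::real_normed_field"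
 assumes "x \<in> c00" "!!n. norm (x n) \<le> B"
  "!!m E. 2 \<le> m ==> successive m E ==> pieces snorm m E x \<le> slog m * B"
 shows "snorm x \<le> B"
 using schlumprecht_eq_le[OF snorm_eq assms] by blast

section \<open>Flat vectors and systems of l_1 type\<close>

lemma norming_card:
 assumes "norming \<phi>" "finite A" "A \<noteq> {}"
 shows "(\<Sum>n\<in>A. \<phi> n) \<le> card A / slog (card A)"
 using assms
proof (induction arbitrary: A rule: norming.induct)
 case (norming_unit n)
 have "1 \<le> card A" using norming_unit by (simp add: Suc_leI card_gt_0_iff)
 hence "slog (card A) \<le> card A"
 proof -
  show ?thesis using \<open>1 \<le> card A\<close> by (intro slog_le_self) auto
 qed
 hence "1 \<le> card A / slog (card A)" using slog_pos[of "card A"] \<open>1 \<le> card A\<close> by simp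
 moreover have "(\<Sum>m\<in>A. unitv n m) \<le> (1::real)" using norming_unit by (simp add: unitv_def)
 ultimately show ?case by linarith
next
 case (norming_comb m E \<phi>)
 have s: "slog m > 0" using norming_comb(1) by (intro slog_pos) auto
 have A: "card A > 0" using norming_comb.prems by (simp add: card_gt_0_iff)
 have disj: "disjoint_family_on (%l. E l \<inter> A) {..<m}"
  using successive_disjoint[OF norming_comb(2)] by (auto simp: disjoint_family_on_def)
 have sumcard: "(\<Sum>l<m. card (E l \<inter> A)) \<le> card A"
 proof -
  have "(\<Sum>l<m. card (E l \<inter> A)) = card (\<Union>l<m. E l \<inter> A)"
   using norming_comb.prems disj by (subst card_UN_disjoint) (auto simp: disjoint_family_on_def)
  also have "... \<le> card A" using norming_comb.prems by (intro card_mono) auto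
  finally show ?thesis .
 qed
 have "(\<Sum>n\<in>A. \<Sum>l<m. restr (E l) (\<phi> l) n) = (\<Sum>l<m. \<Sum>n\<in>A. restr (E l) (\<phi> l) n)" by (rule sum.swap)
 also have "... = (\<Sum>l<m. \<Sum>n\<in>E l \<inter> A. \<phi> l n)"
 proof (rule sum.cong[OF refl])
  fix l
  have "(\<Sum>n\<in>E l \<inter> A. \<phi> l n) = (\<Sum>n\<in>E l \<inter> A. restr (E l) (\<phi> l) n)" by (intro sum.cong) (auto simp: restr_def)
  also have "... = (\<Sum>n\<in>A. restr (E l) (\<phi> l) n)"
   using norming_comb.prems by (intro sum.mono_neutral_left) (auto simp: restr_def)
  finally show "(\<Sum>n\<in>A. restr (E l) (\<phi> l) n) = (\<Sum>n\<in>E l \<inter> A. \<phi> l n)" by simp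
 qed
 also have "... \<le> (\<Sum>l<m. card (E l \<inter> A) / slog (card (E l \<inter> A)))"
 proof (rule sum_mono)
  fix l assume l: "l \<in> {..<m}"
  show "(\<Sum>n\<in>E l \<inter> A. \<phi> l n) \<le> card (E l \<inter> A) / slog (card (E l \<inter> A))"
  proof (cases "E l \<inter> A = {}")
   case False
   thus ?thesis using l norming_comb.IH[of l "E l \<inter> A"] norming_comb.prems by auto
  qed simp
 qed
 also have "... \<le> slog m * ((\<Sum>l<m. card (E l \<inter> A)) / slog (\<Sum>l<m. card (E l \<inter> A)))"
  using norming_comb(1) by (intro sum_div_slog) auto
 also have "... \<le> slog m * (card A / slog (card A))"
 proof (intro mult_left_mono)
  show "real (\<Sum>l<m. card (E l \<inter> A)) / slog (\<Sum>l<m. card (E l \<inter> A)) \<le> card A / slog (card A)"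
  proof (cases "(\<Sum>l<m. card (E l \<inter> A)) = 0")
   case True
   have "slog (card A) > 0" using A by (intro slog_pos) auto
   thus ?thesis using True by simp
  next
   case False
   hence "1 \<le> real (\<Sum>l<m. card (E l \<inter> A))" by linarith
   thus ?thesis using div_slog_mono[of "real (\<Sum>l<m. card (E l \<inter> A))" "real (card A)"] sumcard by linarith
  qed
 qed (use s in auto)
 finally show ?case using s by (simp add: sum_divide_distrib[symmetric] field_simps)
qed

lemma snorm_indicator:
 assumes "finite A"
 shows "snorm (%n. if n \<in> A then c else (0::'k::real_normed_field)) \<le> norm c * (card A / slog (card A))"
proof (cases "A = {} \<or> c = 0")
 case True
 hence "(%n. if n \<in> A then c else 0) = (0 :: nat => 'k)" by auto
 moreover have "0 \<le> norm c * (card A / slog (card A))"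
  using slog_pos[of "card A"] by (cases "card A = 0") auto
 ultimately show ?thesis by (simp only: lat_zero[OF snorm_lattice])
next
 case False
 let ?x = "%n. if n \<in> A then c else (0::'k)"
 show ?thesis
 proof (rule snorm_least)
  show "?x \<in> c00" using assms by (intro c00_supp[of _ A]) (auto split: if_splits)
  fix \<phi> assume \<phi>: "norming \<phi>"
  have "(\<Sum>n | ?x n \<noteq> 0. \<phi> n * norm (?x n)) = (\<Sum>n\<in>A. \<phi> n * norm (?x n))"
   using assms by (intro ev_mono_set) (auto split: if_splits)
  also have "... = norm c * (\<Sum>n\<in>A. \<phi> n)" by (simp add: sum_distrib_left mult.commute)
  also have "... \<le> norm c * (card A / slog (card A))"
   using norming_card[OF \<phi>, of A] assms False by (intro mult_left_mono) auto
  finally show "(\<Sum>n | ?x n \<noteq> 0. \<phi> n * norm (?x n)) \<le> norm c * (card A / slog (card A))" .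
 qed
qed

text \<open>The points of F, taken as singletons, form a splitting; \<open>2 \<le> card F\<close>
  because the norm equation knows no splitting into one set.\<close>

lemma snorm_sum_coords:
 fixes x :: "nat => 'k::real_normed_field"
 assumes "x \<in> c00" "finite F" "2 \<le> card F"
 shows "(\<Sum>n\<in>F. norm (x n)) \<le> slog (card F) * snorm x"
proof -
 define e where "e l = {sorted_list_of_set F ! l}" for l
 have s: "successive (card F) e"
  by (rule successiveI) (use assms(2) in \<open>auto simp: e_def intro!: strict_sorted_iff[THEN iffD1] sorted_wrt_nth_less[where P = "(<)"] strict_sorted_list_of_set\<close>)
 have "bij_betw ((!) (sorted_list_of_set F)) {..<card F} F"
  using assms(2) by (intro bij_betw_nth) auto
 hence "(\<Sum>n\<in>F. norm (x n)) = (\<Sum>l<card F. norm (x (sorted_list_of_set F ! l)))"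
  by (rule sum.reindex_bij_betw[symmetric])
 also have "... \<le> (\<Sum>l<card F. snorm (restr (e l) x))"
 proof (rule sum_mono)
  fix l
  have "norm (restr (e l) x (sorted_list_of_set F ! l)) \<le> snorm (restr (e l) x)"
   using assms(1) by (intro snorm_coord) auto
  thus "norm (x (sorted_list_of_set F ! l)) \<le> snorm (restr (e l) x)" by (simp add: restr_def e_def)
 qed
 also have "... \<le> slog (card F) * snorm x" by (rule snorm_succ[OF assms(1,3) s])
 finally show ?thesis .
qed

definition block_sets :: "nat => nat => (nat => nat set) => bool"
 where "block_sets k n0 A \<longleftrightarrow> (\<forall>i<k. finite (A i) \<and> 2 \<le> card (A i) \<and> A i \<subseteq> {n0..}) \<and>
  (\<forall>i<k. \<forall>j<k. i \<noteq> j --> A i \<inter> A j = {})"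

text \<open>The parameter \<open>\<mu>\<close> is the reciprocal of the exponent. Weights \<open>w\<close> are used instead of coefficients
 so that the exponents \<open>1\<close> and \<open>\<infinity>\<close> need no separate treatment.\<close>

definition ell_system ::
  "((nat => 'k::real_normed_field) => real) => real => real => nat => (nat => nat set) => (nat => real) => (nat => real) => bool"
 where "ell_system N \<mu> C k A c d \<longleftrightarrow>
  (\<forall>B w. B \<subseteq> {..<k} \<and> (\<forall>i\<in>B. w i > 0) -->
   N (%n. \<Sum>i\<in>B. if n \<in> A i then of_real (w i powr \<mu> * c i) else 0) \<le> C * (\<Sum>i\<in>B. w i) powr \<mu> \<and>
   (\<forall>x\<in>c00. (\<Sum>i\<in>B. \<Sum>n\<in>A i. w i powr (1 - \<mu>) * d i * norm (x n)) \<le> C * (\<Sum>i\<in>B. w i) powr (1 - \<mu>) * N x))"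

text \<open>All blocks have the same length L > k. A union of at most k of them has at most L^2
  points, and \<open>slog (L^2) \<le> 2 * slog L\<close>: this is the constant 2 of the lower
  estimate. The upper estimate is the triangle inequality.\<close>

lemma schlumprecht_ell1_system:
 "\<exists>A. block_sets k n0 A \<and> ell_system (snorm :: (nat => 'k::real_normed_field) => real) 1 2 k A
  (%i. slog (card (A i)) / card (A i)) (%i. 1 / slog (card (A i)))"
proof -
 define L where "L = k + 2"
 define A where "A i = {n0 + i * L..<n0 + i * L + L}" for i
 have card: "card (A i) = L" for i by (simp add: A_def)
 have disj: "A i \<inter> A j = {}" if "i \<noteq> j" for i j
 proof -
  have "False" if "i < j" "n \<in> A i" "n \<in> A j" for n i j
  proof -
   have "i * L + L \<le> j * L" using that(1) mult_le_mono1[of "Suc i" j L] by simp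
   thus False using that by (auto simp: A_def)
  qed
  thus ?thesis using that by (metis disjoint_iff linorder_neqE_nat)
 qed
 have L: "2 \<le> L" "slog L > 0" by (auto simp: L_def intro!: slog_pos)
 have "block_sets k n0 A"
  using disj L(1) by (auto simp: block_sets_def card) (auto simp: A_def)
 moreover have "ell_system (snorm :: (nat => 'k) => real) 1 2 k A (%i. slog (card (A i)) / card (A i)) (%i. 1 / slog (card (A i)))"
  unfolding ell_system_def
 proof (intro allI impI conjI ballI)
  fix B and w :: "nat => real"
  assume B: "B \<subseteq> {..<k} \<and> (\<forall>i\<in>B. w i > 0)"
  have finB: "finite B" using B finite_subset by blast
  let ?c = "%i. w i * (slog L / L)"
  have "snorm (%n. \<Sum>i\<in>B. if n \<in> A i then of_real (?c i) else (0::'k))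
    \<le> (\<Sum>i\<in>B. snorm (%n. if n \<in> A i then of_real (?c i) else (0::'k)))"
   by (intro lat_sum[OF snorm_lattice] c00_supp[of _ "A _"]) (auto simp: A_def split: if_splits)
  also have "... \<le> (\<Sum>i\<in>B. w i)"
  proof (rule sum_mono)
   fix i assume i: "i \<in> B"
   have "snorm (%n. if n \<in> A i then of_real (?c i) else (0::'k)) \<le> norm (of_real (?c i) :: 'k) * (card (A i) / slog (card (A i)))"
    by (rule snorm_indicator) (simp add: A_def)
   also have "... = w i" using i B L unfolding card norm_of_real by (simp add: abs_mult less_imp_le)
   finally show "snorm (%n. if n \<in> A i then of_real (?c i) else (0::'k)) \<le> w i" .
  qed
  also have "... \<le> 2 * (\<Sum>i\<in>B. w i) powr 1"
  proof -
   have "0 \<le> (\<Sum>i\<in>B. w i)" using B by (intro sum_nonneg) (auto simp: less_imp_le)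
   thus ?thesis by simp
  qed
  finally have *: "snorm (%n. \<Sum>i\<in>B. if n \<in> A i then of_real (?c i) else (0::'k)) \<le> 2 * (\<Sum>i\<in>B. w i) powr 1" .
  show "snorm (%n. \<Sum>i\<in>B. if n \<in> A i then of_real (w i powr 1 * (slog (card (A i)) / card (A i))) else (0::'k))
    \<le> 2 * (\<Sum>i\<in>B. w i) powr 1"
  proof -
   have "(\<Sum>i\<in>B. if n \<in> A i then of_real (w i powr 1 * (slog (card (A i)) / card (A i))) else (0::'k))
    = (\<Sum>i\<in>B. if n \<in> A i then of_real (?c i) else 0)" for n
    unfolding card using B by (intro sum.cong refl) (simp add: less_imp_le)
   thus ?thesis using * by (simp only:)
  qed
  fix x :: "nat => 'k" assume x: "x \<in> c00"
  show "(\<Sum>i\<in>B. \<Sum>n\<in>A i. w i powr (1 - 1) * (1 / slog (card (A i))) * norm (x n)) \<le> 2 * (\<Sum>i\<in>B. w i) powr (1 - 1) * snorm x"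
  proof (cases "B = {}")
   case False
   let ?F = "\<Union>i\<in>B. A i"
   have F: "finite ?F" using finB by (auto simp: A_def)
   have cF: "card ?F = card B * L"
    using finB disj by (subst card_UN_disjoint) (auto simp: card, auto simp: A_def)
   have B1: "1 \<le> card B" "card B \<le> k"
    using False finB B card_mono[of "{..<k}" B] by (auto simp: Suc_le_eq card_gt_0_iff)
   have F2: "2 \<le> card ?F" using cF B1 L(1) mult_le_mono[of 1 "card B" 2 L] by simp
   have w0: "0 < (\<Sum>i\<in>B. w i)" using B False finB by (intro sum_pos) auto
   have "real (card ?F) + 1 \<le> (real L + 1)\<^sup>2"
   proof -
    have "card B * L + 1 \<le> (L + 1)\<^sup>2" using B1 mult_le_mono1[of "card B" L L] by (auto simp: L_def power2_eq_square)
    hence "real (card B * L + 1) \<le> real ((L + 1)\<^sup>2)" by (rule of_nat_mono)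
    thus ?thesis unfolding cF by (simp add: add.commute)
   qed
   hence "slog (card ?F) \<le> log 2 ((real L + 1)\<^sup>2)"
    unfolding slog_def by (intro log_mono) auto
   also have "... = 2 * slog L" unfolding slog_def by (subst log_nat_power) auto
   finally have sF: "slog (card ?F) \<le> 2 * slog L" .
   have "(\<Sum>i\<in>B. \<Sum>n\<in>A i. w i powr (1 - 1) * (1 / slog (card (A i))) * norm (x n)) = (\<Sum>i\<in>B. \<Sum>n\<in>A i. norm (x n)) / slog L"
    unfolding card using B by (simp add: sum_divide_distrib cong: sum.cong) (intro sum.cong refl, force)
   also have "(\<Sum>i\<in>B. \<Sum>n\<in>A i. norm (x n)) = (\<Sum>n\<in>?F. norm (x n))"
    using finB disj by (intro sum.UNION_disjoint[symmetric]) (auto simp: A_def)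
   also have "... \<le> slog (card ?F) * snorm x" by (rule snorm_sum_coords[OF x F F2])
   also have "... \<le> (2 * slog L) * snorm x"
    using sF lat_nonneg[OF snorm_lattice x] by (intro mult_right_mono)
   finally show ?thesis using L(2) w0 by (simp add: divide_right_mono)
  qed simp
 qed
 ultimately show ?thesis by blast
qed

section \<open>Interleaved averages and systems of l_infinity type\<close>

definition hull_set :: "nat set => nat set"
 where "hull_set E = {x. \<exists>a\<in>E. \<exists>b\<in>E. a \<le> x \<and> x \<le> b}"

lemma hull_subset_Icc: "E \<subseteq> {a..<b} ==> hull_set E \<subseteq> {a..<b}"
 unfolding hull_set_def by fastforce

lemma finite_hull: "finite E ==> finite (hull_set E)"
 using hull_subset_Icc[of E 0 "Suc (Max E)"] Max_ge[of E] finite_subset[of "hull_set E" "{0..<Suc (Max E)}"]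
 by (force simp: less_Suc_eq_le)

lemma hull_mono: "E \<subseteq> F ==> hull_set E \<subseteq> hull_set F"
 unfolding hull_set_def by blast

lemma successive_hull: "successive m E ==> successive m (%l. hull_set (E l))"
proof (rule successiveI)
 fix i assume "successive m E" "i < m"
 thus "finite (hull_set (E i))" using successive_finite finite_hull by blast
next
 fix i j a b assume *: "successive m E" "i < j" "j < m" "a \<in> hull_set (E i)" "b \<in> hull_set (E j)"
 then obtain a' b' where "a' \<in> E i" "a \<le> a'" "b' \<in> E j" "b' \<le> b" unfolding hull_set_def by blast
 thus "a < b" using successive_less[OF *(1-3), of a' b'] by simp
qed

text \<open>Sets are measured by their hulls: hulls of successive sets are still disjoint, and the
  hull controls the share that a set takes of every evenly spaced set at once.\<close>

lemma card_hull_successive: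
 assumes "successive m E" "finite F"
 shows "(\<Sum>l<m. card (hull_set (E l \<inter> F))) \<le> card (hull_set F)"
proof -
 have s: "successive m (%l. hull_set (E l \<inter> F))" by (intro successive_hull successive_inter assms)
 have "(\<Sum>l<m. card (hull_set (E l \<inter> F))) = card (\<Union>l<m. hull_set (E l \<inter> F))"
  using successive_disjoint[OF s] successive_finite[OF s] by (intro card_UN_disjoint[symmetric]) auto
 also have "... \<le> card (hull_set F)"
  using hull_mono[of _ F] by (intro card_mono finite_hull assms(2) UN_least) auto
 finally show ?thesis .
qed

text \<open>Every point of F except the last owns the D places from itself on, and all of these lie
  in the hull.\<close>

lemma card_hull_spaced:
 assumes "finite F" "!!x y. x \<in> F ==> y \<in> F ==> x < y ==> x + D \<le> y" "D \<ge> 1"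
 shows "(card F - 1) * D \<le> card (hull_set F)"
proof (cases "F = {}")
 case False
 define M where "M = Max F"
 have M: "M \<in> F" "!!x. x \<in> F ==> x \<le> M" using assms(1) False by (auto simp: M_def)
 have inj: "inj_on (%(x, j). x + j) ((F - {M}) \<times> {..<D})"
 proof -
  have "x = y \<and> j = i" if *: "x \<in> F" "y \<in> F" "j < D" "i < D" "x + j = y + i" for x y j i
   using assms(2)[of x y] assms(2)[of y x] * by (cases x y rule: linorder_cases) auto
  thus ?thesis by (auto simp: inj_on_def)
 qed
 have "(%(x, j). x + j) ` ((F - {M}) \<times> {..<D}) \<subseteq> hull_set F"
 proof (rule subsetI)
  fix z assume "z \<in> (%(x, j). x + j) ` ((F - {M}) \<times> {..<D})"
  then obtain x j where *: "x \<in> F" "x \<noteq> M" "j < D" and z: "z = x + j" by auto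
  hence "x + D \<le> M" using assms(2)[of x M] M(1) M(2)[of x] by simp
  thus "z \<in> hull_set F" unfolding z hull_set_def mem_Collect_eq
   using * M(1) by (intro bexI[of _ x] bexI[of _ M]) auto
 qed
 hence "card ((F - {M}) \<times> {..<D}) \<le> card (hull_set F)"
  using inj finite_hull[OF assms(1)] by (metis card_inj_on_le)
 thus ?thesis using M(1) assms(1) by (simp add: card_cartesian_product)
qed simp

lemma slog_sqrt: "slog n \<le> 2 * slog (sqrt n)" if "0 \<le> n" for n :: real
proof -
 have "n + 1 \<le> (sqrt n + 1)\<^sup>2" using that by (simp add: power2_eq_square algebra_simps)
 hence "slog n \<le> log 2 ((sqrt n + 1)\<^sup>2)" unfolding slog_def using that by (intro log_mono) auto
 also have "... = 2 * slog (sqrt n)" unfolding slog_def using that by (subst log_nat_power) (auto intro: add_nonneg_pos)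
 finally show ?thesis .
qed

text \<open>The left side bounds the norm of b coordinates of a normalised average of length n. If b
  \<ge> sqrt n, then \<open>slog n \<le> 2 * slog b\<close> and at most twice the proportion b/n
  remains; otherwise these coordinates are negligible.\<close>

lemma indicator_part_bound:
 fixes b n :: nat
 assumes "1 \<le> n" "b \<le> n"
 shows "slog n / n * (b / slog b) \<le> 2 * (b / n) + slog n / sqrt n"
proof (cases "sqrt n \<le> b")
 case True
 have p: "1 \<le> sqrt n" using assms(1) by simp
 hence b: "1 \<le> real b" using True by linarith
 hence "slog b > 0" by (intro slog_pos) auto
 moreover have "slog n \<le> 2 * slog b"
  using slog_sqrt[of n] slog_mono[of "sqrt n" b] True p by simp
 ultimately have "slog n / slog b \<le> 2" by (simp add: divide_simps)
 hence "b / n * (slog n / slog b) \<le> b / n * 2" by (intro mult_left_mono) auto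
 moreover have "0 \<le> slog n / sqrt n" using slog_pos[of n] assms by simp
 ultimately show ?thesis by (simp add: mult.commute)
next
 case False
 have s: "0 \<le> slog n" using slog_pos[of n] assms by simp
 have "b / slog b \<le> b"
 proof (cases "b = 0")
  case False
  hence "1 \<le> slog b" by (intro slog_ge_1) auto
  thus ?thesis by (simp add: divide_le_eq mult_le_cancel_left1)
 qed simp
 hence "slog n / n * (b / slog b) \<le> slog n / n * sqrt n" using False s by (intro mult_left_mono) auto
 also have "... = slog n / sqrt n" using assms(1) by (simp add: divide_simps)
 also have "... \<le> 2 * (b / n) + slog n / sqrt n" by simp
 finally show ?thesis .
qed

text \<open>An error bound for an average of length n = 2^b: \<open>slog n / sqrt n\<close> is at
  most (b + 1) 2^(-b/2), and the factor 2^((b+1)/4) pays for all m pieces of a splitting with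
  \<open>4 * slog m \<le> slog n\<close>.\<close>

definition etaf :: "nat => real" where "etaf b = (b + 1) * 2 powr ((b + 1) / 4 - b / 2)"

text \<open>Averages of rapidly increasing lengths, interleaved so that every interval contains about the same
 proportion of each of them. A functional of the Schlumprecht norm that acts on such a sum has, up to
 small errors, on each of finitely many intervals only one splitting into many pieces, and this
 splitting is efficient for only one of the averages.\<close>

locale interleaved =
 fixes k a n0 :: nat
 assumes k: "1 \<le> k" and a: "1 \<le> a"
begin

text \<open>The ratio 8 k is 4 * k * 2: the factors 4 and k of \<open>one_active_scale\<close> and a
  2 from \<open>slog (2^e) \<le> e + 1 \<le> 2 * e\<close>. The factor a moves all lengths so far
  out that the errors are small.\<close>

definition ex :: "nat => nat" where "ex i = a * (8 * k) ^ i"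
definition len :: "nat => nat" where "len i = 2 ^ ex i"
text \<open>Chosen so that \<open>gap i * len i\<close> is the same for all i < k and every gap is a
  multiple of k. With the offset i in \<open>A i\<close>, the sets lie in different residue classes
  modulo k.\<close>

definition gap :: "nat => nat" where "gap i = k * 2 ^ (ex (k - 1) - ex i)"
definition total :: nat where "total = k * 2 ^ ex (k - 1)"
definition A :: "nat => nat set" where "A i = (%t. n0 + i + gap i * t) ` {..<len i}"
definition W :: "nat => 'k::real_normed_field"
 where "W m = (\<Sum>i<k. if m \<in> A i then of_real (slog (len i) / len i) else 0)"
definition piece :: "nat => nat set => real"
 where "piece i F = slog (len i) / len i * (card (F \<inter> A i) / slog (card (F \<inter> A i)))"
definition propn :: "nat set => real" where "propn F = card (hull_set F) / total"

lemma ex_growth: "i < j ==> 8 * k * ex i \<le> ex j"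
proof -
 assume "i < j"
 hence "(8 * k) ^ Suc i \<le> (8 * k) ^ j" using k by (intro power_increasing) auto
 hence "a * (8 * k) ^ Suc i \<le> a * (8 * k) ^ j" by (rule mult_le_mono2)
 thus ?thesis by (simp add: ex_def mult_ac)
qed

lemma ex_ge: "1 \<le> ex i" "a \<le> ex i"
proof -
 have "1 \<le> (8 * k) ^ i" using k by simp
 thus "a \<le> ex i" by (simp add: ex_def)
 thus "1 \<le> ex i" using a by linarith
qed

lemma ex_mono: "i \<le> j ==> ex i \<le> ex j"
 using ex_growth[of i j] k by (cases "i = j") (auto intro: order_trans[of _ "8 * k * ex i"])

lemma len_pos: "2 \<le> len i" "0 < len i"
proof -
 have "2 ^ 1 \<le> (2::nat) ^ ex i" using ex_ge[of i] by (intro power_increasing) auto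
 thus "2 \<le> len i" by (simp add: len_def)
 thus "0 < len i" by simp
qed

lemma gap_len: "i < k ==> gap i * len i = total"
 using ex_mono[of i "k - 1"] by (simp add: gap_def len_def total_def mult.assoc power_add[symmetric])

lemma gap_ge: "k \<le> gap i"
 by (simp add: gap_def)

lemma total_pos: "0 < total"
 using k by (simp add: total_def)

lemma finite_A [simp]: "finite (A i)"
 by (simp add: A_def)

lemma card_A: "card (A i) = len i"
proof -
 have "inj_on (%t. n0 + i + gap i * t) {..<len i}" using gap_ge[of i] k by (auto simp: inj_on_def)
 thus ?thesis by (simp add: A_def card_image)
qed

lemma A_subset: "i < k ==> A i \<subseteq> {n0..<n0 + total}"
proof
 fix m assume i: "i < k" and "m \<in> A i"
 then obtain t where t: "t < len i" "m = n0 + i + gap i * t" by (auto simp: A_def)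
 have "gap i * t + gap i \<le> gap i * len i" using t(1) mult_le_mono2[of "Suc t" "len i" "gap i"] by simp
 hence "gap i * t + i < total" using gap_len[OF i] gap_ge[of i] i by linarith
 thus "m \<in> {n0..<n0 + total}" using t by simp
qed

lemma A_disjoint: "i < k ==> j < k ==> i \<noteq> j ==> A i \<inter> A j = {}"
proof (rule ccontr)
 assume ij: "i < k" "j < k" "i \<noteq> j" and "A i \<inter> A j \<noteq> {}"
 then obtain t u where "i + gap i * t = j + gap j * u" by (auto simp: A_def)
 hence "(i + gap i * t) mod k = (j + gap j * u) mod k" by simp
 thus False using ij by (simp add: gap_def mult.assoc)
qed

lemma block_sets_A: "block_sets k n0 A"
 using A_subset A_disjoint len_pos(1) by (fastforce simp: block_sets_def card_A)

text \<open>By the constant spacing of \<open>A i\<close>, c points of it force a hull of at least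
  (c - 1) * \<open>gap i\<close> places; the lost point is the term
  \<open>1 / len i\<close>.\<close>

lemma proportion:
 assumes "i < k" "finite F"
 shows "card (F \<inter> A i) / len i \<le> propn F + 1 / len i"
proof -
 have "(card (F \<inter> A i) - 1) * gap i \<le> card (hull_set (F \<inter> A i))"
 proof (rule card_hull_spaced)
  fix x y assume "x \<in> F \<inter> A i" "y \<in> F \<inter> A i" "x < y"
  then obtain t u where t: "x = n0 + i + gap i * t" "y = n0 + i + gap i * u" "t < u" by (auto simp: A_def)
  thus "x + gap i \<le> y" using mult_le_mono2[of "Suc t" u "gap i"] by simp
 qed (use assms gap_ge[of i] k in auto)
 also have "... \<le> card (hull_set F)" using assms by (intro card_mono finite_hull hull_mono) auto
 finally have "real ((card (F \<inter> A i) - 1) * gap i) \<le> card (hull_set F)" by (rule of_nat_mono)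
 hence "(real (card (F \<inter> A i)) - 1) * gap i \<le> card (hull_set F)"
  by (rule order_trans[rotated]) (auto intro!: mult_right_mono)
 hence "(real (card (F \<inter> A i)) - 1) * gap i / total \<le> propn F"
  unfolding propn_def by (rule divide_right_mono) auto
 moreover have "(real (card (F \<inter> A i)) - 1) * gap i / total = (real (card (F \<inter> A i)) - 1) / len i"
 proof -
  have "real total = real (gap i) * real (len i)" using gap_len[OF assms(1)] by (metis of_nat_mult)
  moreover have "0 < real (gap i)" using gap_ge[of i] k by simp
  ultimately show ?thesis by simp
 qed
 ultimately show ?thesis by (simp add: diff_divide_distrib)
qed

lemma prop_successive:
 assumes "successive m E" "finite F"
 shows "(\<Sum>l<m. propn (E l \<inter> F)) \<le> propn F"
proof -
 have "real (\<Sum>l<m. card (hull_set (E l \<inter> F))) \<le> card (hull_set F)"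
  by (intro of_nat_mono card_hull_successive assms)
 thus ?thesis by (simp add: propn_def sum_divide_distrib[symmetric] divide_right_mono)
qed

lemma slog_len: "ex i \<le> slog (len i)" "slog (len i) \<le> ex i + 1"
proof -
 have "log 2 (2 ^ ex i) \<le> slog (len i)" unfolding slog_def len_def by (intro log_mono) auto
 thus "ex i \<le> slog (len i)" by (simp add: log_nat_power)
 have "real (len i) + 1 \<le> 2 ^ (ex i + 1)" by (simp add: len_def)
 hence "slog (len i) \<le> log 2 (2 ^ (ex i + 1))" unfolding slog_def by (intro log_mono) (auto intro: add_nonneg_pos)
 also have "... = ex i + 1" by (subst log_nat_power) auto
 finally show "slog (len i) \<le> ex i + 1" .
qed

lemma sqrt_len: "sqrt (len i) = 2 powr (ex i / 2)"
 by (simp add: len_def powr_half_sqrt[symmetric] powr_powr powr_realpow[symmetric])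

lemma slog_sqrt_le: "slog (len i) / sqrt (len i) * 2 powr ((ex i + 1) / 4) \<le> etaf (ex i)"
proof -
 have "slog (len i) / sqrt (len i) * 2 powr ((ex i + 1) / 4) \<le> (ex i + 1) / sqrt (len i) * 2 powr ((ex i + 1) / 4)"
  using slog_len(2)[of i] by (intro mult_right_mono divide_right_mono) auto
 also have "... = etaf (ex i)" by (simp add: etaf_def sqrt_len powr_diff add.commute)
 finally show ?thesis .
qed

lemma slog_sqrt_le': "slog (len i) / sqrt (len i) \<le> etaf (ex i)"
proof -
 have "1 \<le> (2::real) powr ((ex i + 1) / 4)" by (intro ge_one_powr_ge_zero) auto
 moreover have "0 \<le> slog (len i) / sqrt (len i)" using slog_pos[of "len i"] len_pos[of i] by simp
 ultimately have "slog (len i) / sqrt (len i) * 1 \<le> slog (len i) / sqrt (len i) * 2 powr ((ex i + 1) / 4)"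
  by (intro mult_left_mono)
 thus ?thesis using slog_sqrt_le[of i] by simp
qed

lemma W_coord:
 assumes "!!i. i < k ==> etaf (ex i) \<le> \<nu>" "0 \<le> \<nu>"
 shows "norm (W m :: 'k::real_normed_field) \<le> \<nu>"
proof (cases "\<exists>j<k. m \<in> A j")
 case True
 then obtain j where j: "j < k" "m \<in> A j" by blast
 have "(W m :: 'k) = (\<Sum>i<k. if i = j then of_real (slog (len j) / len j) else 0)"
  unfolding W_def using A_disjoint[of j] j by (intro sum.cong) auto
 hence "(W m :: 'k) = of_real (slog (len j) / len j)" using j by simp
 hence "norm (W m :: 'k::real_normed_field) = slog (len j) / len j"
  using slog_pos[of "len j"] len_pos[of j] by (simp only: norm_of_real) simp
 also have "... \<le> slog (len j) / sqrt (len j)"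
 proof (rule divide_left_mono)
  show "sqrt (len j) \<le> len j" using len_pos[of j] by (intro real_le_lsqrt) (auto simp: power2_eq_square)
 qed (use slog_pos[of "len j"] len_pos[of j] in auto)
 also have "... \<le> \<nu>" using slog_sqrt_le'[of j] assms(1)[OF j(1)] by simp
 finally show ?thesis .
next
 case False
 hence "(W m :: 'k) = 0" unfolding W_def by (intro sum.neutral) auto
 thus ?thesis using assms(2) by simp
qed

lemma W_c00: "W \<in> c00"
 unfolding W_def by (intro c00_sum c00_supp[of _ "A _"]) (auto split: if_splits)

lemma W_part:
 assumes "finite F"
 shows "snorm (restr F (W :: nat => 'k::real_normed_field)) \<le> (\<Sum>i<k. piece i F)"
proof -
 have "restr F (W :: nat => 'k) = (%m. \<Sum>i<k. if m \<in> F \<inter> A i then of_real (slog (len i) / len i) else 0)"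
  by (auto simp: restr_def W_def fun_eq_iff)
 hence "snorm (restr F (W :: nat => 'k))
   \<le> (\<Sum>i<k. snorm (%m. if m \<in> F \<inter> A i then of_real (slog (len i) / len i) else (0::'k)))"
  by (simp only:) (intro lat_sum[OF snorm_lattice] c00_supp[of _ "A _"], auto split: if_splits)
 also have "... \<le> (\<Sum>i<k. piece i F)"
 proof (rule sum_mono)
  fix i
  have "snorm (%m. if m \<in> F \<inter> A i then of_real (slog (len i) / len i) else (0::'k))
    \<le> norm (of_real (slog (len i) / len i) :: 'k) * (card (F \<inter> A i) / slog (card (F \<inter> A i)))"
   using assms by (intro snorm_indicator) auto
  also have "norm (of_real (slog (len i) / len i) :: 'k) = slog (len i) / len i"
   using slog_pos[of "len i"] len_pos[of i] by (simp only: norm_of_real) simp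
  finally show "snorm (%m. if m \<in> F \<inter> A i then of_real (slog (len i) / len i) else (0::'k)) \<le> piece i F"
   by (simp add: piece_def)
 qed
 finally show ?thesis .
qed

lemma card_le_len: "finite F ==> card (F \<inter> A i) \<le> len i"
 using card_mono[of "A i" "F \<inter> A i"] by (simp add: card_A)

lemma card_successive:
 assumes "successive m E" "finite F"
 shows "(\<Sum>l<m. card (E l \<inter> F)) \<le> card F"
proof -
 have s: "successive m (%l. E l \<inter> F)" by (intro successive_inter assms)
 have "(\<Sum>l<m. card (E l \<inter> F)) = card (\<Union>l<m. E l \<inter> F)"
  using successive_disjoint[OF s] successive_finite[OF s] by (intro card_UN_disjoint[symmetric]) auto
 also have "... \<le> card F" by (intro card_mono assms) auto
 finally show ?thesis .
qed

context
 fixes m :: nat and E :: "nat => nat set" and F :: "nat set"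
 assumes E: "successive m E" and F: "finite F" and m: "2 \<le> m"
begin

lemma card_pieces: "(\<Sum>l<m. real (card (E l \<inter> F \<inter> A i))) \<le> card (F \<inter> A i)"
 using card_successive[OF E, of "F \<inter> A i"] F by (simp add: Int_assoc flip: of_nat_sum)

text \<open>Few pieces: each has about its share plus an error, and
  \<open>real m \<le> 2 powr ((ex i + 1) / 4)\<close> keeps the sum of the m errors below
  \<open>etaf\<close>.\<close>

lemma part_small_split:
 assumes "4 * slog m \<le> slog (len i)"
 shows "(\<Sum>l<m. piece i (E l \<inter> F)) \<le> 2 * (card (F \<inter> A i) / len i) + etaf (ex i)"
proof -
 have "real m \<le> 2 powr slog m" using m by (simp add: slog_def)
 also have "... \<le> 2 powr ((ex i + 1) / 4)" using assms slog_len(2)[of i] by simp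
 finally have m': "real m \<le> 2 powr ((ex i + 1) / 4)" .
 have "(\<Sum>l<m. piece i (E l \<inter> F)) \<le> (\<Sum>l<m. 2 * (card (E l \<inter> F \<inter> A i) / len i) + slog (len i) / sqrt (len i))"
  unfolding piece_def using F len_pos[of i] by (intro sum_mono indicator_part_bound card_le_len) auto
 also have "... = 2 * ((\<Sum>l<m. real (card (E l \<inter> F \<inter> A i))) / len i) + slog (len i) / sqrt (len i) * m"
  by (simp add: sum.distrib sum_distrib_left sum_divide_distrib)
 also have "... \<le> 2 * (card (F \<inter> A i) / len i) + slog (len i) / sqrt (len i) * 2 powr ((ex i + 1) / 4)"
  using card_pieces[of i] m' slog_pos[of "len i"] len_pos[of i]
  by (intro add_mono mult_left_mono divide_right_mono) auto
 also have "... \<le> 2 * (card (F \<inter> A i) / len i) + etaf (ex i)" using slog_sqrt_le[of i] by simp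
 finally show ?thesis .
qed

text \<open>For very many pieces the trivial estimate is good enough, because it will be divided by
  an \<open>slog m\<close> that is at least k times \<open>slog (len i)\<close>.\<close>

lemma part_large_split: "(\<Sum>l<m. piece i (E l \<inter> F)) \<le> slog (len i) * (card (F \<inter> A i) / len i)"
proof -
 have p: "0 \<le> slog (len i) / len i" using slog_pos[of "len i"] len_pos[of i] by simp
 have "b / slog b \<le> b" for b :: nat
 proof (cases "b = 0")
  case False
  hence "1 \<le> slog b" by (intro slog_ge_1) auto
  thus ?thesis by (simp add: divide_le_eq mult_le_cancel_left1)
 qed simp
 hence "(\<Sum>l<m. piece i (E l \<inter> F)) \<le> (\<Sum>l<m. slog (len i) / len i * card (E l \<inter> F \<inter> A i))"
  unfolding piece_def using p by (intro sum_mono mult_left_mono)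
 also have "... = slog (len i) / len i * (\<Sum>l<m. real (card (E l \<inter> F \<inter> A i)))" by (simp add: sum_distrib_left)
 also have "... \<le> slog (len i) / len i * card (F \<inter> A i)" using card_pieces p by (intro mult_left_mono)
 finally show ?thesis by simp
qed

text \<open>Holds for every m; its price is the factor \<open>slog m\<close>, affordable for a
  single average.\<close>

lemma part_split: "(\<Sum>l<m. piece i (E l \<inter> F)) \<le> slog m * (2 * (card (F \<inter> A i) / len i) + etaf (ex i))"
proof -
 have p: "0 \<le> slog (len i) / len i" using slog_pos[of "len i"] len_pos[of i] by simp
 have sm: "0 < slog m" using m by (intro slog_pos) auto
 let ?s = "\<Sum>l<m. card (E l \<inter> F \<inter> A i)"
 have s: "?s \<le> len i"
  using card_successive[OF E, of "F \<inter> A i"] F card_le_len[OF F, of i] by (simp add: Int_assoc)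
 have "(\<Sum>l<m. piece i (E l \<inter> F)) = slog (len i) / len i * (\<Sum>l<m. card (E l \<inter> F \<inter> A i) / slog (card (E l \<inter> F \<inter> A i)))"
  by (simp add: piece_def sum_distrib_left)
 also have "... \<le> slog (len i) / len i * (slog m * (?s / slog ?s))"
  using m p by (intro mult_left_mono sum_div_slog) auto
 also have "... = slog m * (slog (len i) / len i * (?s / slog ?s))" by simp
 also have "... \<le> slog m * (2 * (?s / len i) + slog (len i) / sqrt (len i))"
  using sm s len_pos[of i] by (intro mult_left_mono indicator_part_bound) auto
 also have "... \<le> slog m * (2 * (card (F \<inter> A i) / len i) + etaf (ex i))"
  using sm card_pieces[of i] slog_sqrt_le'[of i]
  by (intro mult_left_mono add_mono divide_right_mono) auto
 finally show ?thesis .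
qed

lemma one_active_scale:
 "\<exists>i0. \<forall>i<k. i \<noteq> i0 --> 4 * slog m \<le> slog (len i) \<or> k * slog (len i) \<le> slog m"
proof (rule ccontr)
 assume none: "\<not> ?thesis"
 then obtain i where i: "i < k" "\<not> (4 * slog m \<le> slog (len i) \<or> k * slog (len i) \<le> slog m)" by metis
 then obtain j where j: "j < k" "j \<noteq> i" "\<not> (4 * slog m \<le> slog (len j) \<or> k * slog (len j) \<le> slog m)"
  using none by metis
 have False if "i < j" "slog (len j) < 4 * slog m" "slog m < k * slog (len i)" for i j
 proof -
  have "real (8 * k * ex i) \<le> ex j" using ex_growth[OF that(1)] by (rule of_nat_mono)
  also have "... \<le> slog (len j)" by (rule slog_len)
  also have "... < 4 * (real k * slog (len i))" using that by linarith
  also have "... \<le> 4 * (real k * (2 * real (ex i)))" using slog_len(2)[of i] ex_ge(1)[of i] by (intro mult_left_mono) auto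
  finally show False by simp
 qed
 thus False using i j by (metis linorder_neqE_nat not_le)
qed

text \<open>When the accumulated weight of the splitting is below 1/k, each of the k averages
  contributes at most b/k, except for one that contributes at most b more. The total 2 b is the
  right-hand side.\<close>

lemma giant_step:
 assumes "0 \<le> w" "w \<le> 1" "w / slog m < 1 / k" "!!i. i < k ==> etaf (ex i) \<le> \<nu> \<and> 1 / len i \<le> \<nu>" "0 \<le> \<nu>"
 shows "w / slog m * (\<Sum>l<m. snorm (restr (E l) (restr F (W :: nat => 'k::real_normed_field)))) \<le> 4 * propn F + 6 * \<nu>"
proof -
 obtain i0 where i0: "!!i. i < k ==> i \<noteq> i0 ==> 4 * slog m \<le> slog (len i) \<or> k * slog (len i) \<le> slog m"
  using one_active_scale by blast
 have sm: "0 < slog m" using m by (intro slog_pos) auto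
 define b where "b = 2 * (propn F + \<nu>) + \<nu>"
 have b0: "0 \<le> b" using assms(5) by (simp add: b_def propn_def)
 have scale: "w / slog m * (\<Sum>l<m. piece i (E l \<inter> F)) \<le> b / k + (if i = i0 then b else 0)" if i: "i < k" for i
 proof -
  have al: "card (F \<inter> A i) / len i \<le> propn F + \<nu>" using proportion[OF i F] assms(4)[OF i] by linarith
  have le_b: "2 * (card (F \<inter> A i) / len i) + etaf (ex i) \<le> b" using al assms(4)[OF i] by (simp add: b_def)
  consider "i = i0" | "i \<noteq> i0" "4 * slog m \<le> slog (len i)" | "i \<noteq> i0" "k * slog (len i) \<le> slog m"
   using i0[OF i] by blast
  thus ?thesis
  proof cases
   case 1
   have "w / slog m * (\<Sum>l<m. piece i (E l \<inter> F)) \<le> w / slog m * (slog m * b)"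
    using part_split[of i] le_b sm assms(1) by (intro mult_left_mono order_trans[OF part_split] mult_left_mono) auto
   also have "... = w * b" using sm by simp
   also have "... \<le> b" using assms(2) b0 by (simp add: mult_left_le_one_le assms(1))
   also have "... \<le> b / k + b" using b0 by simp
   finally show ?thesis using 1 by simp
  next
   case 2
   have "w / slog m * (\<Sum>l<m. piece i (E l \<inter> F)) \<le> w / slog m * b"
    using part_small_split[OF 2(2)] le_b sm assms(1) by (intro mult_left_mono) auto
   also have "... \<le> 1 / k * b" using assms(3) b0 by (intro mult_right_mono) auto
   finally show ?thesis using 2 by simp
  next
   case 3
   have "w / slog m * (\<Sum>l<m. piece i (E l \<inter> F)) \<le> w / slog m * (slog (len i) * b)"
   proof (rule mult_left_mono)
    have "0 \<le> slog (len i)" using slog_pos[of "len i"] len_pos[of i] by simp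
    moreover have "card (F \<inter> A i) / len i \<le> b" using al assms(5) b0 by (simp add: b_def)
    ultimately show "(\<Sum>l<m. piece i (E l \<inter> F)) \<le> slog (len i) * b"
     using part_large_split[of i] by (meson mult_left_mono order_trans)
   qed (use assms sm in auto)
   also have "... = w * (slog (len i) / slog m) * b" by simp
   also have "... \<le> 1 * (1 / k) * b"
    using assms(1,2) 3(2) sm k slog_pos[of "len i"] len_pos[of i] b0
    by (intro mult_right_mono mult_mono) (auto simp: divide_simps mult.commute)
   finally show ?thesis using 3 by simp
  qed
 qed
 have "w / slog m * (\<Sum>l<m. snorm (restr (E l) (restr F (W :: nat => 'k))))
   \<le> w / slog m * (\<Sum>l<m. \<Sum>i<k. piece i (E l \<inter> F))"
  using assms(1) sm F by (intro mult_left_mono sum_mono) (auto simp: restr_restr intro!: W_part)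
 also have "... = (\<Sum>i<k. w / slog m * (\<Sum>l<m. piece i (E l \<inter> F)))"
  by (subst sum.swap) (simp add: sum_distrib_left)
 also have "... \<le> (\<Sum>i<k. b / k + (if i = i0 then b else 0))" by (intro sum_mono scale) auto
 also have "... \<le> b + b" using k b0 by (simp add: sum.distrib)
 also have "... = 4 * propn F + 6 * \<nu>" by (simp add: b_def)
 finally show ?thesis .
qed

end

lemma W_step:
 fixes w :: real
 assumes "0 < w" "w \<le> 1" "!!i. i < k ==> etaf (ex i) \<le> \<nu>" "0 \<le> \<nu>" "\<nu> \<le> R"
  and "!!m E. 2 \<le> m ==> successive m E ==>
   w / slog m * (\<Sum>l<m. snorm (restr (E l) (restr F (W :: nat => 'k::real_normed_field)))) \<le> R"
 shows "w * snorm (restr F (W :: nat => 'k)) \<le> R"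
proof -
 have "snorm (restr F (W :: nat => 'k)) \<le> R / w"
 proof (rule snorm_le)
  show "restr F (W :: nat => 'k) \<in> c00" by (intro c00_restr W_c00)
  fix n
  have "norm (restr F (W :: nat => 'k) n) \<le> norm (W n :: 'k)" by (simp add: restr_def)
  also have "... \<le> \<nu>" by (rule W_coord[OF assms(3,4)])
  also have "... \<le> R" by (rule assms(5))
  also have "... \<le> R / w" using assms(1,2,4,5) mult_left_le[of w R] by (simp add: le_divide_eq)
  finally show "norm (restr F (W :: nat => 'k) n) \<le> R / w" .
 next
  fix m :: nat and E assume m: "2 \<le> m" "successive m E"
  have "0 < slog m" using m(1) by (intro slog_pos) auto
  thus "(\<Sum>l<m. snorm (restr (E l) (restr F (W :: nat => 'k)))) \<le> slog m * (R / w)"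
   using assms(6)[OF m] assms(1) by (simp add: field_simps)
 qed
 thus ?thesis using assms(1) by (simp add: field_simps)
qed

text \<open>Here w is the product of the factors \<open>1 / slog m\<close> of the splittings made so
  far. If the next splitting pushes the weight below 1/k, \<open>giant_step\<close> ends the
  descent. Otherwise \<open>slog m \<le> k\<close>, so there are at most 2^k pieces: the proportions
  add up over successive pieces, and the errors are multiplied by 2^k. Every descent lowers the
  weight by a factor 3/2, so d need only be of the order of log k.\<close>

lemma W_weighted:
 fixes w :: real
 assumes "!!i. i < k ==> etaf (ex i) \<le> \<nu> \<and> 1 / len i \<le> \<nu>" "0 \<le> \<nu>"
 shows "finite F ==> 0 < w ==> w \<le> 1 ==> w * k < (3 / 2) ^ d ==>
  w * snorm (restr F (W :: nat => 'k::real_normed_field)) \<le> 4 * propn F + (2 ^ k) ^ d * (6 * \<nu>)"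
proof (induction d arbitrary: F w)
 case (0 F w)
 have p0: "0 \<le> propn F" by (simp add: propn_def)
 show ?case
 proof (rule W_step[where \<nu> = \<nu>])
  fix m :: nat and E assume m: "2 \<le> m" "successive m E"
  have "1 \<le> slog m" using m(1) by (intro slog_ge_1) auto
  hence "w / slog m \<le> w" using 0 by (simp add: divide_le_eq)
  also have "... < 1 / k" using 0 k by (simp add: field_simps)
  finally show "w / slog m * (\<Sum>l<m. snorm (restr (E l) (restr F (W :: nat => 'k)))) \<le> 4 * propn F + (2 ^ k) ^ 0 * (6 * \<nu>)"
   using giant_step[OF m(2) 0(1) m(1), of w \<nu>, where 'k = 'k] 0 assms by simp
 qed (use 0 assms p0 in auto)
next
 case (Suc d F w)
 have p0: "0 \<le> propn F" by (simp add: propn_def)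
 have big: "6 * \<nu> \<le> (2 ^ k) ^ Suc d * (6 * \<nu>)"
  using mult_right_mono[of 1 "(2 ^ k) ^ Suc d :: real" "6 * \<nu>"] assms(2) one_le_power[of "2 ^ k :: real" "Suc d"] by simp
 show ?case
 proof (rule W_step[where \<nu> = \<nu>])
  show "\<nu> \<le> 4 * propn F + (2 ^ k) ^ Suc d * (6 * \<nu>)" using big p0 assms(2) by linarith
  fix m :: nat and E assume m: "2 \<le> m" "successive m E"
  have sm: "3 / 2 \<le> slog m" using m(1) by (intro slog_ge_3_2) auto
  show "w / slog m * (\<Sum>l<m. snorm (restr (E l) (restr F (W :: nat => 'k)))) \<le> 4 * propn F + (2 ^ k) ^ Suc d * (6 * \<nu>)"
  proof (cases "w / slog m < 1 / k")
   case True
   thus ?thesis using giant_step[OF m(2) Suc.prems(1) m(1) _ _ True, of \<nu>, where 'k = 'k] Suc.prems assms big by simp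
  next
   case False
   hence "slog m \<le> w * k" using sm k by (simp add: field_simps)
   also have "... \<le> k" using Suc.prems mult_right_mono[of w 1 "real k"] by simp
   finally have "2 powr slog m \<le> 2 powr k" by simp
   hence "real m + 1 \<le> 2 ^ k" using m(1) by (simp add: slog_def powr_realpow)
   hence mk: "real m \<le> 2 ^ k" by linarith
   have w': "0 < w / slog m" "w / slog m \<le> 1" "w / slog m * k < (3 / 2) ^ d"
   proof -
    show "0 < w / slog m" "w / slog m \<le> 1" using Suc.prems sm by (auto simp: divide_le_eq)
    have "w * k < (3 / 2) ^ d * (3 / 2)" using Suc.prems by (simp add: mult.commute)
    also have "... \<le> (3 / 2) ^ d * slog m" using sm by (intro mult_left_mono) auto
    finally show "w / slog m * k < (3 / 2) ^ d" using sm by (simp add: field_simps)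
   qed
   have "w / slog m * (\<Sum>l<m. snorm (restr (E l) (restr F (W :: nat => 'k))))
     = (\<Sum>l<m. w / slog m * snorm (restr (E l \<inter> F) (W :: nat => 'k)))"
    by (simp add: restr_restr sum_distrib_left)
   also have "... \<le> (\<Sum>l<m. 4 * propn (E l \<inter> F) + (2 ^ k) ^ d * (6 * \<nu>))"
    using Suc.prems(1) by (intro sum_mono Suc.IH w') auto
   also have "... = 4 * (\<Sum>l<m. propn (E l \<inter> F)) + m * ((2 ^ k) ^ d * (6 * \<nu>))"
    by (simp add: sum.distrib sum_distrib_left)
   also have "... \<le> 4 * propn F + 2 ^ k * ((2 ^ k) ^ d * (6 * \<nu>))"
    using prop_successive[OF m(2) Suc.prems(1)] mk assms(2) by (intro add_mono mult_right_mono) auto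
   finally show ?thesis by (simp add: mult.assoc)
  qed
 qed (use Suc.prems assms in auto)
qed

text \<open>The start of the descent has weight 1: four for the full proportion, one for all errors
  together.\<close>

lemma W_bound:
 assumes "!!i. i < k ==> etaf (ex i) \<le> \<nu> \<and> 1 / len i \<le> \<nu>" "0 \<le> \<nu>" "k < (3 / 2 :: real) ^ d" "(2 ^ k) ^ d * (6 * \<nu>) \<le> 1"
 shows "snorm (W :: nat => 'k::real_normed_field) \<le> 5"
proof -
 let ?F = "{n0..<n0 + total}"
 have "restr ?F (W :: nat => 'k) = W"
 proof (rule restr_supp)
  fix n assume "(W :: nat => 'k) n \<noteq> 0"
  hence "\<exists>i<k. n \<in> A i" unfolding W_def by (rule contrapos_np) (auto intro: sum.neutral)
  thus "n \<in> ?F" using A_subset by blast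
 qed
 moreover have "1 * snorm (restr ?F (W :: nat => 'k)) \<le> 4 * propn ?F + (2 ^ k) ^ d * (6 * \<nu>)"
  using assms by (intro W_weighted) auto
 moreover have "card (hull_set ?F) \<le> total"
  using card_mono[OF _ hull_subset_Icc[OF order_refl, of n0 "n0 + total"]] by simp
 hence "propn ?F \<le> 1" using total_pos by (simp add: propn_def)
 ultimately show ?thesis using assms(4) by simp
qed

end

lemma etaf_tendsto_0: "etaf \<longlonglongrightarrow> 0"
proof -
 define c :: real where "c = 2 powr (- 1 / 4)"
 have c: "norm c < 1" "0 < c" by (auto simp: c_def powr_less_one)
 have "(%b. 2 powr (1 / 4) * (of_nat b * c ^ b + c ^ b)) \<longlonglongrightarrow> 2 powr (1 / 4) * (0 + 0)"
  using c by (intro tendsto_intros powser_times_n_limit_0 LIMSEQ_power_zero)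
 moreover have "etaf = (%b. 2 powr (1 / 4) * (of_nat b * c ^ b + c ^ b))"
 proof
  fix b
  have "c ^ b = 2 powr (- real b / 4)" using c(2) by (simp add: c_def powr_power)
  hence "2 powr (1 / 4) * c ^ b = 2 powr ((real b + 1) / 4 - real b / 2)"
  proof -
   have e: "(real b + 1) / 4 - real b / 2 = 1 / 4 + (- real b / 4)" by (simp add: field_simps)
   show ?thesis unfolding e powr_add using \<open>c ^ b = _\<close> by simp
  qed
  hence "etaf b = (real b + 1) * (2 powr (1 / 4) * c ^ b)" by (simp only: etaf_def)
  thus "etaf b = 2 powr (1 / 4) * (of_nat b * c ^ b + c ^ b)" by (simp add: algebra_simps)
 qed
 ultimately show ?thesis by (simp only: add_0 mult_zero_right)
qed

lemma schlumprecht_sup_system: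
 "\<exists>A. block_sets k n0 A \<and> ell_system (snorm :: (nat => 'k::real_normed_field) => real) 0 5 k A
  (%i. slog (card (A i)) / card (A i)) (%i. 1 / slog (card (A i)))"
proof -
 \<comment> \<open>The construction wants at least one average, while k may be 0. One average too
   many is made, and the first k are used.\<close>
 define K where "K = Suc k"
 obtain d where d: "real K < (3 / 2) ^ d" using real_arch_pow[of "3 / 2" "real K"] by auto
 \<comment> \<open>With this value the errors accumulated over d nested splittings add up to exactly
   1.\<close>
 define \<nu> :: real where "\<nu> = 1 / (6 * (2 ^ K) ^ d)"
 have \<nu>: "0 < \<nu>" "(2 ^ K) ^ d * (6 * \<nu>) \<le> 1" by (auto simp: \<nu>_def)
 have "(%b. (1 / 2) ^ b) \<longlonglongrightarrow> (0::real)" by (intro LIMSEQ_power_zero) auto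
 from order_tendstoD(2)[OF this \<nu>(1)]
 obtain b1 where b1: "!!b. b1 \<le> b ==> (1 / 2) ^ b < \<nu>" unfolding eventually_sequentially by blast
 from order_tendstoD(2)[OF etaf_tendsto_0 \<nu>(1)]
 obtain b2 where b2: "!!b. b2 \<le> b ==> etaf b < \<nu>" unfolding eventually_sequentially by blast
 define a where "a = b1 + b2 + 1"
 have le_a: "b1 \<le> a" "b2 \<le> a" by (auto simp: a_def)
 interpret interleaved K a n0 by standard (auto simp: K_def a_def)
 have "snorm (W :: nat => 'k) \<le> 5"
 proof (rule W_bound[OF _ _ d \<nu>(2)])
  fix i
  have "a \<le> ex i" by (rule ex_ge)
  hence "(1 / 2) ^ ex i < \<nu>" "etaf (ex i) < \<nu>" using b1 b2 le_a by (meson order_trans)+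
  moreover have "1 / real (len i) = (1 / 2) ^ ex i" by (simp add: len_def power_one_over)
  ultimately show "etaf (ex i) \<le> \<nu> \<and> 1 / len i \<le> \<nu>" by simp
 qed (use \<nu> in auto)
 have "block_sets k n0 A" using block_sets_A by (simp add: block_sets_def K_def)
 moreover have "ell_system (snorm :: (nat => 'k) => real) 0 5 k A (%i. slog (card (A i)) / card (A i)) (%i. 1 / slog (card (A i)))"
  unfolding ell_system_def
 proof (intro allI impI conjI ballI)
  fix B and w :: "nat => real"
  assume B: "B \<subseteq> {..<k} \<and> (\<forall>i\<in>B. w i > 0)"
  have finB: "finite B" using B finite_subset by blast
  let ?y = "%n. \<Sum>i\<in>B. if n \<in> A i then of_real (w i powr 0 * (slog (card (A i)) / card (A i))) else (0::'k)"
  let ?r = "%i n. if n \<in> A i then slog (len i) / len i else 0"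
  have r0: "0 \<le> ?r i n" for i n using slog_pos[of "len i"] len_pos[of i] by simp
  have y: "?y n = of_real (\<Sum>i\<in>B. ?r i n)" for n
   unfolding of_real_sum using B by (intro sum.cong refl) (auto simp: card_A)
  have W: "W n = (of_real (\<Sum>i<K. ?r i n) :: 'k)" for n
   unfolding of_real_sum W_def by (intro sum.cong refl) auto
  show "snorm ?y \<le> 5 * (\<Sum>i\<in>B. w i) powr 0"
  proof (cases "B = {}")
   case True
   thus ?thesis by (simp add: lat_zero[OF snorm_lattice])
  next
   case False
   have "0 < (\<Sum>i\<in>B. w i)" using B False finB by (intro sum_pos) auto
   moreover have "snorm ?y \<le> snorm (W :: nat => 'k)"
   proof (rule lat_mono[OF snorm_lattice W_c00])
    fix n
    have "(\<Sum>i\<in>B. ?r i n) \<le> (\<Sum>i<K. ?r i n)"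
     using B r0 by (intro sum_mono2) (auto simp: K_def)
    moreover have "0 \<le> (\<Sum>i\<in>B. ?r i n)" using r0 by (intro sum_nonneg)
    ultimately show "norm (?y n) \<le> norm (W n :: 'k)" unfolding y W norm_of_real by linarith
   qed
   ultimately show ?thesis using \<open>snorm W \<le> 5\<close> by simp
  qed
  fix x :: "nat => 'k" assume x: "x \<in> c00"
  have "(\<Sum>i\<in>B. \<Sum>n\<in>A i. w i powr (1 - 0) * (1 / slog (card (A i))) * norm (x n)) \<le> (\<Sum>i\<in>B. w i * snorm x)"
  proof (rule sum_mono)
   fix i assume i: "i \<in> B"
   have s: "0 < slog (card (A i))" using len_pos[of i] by (intro slog_pos) (simp add: card_A)
   have "(\<Sum>n\<in>A i. w i powr (1 - 0) * (1 / slog (card (A i))) * norm (x n)) = w i * (1 / slog (card (A i)) * (\<Sum>n\<in>A i. norm (x n)))"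
    using i B by (simp add: sum_distrib_left less_imp_le)
   also have "... \<le> w i * (1 / slog (card (A i)) * (slog (card (A i)) * snorm x))"
    using i B s len_pos[of i] x by (intro mult_left_mono snorm_sum_coords) (auto simp: card_A less_imp_le)
   finally show "(\<Sum>n\<in>A i. w i powr (1 - 0) * (1 / slog (card (A i))) * norm (x n)) \<le> w i * snorm x" using s by simp
  qed
  also have "... = (\<Sum>i\<in>B. w i) * snorm x" by (simp add: sum_distrib_right)
  also have "... \<le> 5 * (\<Sum>i\<in>B. w i) powr (1 - 0) * snorm x"
  proof -
   have "0 \<le> (\<Sum>i\<in>B. w i)" using B by (intro sum_nonneg) (auto simp: less_imp_le)
   thus ?thesis using lat_nonneg[OF snorm_lattice x] by (simp add: mult_right_mono)
  qed
  finally show "(\<Sum>i\<in>B. \<Sum>n\<in>A i. w i powr (1 - 0) * (1 / slog (card (A i))) * norm (x n)) \<le> 5 * (\<Sum>i\<in>B. w i) powr (1 - 0) * snorm x" .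
 qed
 ultimately show ?thesis by blast
qed

section \<open>No block sequence of Schlumprecht's space has a lower l_1-estimate\<close>

definition block_seq :: "(nat => nat => 'k::real_normed_field) => bool"
 where "block_seq x \<longleftrightarrow> (\<forall>j. x j \<in> c00) \<and> (\<forall>i j m n. i < j --> x i m \<noteq> 0 --> x j n \<noteq> 0 --> m < n)"

text \<open>The lower estimate concerns nonnegative coefficients only. In this form it passes to
  moduli and so to a factor of a Calderon product.\<close>

definition l1_blocks :: "((nat => 'k::real_normed_field) => real) => real => real => (nat => nat => 'k) => bool"
 where "l1_blocks N \<delta> C x \<longleftrightarrow> block_seq x \<and> (\<forall>j. N (x j) \<le> C) \<and>
  (\<forall>m a. (\<forall>j. 0 \<le> a j) --> \<delta> * (\<Sum>j<m. a j) \<le> N (%n. \<Sum>j<m. of_real (a j) * x j n))"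

lemma block_seqD: "block_seq x ==> x j \<in> c00" "block_seq x ==> i < j ==> x i m \<noteq> 0 ==> x j n \<noteq> 0 ==> m < n"
 unfolding block_seq_def by blast+

text \<open>A block met by a single set contributes at most b. A block met by several sets costs a
  factor \<open>slog m\<close>, but there are at most m of these: each is determined by the first
  set that meets it, since a later block meeting that set would have to precede points of the
  earlier block.\<close>

lemma split_sum_bound:
 fixes w :: "nat => nat => 'k::real_normed_field"
 assumes w: "!!i. i < L ==> w i \<in> c00" "!!i j p q. i < j ==> j < L ==> w i p \<noteq> 0 ==> w j q \<noteq> 0 ==> p < q"
  and b: "!!i. i < L ==> snorm (w i) \<le> b" "0 \<le> b"
  and m: "2 \<le> m" "successive m E"
 shows "pieces snorm m E (%n. \<Sum>i<L. w i n) \<le> (L + m * slog m) * b"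
proof -
 define meets where "meets i l \<longleftrightarrow> (\<exists>n\<in>E l. w i n \<noteq> 0)" for i l
 define S where "S = {i. i < L \<and> (\<exists>l l'. l < l' \<and> l' < m \<and> meets i l \<and> meets i l')}"
 define first where "first i = (LEAST l. meets i l)" for i
 have sm: "0 < slog m" using m(1) by (intro slog_pos) auto
 have first: "meets i (first i)" "first i < m" if "i \<in> S" for i
 proof -
  from that have "\<exists>l l'. l < l' \<and> l' < m \<and> meets i l \<and> meets i l'" by (simp only: S_def mem_Collect_eq)
  then obtain l l' where "l < l'" "l' < m" and l: "meets i l" by (elim exE conjE)
  hence "l < m" by simp
  show "meets i (first i)" unfolding first_def using l by (rule LeastI)
  have "first i \<le> l" unfolding first_def using l by (rule Least_le)
  thus "first i < m" using \<open>l < m\<close> by simp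
 qed
 have later: "\<exists>l'. first i < l' \<and> l' < m \<and> meets i l'" if "i \<in> S" for i
 proof -
  from that have "\<exists>l l'. l < l' \<and> l' < m \<and> meets i l \<and> meets i l'" by (simp only: S_def mem_Collect_eq)
  then obtain l l' where l: "l < l'" "l' < m" "meets i l" "meets i l'" by (elim exE conjE)
  have "first i \<le> l" unfolding first_def using l(3) by (rule Least_le)
  thus ?thesis using l by (meson le_less_trans)
 qed
 have noteq: "first i \<noteq> first j" if ij: "i \<in> S" "j \<in> S" "i < j" for i j
 proof
  assume eq: "first i = first j"
  obtain l' where l': "first i < l'" "l' < m" "meets i l'" using later[OF ij(1)] by blast
  obtain p where p: "p \<in> E l'" "w i p \<noteq> 0" using l'(3) by (auto simp: meets_def)
  obtain q where q: "q \<in> E (first i)" "w j q \<noteq> 0" using first(1)[OF ij(2)] by (auto simp: meets_def eq)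
  have "q < p" by (rule successive_less[OF m(2) l'(1,2) q(1) p(1)])
  moreover have "p < q" using w(2)[OF ij(3) _ p(2) q(2)] ij(2) by (simp add: S_def)
  ultimately show False by simp
 qed
 have "inj_on first S"
 proof (rule inj_onI)
  fix i j assume "i \<in> S" "j \<in> S" "first i = first j"
  thus "i = j" using noteq[of i j] noteq[of j i] by (cases i j rule: linorder_cases) auto
 qed
 hence cS: "card S \<le> m"
  using card_inj_on_le[of first S "{..<m}"] first(2) by auto
 have SL: "S \<subseteq> {..<L}" by (auto simp: S_def)
 have zero: "snorm (restr (E l) (w i)) = 0" if "\<not> meets i l" for i l
 proof -
  have "restr (E l) (w i) = 0" using that by (auto simp: restr_def meets_def fun_eq_iff)
  thus ?thesis by (simp only: lat_zero[OF snorm_lattice])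
 qed
 have each: "pieces snorm m E (w i) \<le> b + (if i \<in> S then slog m * b else 0)" if i: "i < L" for i
 proof (cases "i \<in> S")
  case True
  have "pieces snorm m E (w i) \<le> slog m * snorm (w i)" by (rule snorm_succ[OF w(1)[OF i] m])
  also have "... \<le> slog m * b" using sm b(1)[OF i] by (intro mult_left_mono) auto
  finally show ?thesis using True b(2) by simp
 next
  case False
  show ?thesis
  proof (cases "\<exists>k<m. meets i k")
   case True
   then obtain k where k: "k < m" "meets i k" by blast
   have "\<not> meets i l" if "l < m" "l \<noteq> k" for l
    using False k i that unfolding S_def by (cases "l < k") auto
   hence "pieces snorm m E (w i) = (\<Sum>l<m. if l = k then snorm (restr (E k) (w i)) else 0)"
    using zero by (intro sum.cong) auto
   also have "... = snorm (restr (E k) (w i))" using k by simp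
   also have "... \<le> snorm (w i)" by (rule lat_restr[OF snorm_lattice w(1)[OF i]])
   finally show ?thesis using b(1)[OF i] False by simp
  next
   case none: False
   hence "pieces snorm m E (w i) = 0" using zero by (intro sum.neutral) auto
   thus ?thesis using b(2) False by simp
  qed
 qed
 have "snorm (restr (E l) (%n. \<Sum>i<L. w i n)) \<le> (\<Sum>i<L. snorm (restr (E l) (w i)))" for l
 proof -
  have "restr (E l) (%n. \<Sum>i<L. w i n) = (%n. \<Sum>i<L. restr (E l) (w i) n)" by (auto simp: restr_def)
  thus ?thesis using lat_sum[OF snorm_lattice, of "{..<L}" "%i. restr (E l) (w i)"] w(1) by simp
 qed
 hence "pieces snorm m E (%n. \<Sum>i<L. w i n) \<le> (\<Sum>l<m. \<Sum>i<L. snorm (restr (E l) (w i)))"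
  by (rule sum_mono)
 also have "... = (\<Sum>i<L. \<Sum>l<m. snorm (restr (E l) (w i)))" by (rule sum.swap)
 also have "... \<le> (\<Sum>i<L. b + (if i \<in> S then slog m * b else 0))" by (intro sum_mono each) auto
 also have "... = L * b + card S * (slog m * b)"
  using SL by (simp add: sum.distrib sum.If_cases Int_absorb1)
 also have "... \<le> L * b + m * (slog m * b)" using cS sm b(2) by (intro add_left_mono mult_right_mono) auto
 finally show ?thesis by (simp add: algebra_simps)
qed

definition conv_block :: "(nat => nat => 'k::real_normed_field) => nat => nat => (nat => 'k) => bool"
 where "conv_block x n m w \<longleftrightarrow> (\<exists>a. (\<forall>j. 0 \<le> a j) \<and> (\<forall>j. a j \<noteq> 0 --> n \<le> j \<and> j < m) \<and> (\<Sum>j<m. a j) = 1 \<and>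
  w = (%i. \<Sum>j<m. of_real (a j) * x j i))"

lemma conv_block_supp: "conv_block x n m w ==> w p \<noteq> 0 ==> \<exists>j. n \<le> j \<and> j < m \<and> x j p \<noteq> 0"
proof -
 assume "conv_block x n m w" and p: "w p \<noteq> 0"
 then obtain a where a: "!!j. a j \<noteq> 0 ==> n \<le> j \<and> j < m" "w = (%i. \<Sum>j<m. of_real (a j) * x j i)"
  unfolding conv_block_def by blast
 from p a(2) obtain j where "of_real (a j) * x j p \<noteq> 0" by (metis (no_types, lifting) sum.neutral)
 thus ?thesis using a(1)[of j] by auto
qed

lemma conv_block_c00: "block_seq x ==> conv_block x n m w ==> w \<in> c00"
 unfolding conv_block_def by (elim exE conjE) (simp add: block_seqD(1))

lemma conv_block_less: "conv_block x n m w ==> n < m"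
proof -
 assume "conv_block x n m w"
 then obtain a where a: "!!j. a j \<noteq> 0 ==> n \<le> j \<and> j < m" "(\<Sum>j<m. a j) = (1::real)"
  unfolding conv_block_def by blast
 then obtain j where "a j \<noteq> 0" by (metis sum.neutral zero_neq_one)
 thus ?thesis using a(1)[of j] by simp
qed

lemma conv_block_ordered:
 assumes "block_seq x" "conv_block x n m w" "conv_block x n' m' w'" "m \<le> n'" "w p \<noteq> 0" "w' q \<noteq> 0"
 shows "p < q"
proof -
 obtain i where i: "i < m" "x i p \<noteq> 0" using conv_block_supp[OF assms(2,5)] by blast
 obtain j where j: "n' \<le> j" "x j q \<noteq> 0" using conv_block_supp[OF assms(3,6)] by blast
 have "i < j" using i(1) j(1) assms(4) by simp
 thus ?thesis using i(2) j(2) by (rule block_seqD(2)[OF assms(1)])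
qed

lemma conv_block_avg:
 assumes "!!i. i < L ==> conv_block x (p i) (p (Suc i)) (w i)" "0 < L"
 shows "conv_block x (p 0) (p L) (%n. (\<Sum>i<L. w i n) / of_nat L)"
proof -
 have less: "p i < p (Suc i)" if "i < L" for i using conv_block_less[OF assms(1)[OF that]] .
 have le: "p i \<le> p j" if "i \<le> j" "j \<le> L" for i j
  using that
 proof (induction j rule: dec_induct)
  case (step j)
  thus ?case using less[of j] by simp
 qed simp
 have "\<forall>i. \<exists>a. i < L --> (\<forall>j. 0 \<le> a j) \<and> (\<forall>j. a j \<noteq> 0 --> p i \<le> j \<and> j < p (Suc i)) \<and> (\<Sum>j<p (Suc i). a j) = 1 \<and>
  w i = (%n. \<Sum>j<p (Suc i). of_real (a j) * x j n)"
  using assms(1) unfolding conv_block_def by blast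
 from choice[OF this] obtain a where a': "!!i. i < L ==> (\<forall>j. 0 \<le> a i j) \<and> (\<forall>j. a i j \<noteq> 0 --> p i \<le> j \<and> j < p (Suc i)) \<and>
  (\<Sum>j<p (Suc i). a i j) = 1 \<and> w i = (%n. \<Sum>j<p (Suc i). of_real (a i j) * x j n)" by blast
 hence a: "!!i j. i < L ==> 0 \<le> a i j" "!!i j. i < L ==> a i j \<noteq> 0 ==> p i \<le> j \<and> j < p (Suc i)"
  "!!i. i < L ==> (\<Sum>j<p (Suc i). a i j) = 1" "!!i. i < L ==> w i = (%n. \<Sum>j<p (Suc i). of_real (a i j) * x j n)"
  by blast+
 have a3: "(\<Sum>j<p L. a i j) = 1" if "i < L" for i
 proof -
  have "(\<Sum>j<p (Suc i). a i j) = (\<Sum>j<p L. a i j)"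
   using le[of "Suc i" L] a(2)[OF that] that by (intro sum.mono_neutral_left) force+
  thus ?thesis using a(3)[OF that] by simp
 qed
 have a4: "w i n = (\<Sum>j<p L. of_real (a i j) * x j n)" if "i < L" for i n
 proof -
  have "(\<Sum>j<p (Suc i). of_real (a i j) * x j n) = (\<Sum>j<p L. of_real (a i j) * x j n)"
   using le[of "Suc i" L] a(2)[OF that] that by (intro sum.mono_neutral_left) force+
  thus ?thesis using a(4)[OF that] by simp
 qed
 show ?thesis unfolding conv_block_def
 proof (intro exI[of _ "%j. (\<Sum>i<L. a i j) / L"] conjI allI impI ext)
  fix j show "0 \<le> (\<Sum>i<L. a i j) / L" using a(1) by (intro divide_nonneg_nonneg sum_nonneg) auto
 next
  fix j assume "(\<Sum>i<L. a i j) / L \<noteq> 0"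
  hence "(\<Sum>i<L. a i j) \<noteq> 0" by auto
  then obtain i where i: "i < L" "a i j \<noteq> 0" by (metis lessThan_iff sum.neutral)
  thus "p 0 \<le> j" "j < p L" using a(2)[OF i] le[of 0 i] le[of "Suc i" L] by auto
 next
  have "(\<Sum>j<p L. (\<Sum>i<L. a i j) / L) = (\<Sum>j<p L. \<Sum>i<L. a i j) / L" by (rule sum_divide_distrib[symmetric])
  also have "... = (\<Sum>i<L. \<Sum>j<p L. a i j) / L" by (subst sum.swap) simp
  finally show "(\<Sum>j<p L. (\<Sum>i<L. a i j) / L) = 1" using a3 assms(2) by simp
 next
  fix n
  have "(\<Sum>i<L. w i n) = (\<Sum>i<L. \<Sum>j<p L. of_real (a i j) * x j n)" using a4 by simp
  also have "... = (\<Sum>j<p L. \<Sum>i<L. of_real (a i j) * x j n)" by (rule sum.swap)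
  finally show "(\<Sum>i<L. w i n) / of_nat L = (\<Sum>j<p L. of_real ((\<Sum>i<L. a i j) / L) * x j n)"
   by (simp add: sum_divide_distrib sum_distrib_right)
 qed
qed

text \<open>James' argument: far out, all convex combinations of the blocks have almost at least the norm \<open>\<kappa>\<close>,
 and this value is almost attained.\<close>

lemma l1_blocks_min:
 fixes x :: "nat => nat => 'k::real_normed_field"
 assumes "l1_blocks snorm \<delta> C x" "0 < \<delta>"
 obtains \<kappa> n0 where "0 < \<kappa>" "!!n m w. n0 \<le> n ==> conv_block x n m w ==> 99 / 100 * \<kappa> \<le> snorm w"
  "!!n. n0 \<le> n ==> \<exists>m w. conv_block x n m w \<and> snorm w \<le> 101 / 100 * \<kappa>"
proof -
 have x: "block_seq x" "!!j. snorm (x j) \<le> C"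
  "!!m a. (!!j. 0 \<le> a j) ==> \<delta> * (\<Sum>j<m. a j) \<le> snorm (%n. \<Sum>j<m. of_real (a j) * x j n)"
  using assms(1) unfolding l1_blocks_def by blast+
 have low: "\<delta> \<le> snorm w" if "conv_block x n m w" for n m w
  using that x(3) unfolding conv_block_def by (metis mult.right_neutral)
 define V where "V n = {snorm w | m w. conv_block x n m w}" for n
 have xn: "conv_block x n (Suc n) (x n)" for n
  unfolding conv_block_def by (rule exI[of _ "unitv n"]) (auto simp: unitv_def)
 have V: "snorm (x n) \<in> V n" "bdd_below (V n)" for n
 proof -
  show "snorm (x n) \<in> V n" unfolding V_def using xn[of n] by blast
  show "bdd_below (V n)" by (rule bdd_belowI[of _ \<delta>]) (use low in \<open>auto simp: V_def\<close>)
 qed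
 have mono: "V m \<subseteq> V n" if "n \<le> m" for n m
  unfolding V_def conv_block_def using that by (blast intro: order_trans)
 define k where "k n = Inf (V n)" for n
 have k_mono: "k n \<le> k m" if "n \<le> m" for n m
  unfolding k_def using V mono[OF that] by (intro cInf_superset_mono) auto
 have k_le: "k n \<le> C" for n
  unfolding k_def using cInf_lower[OF V(1,2)] x(2)[of n] by (rule order_trans)
 have k_ge: "\<delta> \<le> k n" for n
  unfolding k_def
 proof (rule cInf_greatest)
  show "V n \<noteq> {}" using V(1)[of n] by blast
  show "\<delta> \<le> v" if "v \<in> V n" for v using that low by (auto simp: V_def)
 qed
 define \<kappa> where "\<kappa> = Sup (range k)"
 have bdd: "bdd_above (range k)" by (rule bdd_aboveI[of _ C]) (use k_le in auto)
 have k_le_\<kappa>: "k n \<le> \<kappa>" for n unfolding \<kappa>_def using bdd by (intro cSup_upper) auto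
 have \<kappa>: "0 < \<kappa>" using k_ge[of 0] k_le_\<kappa>[of 0] assms(2) by linarith
 hence "99 / 100 * \<kappa> < Sup (range k)" by (simp add: \<kappa>_def[symmetric])
 then obtain n0 where n0: "99 / 100 * \<kappa> < k n0" using less_cSup_iff[OF _ bdd] by blast
 show thesis
 proof (rule that[OF \<kappa>, of n0])
  fix n m w assume "n0 \<le> n" "conv_block x n m w"
  hence "snorm w \<in> V n" by (auto simp: V_def)
  hence "k n \<le> snorm w" unfolding k_def using V(2) by (intro cInf_lower)
  thus "99 / 100 * \<kappa> \<le> snorm w" using n0 k_mono[OF \<open>n0 \<le> n\<close>] by linarith
 next
  fix n
  have "Inf (V n) < 101 / 100 * \<kappa>" using k_le_\<kappa>[of n] \<kappa> by (simp add: k_def)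
  then obtain v where "v \<in> V n" "v < 101 / 100 * \<kappa>" using V cInf_less_iff[OF _ V(2)] by blast
  thus "\<exists>m w. conv_block x n m w \<and> snorm w \<le> 101 / 100 * \<kappa>" by (force simp: V_def)
 qed
qed

text \<open>An average of L successive vectors hardly notices splittings into k sets as long as k *
  \<open>slog k\<close> is small against L, by \<open>split_sum_bound\<close>.\<close>

lemma conv_block_average_exists:
 fixes x :: "nat => nat => 'k::real_normed_field" and L :: nat
 assumes x: "block_seq x" and ex: "!!n. n0 \<le> n ==> \<exists>m w. conv_block x n m w \<and> snorm w \<le> b"
  and n: "n0 \<le> n" and L: "0 < L" and b: "0 \<le> b"
 shows "\<exists>m w. conv_block x n m w \<and> snorm w \<le> b \<and>
  (\<forall>k E. 2 \<le> k --> successive k E --> pieces snorm k E w \<le> (1 + k * slog k / L) * b)"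
proof -
 have "\<exists>p. p 0 = n \<and> (\<forall>i. n0 \<le> p i \<and> (\<exists>w. conv_block x (p i) (p (Suc i)) w \<and> snorm w \<le> b))"
 proof -
  have "\<exists>p. \<forall>i. (n0 \<le> p i \<and> (i = 0 --> p i = n)) \<and> (\<exists>w. conv_block x (p i) (p (Suc i)) w \<and> snorm w \<le> b)"
  proof (rule dependent_nat_choice[where P = "%i q. n0 \<le> q \<and> (i = 0 --> q = n)" and
     Q = "%i q q'. \<exists>w. conv_block x q q' w \<and> snorm w \<le> b"])
   show "\<exists>q. n0 \<le> q \<and> (0 = 0 --> q = n)" using n by blast
   fix q :: nat and i :: nat assume q: "n0 \<le> q \<and> (i = 0 --> q = n)"
   then obtain m w where mw: "conv_block x q m w" "snorm w \<le> b" using ex by blast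
   thus "\<exists>y. (n0 \<le> y \<and> (Suc i = 0 --> y = n)) \<and> (\<exists>w. conv_block x q y w \<and> snorm w \<le> b)"
    using conv_block_less[OF mw(1)] q by (intro exI[of _ m]) auto
  qed
  thus ?thesis by blast
 qed
 then obtain p where p: "p 0 = n" "!!i. \<exists>w. conv_block x (p i) (p (Suc i)) w \<and> snorm w \<le> b" by blast
 from p(2) obtain w where w: "!!i. conv_block x (p i) (p (Suc i)) (w i)" "!!i. snorm (w i) \<le> b" by metis
 have "p i < p (Suc i)" for i using conv_block_less[OF w(1)] .
 hence p_mono: "i \<le> j ==> p i \<le> p j" for i j by (rule lift_Suc_mono_le[OF less_imp_le])
 have wc: "w i \<in> c00" for i by (rule conv_block_c00[OF x w(1)])
 let ?s = "%n. \<Sum>i<L. w i n"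
 let ?W = "%n. ?s n / of_nat L"
 have W: "?W = (%n. of_real (1 / L) * ?s n)" by auto
 have sc: "?s \<in> c00" using wc by (intro c00_sum)
 have scale: "snorm (restr F ?W) = snorm (restr F ?s) / L" for F
 proof -
  have "restr F ?W = (%n. of_real (1 / L) * restr F ?s n)" by (auto simp: restr_def)
  hence "snorm (restr F ?W) = norm (of_real (1 / L) :: 'k) * snorm (restr F ?s)"
   by (simp only: lat_scale[OF snorm_lattice c00_restr[OF sc]])
  thus ?thesis by (simp only: norm_of_real) simp
 qed
 have "snorm ?s \<le> (\<Sum>i<L. snorm (w i))" by (rule lat_sum[OF snorm_lattice wc])
 also have "... \<le> L * b" using sum_mono[of "{..<L}" "%i. snorm (w i)" "%_. b"] w(2) by simp
 finally have "snorm ?s / L \<le> b" using L by (simp add: field_simps)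
 hence "snorm ?W \<le> b" using scale[of UNIV] by (simp add: restr_def)
 moreover have "conv_block x n (p L) ?W" using conv_block_avg[of L x p w] w(1) L p(1) by simp
 moreover have "pieces snorm k E ?W \<le> (1 + k * slog k / L) * b" if k: "2 \<le> k" "successive k E" for k E
 proof -
  have "pieces snorm k E ?s \<le> (L + k * slog k) * b"
  proof (rule split_sum_bound[OF _ _ _ b k])
   fix i j q q' assume "i < j" "j < L" "w i q \<noteq> 0" "w j q' \<noteq> 0"
   thus "q < q'" using conv_block_ordered[OF x w(1)[of i] w(1)[of j]] p_mono[of "Suc i" j] by auto
  qed (use wc w(2) in auto)
  hence "pieces snorm k E ?s / L \<le> (L + k * slog k) * b / L" by (intro divide_right_mono) auto
  also have "... = (1 + k * slog k / L) * b" using L by (simp add: field_simps)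
  finally show ?thesis unfolding scale sum_divide_distrib[symmetric] .
 qed
 ultimately show ?thesis by blast
qed

text \<open>Average M vectors that are almost extremal for the constant \<kappa> of
  \<open>l1_blocks_min\<close>, the i-th being itself an average of L_i vectors with L_i growing
  fast. The result is again a convex combination far out, so its norm is at least 99/100 \<kappa>.
  But a splitting either has so few sets that it cuts few summands, or it is efficient on at most
  one summand; this keeps the norm below 9/10 \<kappa>.\<close>

theorem schlumprecht_no_l1_blocks:
 fixes x :: "nat => nat => 'k::real_normed_field"
 assumes "0 < \<delta>" shows "\<not> l1_blocks snorm \<delta> C x"
proof
 assume l1: "l1_blocks snorm \<delta> C x"
 hence x: "block_seq x" by (simp add: l1_blocks_def)
 obtain \<kappa> n0 where \<kappa>: "0 < \<kappa>" and lo: "!!n m w. n0 \<le> n ==> conv_block x n m w ==> 99 / 100 * \<kappa> \<le> snorm w"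
  and hi: "!!n. n0 \<le> n ==> \<exists>m w. conv_block x n m w \<and> snorm w \<le> 101 / 100 * \<kappa>"
  using l1_blocks_min[OF l1 assms] by blast
 define b where "b = 101 / 100 * \<kappa>"
 have b0: "0 \<le> b" using \<kappa> by (simp add: b_def)
 \<comment> \<open>A bound for all splittings of w, however fine.\<close>
 define \<Lambda> where "\<Lambda> w = (\<Sum>n | w n \<noteq> 0. snorm (restr {n} w))" for w :: "nat => 'k"
 \<comment> \<open>So long that a number k of sets with k * \<open>slog k\<close> beyond this length
   satisfies \<open>slog k \<ge> 4 * \<Lambda> w / \<kappa>\<close>. This uses k \<le> 2^(slog k)
   and slog k \<le> k.\<close>
 define next_len :: "nat => (nat => 'k) => nat" where "next_len L w = max L (nat \<lceil>(2 powr (4 * \<Lambda> w / \<kappa>))\<^sup>2\<rceil>)" for L w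
 define good where "good = (%(n :: nat, m :: nat, w :: nat => 'k, L :: nat). n0 \<le> n \<and> 0 < L \<and> conv_block x n m w \<and> snorm w \<le> b \<and>
  (\<forall>k E. 2 \<le> k --> successive k E --> pieces snorm k E w \<le> (1 + k * slog k / L) * b))"
 have good_ex: "\<exists>m w. good (n, m, w, L)" if "n0 \<le> n" "0 < L" for n L
  using conv_block_average_exists[OF x hi, of n0 n L] that b0 unfolding good_def b_def by simp
 have "\<exists>s. \<forall>i. good (s i) \<and> (fst (s (Suc i)) = fst (snd (s i)) \<and>
   snd (snd (snd (s (Suc i)))) = next_len (snd (snd (snd (s i)))) (fst (snd (snd (s i)))))"
 proof (rule dependent_nat_choice[where P = "%i. good" and Q = "%i s s'. fst s' = fst (snd s) \<and>
    snd (snd (snd s')) = next_len (snd (snd (snd s))) (fst (snd (snd s)))"])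
  show "\<exists>s. good s" using good_ex[of n0 1] by auto
  fix s :: "nat \<times> nat \<times> (nat => 'k) \<times> nat" and i :: nat assume "good s"
  obtain n m w L where s: "s = (n, m, w, L)" by (cases s) auto
  have "n0 \<le> m" using \<open>good s\<close> conv_block_less[of x n m w] by (auto simp: s good_def)
  moreover have "0 < next_len L w" using \<open>good s\<close> by (auto simp: s good_def next_len_def)
  ultimately obtain m' w' where "good (m, m', w', next_len L w)" using good_ex by blast
  thus "\<exists>s'. good s' \<and> fst s' = fst (snd s) \<and> snd (snd (snd s')) = next_len (snd (snd (snd s))) (fst (snd (snd s)))"
   by (intro exI[of _ "(m, m', w', next_len L w)"]) (simp add: s)
 qed
 then obtain s where s: "!!i. good (s i)" "!!i. fst (s (Suc i)) = fst (snd (s i))"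
  "!!i. snd (snd (snd (s (Suc i)))) = next_len (snd (snd (snd (s i)))) (fst (snd (snd (s i))))" by blast
 define p where "p i = fst (s i)" for i
 define w where "w i = fst (snd (snd (s i)))" for i
 define L where "L i = snd (snd (snd (s i)))" for i
 have s_eq: "s i = (p i, p (Suc i), w i, L i)" for i by (simp add: p_def w_def L_def s(2))
 have w: "conv_block x (p i) (p (Suc i)) (w i)" "snorm (w i) \<le> b" "n0 \<le> p i" "0 < L i" for i
  using s(1)[of i] by (auto simp: s_eq good_def)
 have wE: "pieces snorm k E (w i) \<le> (1 + k * slog k / L i) * b" if "2 \<le> k" "successive k E" for i k E
  using s(1)[of i] that unfolding s_eq good_def by blast
 have L_Suc: "L (Suc i) = next_len (L i) (w i)" for i by (simp add: L_def w_def s(3))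
 have L_mono: "i \<le> j ==> L i \<le> L j" for i j
  by (rule lift_Suc_mono_le) (simp_all add: L_Suc next_len_def)
 have p_mono: "i \<le> j ==> p i \<le> p j" for i j
  by (rule lift_Suc_mono_le) (simp_all add: conv_block_less[OF w(1)] less_imp_le)
 have wc: "w i \<in> c00" for i by (rule conv_block_c00[OF x w(1)])
 have ordered: "q < q'" if "i < j" "w i q \<noteq> 0" "w j q' \<noteq> 0" for i j q q'
  using conv_block_ordered[OF x w(1)[of i] w(1)[of j]] p_mono[of "Suc i" j] that by auto
 have \<Lambda>: "pieces snorm k E (w i) \<le> \<Lambda> (w i)" if "successive k E" for i k E
  unfolding \<Lambda>_def by (rule successive_norm_bound[OF snorm_is_norm wc that])
 have growth: "k * slog k \<le> L j" if ij: "i < j" and k: "2 \<le> k" "slog k < 4 * \<Lambda> (w i) / \<kappa>" for i j and k :: nat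
 proof -
  have "real k \<le> 2 powr slog k" using k(1) by (simp add: slog_def)
  also have "... \<le> 2 powr (4 * \<Lambda> (w i) / \<kappa>)" using k(2) by simp
  finally have kk: "real k \<le> 2 powr (4 * \<Lambda> (w i) / \<kappa>)" .
  have "k * slog k \<le> real k * real k" using k(1) by (intro mult_left_mono slog_le_self) auto
  also have "... \<le> (2 powr (4 * \<Lambda> (w i) / \<kappa>))\<^sup>2" using kk unfolding power2_eq_square by (intro mult_mono) auto
  also have "... \<le> next_len (L i) (w i)" unfolding next_len_def by linarith
  also have "... \<le> L j" using L_mono[of "Suc i" j] ij by (simp add: L_Suc)
  finally show ?thesis .
 qed
 \<comment> \<open>What must hold is 101/100 (2/3 M + 256) \<le> 9/10 M for splittings into at most
   256 sets and 26/100 M + 101/100 \<le> 9/10 M for all others.\<close>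
 define M :: nat where "M = 2560"
 let ?s = "%n. \<Sum>i<M. w i n"
 let ?W = "%n. ?s n / of_nat M"
 have "99 / 100 * \<kappa> \<le> snorm ?W"
  by (rule lo[OF w(3)[of 0] conv_block_avg[of M x p w]]) (auto simp: w(1) M_def)
 moreover have sc: "?s \<in> c00" using wc by (intro c00_sum)
 have "?W = (%n. of_real (1 / M) * ?s n)" by auto
 hence "snorm ?W = norm (of_real (1 / M) :: 'k) * snorm ?s" by (simp only: lat_scale[OF snorm_lattice sc])
 hence "snorm ?W = snorm ?s / M" by (simp only: norm_of_real) simp
 moreover have "snorm ?s \<le> M * (9 / 10 * \<kappa>)"
 proof (rule snorm_le[OF sc])
  fix n
  have "norm (?s n) \<le> b"
  proof (cases "\<exists>j<M. w j n \<noteq> 0")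
   case True
   then obtain j where j: "j < M" "w j n \<noteq> 0" by blast
   have "?s n = (\<Sum>i<M. if i = j then w j n else 0)"
   proof (intro sum.cong refl)
    fix i show "w i n = (if i = j then w j n else 0)"
     using ordered[of i j n n] ordered[of j i n n] j by (cases i j rule: linorder_cases) auto
   qed
   also have "... = w j n" using j by simp
   finally show ?thesis using snorm_coord[OF wc, of j n] w(2)[of j] by simp
  next
   case False
   hence "?s n = 0" by (intro sum.neutral) auto
   thus ?thesis using b0 by simp
  qed
  also have "... \<le> M * (9 / 10 * \<kappa>)" using \<kappa> by (simp add: b_def M_def)
  finally show "norm (?s n) \<le> M * (9 / 10 * \<kappa>)" .
 next
  fix m :: nat and E assume m: "2 \<le> m" "successive m E"
  have sm: "3 / 2 \<le> slog m" using m(1) by (intro slog_ge_3_2) auto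
  show "pieces snorm m E ?s \<le> slog m * (M * (9 / 10 * \<kappa>))"
  \<comment> \<open>Below 8 there are at most 256 sets, and \<open>slog m \<ge> 3 / 2\<close> gains
    a factor 2/3 on the uncut summands. From 8 on, a summand that hardly notices the splitting gives
    at most 2 b = 202/100 \<kappa> \<le> 26/100 * 8 \<kappa>.\<close>
  proof (cases "slog m < 8")
   case True
   hence "real m + 1 < 2 powr 8" using m(1) by (simp add: slog_def log_less_iff)
   hence m256: "real m \<le> 256" by simp
   have "pieces snorm m E ?s \<le> (M + m * slog m) * b"
    by (rule split_sum_bound[OF wc ordered w(2) b0 m])
   also have "... \<le> (slog m * (2 / 3 * M) + 256 * slog m) * b"
   proof (rule mult_right_mono[OF add_mono b0])
    show "real M \<le> slog m * (2 / 3 * M)" using mult_right_mono[OF sm, of "2 / 3 * real M"] by simp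
    show "m * slog m \<le> 256 * slog m" using m256 sm by (intro mult_right_mono) auto
   qed
   also have "... \<le> slog m * (M * (9 / 10 * \<kappa>))"
    using sm \<kappa> by (simp add: b_def M_def algebra_simps)
   finally show ?thesis .
  next
   case False
   have small: "pieces snorm m E (w i) \<le> 26 / 100 * \<kappa> * slog m" if "m * slog m \<le> L i" for i
   proof -
    have "pieces snorm m E (w i) \<le> (1 + m * slog m / L i) * b" by (rule wE[OF m])
    also have "... \<le> 2 * b" using that w(4)[of i] b0 by (intro mult_right_mono) auto
    also have "... \<le> 26 / 100 * \<kappa> * 8" using \<kappa> by (simp add: b_def)
    also have "... \<le> 26 / 100 * \<kappa> * slog m" using False \<kappa> by (intro mult_left_mono) auto
    finally show ?thesis .
   qed
   have small': "pieces snorm m E (w i) \<le> 26 / 100 * \<kappa> * slog m" if "i < j" "\<not> m * slog m \<le> L j" for i j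
   proof -
    have "4 * \<Lambda> (w i) / \<kappa> \<le> slog m" using growth[OF that(1) m(1)] that(2) by linarith
    hence "4 * \<Lambda> (w i) \<le> \<kappa> * slog m" using \<kappa> by (simp add: field_simps)
    moreover have "0 \<le> \<kappa> * slog m" using \<kappa> sm by simp
    ultimately show ?thesis using \<Lambda>[OF m(2), of i] by linarith
   qed
   have "\<exists>i0. \<forall>i<M. i \<noteq> i0 --> pieces snorm m E (w i) \<le> 26 / 100 * \<kappa> * slog m"
   proof (cases "\<exists>i<M. \<not> m * slog m \<le> L i")
    case True
    \<comment> \<open>The exception is the last summand whose length is too short for m. Later
      summands hardly notice the splitting, and for earlier ones \<open>slog m\<close> already
      dominates their bound \<Lambda>.\<close>
    define i0 where "i0 = Max {i. i < M \<and> \<not> m * slog m \<le> L i}"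
    have i0: "i0 < M" "\<not> m * slog m \<le> L i0" "!!i. i < M ==> \<not> m * slog m \<le> L i ==> i \<le> i0"
     using Max_in[of "{i. i < M \<and> \<not> m * slog m \<le> L i}"] True unfolding i0_def by (auto intro!: Max_ge)
    show ?thesis
    proof (intro exI[of _ i0] allI impI)
     fix i assume i: "i < M" "i \<noteq> i0"
     show "pieces snorm m E (w i) \<le> 26 / 100 * \<kappa> * slog m"
      using small[of i] small'[of i i0] i0(2) i0(3)[OF i(1)] i by (cases "m * slog m \<le> L i") auto
    qed
   qed (use small in blast)
   then obtain i0 where i0: "!!i. i < M ==> i \<noteq> i0 ==> pieces snorm m E (w i) \<le> 26 / 100 * \<kappa> * slog m" by blast
   have all: "pieces snorm m E (w i) \<le> slog m * b" for i
    using snorm_succ[OF wc m, of i] mult_left_mono[OF w(2)[of i], of "slog m"] sm by linarith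
   have pos: "0 \<le> 26 / 100 * \<kappa> * slog m" "0 \<le> slog m * b" using \<kappa> sm b0 by auto
   have "snorm (restr (E l) ?s) \<le> (\<Sum>i<M. snorm (restr (E l) (w i)))" for l
   proof -
    have "restr (E l) ?s = (%n. \<Sum>i<M. restr (E l) (w i) n)" by (auto simp: restr_def)
    thus ?thesis using lat_sum[OF snorm_lattice, of "{..<M}" "%i. restr (E l) (w i)"] wc by simp
   qed
   hence "pieces snorm m E ?s \<le> (\<Sum>l<m. \<Sum>i<M. snorm (restr (E l) (w i)))" by (rule sum_mono)
   also have "... = (\<Sum>i<M. \<Sum>l<m. snorm (restr (E l) (w i)))" by (rule sum.swap)
   also have "... \<le> (\<Sum>i<M. 26 / 100 * \<kappa> * slog m + (if i = i0 then slog m * b else 0))"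
   proof (rule sum_mono)
    fix i assume "i \<in> {..<M}"
    thus "pieces snorm m E (w i) \<le> 26 / 100 * \<kappa> * slog m + (if i = i0 then slog m * b else 0)"
     using i0[of i] all[of i] pos by (cases "i = i0") auto
   qed
   also have "... = M * (26 / 100 * \<kappa> * slog m) + (if i0 < M then slog m * b else 0)" by (simp add: sum.distrib)
   also have "... \<le> M * (26 / 100 * \<kappa> * slog m) + slog m * b" using pos by simp
   also have "... \<le> slog m * (M * (9 / 10 * \<kappa>))"
    using sm \<kappa> by (simp add: b_def M_def algebra_simps)
   finally show ?thesis .
  qed
 qed
 ultimately show False using \<kappa> by (simp add: M_def)
qed

section \<open>The norms of the spaces \<open>\<ell>\<^sub>t\<close>\<close>

lemma ell_norm_finite:
 fixes x :: "nat => 'k::real_normed_field"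
 assumes "finite F" "{n. x n \<noteq> 0} \<subseteq> F" "t \<noteq> \<infinity>"
 shows "ell_norm t x = (\<Sum>n\<in>F. norm (x n) powr real_of_ereal t) powr (1 / real_of_ereal t)"
proof -
 have "(\<Sum>n | x n \<noteq> 0. norm (x n) powr real_of_ereal t) = (\<Sum>n\<in>F. norm (x n) powr real_of_ereal t)"
  using assms(1,2) by (intro sum.mono_neutral_left) auto
 thus ?thesis using assms(3) by (simp add: ell_norm_def)
qed

lemma sup_norm_lattice: "lattice_norm (sup_norm :: (nat => 'k::real_normed_field) => real)"
proof -
 have scale_le: "sup_norm (fscale a x) \<le> norm a * sup_norm x" if "x \<in> c00" for x :: "nat => 'k" and a
  by (rule sup_norm_le) (auto simp: fscale_def norm_mult intro!: mult_left_mono le_sup_norm that)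
 have triangle: "sup_norm (x + y) \<le> sup_norm x + sup_norm y" if "x \<in> c00" "y \<in> c00" for x y :: "nat => 'k"
 proof (rule sup_norm_le)
  fix n show "norm ((x + y) n) \<le> sup_norm x + sup_norm y"
   using norm_triangle_ineq[of "x n" "y n"] le_sup_norm[OF that(1), of n] le_sup_norm[OF that(2), of n] by simp
 qed
 have mono: "sup_norm x \<le> sup_norm y" if "y \<in> c00" "!!n. norm (x n) \<le> norm (y n)" for x y :: "nat => 'k"
  by (rule sup_norm_le) (rule order_trans[OF that(2) le_sup_norm[OF that(1)]])
 have unit: "sup_norm (unitv n :: nat => 'k) \<le> 1" for n by (rule sup_norm_le) (auto simp: unitv_def)
 show ?thesis by (rule lattice_normI[OF le_sup_norm scale_le triangle mono unit])
qed

lemma ell_norm_lattice: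
 assumes "1 \<le> t" shows "lattice_norm (ell_norm t :: (nat => 'k::real_normed_field) => real)"
proof (cases "t = \<infinity>")
 case True
 hence "(ell_norm t :: (nat => 'k) => real) = sup_norm" by (auto simp: ell_norm_def)
 thus ?thesis using sup_norm_lattice by simp
next
 case False
 define s where "s = real_of_ereal t"
 have s: "1 \<le> s" using assms False by (cases t) (auto simp: s_def)
 have N: "ell_norm t x = (\<Sum>n\<in>F. norm (x n) powr s) powr (1 / s)" if "finite F" "{n. x n \<noteq> 0} \<subseteq> F" for x :: "nat => 'k" and F
  unfolding s_def by (rule ell_norm_finite[OF that False])
 have coord: "norm (x n) \<le> ell_norm t x" if "x \<in> c00" for x :: "nat => 'k" and n
 proof (cases "x n = 0")
  case True
  thus ?thesis using False by (simp add: ell_norm_def)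
 next
  case False
  have "norm (x n) powr s \<le> (\<Sum>n | x n \<noteq> 0. norm (x n) powr s)"
   using False c00_finite[OF that] by (intro member_le_sum) auto
  hence "(norm (x n) powr s) powr (1 / s) \<le> (\<Sum>n | x n \<noteq> 0. norm (x n) powr s) powr (1 / s)"
   using s by (intro powr_mono2) auto
  thus ?thesis using s by (simp add: powr_powr N[OF c00_finite[OF that] order_refl])
 qed
 have scale: "ell_norm t (fscale a x) = norm a * ell_norm t x" if "x \<in> c00" for x :: "nat => 'k" and a
 proof -
  have "ell_norm t (fscale a x) = (\<Sum>n | x n \<noteq> 0. norm (fscale a x n) powr s) powr (1 / s)"
   by (rule N[OF c00_finite[OF that]]) (auto simp: fscale_def)
  also have "(\<Sum>n | x n \<noteq> 0. norm (fscale a x n) powr s) = norm a powr s * (\<Sum>n | x n \<noteq> 0. norm (x n) powr s)"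
   by (simp add: fscale_def norm_mult powr_mult sum_distrib_left)
  also have "... powr (1 / s) = norm a * (\<Sum>n | x n \<noteq> 0. norm (x n) powr s) powr (1 / s)"
   using s by (simp add: powr_mult powr_powr sum_nonneg)
  finally show ?thesis by (simp add: N[OF c00_finite[OF that] order_refl])
 qed
 have mono: "ell_norm t x \<le> ell_norm t y" if "y \<in> c00" "!!n. norm (x n) \<le> norm (y n)" for x y :: "nat => 'k"
 proof -
  have "{n. x n \<noteq> 0} \<subseteq> {n. y n \<noteq> 0}" using that(2) by (auto, metis norm_le_zero_iff norm_zero)
  hence "ell_norm t x = (\<Sum>n | y n \<noteq> 0. norm (x n) powr s) powr (1 / s)" by (rule N[OF c00_finite[OF that(1)]])
  also have "... \<le> (\<Sum>n | y n \<noteq> 0. norm (y n) powr s) powr (1 / s)"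
   using s that(2) by (intro powr_mono2 sum_mono) (auto intro: sum_nonneg)
  also have "... = ell_norm t y" by (simp add: N[OF c00_finite[OF that(1)] order_refl])
  finally show ?thesis .
 qed
 have triangle: "ell_norm t (x + y) \<le> ell_norm t x + ell_norm t y" if "x \<in> c00" "y \<in> c00" for x y :: "nat => 'k"
 proof -
  let ?F = "{n. x n \<noteq> 0} \<union> {n. y n \<noteq> 0}"
  have F: "finite ?F" using that c00_finite by blast
  have "ell_norm t (x + y) = (\<Sum>n\<in>?F. norm ((x + y) n) powr s) powr (1 / s)" by (rule N[OF F]) auto
  also have "... \<le> (\<Sum>n\<in>?F. (norm (x n) + norm (y n)) powr s) powr (1 / s)"
   using s by (intro powr_mono2 sum_mono) (auto intro: sum_nonneg norm_triangle_ineq)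
  also have "... \<le> (\<Sum>n\<in>?F. norm (x n) powr s) powr (1 / s) + (\<Sum>n\<in>?F. norm (y n) powr s) powr (1 / s)"
   using s by (intro minkowski_sum) auto
  also have "(\<Sum>n\<in>?F. norm (x n) powr s) powr (1 / s) = ell_norm t x" by (rule N[OF F, symmetric]) auto
  also have "(\<Sum>n\<in>?F. norm (y n) powr s) powr (1 / s) = ell_norm t y" by (rule N[OF F, symmetric]) auto
  finally show ?thesis .
 qed
 have unit: "ell_norm t (unitv n :: nat => 'k) = 1" for n
 proof -
  have "{m. (unitv n :: nat => 'k) m \<noteq> 0} \<subseteq> {n}" by (auto simp: unitv_def)
  thus ?thesis by (subst N[of "{n}"]) auto
 qed
 show ?thesis by (rule lattice_normI[OF coord eq_refl[OF scale] triangle mono eq_refl[OF unit]])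
qed

definition recip :: "ereal => real" where "recip t = (if t = \<infinity> then 0 else 1 / real_of_ereal t)"

lemma sum_Sigma_disjoint_le:
 fixes g :: "nat => real"
 assumes "finite B" "!!i. i \<in> B ==> finite (A i)" "!!i j. i \<in> B ==> j \<in> B ==> i \<noteq> j ==> A i \<inter> A j = {}"
  and "!!n. 0 \<le> g n" "finite F" "!!n. n \<notin> F ==> g n = 0"
 shows "(\<Sum>(i, n)\<in>Sigma B A. g n) \<le> (\<Sum>n\<in>F. g n)"
proof -
 have "(\<Sum>(i, n)\<in>Sigma B A. g n) = (\<Sum>i\<in>B. \<Sum>n\<in>A i. g n)" using assms by (intro sum.Sigma[symmetric]) auto
 also have "... = (\<Sum>n\<in>(\<Union>i\<in>B. A i). g n)" using assms by (intro sum.UNION_disjoint[symmetric]) auto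
 also have "... \<le> (\<Sum>n\<in>F \<union> (\<Union>i\<in>B. A i). g n)" using assms by (intro sum_mono2) auto
 also have "... = (\<Sum>n\<in>F. g n)" using assms by (intro sum.mono_neutral_right) auto
 finally show ?thesis .
qed

lemma block_sum_at:
 assumes "block_sets k n0 A" "B \<subseteq> {..<k}" "i \<in> B" "n \<in> A i"
 shows "(\<Sum>j\<in>B. if n \<in> A j then c j else 0) = c i"
proof -
 have "finite B" using assms(2) finite_subset by blast
 have "(\<Sum>j\<in>B. if n \<in> A j then c j else 0) = (\<Sum>j\<in>B. if j = i then c i else 0)"
 proof (rule sum.cong[OF refl])
  fix j assume j: "j \<in> B"
  have "A i \<inter> A j = {}" if "j \<noteq> i" using assms(1-3) j that unfolding block_sets_def by blast
  thus "(if n \<in> A j then c j else 0) = (if j = i then c i else 0)" using assms(4) by auto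
 qed
 thus ?thesis using assms(3) \<open>finite B\<close> by simp
qed

lemma block_sum_out: "n \<notin> (\<Union>i\<in>B. A i) ==> (\<Sum>j\<in>B. if n \<in> A j then c j else 0) = 0"
 by (intro sum.neutral) auto

lemma block_sum_c00:
 fixes c :: "nat => 'k::real_normed_field"
 shows "block_sets k n0 A ==> B \<subseteq> {..<k} ==> (%n. \<Sum>j\<in>B. if n \<in> A j then c j else 0) \<in> c00"
 by (rule c00_sum, rule c00_supp[of _ "A _"]) (auto simp: block_sets_def split: if_splits)

text \<open>Normalised indicators of disjoint sets span l_t isometrically, and the lower estimate is
  Hoelder's inequality on the union of the sets; hence the constant 1. For t = \<infinity> all
  coefficients \<open>w i powr 0\<close> are 1.\<close>

lemma ell_norm_system:
 assumes "1 \<le> t" "block_sets k n0 A"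
 shows "ell_system (ell_norm t :: (nat => 'k::real_normed_field) => real) (recip t) 1 k A
  (%i. real (card (A i)) powr - recip t) (%i. real (card (A i)) powr - (1 - recip t))"
 unfolding ell_system_def
proof (intro allI impI conjI ballI)
 define s where "s = recip t"
 have s: "0 \<le> s" "s \<le> 1"
  using assms(1) by (cases t; auto simp: s_def recip_def)+
 fix B and w :: "nat => real"
 assume B: "B \<subseteq> {..<k} \<and> (\<forall>i\<in>B. w i > 0)"
 have finB: "finite B" using B finite_subset by blast
 have A: "finite (A i)" "0 < card (A i)" if "i \<in> B" for i using assms(2) B that by (force simp: block_sets_def)+
 have disj: "A i \<inter> A j = {}" if "i \<in> B" "j \<in> B" "i \<noteq> j" for i j
  using assms(2) B that unfolding block_sets_def by blast
 let ?S = "Sigma B A"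
 have sumw: "(\<Sum>(i, n)\<in>?S. w i / card (A i)) = (\<Sum>i\<in>B. w i)"
 proof -
  have "(\<Sum>(i, n)\<in>?S. w i / card (A i)) = (\<Sum>i\<in>B. \<Sum>n\<in>A i. w i / card (A i))"
   using finB A by (intro sum.Sigma[symmetric]) auto
  also have "... = (\<Sum>i\<in>B. w i)" using A(2) by (intro sum.cong) auto
  finally show ?thesis .
 qed
 let ?x = "%n. \<Sum>i\<in>B. if n \<in> A i then of_real (w i powr recip t * card (A i) powr - recip t) else (0::'k)"
 have coef: "w i powr s * card (A i) powr - s = (w i / card (A i)) powr s" if "i \<in> B" for i
  using A(2)[OF that] B that by (simp add: powr_divide powr_minus_divide)
 have xin: "norm (?x n) = (w i / card (A i)) powr s" if "i \<in> B" "n \<in> A i" for i n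
 proof -
  have "?x n = of_real (w i powr s * card (A i) powr - s)"
   unfolding s_def by (rule block_sum_at[OF assms(2) _ that]) (use B in blast)
  thus ?thesis unfolding coef[OF that(1)] by (simp only: norm_of_real) simp
 qed
 show "ell_norm t ?x \<le> 1 * (\<Sum>i\<in>B. w i) powr recip t"
 proof (cases "t = \<infinity>")
  case True
  have "sup_norm ?x \<le> (\<Sum>i\<in>B. w i) powr 0"
  proof (rule sup_norm_le)
   fix n show "norm (?x n) \<le> (\<Sum>i\<in>B. w i) powr 0"
   proof (cases "n \<in> (\<Union>i\<in>B. A i)")
    case n: True
    then obtain i where i: "i \<in> B" "n \<in> A i" by blast
    have "0 < (\<Sum>i\<in>B. w i)" using B i finB by (intro sum_pos) auto
    thus ?thesis using xin[OF i] True B i(1) A(2)[OF i(1)] by (simp add: s_def recip_def)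
   next
    case False
    show ?thesis unfolding block_sum_out[OF False] by simp
   qed
  qed
  thus ?thesis using True by (simp add: ell_norm_def recip_def)
 next
  case False
  define r where "r = real_of_ereal t"
  have r: "1 \<le> r" "s = 1 / r" using assms(1) False by (cases t; auto simp: r_def s_def recip_def)+
  have "ell_norm t ?x = (\<Sum>n\<in>(\<Union>i\<in>B. A i). norm (?x n) powr r) powr (1 / r)"
   unfolding r_def
  proof (rule ell_norm_finite[OF _ _ False])
   show "{n. ?x n \<noteq> 0} \<subseteq> (\<Union>i\<in>B. A i)"
   proof (rule subsetI, rule ccontr)
    fix n assume n: "n \<in> {n. ?x n \<noteq> 0}" and out: "n \<notin> (\<Union>i\<in>B. A i)"
    from n have "?x n \<noteq> 0" by (rule CollectD)
    moreover have "?x n = 0" by (rule block_sum_out[OF out])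
    ultimately show False by (rule notE)
   qed
  qed (use finB A in auto)
  also have "(\<Sum>n\<in>(\<Union>i\<in>B. A i). norm (?x n) powr r) = (\<Sum>i\<in>B. \<Sum>n\<in>A i. norm (?x n) powr r)"
   using finB A disj by (intro sum.UNION_disjoint) auto
  also have "... = (\<Sum>i\<in>B. w i)"
  proof (rule sum.cong[OF refl])
   fix i assume i: "i \<in> B"
   have "(\<Sum>n\<in>A i. norm (?x n) powr r) = (\<Sum>n\<in>A i. w i / card (A i))"
   proof (rule sum.cong[OF refl])
    fix n assume "n \<in> A i"
    show "norm (?x n) powr r = w i / card (A i)"
     unfolding xin[OF i \<open>n \<in> A i\<close>] using r B i by (simp add: powr_powr less_imp_le)
   qed
   thus "(\<Sum>n\<in>A i. norm (?x n) powr r) = w i" using A(2)[OF i] by simp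
  qed
  finally show ?thesis using r by (simp add: s_def)
 qed
 fix x :: "nat => 'k" assume x: "x \<in> c00"
 have "(\<Sum>i\<in>B. \<Sum>n\<in>A i. w i powr (1 - recip t) * card (A i) powr - (1 - recip t) * norm (x n))
   = (\<Sum>(i, n)\<in>?S. (w i / card (A i)) powr (1 - s) * norm (x n))"
 proof -
  have "(\<Sum>i\<in>B. \<Sum>n\<in>A i. w i powr (1 - recip t) * card (A i) powr - (1 - recip t) * norm (x n))
   = (\<Sum>i\<in>B. \<Sum>n\<in>A i. (w i / card (A i)) powr (1 - s) * norm (x n))"
  proof (intro sum.cong refl)
   fix i n assume i: "i \<in> B"
   have "w i powr (1 - s) * card (A i) powr - (1 - s) = (w i / card (A i)) powr (1 - s)"
    using A(2)[OF i] B i by (simp add: powr_divide powr_minus_divide del: minus_diff_eq)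
   thus "w i powr (1 - recip t) * card (A i) powr - (1 - recip t) * norm (x n) = (w i / card (A i)) powr (1 - s) * norm (x n)"
    by (simp add: s_def)
  qed
  thus ?thesis using finB A by (simp add: sum.Sigma)
 qed
 also have "... \<le> (\<Sum>i\<in>B. w i) powr (1 - s) * ell_norm t x"
 proof (cases "t = \<infinity>")
  case True
  have "(\<Sum>(i, n)\<in>?S. (w i / card (A i)) powr (1 - s) * norm (x n)) \<le> (\<Sum>(i, n)\<in>?S. w i / card (A i) * sup_norm x)"
  proof (rule sum_mono, clarify)
   fix i n assume "i \<in> B"
   thus "(w i / card (A i)) powr (1 - s) * norm (x n) \<le> w i / card (A i) * sup_norm x"
    using True B le_sup_norm[OF x, of n] mult_left_mono[OF le_sup_norm[OF x, of n], of "w i / card (A i)"]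
    by (simp add: s_def recip_def less_imp_le)
  qed
  also have "... = (\<Sum>(i, n)\<in>?S. w i / card (A i)) * sup_norm x"
   by (simp add: sum_distrib_right case_prod_unfold)
  also have "... = (\<Sum>i\<in>B. w i) powr (1 - s) * ell_norm t x"
   unfolding sumw using True B by (simp add: s_def recip_def ell_norm_def sum_nonneg less_imp_le)
  finally show ?thesis .
 next
  case False
  define r where "r = real_of_ereal t"
  have r: "1 \<le> r" "s = 1 / r" using assms(1) False by (cases t; auto simp: r_def s_def recip_def)+
  have "(\<Sum>(i, n)\<in>?S. (w i / card (A i)) powr (1 - s) * norm (x n))
    = (\<Sum>p\<in>?S. (case p of (i, n) => w i / card (A i)) powr (1 - s) * (case p of (i, n) => norm (x n) powr r) powr s)"
   using r by (intro sum.cong) (auto simp: powr_powr)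
  also have "... \<le> (\<Sum>(i, n)\<in>?S. w i / card (A i)) powr (1 - s) * (\<Sum>(i, n)\<in>?S. norm (x n) powr r) powr s"
   using s B by (intro hoelder_sum) (auto simp: less_imp_le)
  also have "... \<le> (\<Sum>i\<in>B. w i) powr (1 - s) * (\<Sum>n | x n \<noteq> 0. norm (x n) powr r) powr s"
   unfolding sumw
  proof (intro mult_left_mono powr_mono2)
   show "(\<Sum>(i, n)\<in>?S. norm (x n) powr r) \<le> (\<Sum>n | x n \<noteq> 0. norm (x n) powr r)"
    using finB A disj c00_finite[OF x] by (intro sum_Sigma_disjoint_le) auto
   show "0 \<le> (\<Sum>(i, n)\<in>?S. norm (x n) powr r)" by (intro sum_nonneg) auto
  qed (use s in auto)
  also have "(\<Sum>n | x n \<noteq> 0. norm (x n) powr r) powr s = ell_norm t x"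
   using False r by (simp add: ell_norm_def r_def)
  finally show ?thesis .
 qed
 finally show "(\<Sum>i\<in>B. \<Sum>n\<in>A i. w i powr (1 - recip t) * card (A i) powr - (1 - recip t) * norm (x n))
   \<le> 1 * (\<Sum>i\<in>B. w i) powr (1 - recip t) * ell_norm t x" by (simp add: s_def)
qed

section \<open>The Calderon product\<close>

locale calderon =
 fixes \<theta> :: real and N1 N2 :: "(nat => 'k::real_normed_field) => real"
 assumes \<theta>: "0 < \<theta>" "\<theta> < 1" and N1: "lattice_norm N1" and N2: "lattice_norm N2"
begin

abbreviation mix :: "real => real => real" where "mix a b \<equiv> a powr (1 - \<theta>) * b powr \<theta>"

abbreviation "N \<equiv> calderon_norm \<theta> N1 N2"

definition factors :: "(nat => 'k) => (nat => 'k) => (nat => 'k) => bool"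
 where "factors z x y \<longleftrightarrow> x \<in> c00 \<and> y \<in> c00 \<and> (\<forall>n. norm (z n) = mix (norm (x n)) (norm (y n)))"

lemma N_eq: "N z = Inf {mix (N1 x) (N2 y) | x y. factors z x y}"
 by (simp add: calderon_norm_def factors_def)

lemma set_bdd: "bdd_below {mix (N1 x) (N2 y) | x y. factors z x y}"
 by (rule bdd_belowI[of _ 0]) auto

lemma factors_self: "z \<in> c00 ==> factors z z z"
 by (auto simp: factors_def powr_add[symmetric])

lemma upper: "factors z x y ==> N z \<le> mix (N1 x) (N2 y)"
 unfolding N_eq by (rule cInf_lower[OF _ set_bdd]) blast

lemma lower:
 assumes "z \<in> c00" "!!x y. factors z x y ==> B \<le> mix (N1 x) (N2 y)"
 shows "B \<le> N z"
 unfolding N_eq using factors_self[OF assms(1)] assms(2) by (intro cInf_greatest) auto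

text \<open>The Calderon norm is an infimum over exact factorisations. Shrinking the first factor by
  numbers \<open>c n \<le> 1\<close> makes a domination exact; solving for them takes a root of
  order 1 - \<theta>, and a lattice norm does not grow under the shrinking.\<close>

lemma factors_exist:
 fixes x y z :: "nat => 'k"
 assumes "x \<in> c00" "y \<in> c00" "!!n. norm (z n) \<le> mix (norm (x n)) (norm (y n))"
 obtains x' where "factors z x' y" "!!n. norm (x' n) \<le> norm (x n)"
proof -
 define c where "c n = (norm (z n) / mix (norm (x n)) (norm (y n))) powr (1 / (1 - \<theta>))" for n
 have c: "0 \<le> c n" "c n \<le> 1" for n
 proof -
  have "norm (z n) / mix (norm (x n)) (norm (y n)) \<le> 1"
   using assms(3)[of n] by (auto simp: divide_le_eq_1 not_less)
  hence "c n \<le> 1 powr (1 / (1 - \<theta>))" unfolding c_def using \<theta> by (intro powr_mono2) auto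
  thus "c n \<le> 1" by simp
 qed (simp add: c_def)
 define x' where "x' n = of_real (c n) * x n" for n
 have le: "norm (x' n) \<le> norm (x n)" for n
  using c[of n] by (simp add: x'_def norm_mult mult_left_le_one_le)
 have "norm (z n) = mix (norm (x' n)) (norm (y n))" for n
 proof (cases "mix (norm (x n)) (norm (y n)) = 0")
  case True
  have "norm (z n) = 0" using assms(3)[of n] unfolding True by simp
  moreover have "x n = 0 \<or> y n = 0" using True by auto
  hence "mix (norm (x' n)) (norm (y n)) = 0" by (auto simp: x'_def)
  ultimately show ?thesis by linarith
 next
  case False
  have "norm (x' n) powr (1 - \<theta>) = c n powr (1 - \<theta>) * norm (x n) powr (1 - \<theta>)"
   using c[of n] by (simp add: x'_def norm_mult powr_mult)
  also have "c n powr (1 - \<theta>) = norm (z n) / mix (norm (x n)) (norm (y n))"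
   using \<theta> by (simp add: c_def powr_powr)
  finally show ?thesis using False by simp
 qed
 moreover have "x' \<in> c00" by (rule c00_mono[OF assms(1) le])
 ultimately show thesis using that[of x'] le assms(2) by (simp add: factors_def)
qed

lemma dominated:
 fixes x y z :: "nat => 'k"
 assumes "x \<in> c00" "y \<in> c00" "!!n. norm (z n) \<le> mix (norm (x n)) (norm (y n))"
 shows "N z \<le> mix (N1 x) (N2 y)"
proof -
 obtain x' where x': "factors z x' y" "!!n. norm (x' n) \<le> norm (x n)" using factors_exist[OF assms] by blast
 have "N z \<le> mix (N1 x') (N2 y)" by (rule upper[OF x'(1)])
 also have "... \<le> mix (N1 x) (N2 y)"
  using \<theta> lat_mono[OF N1 assms(1) x'(2)] lat_nonneg[OF N1, of x'] x'(1)
  by (intro mult_right_mono powr_mono2) (auto simp: factors_def)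
 finally show ?thesis .
qed

lemma balanced_le:
 fixes x y z :: "nat => 'k"
 assumes "x \<in> c00" "y \<in> c00" "!!n. norm (z n) \<le> mix (norm (x n)) (norm (y n))" "N1 x \<le> r" "N2 y \<le> r"
 shows "N z \<le> r"
proof -
 have r: "0 \<le> r" using lat_nonneg[OF N1 assms(1)] assms(4) by linarith
 have "N z \<le> mix (N1 x) (N2 y)" by (rule dominated[OF assms(1-3)])
 also have "... \<le> r powr (1 - \<theta>) * r powr \<theta>"
  using \<theta> assms lat_nonneg[OF N1 assms(1)] lat_nonneg[OF N2 assms(2)]
  by (intro mult_mono powr_mono2) auto
 also have "... = r" using r by (simp add: powr_add[symmetric])
 finally show ?thesis .
qed

lemma nonneg: "z \<in> c00 ==> 0 \<le> N z"
 by (rule lower) auto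

text \<open>Multiplying x and y by suitable positive numbers keeps the factorisation and makes both
  norms equal to the value that it gives. A bound for a product can then be proved for each factor
  separately.\<close>

lemma balanced:
 assumes "z \<in> c00" "N z < r"
 obtains x y where "factors z x y" "N1 x \<le> r" "N2 y \<le> r"
proof -
 have "\<exists>v\<in>{mix (N1 x) (N2 y) | x y. factors z x y}. v < r"
  using cInf_less_iff[OF _ set_bdd, of z r] factors_self[OF assms(1)] assms(2) unfolding N_eq by blast
 then obtain x y where xy: "factors z x y" "mix (N1 x) (N2 y) < r" by blast
 have c: "x \<in> c00" "y \<in> c00" using xy(1) by (auto simp: factors_def)
 define \<rho> where "\<rho> = mix (N1 x) (N2 y)"
 have r: "0 < r" using nonneg[OF assms(1)] assms(2) by linarith
 show thesis
 proof (cases "N1 x = 0 \<or> N2 y = 0")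
  case True
  hence "x = 0 \<or> y = 0" using lat_eq_0[OF N1 c(1)] lat_eq_0[OF N2 c(2)] by blast
  hence "norm (z n) = 0" for n using xy(1) by (auto simp: factors_def)
  hence "factors z 0 0" by (simp add: factors_def)
  thus thesis using that[of 0 0] r lat_zero(1)[OF N1] lat_zero(1)[OF N2] by simp
 next
  case False
  hence p: "0 < N1 x" "0 < N2 y" using lat_nonneg[OF N1 c(1)] lat_nonneg[OF N2 c(2)] by auto
  hence \<rho>: "0 < \<rho>" by (simp add: \<rho>_def)
  let ?x = "%n. of_real (\<rho> / N1 x) * x n" and ?y = "%n. of_real (\<rho> / N2 y) * y n"
  have "norm (z n) = norm (?x n) powr (1 - \<theta>) * norm (?y n) powr \<theta>" for n
  proof -
   have "norm (?x n) powr (1 - \<theta>) * norm (?y n) powr \<theta>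
     = (\<rho> powr (1 - \<theta>) * \<rho> powr \<theta>) / (mix (N1 x) (N2 y)) * mix (norm (x n)) (norm (y n))"
    unfolding norm_mult norm_of_real using \<rho> p by (simp add: powr_mult powr_divide)
   also have "\<rho> powr (1 - \<theta>) * \<rho> powr \<theta> = \<rho>" using \<rho> by (simp add: powr_add[symmetric])
   finally show ?thesis using xy(1) \<rho> by (simp add: factors_def \<rho>_def[symmetric])
  qed
  hence "factors z ?x ?y" unfolding factors_def using c00_mult[OF c(1)] c00_mult[OF c(2)] by blast
  moreover have "N1 ?x = \<rho>" "N2 ?y = \<rho>"
   unfolding lat_scale[OF N1 c(1)] lat_scale[OF N2 c(2)] norm_of_real using \<rho> p by auto
  ultimately show thesis using that[of ?x ?y] xy(2) by (simp add: \<rho>_def)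
 qed
qed

lemma coord: "z \<in> c00 ==> norm (z n) \<le> N z"
proof (rule field_le_epsilon)
 fix e :: real assume z: "z \<in> c00" and e: "0 < e"
 obtain x y where xy: "factors z x y" "N1 x \<le> N z + e" "N2 y \<le> N z + e" using balanced[OF z, of "N z + e"] e by auto
 have r: "0 \<le> N z + e" using nonneg[OF z] e by simp
 have c: "x \<in> c00" "y \<in> c00" using xy(1) by (auto simp: factors_def)
 have "norm (z n) = mix (norm (x n)) (norm (y n))" using xy(1) by (simp add: factors_def)
 also have "... \<le> (N z + e) powr (1 - \<theta>) * (N z + e) powr \<theta>"
  using \<theta> lat_coord[OF N1 c(1), of n] lat_coord[OF N2 c(2), of n] xy(2,3)
  by (intro mult_mono powr_mono2) auto
 also have "... = N z + e" using r by (simp add: powr_add[symmetric])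
 finally show "norm (z n) \<le> N z + e" .
qed

lemma lattice: "lattice_norm N"
proof -
 have mono: "N z \<le> N z'" if "z' \<in> c00" "!!n. norm (z n) \<le> norm (z' n)" for z z'
 proof (rule lower[OF that(1)])
  fix x y assume "factors z' x y"
  thus "N z \<le> mix (N1 x) (N2 y)"
   using that(2) by (intro dominated) (auto simp: factors_def)
 qed
 have scale_le: "N (fscale a z) \<le> norm a * N z" if z: "z \<in> c00" for z a
 proof (rule field_le_epsilon)
  fix e :: real assume e: "0 < e"
  define e' where "e' = e / (norm a + 1)"
  have na: "0 < norm a + 1" by (simp add: add_nonneg_pos)
  have e': "0 < e'" using e na by (simp add: e'_def)
  obtain x y where xy: "factors z x y" "N1 x \<le> N z + e'" "N2 y \<le> N z + e'" using balanced[OF z, of "N z + e'"] e' by auto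
  have c: "x \<in> c00" "y \<in> c00" using xy(1) by (auto simp: factors_def)
  have "N (fscale a z) \<le> norm a * (N z + e')"
  proof (rule balanced_le[of "%n. a * x n" "%n. a * y n"])
   fix n
   have "norm (a * x n) powr (1 - \<theta>) * norm (a * y n) powr \<theta> = (norm a powr (1 - \<theta>) * norm a powr \<theta>) * norm (z n)"
    using xy(1) by (simp add: norm_mult powr_mult factors_def)
   also have "norm a powr (1 - \<theta>) * norm a powr \<theta> = norm a" by (simp add: powr_add[symmetric])
   finally show "norm (fscale a z n) \<le> norm (a * x n) powr (1 - \<theta>) * norm (a * y n) powr \<theta>"
    by (simp add: fscale_def norm_mult)
  qed (use c xy in \<open>auto simp: lat_scale[OF N1] lat_scale[OF N2] intro!: mult_left_mono\<close>)
  also have "... = norm a * N z + norm a * e'" by (simp add: distrib_left)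
  also have "norm a * e' \<le> e" using e na by (simp add: e'_def divide_simps)
  finally show "N (fscale a z) \<le> norm a * N z + e" by simp
 qed
 have triangle: "N (z1 + z2) \<le> N z1 + N z2" if z: "z1 \<in> c00" "z2 \<in> c00" for z1 z2
 proof (rule field_le_epsilon)
  fix e :: real assume e: "0 < e"
  obtain x1 y1 where 1: "factors z1 x1 y1" "N1 x1 \<le> N z1 + e / 2" "N2 y1 \<le> N z1 + e / 2"
   using balanced[OF z(1), of "N z1 + e / 2"] e by auto
  obtain x2 y2 where 2: "factors z2 x2 y2" "N1 x2 \<le> N z2 + e / 2" "N2 y2 \<le> N z2 + e / 2"
   using balanced[OF z(2), of "N z2 + e / 2"] e by auto
  have c: "x1 \<in> c00" "y1 \<in> c00" "x2 \<in> c00" "y2 \<in> c00" using 1(1) 2(1) by (auto simp: factors_def)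
  \<comment> \<open>Moduli are added, so that nothing cancels in the factors; the triangle
    inequality is then \<open>hoelder_two\<close> in each coordinate.\<close>
  define ab :: "(nat => 'k) => nat => 'k" where "ab x = (%n. of_real (norm (x n)))" for x
  have ab: "ab x \<in> c00" if "x \<in> c00" for x by (rule c00_mono[OF that]) (simp add: ab_def)
  have N_ab: "M (ab x) \<le> M x" if "lattice_norm M" "x \<in> c00" for M x
   by (rule lat_mono[OF that]) (simp add: ab_def)
  have sum_le: "M (ab x + ab x') \<le> M x + M x'" if "lattice_norm M" "x \<in> c00" "x' \<in> c00" for M x x'
   using lat_triangle[OF that(1) ab[OF that(2)] ab[OF that(3)]] N_ab[OF that(1,2)] N_ab[OF that(1,3)] by linarith
  have nab: "norm ((ab x + ab x') n) = norm (x n) + norm (x' n)" for x x' n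
   unfolding ab_def plus_fun_apply of_real_add[symmetric] norm_of_real by simp
  show "N (z1 + z2) \<le> N z1 + N z2 + e"
  proof (rule balanced_le[of "ab x1 + ab x2" "ab y1 + ab y2"])
   fix n
   have "norm ((z1 + z2) n) \<le> norm (z1 n) + norm (z2 n)" by (simp add: norm_triangle_ineq)
   also have "... = mix (norm (x1 n)) (norm (y1 n)) + mix (norm (x2 n)) (norm (y2 n))"
    using 1(1) 2(1) by (simp add: factors_def)
   also have "... \<le> (norm (x1 n) + norm (x2 n)) powr (1 - \<theta>) * (norm (y1 n) + norm (y2 n)) powr \<theta>"
    using \<theta> by (intro hoelder_two) auto
   finally show "norm ((z1 + z2) n) \<le> norm ((ab x1 + ab x2) n) powr (1 - \<theta>) * norm ((ab y1 + ab y2) n) powr \<theta>"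
    by (simp only: nab)
  qed (use c ab sum_le[OF N1 c(1,3)] sum_le[OF N2 c(2,4)] 1 2 in auto)
 qed
 have unit: "N (unitv n) \<le> 1" for n
 proof (rule balanced_le[of "unitv n" "unitv n"])
  fix m show "norm (unitv n m :: 'k) \<le> norm (unitv n m :: 'k) powr (1 - \<theta>) * norm (unitv n m :: 'k) powr \<theta>"
   by (cases "m = n") auto
 qed (use N1 N2 in \<open>auto simp: lattice_norm_def\<close>)
 show ?thesis by (rule lattice_normI[OF coord scale_le triangle mono unit])
qed

text \<open>Weights interpolate: \<open>w powr ((1 - \<theta>) * \<mu>1 + \<theta> * \<mu>2)\<close>
  is the mix of \<open>w powr \<mu>1\<close> and \<open>w powr \<mu>2\<close>, so the combinations
  in the two spaces factor the combination in the product. The lower estimate is Hoelder's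
  inequality over all coordinates, applied to an arbitrary factorisation of the vector.\<close>

lemma system:
 assumes A: "block_sets k n0 A"
  and 1: "ell_system N1 \<mu>1 C1 k A c1 d1" and 2: "ell_system N2 \<mu>2 C2 k A c2 d2"
  and pos: "!!i. i < k ==> 0 < c1 i \<and> 0 < c2 i \<and> 0 < d1 i \<and> 0 < d2 i" "0 \<le> C1" "0 \<le> C2"
 shows "ell_system N ((1 - \<theta>) * \<mu>1 + \<theta> * \<mu>2) (C1 powr (1 - \<theta>) * C2 powr \<theta>) k A
  (%i. c1 i powr (1 - \<theta>) * c2 i powr \<theta>) (%i. d1 i powr (1 - \<theta>) * d2 i powr \<theta>)"
 unfolding ell_system_def
proof (intro allI impI conjI ballI)
 fix B and w :: "nat => real"
 assume B: "B \<subseteq> {..<k} \<and> (\<forall>i\<in>B. w i > 0)"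
 have finB: "finite B" using B finite_subset by blast
 have BA: "B \<subseteq> {..<k}" using B by blast
 let ?\<mu> = "(1 - \<theta>) * \<mu>1 + \<theta> * \<mu>2"
 let ?W = "\<Sum>i\<in>B. w i"
 have W0: "0 \<le> ?W" using B by (intro sum_nonneg) (auto simp: less_imp_le)
 let ?x = "%n. \<Sum>i\<in>B. if n \<in> A i then of_real (w i powr \<mu>1 * c1 i) else (0::'k)"
 let ?y = "%n. \<Sum>i\<in>B. if n \<in> A i then of_real (w i powr \<mu>2 * c2 i) else (0::'k)"
 let ?z = "%n. \<Sum>i\<in>B. if n \<in> A i then of_real (w i powr ?\<mu> * (c1 i powr (1 - \<theta>) * c2 i powr \<theta>)) else (0::'k)"
 have c: "?x \<in> c00" "?y \<in> c00" by (rule block_sum_c00[OF A BA])+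
 have "N ?z \<le> mix (N1 ?x) (N2 ?y)"
 proof (rule dominated[OF c])
  fix n
  show "norm (?z n) \<le> norm (?x n) powr (1 - \<theta>) * norm (?y n) powr \<theta>"
  proof (cases "n \<in> (\<Union>i\<in>B. A i)")
   case True
   then obtain i where i: "i \<in> B" "n \<in> A i" by blast
   have p: "0 < w i" "0 < c1 i" "0 < c2 i" using B pos(1)[of i] i(1) by auto
   show ?thesis unfolding block_sum_at[OF A BA i] norm_of_real
    using p \<theta> by (simp add: powr_mult powr_powr powr_add mult_ac)
  next
   case False
   show ?thesis unfolding block_sum_out[OF False] by simp
  qed
 qed
 also have "... \<le> (C1 * ?W powr \<mu>1) powr (1 - \<theta>) * (C2 * ?W powr \<mu>2) powr \<theta>"
 proof (intro mult_mono powr_mono2)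
  show "N1 ?x \<le> C1 * ?W powr \<mu>1" using 1 B unfolding ell_system_def by blast
  show "N2 ?y \<le> C2 * ?W powr \<mu>2" using 2 B unfolding ell_system_def by blast
 qed (use \<theta> lat_nonneg[OF N1 c(1)] lat_nonneg[OF N2 c(2)] in auto)
 also have "... = C1 powr (1 - \<theta>) * C2 powr \<theta> * ?W powr ?\<mu>"
  using W0 pos(2,3) by (simp add: powr_mult powr_powr powr_add mult_ac)
 finally show "N ?z \<le> C1 powr (1 - \<theta>) * C2 powr \<theta> * ?W powr ?\<mu>" .
 fix z :: "nat => 'k" assume z: "z \<in> c00"
 let ?S = "Sigma B A"
 have A_fin: "finite (A i)" if "i \<in> B" for i using A B that by (force simp: block_sets_def)
 define T where "T = (\<Sum>i\<in>B. \<Sum>n\<in>A i. w i powr (1 - ?\<mu>) * (d1 i powr (1 - \<theta>) * d2 i powr \<theta>) * norm (z n))"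
 define K where "K = C1 powr (1 - \<theta>) * C2 powr \<theta> * ?W powr (1 - ?\<mu>)"
 have K0: "0 \<le> K" by (simp add: K_def)
 have step: "T \<le> K * (mix (N1 x) (N2 y))" if xy: "factors z x y" for x y
 proof -
  have xyc: "x \<in> c00" "y \<in> c00" using xy by (auto simp: factors_def)
  have "T = (\<Sum>(i, n)\<in>?S. w i powr (1 - ?\<mu>) * (d1 i powr (1 - \<theta>) * d2 i powr \<theta>) * norm (z n))"
   unfolding T_def using finB A_fin by (simp add: sum.Sigma)
  also have "... = (\<Sum>p\<in>?S. (case p of (i, n) => w i powr (1 - \<mu>1) * d1 i * norm (x n)) powr (1 - \<theta>) *
    (case p of (i, n) => w i powr (1 - \<mu>2) * d2 i * norm (y n)) powr \<theta>)"
  proof (rule sum.cong[OF refl], clarify)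
   fix i n assume i: "i \<in> B"
   have p: "0 < w i" "0 < d1 i" "0 < d2 i" using B pos(1)[of i] i by auto
   have e: "1 - ?\<mu> = (1 - \<mu>1) * (1 - \<theta>) + (1 - \<mu>2) * \<theta>" by (simp add: algebra_simps)
   have "w i powr (1 - ?\<mu>) = (w i powr (1 - \<mu>1)) powr (1 - \<theta>) * (w i powr (1 - \<mu>2)) powr \<theta>"
    unfolding e powr_add by (simp add: powr_powr)
   thus "w i powr (1 - ?\<mu>) * (d1 i powr (1 - \<theta>) * d2 i powr \<theta>) * norm (z n)
     = (w i powr (1 - \<mu>1) * d1 i * norm (x n)) powr (1 - \<theta>) * (w i powr (1 - \<mu>2) * d2 i * norm (y n)) powr \<theta>"
    using p xy by (simp add: powr_mult factors_def mult_ac)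
  qed
  also have "... \<le> (\<Sum>(i, n)\<in>?S. w i powr (1 - \<mu>1) * d1 i * norm (x n)) powr (1 - \<theta>) *
    (\<Sum>(i, n)\<in>?S. w i powr (1 - \<mu>2) * d2 i * norm (y n)) powr \<theta>"
   using \<theta> pos(1) BA by (intro hoelder_sum) (auto intro!: mult_nonneg_nonneg simp: less_imp_le subset_iff)
  also have "... = (\<Sum>i\<in>B. \<Sum>n\<in>A i. w i powr (1 - \<mu>1) * d1 i * norm (x n)) powr (1 - \<theta>) *
    (\<Sum>i\<in>B. \<Sum>n\<in>A i. w i powr (1 - \<mu>2) * d2 i * norm (y n)) powr \<theta>"
   using finB A_fin by (simp add: sum.Sigma)
  also have "... \<le> (C1 * ?W powr (1 - \<mu>1) * N1 x) powr (1 - \<theta>) * (C2 * ?W powr (1 - \<mu>2) * N2 y) powr \<theta>"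
  proof (intro mult_mono powr_mono2)
   show "(\<Sum>i\<in>B. \<Sum>n\<in>A i. w i powr (1 - \<mu>1) * d1 i * norm (x n)) \<le> C1 * ?W powr (1 - \<mu>1) * N1 x"
    using 1 B xyc unfolding ell_system_def by blast
   show "(\<Sum>i\<in>B. \<Sum>n\<in>A i. w i powr (1 - \<mu>2) * d2 i * norm (y n)) \<le> C2 * ?W powr (1 - \<mu>2) * N2 y"
    using 2 B xyc unfolding ell_system_def by blast
  qed (use \<theta> pos BA in \<open>auto intro!: sum_nonneg mult_nonneg_nonneg simp: less_imp_le subset_iff\<close>)
  also have "... = K * (mix (N1 x) (N2 y))"
  proof -
   have e: "1 - ?\<mu> = (1 - \<mu>1) * (1 - \<theta>) + (1 - \<mu>2) * \<theta>" by (simp add: algebra_simps)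
   show ?thesis unfolding K_def e powr_add
    using W0 pos(2,3) lat_nonneg[OF N1 xyc(1)] lat_nonneg[OF N2 xyc(2)]
    by (simp add: powr_mult powr_powr mult_ac)
  qed
  finally show ?thesis .
 qed
 have "T \<le> K * N z"
 proof (cases "K = 0")
  case True
  thus ?thesis using step[OF factors_self[OF z]] by simp
 next
  case False
  hence "0 < K" using K0 by simp
  hence "T / K \<le> N z" using step by (intro lower[OF z]) (simp add: field_simps)
  thus ?thesis using \<open>0 < K\<close> by (simp add: field_simps)
 qed
 thus "(\<Sum>i\<in>B. \<Sum>n\<in>A i. w i powr (1 - ?\<mu>) * (d1 i powr (1 - \<theta>) * d2 i powr \<theta>) * norm (z n))
   \<le> C1 powr (1 - \<theta>) * C2 powr \<theta> * ?W powr (1 - ?\<mu>) * N z"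
  unfolding T_def K_def .
qed

text \<open>Factor the blocks with norms at most D. By Hoelder, a combination with coefficients of
  sum s is dominated by the mix of the same combinations of the factors. The first of these has norm
  at most D s, so the second must have norm at least a fixed multiple of s.\<close>

lemma l1_blocks_factor:
 fixes x :: "nat => nat => 'k"
 assumes l1: "l1_blocks N \<delta> C x" and \<delta>: "0 < \<delta>"
 shows "\<exists>\<delta>' C' x'. 0 < \<delta>' \<and> l1_blocks N2 \<delta>' C' (x' :: nat => nat => 'k)"
proof -
 have x: "block_seq x" "!!j. N (x j) \<le> C"
  "!!m a. (!!j. 0 \<le> a j) ==> \<delta> * (\<Sum>j<m. a j) \<le> N (%n. \<Sum>j<m. of_real (a j) * x j n)"
  using l1 unfolding l1_blocks_def by blast+
 have xc: "x j \<in> c00" for j by (rule block_seqD[OF x(1)])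
 define D where "D = C + 1"
 have D: "0 < D" using nonneg[OF xc, of 0] x(2)[of 0] by (simp add: D_def)
 have "\<exists>u v. factors (x j) u v \<and> N1 u \<le> D \<and> N2 v \<le> D" for j
 proof -
  have "N (x j) < D" using x(2)[of j] by (simp add: D_def)
  thus ?thesis using balanced[OF xc] by blast
 qed
 then obtain u v where uv: "!!j. factors (x j) (u j) (v j)" "!!j. N1 (u j) \<le> D" "!!j. N2 (v j) \<le> D" by metis
 have c: "u j \<in> c00" "v j \<in> c00" for j using uv(1)[of j] by (auto simp: factors_def)
 define u' where "u' j = (%n. of_real (norm (u j n)) :: 'k)" for j
 \<comment> \<open>The second factor may be nonzero where the first one vanishes. Cutting it to the
   support of \<open>x j\<close> keeps the blocks successive.\<close>
 define x' where "x' j = (%n. if x j n = 0 then 0 else of_real (norm (v j n)) :: 'k)" for j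
 have u'c: "u' j \<in> c00" "N1 (u' j) \<le> D" for j
 proof -
  have "norm (u' j n) \<le> norm (u j n)" for n by (simp add: u'_def)
  hence "u' j \<in> c00" "N1 (u' j) \<le> N1 (u j)" by (rule c00_mono[OF c(1)], rule lat_mono[OF N1 c(1)])
  thus "u' j \<in> c00" "N1 (u' j) \<le> D" using uv(2)[of j] by auto
 qed
 have x'c: "x' j \<in> c00" "N2 (x' j) \<le> D" for j
 proof -
  have "norm (x' j n) \<le> norm (v j n)" for n by (simp add: x'_def)
  hence "x' j \<in> c00" "N2 (x' j) \<le> N2 (v j)" by (rule c00_mono[OF c(2)], rule lat_mono[OF N2 c(2)])
  thus "x' j \<in> c00" "N2 (x' j) \<le> D" using uv(3)[of j] by auto
 qed
 have "block_seq x'"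
  unfolding block_seq_def
 proof (intro conjI allI impI)
  fix i j m n assume "i < j" "x' i m \<noteq> 0" "x' j n \<noteq> 0"
  thus "m < n" using block_seqD(2)[OF x(1), of i j m n] by (auto simp: x'_def split: if_splits)
 qed (rule x'c)
 moreover have "(\<delta> / D powr (1 - \<theta>)) powr (1 / \<theta>) * (\<Sum>j<m. a j) \<le> N2 (%n. \<Sum>j<m. of_real (a j) * x' j n)"
  if a: "\<forall>j. 0 \<le> a j" for m a
 proof (cases "(\<Sum>j<m. a j) = 0")
  case True
  have "(%n. \<Sum>j<m. of_real (a j) * x' j n) \<in> c00" using x'c by (intro c00_sum c00_mult)
  from lat_nonneg[OF N2 this] show ?thesis using True by simp
 next
  case False
  define s where "s = (\<Sum>j<m. a j)"
  have s: "0 < s" using False a sum_nonneg[of "{..<m}" a] unfolding s_def by force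
  let ?u = "%n. \<Sum>j<m. of_real (a j) * u' j n" and ?v = "%n. \<Sum>j<m. of_real (a j) * x' j n"
  have uvc: "?u \<in> c00" "?v \<in> c00" using u'c x'c by (auto intro!: c00_sum c00_mult)
  have "\<delta> * s \<le> N (%n. \<Sum>j<m. of_real (a j) * x j n)" unfolding s_def using a by (intro x(3)) auto
  also have "... \<le> mix (N1 ?u) (N2 ?v)"
  proof (rule dominated[OF uvc])
   fix n
   have nv: "x' j n = of_real (if x j n = 0 then 0 else norm (v j n))" for j by (simp add: x'_def)
   have "norm (\<Sum>j<m. of_real (a j) * x j n) \<le> (\<Sum>j<m. norm (of_real (a j) * x j n))" by (rule norm_sum)
   also have "... = (\<Sum>j<m. (a j * norm (u j n)) powr (1 - \<theta>) * (a j * (if x j n = 0 then 0 else norm (v j n))) powr \<theta>)"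
   proof (rule sum.cong[OF refl])
    fix j
    have "norm (x j n) = norm (u j n) powr (1 - \<theta>) * norm (v j n) powr \<theta>" using uv(1)[of j] by (simp add: factors_def)
    moreover have "a j = a j powr (1 - \<theta>) * a j powr \<theta>" using a by (simp add: powr_add[symmetric])
    ultimately show "norm (of_real (a j) * x j n) = (a j * norm (u j n)) powr (1 - \<theta>) * (a j * (if x j n = 0 then 0 else norm (v j n))) powr \<theta>"
     using a by (cases "x j n = 0") (auto simp: norm_mult powr_mult)
   qed
   also have "... \<le> (\<Sum>j<m. a j * norm (u j n)) powr (1 - \<theta>) * (\<Sum>j<m. a j * (if x j n = 0 then 0 else norm (v j n))) powr \<theta>"
    using \<theta> a by (intro hoelder_sum) auto
   also have "(\<Sum>j<m. a j * norm (u j n)) = norm (?u n)"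
   proof -
    have "?u n = of_real (\<Sum>j<m. a j * norm (u j n))" by (simp add: u'_def)
    thus ?thesis using a by (simp only: norm_of_real) (simp add: sum_nonneg)
   qed
   also have "(\<Sum>j<m. a j * (if x j n = 0 then 0 else norm (v j n))) = norm (?v n)"
   proof -
    have "?v n = of_real (\<Sum>j<m. a j * (if x j n = 0 then 0 else norm (v j n)))" unfolding nv by simp
    thus ?thesis using a by (simp only: norm_of_real) (simp add: sum_nonneg)
   qed
   finally show "norm (\<Sum>j<m. of_real (a j) * x j n) \<le> norm (?u n) powr (1 - \<theta>) * norm (?v n) powr \<theta>" .
  qed
  also have "... \<le> (D * s) powr (1 - \<theta>) * N2 ?v powr \<theta>"
  proof (intro mult_right_mono powr_mono2)
   have "N1 ?u \<le> (\<Sum>j<m. N1 (%n. of_real (a j) * u' j n))"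
    using u'c by (intro lat_sum[OF N1] c00_mult)
   also have "... \<le> (\<Sum>j<m. a j * D)"
    using a u'c by (intro sum_mono) (auto simp: lat_scale[OF N1] intro!: mult_left_mono)
   also have "... = D * s" by (simp add: s_def sum_distrib_left mult.commute)
   finally show "N1 ?u \<le> D * s" .
  qed (use \<theta> lat_nonneg[OF N1 uvc(1)] in auto)
  finally have main: "\<delta> * s \<le> (D * s) powr (1 - \<theta>) * N2 ?v powr \<theta>" .
  have "s = s powr (1 - \<theta>) * s powr \<theta>" using s by (simp add: powr_add[symmetric])
  hence "\<delta> * s powr \<theta> * s powr (1 - \<theta>) \<le> D powr (1 - \<theta>) * N2 ?v powr \<theta> * s powr (1 - \<theta>)"
   using main D s by (simp add: powr_mult mult_ac)
  hence "\<delta> * s powr \<theta> \<le> D powr (1 - \<theta>) * N2 ?v powr \<theta>" using s by simp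
  hence "\<delta> / D powr (1 - \<theta>) * s powr \<theta> \<le> N2 ?v powr \<theta>" using D by (simp add: field_simps)
  hence "(\<delta> / D powr (1 - \<theta>) * s powr \<theta>) powr (1 / \<theta>) \<le> (N2 ?v powr \<theta>) powr (1 / \<theta>)"
   using \<theta> \<delta> by (intro powr_mono2) auto
  moreover have "(\<delta> / D powr (1 - \<theta>) * s powr \<theta>) powr (1 / \<theta>) = (\<delta> / D powr (1 - \<theta>)) powr (1 / \<theta>) * s"
   using \<theta> \<delta> s by (subst powr_mult) (auto simp: powr_powr)
  moreover have "(N2 ?v powr \<theta>) powr (1 / \<theta>) = N2 ?v"
   using \<theta> lat_nonneg[OF N2 uvc(2)] by (simp add: powr_powr)
  ultimately show ?thesis by (simp only: s_def)
 qed
 ultimately have "l1_blocks N2 ((\<delta> / D powr (1 - \<theta>)) powr (1 / \<theta>)) D x'"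
  using x'c by (simp add: l1_blocks_def)
 thus ?thesis using \<delta> D by (intro exI conjI) auto
qed

end

section \<open>Schlumprecht type norms\<close>

text \<open>Both kinds of systems use the same normalisation of vectors and functionals, so one
  statement with the larger constant serves for both.\<close>

lemma schlumprecht_system:
 assumes "\<nu> \<in> {0, 1}"
 shows "\<exists>A. block_sets k n0 A \<and> ell_system (snorm :: (nat => 'k::real_normed_field) => real) \<nu> 5 k A
  (%i. slog (card (A i)) / card (A i)) (%i. 1 / slog (card (A i)))"
proof (cases "\<nu> = 0")
 case True
 thus ?thesis using schlumprecht_sup_system[of k n0] by simp
next
 case False
 have mono: "ell_system (snorm :: (nat => 'k) => real) 1 5 k A c d" if s: "ell_system (snorm :: (nat => 'k) => real) 1 2 k A c d" for A c d
  unfolding ell_system_def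
 proof (intro allI impI conjI ballI)
  fix B and w :: "nat => real" assume B: "B \<subseteq> {..<k} \<and> (\<forall>i\<in>B. w i > 0)"
  have "snorm (%n. \<Sum>i\<in>B. if n \<in> A i then of_real (w i powr 1 * c i) else (0::'k)) \<le> 2 * (\<Sum>i\<in>B. w i) powr 1"
   using s B unfolding ell_system_def by blast
  also have "... \<le> 5 * (\<Sum>i\<in>B. w i) powr 1" by (intro mult_right_mono) auto
  finally show "snorm (%n. \<Sum>i\<in>B. if n \<in> A i then of_real (w i powr 1 * c i) else (0::'k)) \<le> 5 * (\<Sum>i\<in>B. w i) powr 1" .
  fix x :: "nat => 'k" assume x: "x \<in> c00"
  have "(\<Sum>i\<in>B. \<Sum>n\<in>A i. w i powr (1 - 1) * d i * norm (x n)) \<le> 2 * (\<Sum>i\<in>B. w i) powr (1 - 1) * snorm x"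
   using s B x unfolding ell_system_def by blast
  also have "... \<le> 5 * (\<Sum>i\<in>B. w i) powr (1 - 1) * snorm x"
   using lat_nonneg[OF snorm_lattice x] by (intro mult_right_mono) auto
  finally show "(\<Sum>i\<in>B. \<Sum>n\<in>A i. w i powr (1 - 1) * d i * norm (x n)) \<le> 5 * (\<Sum>i\<in>B. w i) powr (1 - 1) * snorm x" .
 qed
 have "\<nu> = 1" using assms False by simp
 thus ?thesis using schlumprecht_ell1_system[of k n0] mono by blast
qed

text \<open>Everything that the rest of the proof uses of the norm. The product condition makes the
  flat vectors of height c biorthogonal to the flat functionals of height d, and \<mu> \<noteq> 1/2
  separates the system from l_2.\<close>

definition good_norm :: "((nat => 'k::real_normed_field) => real) => bool"
 where "good_norm N \<longleftrightarrow> lattice_norm N \<and> (\<forall>\<delta> C x. 0 < \<delta> --> \<not> l1_blocks N \<delta> C x) \<and>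
  (\<exists>\<mu> C. 0 \<le> \<mu> \<and> \<mu> \<le> 1 \<and> \<mu> \<noteq> 1 / 2 \<and> (\<forall>k n0. \<exists>A c d. block_sets k n0 A \<and>
   (\<forall>i<k. 0 < c i \<and> 0 < d i \<and> c i * d i * real (card (A i)) = 1) \<and> ell_system N \<mu> C k A c d))"

text \<open>The factor l_t contributes 1/r to the reciprocal exponent of a system in the product,
  and an l_1-system of S contributes \<theta> more, which makes 1/p.\<close>

lemma type_parameters:
 assumes "1 \<le> p" "p < r" "\<not> (p = 1 \<and> r = \<infinity>)"
 defines "\<theta> \<equiv> real_of_ereal (1 / p - 1 / r)"
 shows "0 < \<theta>" "\<theta> < 1" "1 \<le> ereal (1 - \<theta>) * r" "(1 - \<theta>) * recip (ereal (1 - \<theta>) * r) = recip r"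
  "recip r + \<theta> = 1 / real_of_ereal p" "0 \<le> recip r"
proof -
 obtain P where P: "p = ereal P" "1 \<le> P" using assms(1,2) by (cases p) auto
 have all: "0 < \<theta> \<and> \<theta> < 1 \<and> 1 \<le> ereal (1 - \<theta>) * r \<and> (1 - \<theta>) * recip (ereal (1 - \<theta>) * r) = recip r \<and>
  recip r + \<theta> = 1 / real_of_ereal p \<and> 0 \<le> recip r"
 proof (cases r)
  case (real R)
  hence R: "P < R" using P assms(2) by simp
  have \<theta>: "\<theta> = 1 / P - 1 / R" using real R P by (simp add: \<theta>_def one_ereal_def)
  have t: "(1 - \<theta>) * R = R - R / P + 1" using R P by (simp add: \<theta> field_simps)
  have "R / P \<le> R" using R P by (simp add: divide_le_eq mult_le_cancel_left1)
  hence t1: "1 \<le> (1 - \<theta>) * R" using t by linarith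
  have "0 < \<theta>" using R P by (simp add: \<theta> frac_less2)
  moreover have "\<theta> < 1"
  proof -
   have "1 / P \<le> 1" "0 < 1 / R" using R P by auto
   thus ?thesis unfolding \<theta> by linarith
  qed
  ultimately show ?thesis using t1 R P real by (auto simp: recip_def \<theta> one_ereal_def)
 next
  case PInf
  hence "P \<noteq> 1" using assms(3) P by (auto simp: one_ereal_def)
  hence "1 < P" using P by simp
  moreover have \<theta>: "\<theta> = 1 / P" using PInf P by (simp add: \<theta>_def one_ereal_def)
  ultimately show ?thesis using PInf P by (auto simp: recip_def)
 next
  case MInf
  thus ?thesis using assms(2) by simp
 qed
 thus "0 < \<theta>" "\<theta> < 1" "1 \<le> ereal (1 - \<theta>) * r" "(1 - \<theta>) * recip (ereal (1 - \<theta>) * r) = recip r"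
  "recip r + \<theta> = 1 / real_of_ereal p" "0 \<le> recip r" by blast+
qed

theorem schlumprecht_type_norm_good:
 assumes "1 \<le> p" "p < r"
 shows "good_norm (schlumprecht_type_norm p r :: (nat => 'k::real_normed_field) => real)"
proof (cases "p = 1 \<and> r = \<infinity>")
 case True
 hence N: "(schlumprecht_type_norm p r :: (nat => 'k) => real) = snorm"
  by (simp add: schlumprecht_type_norm_def schlumprecht_norm_eq)
 have "\<exists>A c d. block_sets k n0 A \<and> (\<forall>i<k. 0 < c i \<and> 0 < d i \<and> c i * d i * real (card (A i)) = 1) \<and>
   ell_system (snorm :: (nat => 'k) => real) 1 5 k A c d" for k n0
 proof -
  obtain A where A: "block_sets k n0 A" "ell_system (snorm :: (nat => 'k) => real) 1 5 k A
   (%i. slog (card (A i)) / card (A i)) (%i. 1 / slog (card (A i)))" using schlumprecht_system[of 1] by auto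
  have "0 < slog (card (A i)) \<and> 0 < card (A i)" if "i < k" for i
   using A(1) that unfolding block_sets_def by (intro conjI slog_pos) force+
  thus ?thesis using A
   by (intro exI[of _ A] exI[of _ "%i. slog (card (A i)) / card (A i)"] exI[of _ "%i. 1 / slog (card (A i))"] conjI)
    (simp_all add: less_imp_neq[symmetric])
 qed
 hence "\<exists>\<mu> C. 0 \<le> \<mu> \<and> \<mu> \<le> 1 \<and> \<mu> \<noteq> 1 / 2 \<and> (\<forall>k n0. \<exists>A c d. block_sets k n0 A \<and>
   (\<forall>i<k. 0 < c i \<and> 0 < d i \<and> c i * d i * real (card (A i)) = 1) \<and> ell_system (snorm :: (nat => 'k) => real) \<mu> C k A c d)"
  by (intro exI[of _ 1] exI[of _ 5]) auto
 thus ?thesis using snorm_lattice schlumprecht_no_l1_blocks unfolding N good_norm_def by blast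
next
 case False
 define \<theta> where "\<theta> = real_of_ereal (1 / p - 1 / r)"
 define t where "t = ereal (1 - \<theta>) * r"
 note par = type_parameters[OF assms False, folded \<theta>_def, folded t_def]
 have N: "(schlumprecht_type_norm p r :: (nat => 'k) => real) = calderon_norm \<theta> (ell_norm t) snorm"
  using False by (auto simp: schlumprecht_type_norm_def schlumprecht_norm_eq Let_def \<theta>_def t_def)
 interpret calderon \<theta> "ell_norm t :: (nat => 'k) => real" snorm
  by standard (use par ell_norm_lattice snorm_lattice in auto)
 define \<nu> :: real where "\<nu> = (if p = 2 then 0 else 1)"
 define \<mu> where "\<mu> = (1 - \<theta>) * recip t + \<theta> * \<nu>"
 have P: "p = ereal (real_of_ereal p)" "1 \<le> real_of_ereal p" using assms by (cases p; auto)+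
 have \<mu>: "0 \<le> \<mu>" "\<mu> \<le> 1" "\<mu> \<noteq> 1 / 2"
 proof -
  have e: "\<mu> = recip r + \<theta> * \<nu>" by (simp add: \<mu>_def par(4))
  show "0 \<le> \<mu>" using par(1,6) by (simp add: e \<nu>_def)
  have "\<mu> \<le> recip r + \<theta>" using par(1) by (simp add: e \<nu>_def)
  also have "... \<le> 1" unfolding par(5) using P(2) by simp
  finally show "\<mu> \<le> 1" .
  show "\<mu> \<noteq> 1 / 2"
  proof (cases "p = 2")
   case True
   hence "recip r + \<theta> = 1 / 2" using par(5) by simp
   thus ?thesis using True par(1) by (simp add: e \<nu>_def)
  next
   case False
   hence "real_of_ereal p \<noteq> 2" using P(1) by (metis numeral_eq_ereal)
   hence "1 / real_of_ereal p \<noteq> 1 / 2" by simp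
   moreover have "\<mu> = 1 / real_of_ereal p" unfolding par(5)[symmetric] using False by (simp add: e \<nu>_def)
   ultimately show ?thesis by simp
  qed
 qed
 have "\<exists>A c d. block_sets k n0 A \<and> (\<forall>i<k. 0 < c i \<and> 0 < d i \<and> c i * d i * real (card (A i)) = 1) \<and>
   ell_system N \<mu> (5 powr \<theta>) k A c d" for k n0
 proof -
  obtain A where A: "block_sets k n0 A" "ell_system (snorm :: (nat => 'k) => real) \<nu> 5 k A
   (%i. slog (card (A i)) / card (A i)) (%i. 1 / slog (card (A i)))"
  proof -
   have "\<nu> \<in> {0, 1}" by (simp add: \<nu>_def)
   from schlumprecht_system[OF this] show ?thesis using that by blast
  qed
  have pos: "0 < slog (card (A i))" "0 < real (card (A i))" if "i < k" for i
   using A(1) that unfolding block_sets_def by (auto intro!: slog_pos)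
  let ?c1 = "%i. real (card (A i)) powr - recip t" and ?d1 = "%i. real (card (A i)) powr - (1 - recip t)"
  let ?c2 = "%i. slog (card (A i)) / card (A i)" and ?d2 = "%i. 1 / slog (card (A i))"
  have s: "ell_system N \<mu> (1 powr (1 - \<theta>) * 5 powr \<theta>) k A
   (%i. ?c1 i powr (1 - \<theta>) * ?c2 i powr \<theta>) (%i. ?d1 i powr (1 - \<theta>) * ?d2 i powr \<theta>)"
   unfolding \<mu>_def using pos by (intro system[OF A(1) ell_norm_system[OF par(3) A(1)] A(2)]) auto
  have "?c1 i powr (1 - \<theta>) * ?c2 i powr \<theta> * (?d1 i powr (1 - \<theta>) * ?d2 i powr \<theta>) * card (A i) = 1" if "i < k" for i
  proof -
   have n: "0 < real (card (A i))" "0 < slog (card (A i))" using pos that by auto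
   have "?c1 i powr (1 - \<theta>) * ?c2 i powr \<theta> * (?d1 i powr (1 - \<theta>) * ?d2 i powr \<theta>)
     = (?c1 i * ?d1 i) powr (1 - \<theta>) * (?c2 i * ?d2 i) powr \<theta>"
    using n by (simp add: powr_mult powr_divide mult_ac)
   also have "?c1 i * ?d1 i = real (card (A i)) powr - 1" unfolding powr_add[symmetric] by simp
   also have "?c2 i * ?d2 i = real (card (A i)) powr - 1" using n by (simp add: powr_minus_divide)
   also have "(real (card (A i)) powr - 1) powr (1 - \<theta>) * (real (card (A i)) powr - 1) powr \<theta> = real (card (A i)) powr - 1"
    by (simp add: powr_add[symmetric])
   finally show ?thesis using n by (simp add: powr_minus_divide)
  qed
  thus ?thesis using s A(1) pos
   by (intro exI[of _ A] exI[of _ "%i. ?c1 i powr (1 - \<theta>) * ?c2 i powr \<theta>"] exI[of _ "%i. ?d1 i powr (1 - \<theta>) * ?d2 i powr \<theta>"] conjI)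
    (simp_all add: order_less_imp_not_eq2)
 qed
 moreover have "\<not> l1_blocks N \<delta> C x" if "0 < \<delta>" for \<delta> C x
  using l1_blocks_factor[OF _ that] schlumprecht_no_l1_blocks by blast
 ultimately show ?thesis unfolding good_norm_def N using lattice \<mu> by blast
qed

section \<open>Normed spaces of functions and completions\<close>

lemma fscale_vector_space: "vector_space (fscale :: 'k::real_normed_field => ('i => 'k) => _)"
 by unfold_locales (auto simp: fscale_def fun_eq_iff algebra_simps)

locale normed_fspace =
 fixes X :: "('i, 'k::real_normed_field) fspace"
 assumes is_norm: "is_norm_on (vecs X) (nrm X)"
  and zero_in [simp]: "0 \<in> vecs X"
  and add_in [simp]: "x \<in> vecs X ==> y \<in> vecs X ==> x + y \<in> vecs X"
  and scale_in [simp]: "x \<in> vecs X ==> fscale a x \<in> vecs X"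
begin

lemma nonneg [simp]: "x \<in> vecs X ==> 0 \<le> nrm X x"
 using is_norm by (auto simp: is_norm_on_def)

lemma eq_0: "x \<in> vecs X ==> nrm X x = 0 \<longleftrightarrow> x = 0"
 using is_norm unfolding is_norm_on_def by blast

lemma nrm_zero [simp]: "nrm X 0 = 0"
 using eq_0 by simp

lemma scale: "x \<in> vecs X ==> nrm X (fscale a x) = norm a * nrm X x"
 using is_norm unfolding is_norm_on_def by blast

lemma triangle: "x \<in> vecs X ==> y \<in> vecs X ==> nrm X (x + y) \<le> nrm X x + nrm X y"
 using is_norm unfolding is_norm_on_def by blast

lemma uminus_in [simp]: "x \<in> vecs X ==> - x \<in> vecs X"
 using scale_in[of x "-1"] by (simp add: fscale_def fun_Compl_def)

lemma nrm_uminus: "x \<in> vecs X ==> nrm X (- x) = nrm X x"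
 using scale[of x "-1"] by (simp add: fscale_def fun_Compl_def)

lemma diff_in [simp]: "x \<in> vecs X ==> y \<in> vecs X ==> x - y \<in> vecs X"
 using add_in[of x "- y"] by simp

lemma nrm_diff_commute: "x \<in> vecs X ==> y \<in> vecs X ==> nrm X (x - y) = nrm X (y - x)"
 using nrm_uminus[of "x - y"] by simp

lemma nrm_diff: "x \<in> vecs X ==> y \<in> vecs X ==> nrm X (x - y) \<le> nrm X x + nrm X y"
 using triangle[of x "- y"] nrm_uminus[of y] by simp

lemma nrm_diff_triangle:
 "x \<in> vecs X ==> y \<in> vecs X ==> z \<in> vecs X ==> nrm X (x - z) \<le> nrm X (x - y) + nrm X (y - z)"
 using triangle[of "x - y" "y - z"] by simp

lemma nrm_reverse: "x \<in> vecs X ==> y \<in> vecs X ==> nrm X x \<le> nrm X y + nrm X (x - y)"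
 using triangle[of y "x - y"] by simp

lemma sum_in [simp]: "(!!i. i \<in> I ==> x i \<in> vecs X) ==> (\<Sum>i\<in>I. x i) \<in> vecs X"
 by (induction I rule: infinite_finite_induct) auto

lemma nrm_sum: "(!!i. i \<in> I ==> x i \<in> vecs X) ==> nrm X (\<Sum>i\<in>I. x i) \<le> (\<Sum>i\<in>I. nrm X (x i))"
proof (induction I rule: infinite_finite_induct)
 case (insert i I)
 have "nrm X (x i + sum x I) \<le> nrm X (x i) + nrm X (sum x I)" using insert.prems by (intro triangle) auto
 moreover have "nrm X (sum x I) \<le> (\<Sum>i\<in>I. nrm X (x i))" using insert by blast
 ultimately show ?case unfolding sum.insert[OF insert(1,2)] by linarith
qed auto

sublocale Metric_space "vecs X" "norm_dist (vecs X) (nrm X)"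
 by standard (use eq_0 nrm_diff_commute nrm_diff_triangle in \<open>auto simp: norm_dist_def\<close>)

lemma topology_eq: "norm_topology X = mtopology"
 by (simp add: norm_topology_def)

end

section \<open>The completion of a lattice norm\<close>

lemma lattice_normed_fspace:
 "lattice_norm N ==> normed_fspace \<lparr>vecs = c00, nrm = N\<rparr>"
 by standard (auto simp: lattice_norm_def)

locale completed =
 fixes N :: "(nat => 'k::real_normed_field) => real"
 assumes N: "lattice_norm N"
begin

abbreviation cut :: "nat => (nat => 'k) => nat => 'k" where "cut n x \<equiv> restr {..<n} x"

lemma cut_c00 [simp]: "cut n x \<in> c00"
 by (rule c00_restr_finite) simp

lemma represents_iff: "represents N u x \<longleftrightarrow> (\<forall>k. u k \<in> c00) \<and>
 (\<forall>e>0. \<exists>K. \<forall>k\<ge>K. \<forall>l\<ge>K. N (u k - u l) < e) \<and> (\<forall>n. (%k. u k n) \<longlonglongrightarrow> x n)"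
proof -
 interpret C: normed_fspace "\<lparr>vecs = c00, nrm = N\<rparr>" by (rule lattice_normed_fspace[OF N])
 have "C.MCauchy u \<longleftrightarrow> (\<forall>k. u k \<in> c00) \<and> (\<forall>e>0. \<exists>K. \<forall>k\<ge>K. \<forall>l\<ge>K. N (u k - u l) < e)"
 proof (cases "\<forall>k. u k \<in> c00")
  case True
  hence "norm_dist c00 N (u k) (u l) = N (u k - u l)" for k l by (simp add: norm_dist_def)
  thus ?thesis using True unfolding C.MCauchy_def by auto
 next
  case False
  thus ?thesis unfolding C.MCauchy_def by auto
 qed
 thus ?thesis by (simp add: represents_def)
qed

lemma representsD:
 assumes "represents N u x"
 shows "u k \<in> c00" "0 < e ==> \<exists>K. \<forall>k\<ge>K. \<forall>l\<ge>K. N (u k - u l) < e" "(%k. u k n) \<longlonglongrightarrow> x n"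
 using assms by (simp_all add: represents_iff)

text \<open>A term far out in the sequence has finite support. Beyond that support a later term
  coincides with their difference, so its tail is small by monotonicity; on the finitely many
  remaining coordinates there is convergence.\<close>

lemma represents_close:
 assumes "represents N u x" "0 < e"
 shows "\<exists>M. \<forall>m\<ge>M. \<exists>K. \<forall>k\<ge>K. N (u k - cut m x) \<le> e"
proof -
 note u = representsD[OF assms(1)]
 have "0 < e / 2" using assms(2) by simp
 from u(2)[OF this] obtain K where K: "!!k l. K \<le> k ==> K \<le> l ==> N (u k - u l) < e / 2" by blast
 obtain M where M: "!!n. u K n \<noteq> 0 ==> n < M"
  using c00_finite[OF u(1), of K] finite_nat_set_iff_bounded by auto
 have "\<exists>K'. \<forall>k\<ge>K'. N (u k - cut m x) \<le> e" if m: "M \<le> m" for m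
 proof -
  have tail: "N (u k - cut m (u k)) \<le> e / 2" if "K \<le> k" for k
  proof -
   have "N (u k - cut m (u k)) \<le> N (u k - u K)"
   proof (rule lat_mono[OF N])
    fix n show "norm ((u k - cut m (u k)) n) \<le> norm ((u k - u K) n)"
     using M[of n] m by (cases "u K n = 0") (auto simp: restr_def)
   qed (use u(1) in auto)
   thus ?thesis using K[OF that order_refl] by simp
  qed
  have "(%k. \<Sum>n<m. norm (u k n - x n)) \<longlonglongrightarrow> (\<Sum>n<m. norm (x n - x n))"
   by (intro tendsto_intros u(3))
  hence "\<forall>\<^sub>F k in sequentially. (\<Sum>n<m. norm (u k n - x n)) < e / 2"
   using assms(2) by (intro order_tendstoD(2)) auto
  then obtain K' where K': "!!k. K' \<le> k ==> (\<Sum>n<m. norm (u k n - x n)) < e / 2"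
   unfolding eventually_sequentially by blast
  show ?thesis
  proof (intro exI[of _ "max K K'"] allI impI)
   fix k assume k: "max K K' \<le> k"
   have "cut m (u k) - cut m x = (%j. \<Sum>n<m. (u k n - x n) * unitv n j)"
   proof
    fix j
    have "(\<Sum>n<m. (u k n - x n) * unitv n j) = (\<Sum>n<m. if n = j then u k j - x j else 0)"
     by (intro sum.cong) (auto simp: unitv_def)
    thus "(cut m (u k) - cut m x) j = (\<Sum>n<m. (u k n - x n) * unitv n j)" by (simp add: restr_def)
   qed
   hence "N (cut m (u k) - cut m x) \<le> (\<Sum>n<m. N (%j. (u k n - x n) * unitv n j))"
    by (simp only:) (intro lat_sum[OF N] c00_mult c00_unitv)
   also have "... = (\<Sum>n<m. norm (u k n - x n))"
    using N by (simp add: lat_scale[OF N] lattice_norm_def)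
   finally have "N (cut m (u k) - cut m x) \<le> e / 2" using K'[of k] k by simp
   moreover have "N (u k - cut m x) \<le> N (u k - cut m (u k)) + N (cut m (u k) - cut m x)"
    using lat_triangle[OF N, of "u k - cut m (u k)" "cut m (u k) - cut m x"] u(1) by simp
   ultimately show "N (u k - cut m x) \<le> e" using tail[of k] k by simp
  qed
 qed
 thus ?thesis by blast
qed

lemma N_diff_le: "x \<in> c00 ==> y \<in> c00 ==> \<bar>N x - N y\<bar> \<le> N (x - y)"
proof -
 interpret C: normed_fspace "\<lparr>vecs = c00, nrm = N\<rparr>" by (rule lattice_normed_fspace[OF N])
 assume "x \<in> c00" "y \<in> c00"
 thus ?thesis using C.nrm_reverse[of x y] C.nrm_reverse[of y x] C.nrm_diff_commute[of x y] by simp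
qed

text \<open>The initial segments depend on x alone. The common limit therefore shows that the value
  chosen in \<open>completion\<close> does not depend on the sequence, and identifies the norm with
  the limit of the norms of the segments.\<close>

lemma represents_limit:
 assumes "represents N u x"
 shows "\<exists>L. (%k. N (u k)) \<longlonglongrightarrow> L \<and> (%m. N (cut m x)) \<longlonglongrightarrow> L"
proof -
 note u = representsD[OF assms]
 have "Cauchy (%k. N (u k))"
 proof (rule CauchyI)
  fix e :: real assume "0 < e"
  from u(2)[OF this] obtain K where K: "!!k l. K \<le> k ==> K \<le> l ==> N (u k - u l) < e" by blast
  show "\<exists>K. \<forall>k\<ge>K. \<forall>l\<ge>K. norm (N (u k) - N (u l)) < e"
  proof (intro exI[of _ K] allI impI)
   fix k l assume "K \<le> k" "K \<le> l"
   thus "norm (N (u k) - N (u l)) < e" using N_diff_le[OF u(1) u(1), of k l] K[of k l] by simp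
  qed
 qed
 then obtain L where L: "(%k. N (u k)) \<longlonglongrightarrow> L" using Cauchy_convergent_iff convergent_def by blast
 moreover have "(%m. N (cut m x)) \<longlonglongrightarrow> L"
 proof (rule LIMSEQ_I)
  fix e :: real assume e: "0 < e"
  then obtain M where M: "!!m. M \<le> m ==> \<exists>K. \<forall>k\<ge>K. N (u k - cut m x) \<le> e / 2"
   using represents_close[OF assms, of "e / 2"] by auto
  show "\<exists>M. \<forall>m\<ge>M. norm (N (cut m x) - L) < e"
  proof (intro exI[of _ M] allI impI)
   fix m assume "M \<le> m"
   then obtain K where K: "!!k. K \<le> k ==> N (u k - cut m x) \<le> e / 2" using M by blast
   have "(%k. \<bar>N (u k) - N (cut m x)\<bar>) \<longlonglongrightarrow> \<bar>L - N (cut m x)\<bar>" by (intro tendsto_intros L)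
   hence "\<bar>L - N (cut m x)\<bar> \<le> e / 2"
   proof (rule LIMSEQ_le_const2)
    show "\<exists>K. \<forall>k\<ge>K. \<bar>N (u k) - N (cut m x)\<bar> \<le> e / 2"
     by (rule exI[of _ K]) (use K order_trans[OF N_diff_le[OF u(1) cut_c00]] in blast)
   qed
   thus "norm (N (cut m x) - L) < e" using e by (simp only: real_norm_def abs_minus_commute[of L])
  qed
 qed
 ultimately show ?thesis by blast
qed

abbreviation "X \<equiv> completion N"

lemma in_vecs: "x \<in> vecs X \<longleftrightarrow> (\<exists>u. represents N u x)"
 by (simp add: completion_def)

lemma nrm_limit:
 assumes "represents N u x" shows "(%k. N (u k)) \<longlonglongrightarrow> nrm X x" "(%m. N (cut m x)) \<longlonglongrightarrow> nrm X x"
proof -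
 obtain L where L: "(%k. N (u k)) \<longlonglongrightarrow> L" "(%m. N (cut m x)) \<longlonglongrightarrow> L" using represents_limit[OF assms] by blast
 have "(THE l. \<forall>u. represents N u x --> (%k. N (u k)) \<longlonglongrightarrow> l) = L"
 proof (rule the_equality)
  show "\<forall>u. represents N u x --> (%k. N (u k)) \<longlonglongrightarrow> L"
  proof (intro allI impI)
   fix v assume "represents N v x"
   then obtain L' where "(%k. N (v k)) \<longlonglongrightarrow> L'" "(%m. N (cut m x)) \<longlonglongrightarrow> L'" using represents_limit by blast
   thus "(%k. N (v k)) \<longlonglongrightarrow> L" using L(2) LIMSEQ_unique by blast
  qed
  fix l assume "\<forall>u. represents N u x --> (%k. N (u k)) \<longlonglongrightarrow> l"
  thus "l = L" using assms L(1) LIMSEQ_unique by blast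
 qed
 thus "(%k. N (u k)) \<longlonglongrightarrow> nrm X x" "(%m. N (cut m x)) \<longlonglongrightarrow> nrm X x" using L by (auto simp: completion_def)
qed

lemma cut_limit: "x \<in> vecs X ==> (%m. N (cut m x)) \<longlonglongrightarrow> nrm X x"
 using nrm_limit(2) in_vecs by blast

lemma represents_const: "x \<in> c00 ==> represents N (%k. x) x"
 using lat_zero(1)[OF N] by (simp add: represents_iff)

lemma c00_in [simp]: "x \<in> c00 ==> x \<in> vecs X"
 using represents_const in_vecs by blast

lemma nrm_c00: "x \<in> c00 ==> nrm X x = N x"
 using nrm_limit(1)[OF represents_const] LIMSEQ_unique tendsto_const by blast

lemma represents_add:
 assumes "represents N u x" "represents N v y" shows "represents N (%k. u k + v k) (x + y)"
 unfolding represents_iff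
proof (intro conjI allI impI)
 note u = representsD(1)[OF assms(1)] representsD(1)[OF assms(2)] representsD(3)[OF assms(1)] representsD(3)[OF assms(2)]
 show "u k + v k \<in> c00" for k using u by simp
 show "(%k. (u k + v k) n) \<longlonglongrightarrow> (x + y) n" for n using tendsto_add[OF u(3,4)] by simp
 fix e :: real assume "0 < e"
 hence e2: "0 < e / 2" by simp
 obtain K1 where K1: "!!k l. K1 \<le> k ==> K1 \<le> l ==> N (u k - u l) < e / 2"
  using representsD(2)[OF assms(1) e2] by blast
 obtain K2 where K2: "!!k l. K2 \<le> k ==> K2 \<le> l ==> N (v k - v l) < e / 2"
  using representsD(2)[OF assms(2) e2] by blast
 show "\<exists>K. \<forall>k\<ge>K. \<forall>l\<ge>K. N (u k + v k - (u l + v l)) < e"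
 proof (intro exI[of _ "max K1 K2"] allI impI)
  fix k l assume kl: "max K1 K2 \<le> k" "max K1 K2 \<le> l"
  have e: "u k + v k - (u l + v l) = (u k - u l) + (v k - v l)" by simp
  have "N (u k + v k - (u l + v l)) \<le> N (u k - u l) + N (v k - v l)"
   unfolding e using u by (intro lat_triangle[OF N] c00_diff)
  thus "N (u k + v k - (u l + v l)) < e" using K1[of k l] K2[of k l] kl by simp
 qed
qed

lemma represents_scale:
 assumes "represents N u x" shows "represents N (%k. fscale a (u k)) (fscale a x)"
 unfolding represents_iff
proof (intro conjI allI impI)
 note u = representsD(1,3)[OF assms]
 show "fscale a (u k) \<in> c00" for k using u by simp
 show "(%k. fscale a (u k) n) \<longlonglongrightarrow> fscale a x n" for n unfolding fscale_def by (intro tendsto_intros u)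
 fix e :: real assume "0 < e"
 hence "0 < e / (norm a + 1)" by (simp add: add_nonneg_pos)
 from representsD(2)[OF assms this]
 obtain K where K: "!!k l. K \<le> k ==> K \<le> l ==> N (u k - u l) < e / (norm a + 1)" by blast
 show "\<exists>K. \<forall>k\<ge>K. \<forall>l\<ge>K. N (fscale a (u k) - fscale a (u l)) < e"
 proof (intro exI[of _ K] allI impI)
  fix k l assume kl: "K \<le> k" "K \<le> l"
  have d: "u k - u l \<in> c00" using u by simp
  have "fscale a (u k) - fscale a (u l) = (%n. a * (u k - u l) n)" by (auto simp: fscale_def algebra_simps)
  hence "N (fscale a (u k) - fscale a (u l)) = norm a * N (u k - u l)" by (simp only: lat_scale[OF N d])
  also have "... \<le> (norm a + 1) * N (u k - u l)" using lat_nonneg[OF N d] by (simp add: algebra_simps)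
  also have "... < (norm a + 1) * (e / (norm a + 1))"
   using K[OF kl] by (intro mult_strict_left_mono) (auto simp: add_nonneg_pos)
  also have "... = e" using add_nonneg_pos[of "norm a" 1] by simp
  finally show "N (fscale a (u k) - fscale a (u l)) < e" .
 qed
qed

lemma cut_le: "x \<in> vecs X ==> N (cut m x) \<le> nrm X x"
proof (rule LIMSEQ_le_const[OF cut_limit])
 show "\<exists>M. \<forall>n\<ge>M. N (cut m x) \<le> N (cut n x)"
  by (intro exI[of _ m] allI impI lat_mono[OF N] cut_c00) (auto simp: restr_def)
qed

lemma coord_le: "x \<in> vecs X ==> norm (x n) \<le> nrm X x"
 using lat_coord[OF N cut_c00, of "Suc n" x n] cut_le[of x "Suc n"] by (simp add: restr_def)

lemma nrm_le: "x \<in> vecs X ==> (!!m. N (cut m x) \<le> B) ==> nrm X x \<le> B"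
 using LIMSEQ_le_const2[OF cut_limit] by blast

lemma normed: "normed_fspace X"
proof
 show in0: "0 \<in> vecs X" by simp
 show add: "x + y \<in> vecs X" if "x \<in> vecs X" "y \<in> vecs X" for x y
  using that represents_add in_vecs by blast
 show sc: "fscale a x \<in> vecs X" if "x \<in> vecs X" for a x
  using that represents_scale in_vecs by blast
 have nonneg: "0 \<le> nrm X x" if "x \<in> vecs X" for x
  using coord_le[OF that, of 0] norm_ge_zero[of "x 0"] by linarith
 have zero: "nrm X x = 0 \<longleftrightarrow> x = 0" if "x \<in> vecs X" for x
 proof
  assume "nrm X x = 0"
  thus "x = 0" using coord_le[OF that] by (auto simp: fun_eq_iff)
 next
  assume "x = 0"
  thus "nrm X x = 0" using nrm_c00[of 0] lat_zero(1)[OF N] by simp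
 qed
 have scale: "nrm X (fscale a x) = norm a * nrm X x" if "x \<in> vecs X" for x a
 proof (rule LIMSEQ_unique[OF cut_limit[OF sc[OF that]]])
  have "N (cut m (fscale a x)) = norm a * N (cut m x)" for m
   using lat_scale[OF N cut_c00, of a m x] by (simp add: restr_fscale) (simp add: fscale_def)
  thus "(%m. N (cut m (fscale a x))) \<longlonglongrightarrow> norm a * nrm X x"
   using tendsto_mult_left[OF cut_limit[OF that]] by simp
 qed
 have triangle: "nrm X (x + y) \<le> nrm X x + nrm X y" if "x \<in> vecs X" "y \<in> vecs X" for x y
 proof (rule nrm_le[OF add[OF that]])
  fix m show "N (cut m (x + y)) \<le> nrm X x + nrm X y"
   using lat_triangle[OF N cut_c00 cut_c00, of m x m y] cut_le[OF that(1), of m] cut_le[OF that(2), of m]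
   by (simp add: restr_add)
 qed
 show "is_norm_on (vecs X) (nrm X)" using nonneg zero scale triangle by (auto simp: is_norm_on_def)
qed

lemma cut_approx:
 assumes x: "x \<in> vecs X" and e: "0 < e"
 shows "\<exists>M. \<forall>m\<ge>M. nrm X (x - cut m x) \<le> e"
proof -
 interpret normed_fspace X by (rule normed)
 obtain u where u: "represents N u x" using x in_vecs by blast
 obtain M where M: "!!m. M \<le> m ==> \<exists>K. \<forall>k\<ge>K. N (u k - cut m x) \<le> e" using represents_close[OF u e] by blast
 show ?thesis
 proof (intro exI[of _ M] allI impI)
  fix m assume "M \<le> m"
  then obtain K where K: "!!k. K \<le> k ==> N (u k - cut m x) \<le> e" using M by blast
  have "represents N (%k. u k + fscale (-1) (cut m x)) (x + fscale (-1) (cut m x))"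
   by (intro represents_add u represents_const) auto
  moreover have "v + fscale (-1) (cut m x) = v - cut m x" for v by (auto simp: fscale_def)
  ultimately have "represents N (%k. u k - cut m x) (x - cut m x)" by simp
  hence "(%k. N (u k - cut m x)) \<longlonglongrightarrow> nrm X (x - cut m x)" by (rule nrm_limit)
  thus "nrm X (x - cut m x) \<le> e" by (rule LIMSEQ_le_const2) (use K in blast)
 qed
qed

end

section \<open>Spaces with an unconditional basis\<close>

definition lin_comb :: "(nat => 'i => 'k::real_normed_field) => (nat => 'k) => 'i => 'k"
 where "lin_comb b a = (\<Sum>n | a n \<noteq> 0. fscale (a n) (b n))"

lemma fscale_zero [simp]: "fscale 0 x = (0 :: 'i => 'k::real_normed_field)" "fscale a (0 :: 'i => 'k) = 0"
 by (auto simp: fscale_def)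

lemma fscale_one [simp]: "fscale 1 x = (x :: 'i => 'k::real_normed_field)"
 by (simp add: fscale_def)

lemma fscale_fscale: "fscale a (fscale c x) = fscale (a * c) (x :: 'i => 'k::real_normed_field)"
 by (simp add: fscale_def mult.assoc)

lemma fscale_add_left: "fscale (a + c) x = fscale a x + fscale c (x :: 'i => 'k::real_normed_field)"
 by (auto simp: fscale_def algebra_simps)

lemma fscale_add_right: "fscale a (x + y) = fscale a x + fscale a (y :: 'i => 'k::real_normed_field)"
 by (auto simp: fscale_def algebra_simps)

lemma fscale_sum: "fscale a (\<Sum>i\<in>I. x i) = (\<Sum>i\<in>I. fscale a (x i :: 'i => 'k::real_normed_field))"
 unfolding fun_sum fscale_def by (simp add: sum_distrib_left)

lemma fscale_minus_one: "fscale (- 1) x = - (x :: 'i => 'k::real_normed_field)"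
 by (auto simp: fscale_def)

lemma lin_comb_finite:
 assumes "finite F" "{n. a n \<noteq> 0} \<subseteq> F"
 shows "lin_comb b a = (\<Sum>n\<in>F. fscale (a n) (b n))"
 unfolding lin_comb_def using assms by (intro sum.mono_neutral_left) auto

lemma lin_comb_add: "a \<in> c00 ==> c \<in> c00 ==> lin_comb b (a + c) = lin_comb b a + lin_comb b c"
proof -
 assume "a \<in> c00" "c \<in> c00"
 hence F: "finite ({n. a n \<noteq> 0} \<union> {n. c n \<noteq> 0})" (is "finite ?F") by (simp add: c00_finite)
 have "lin_comb b (a + c) = (\<Sum>n\<in>?F. fscale ((a + c) n) (b n))" by (rule lin_comb_finite[OF F]) auto
 also have "... = (\<Sum>n\<in>?F. fscale (a n) (b n)) + (\<Sum>n\<in>?F. fscale (c n) (b n))"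
  by (simp only: plus_fun_apply fscale_add_left sum.distrib)
 also have "(\<Sum>n\<in>?F. fscale (a n) (b n)) = lin_comb b a" by (rule lin_comb_finite[OF F, symmetric]) auto
 also have "(\<Sum>n\<in>?F. fscale (c n) (b n)) = lin_comb b c" by (rule lin_comb_finite[OF F, symmetric]) auto
 finally show ?thesis .
qed

lemma lin_comb_scale: "a \<in> c00 ==> lin_comb b (fscale s a) = fscale s (lin_comb b a)"
proof -
 assume "a \<in> c00"
 hence "lin_comb b (fscale s a) = (\<Sum>n | a n \<noteq> 0. fscale (fscale s a n) (b n))"
  by (intro lin_comb_finite c00_finite) (auto simp: fscale_def)
 also have "... = fscale s (lin_comb b a)"
  unfolding lin_comb_def fscale_sum fscale_fscale by (simp add: fscale_def)
 finally show ?thesis .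
qed

lemma lin_comb_unitv: "lin_comb b (unitv j) = b j"
proof -
 have "lin_comb b (unitv j) = (\<Sum>n\<in>{j}. fscale (unitv j n) (b n))" by (rule lin_comb_finite) (auto simp: unitv_def)
 thus ?thesis by simp
qed

text \<open>To be used twice: for the completion with the unit vectors and for its dual with the
  coordinate functionals. The assumption \<open>lattice\<close> is unconditionality with constant 1,
  so the norm transported to coefficients is again a lattice norm.\<close>

locale unc_basis = normed_fspace X for X :: "('i, 'k::real_normed_field) fspace" +
 fixes b :: "nat => 'i => 'k" and co :: "('i => 'k) => nat => 'k"
 assumes b_in [simp]: "b j \<in> vecs X"
  and b_norm: "nrm X (b j) = 1"
  and co_add: "x \<in> vecs X ==> y \<in> vecs X ==> co (x + y) n = co x n + co y n"
  and co_scale: "x \<in> vecs X ==> co (fscale s x) n = s * co x n"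
  and co_b: "co (b j) = unitv j"
  and co_bdd: "x \<in> vecs X ==> norm (co x n) \<le> nrm X x"
  and lattice: "a \<in> c00 ==> a' \<in> c00 ==> (!!n. norm (a n) \<le> norm (a' n)) ==>
   nrm X (lin_comb b a) \<le> nrm X (lin_comb b a')"
  and dense: "x \<in> vecs X ==> 0 < e ==> \<exists>a\<in>c00. nrm X (x - lin_comb b a) < e"
begin

abbreviation "lc \<equiv> lin_comb b"
definition N :: "(nat => 'k) => real" where "N a = nrm X (lc a)"

lemma lc_in [simp]: "lc a \<in> vecs X"
 by (simp add: lin_comb_def)

lemma co_zero: "co 0 n = 0"
 using co_scale[of 0 0 n] by simp

lemma co_sum: "(!!i. i \<in> I ==> x i \<in> vecs X) ==> co (\<Sum>i\<in>I. x i) n = (\<Sum>i\<in>I. co (x i) n)"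
proof (induction I rule: infinite_finite_induct)
 case (insert i I)
 have "co (x i + sum x I) n = co (x i) n + co (sum x I) n" using insert.prems by (intro co_add sum_in) auto
 moreover have "co (sum x I) n = (\<Sum>i\<in>I. co (x i) n)" using insert by blast
 ultimately show ?case by (simp only: sum.insert[OF insert(1,2)])
qed (auto simp: co_zero)

lemma co_lc: "a \<in> c00 ==> co (lc a) = a"
proof
 fix n assume a: "a \<in> c00"
 have "co (lc a) n = (\<Sum>m | a m \<noteq> 0. a m * unitv m n)"
  unfolding lin_comb_def by (subst co_sum) (auto simp: co_scale co_b)
 also have "... = (\<Sum>m | a m \<noteq> 0. if m = n then a n else 0)" by (intro sum.cong) (auto simp: unitv_def)
 also have "... = a n" using c00_finite[OF a] by simp
 finally show "co (lc a) n = a n" .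
qed

lemma lattice_N: "lattice_norm N"
proof -
 have "N a = 0 \<longleftrightarrow> a = 0" if "a \<in> c00" for a
 proof
  assume "N a = 0"
  hence "lc a = 0" using eq_0[of "lc a"] by (simp add: N_def)
  hence "a = co 0" using co_lc[OF that] by simp
  thus "a = 0" using co_zero by auto
 qed (simp add: N_def lin_comb_def)
 moreover have "N (fscale s a) = norm s * N a" if "a \<in> c00" for s a
  by (simp add: N_def lin_comb_scale that scale)
 moreover have "N (a + c) \<le> N a + N c" if "a \<in> c00" "c \<in> c00" for a c
  by (simp add: N_def lin_comb_add that triangle)
 moreover have "N (unitv n) = 1" for n by (simp add: N_def lin_comb_unitv b_norm)
 ultimately show ?thesis using lattice by (auto simp: lattice_norm_def is_norm_on_def N_def)
qed

end

lemma (in completed) completion_basis: "unc_basis X unitv (%x. x)"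
proof -
 interpret normed_fspace X by (rule normed)
 have lc: "lin_comb unitv a = a" if "a \<in> c00" for a :: "nat => 'k"
 proof
  fix m
  have "lin_comb unitv a m = (\<Sum>n | a n \<noteq> 0. a n * unitv n m)" by (simp add: lin_comb_def fun_sum fscale_def)
  also have "... = (\<Sum>n | a n \<noteq> 0. if n = m then a m else 0)" by (intro sum.cong) (auto simp: unitv_def)
  also have "... = a m" using c00_finite[OF that] by simp
  finally show "lin_comb unitv a m = a m" .
 qed
 show ?thesis
 proof unfold_locales
  fix x :: "nat => 'k" and e :: real assume x: "x \<in> vecs X" and e: "0 < e"
  then obtain M where "nrm X (x - cut M x) \<le> e / 2" using cut_approx[OF x, of "e / 2"] by auto
  thus "\<exists>a\<in>c00. nrm X (x - lin_comb unitv a) < e" using e by (intro bexI[of _ "cut M x"]) (auto simp: lc)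
 qed (use coord_le N in \<open>auto simp: lc nrm_c00 fscale_def lattice_norm_def\<close>)
qed

section \<open>The dual space\<close>

context normed_fspace
begin

abbreviation "dnrm \<equiv> nrm (dual_space X)"

definition functional :: "(('i => 'k) => 'k) => bool"
 where "functional f \<longleftrightarrow> (\<forall>x. x \<notin> vecs X --> f x = 0) \<and>
  (\<forall>x\<in>vecs X. \<forall>y\<in>vecs X. f (x + y) = f x + f y) \<and> (\<forall>x\<in>vecs X. \<forall>a. f (fscale a x) = a * f x) \<and>
  (\<exists>C. \<forall>x\<in>vecs X. norm (f x) \<le> C * nrm X x)"

lemma in_dual: "f \<in> vecs (dual_space X) \<longleftrightarrow> functional f"
 by (simp add: dual_space_def functional_def)

lemma functionalD:
 assumes "functional f"
 shows "x \<notin> vecs X ==> f x = 0" "x \<in> vecs X ==> y \<in> vecs X ==> f (x + y) = f x + f y"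
  "x \<in> vecs X ==> f (fscale a x) = a * f x" "\<exists>C. \<forall>x\<in>vecs X. norm (f x) \<le> C * nrm X x"
 using assms by (simp_all add: functional_def)

lemma functional_zero: "functional f ==> f 0 = 0"
 using functionalD(3)[of f 0 0] by simp

lemma functional_diff: "functional f ==> x \<in> vecs X ==> y \<in> vecs X ==> f (x - y) = f x - f y"
 using functionalD(2)[of f x "- y"] functionalD(3)[of f y "-1"] by (simp add: fscale_minus_one)

lemma functional_sum: "functional f ==> (!!i. i \<in> I ==> x i \<in> vecs X) ==> f (\<Sum>i\<in>I. x i) = (\<Sum>i\<in>I. f (x i))"
proof (induction I rule: infinite_finite_induct)
 case (insert i I)
 have "f (x i + sum x I) = f (x i) + f (sum x I)" using insert.prems by (intro functionalD(2) sum_in) auto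
 moreover have "f (sum x I) = (\<Sum>i\<in>I. f (x i))" using insert by blast
 ultimately show ?case by (simp only: sum.insert[OF insert(1,2)])
qed (auto simp: functional_zero)

lemma dual_set:
 assumes "functional f"
 shows "bdd_above {norm (f x) | x. x \<in> vecs X \<and> nrm X x \<le> 1}" "0 \<in> {norm (f x) | x. x \<in> vecs X \<and> nrm X x \<le> 1}"
proof -
 obtain C where C: "!!x. x \<in> vecs X ==> norm (f x) \<le> C * nrm X x" using functionalD(4)[OF assms] by blast
 show "bdd_above {norm (f x) | x. x \<in> vecs X \<and> nrm X x \<le> 1}"
 proof (rule bdd_aboveI)
  fix v assume "v \<in> {norm (f x) | x. x \<in> vecs X \<and> nrm X x \<le> 1}"
  then obtain x where x: "v = norm (f x)" "x \<in> vecs X" "nrm X x \<le> 1" by blast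
  have "v \<le> C * nrm X x" using C x by simp
  also have "... \<le> \<bar>C\<bar> * 1" using x by (intro mult_mono) auto
  finally show "v \<le> \<bar>C\<bar>" by simp
 qed
 show "0 \<in> {norm (f x) | x. x \<in> vecs X \<and> nrm X x \<le> 1}"
  using functional_zero[OF assms] by (intro CollectI exI[of _ 0]) auto
qed

lemma dual_upper: "functional f ==> x \<in> vecs X ==> nrm X x \<le> 1 ==> norm (f x) \<le> dnrm f"
 unfolding dual_space_def fspace.simps by (rule cSup_upper[OF _ dual_set(1)]) blast+

lemma dual_least:
 "functional f ==> (!!x. x \<in> vecs X ==> nrm X x \<le> 1 ==> norm (f x) \<le> B) ==> dnrm f \<le> B"
 unfolding dual_space_def fspace.simps by (rule cSup_least) (use dual_set(2) in blast)+

lemma dual_nonneg: "functional f ==> 0 \<le> dnrm f"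
 using dual_upper[of f 0] by (simp add: functional_zero)

lemma dual_bound: "functional f ==> x \<in> vecs X ==> norm (f x) \<le> dnrm f * nrm X x"
proof (cases "nrm X x = 0")
 case True
 assume "functional f" "x \<in> vecs X"
 thus ?thesis using True eq_0 functional_zero by simp
next
 case False
 assume f: "functional f" and x: "x \<in> vecs X"
 hence p: "0 < nrm X x" using False nonneg[OF x] by linarith
 let ?y = "fscale (of_real (inverse (nrm X x))) x"
 have "nrm X ?y = norm (of_real (inverse (nrm X x)) :: 'k) * nrm X x" by (rule scale[OF x])
 also have "... = 1" using p by (simp only: norm_of_real) simp
 finally have "nrm X ?y = 1" .
 hence "norm (f ?y) \<le> dnrm f" using f x by (intro dual_upper) auto
 hence "norm (of_real (inverse (nrm X x)) :: 'k) * norm (f x) \<le> dnrm f"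
  by (simp only: functionalD(3)[OF f x] norm_mult)
 hence "inverse (nrm X x) * norm (f x) \<le> dnrm f" using p by (simp only: norm_of_real) simp
 thus ?thesis using p by (simp add: field_simps)
qed

lemma dual_normed: "normed_fspace (dual_space X)"
proof
 show "(0 :: ('i => 'k) => 'k) \<in> vecs (dual_space X)"
  unfolding in_dual functional_def by (auto intro!: exI[of _ 0])
 show add: "f + g \<in> vecs (dual_space X)" if "f \<in> vecs (dual_space X)" "g \<in> vecs (dual_space X)" for f g
 proof -
  have fg: "functional f" "functional g" using that by (simp_all add: in_dual)
  have "norm ((f + g) x) \<le> (dnrm f + dnrm g) * nrm X x" if "x \<in> vecs X" for x
   using norm_triangle_ineq[of "f x" "g x"] dual_bound[OF fg(1) that] dual_bound[OF fg(2) that] by (simp add: algebra_simps)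
  moreover have "(f + g) x = 0" if "x \<notin> vecs X" for x
   using functionalD(1)[OF fg(1) that] functionalD(1)[OF fg(2) that] by simp
  moreover have "(f + g) (x + y) = (f + g) x + (f + g) y" if "x \<in> vecs X" "y \<in> vecs X" for x y
   using functionalD(2)[OF fg(1) that] functionalD(2)[OF fg(2) that] by (simp add: algebra_simps)
  moreover have "(f + g) (fscale a x) = a * (f + g) x" if "x \<in> vecs X" for x a
   using functionalD(3)[OF fg(1) that] functionalD(3)[OF fg(2) that] by (simp add: algebra_simps)
  ultimately show ?thesis unfolding in_dual functional_def by blast
 qed
 show sc: "fscale s f \<in> vecs (dual_space X)" if "f \<in> vecs (dual_space X)" for s f
 proof -
  have f: "functional f" using that by (simp add: in_dual)
  have "norm (fscale s f x) \<le> (norm s * dnrm f) * nrm X x" if "x \<in> vecs X" for x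
   using mult_left_mono[OF dual_bound[OF f that], of "norm s"] by (simp add: fscale_def norm_mult mult.assoc)
  moreover have "fscale s f x = 0" if "x \<notin> vecs X" for x
   using functionalD(1)[OF f that] by (simp add: fscale_def)
  moreover have "fscale s f (x + y) = fscale s f x + fscale s f y" if "x \<in> vecs X" "y \<in> vecs X" for x y
   using functionalD(2)[OF f that] by (simp add: fscale_def algebra_simps)
  moreover have "fscale s f (fscale a x) = a * fscale s f x" if "x \<in> vecs X" for x a
   using functionalD(3)[OF f that] unfolding fscale_def[of s f] by (simp add: algebra_simps)
  ultimately show ?thesis unfolding in_dual functional_def by blast
 qed
 have zero: "dnrm f = 0 \<longleftrightarrow> f = 0" if f: "functional f" for f
 proof
  assume "dnrm f = 0"
  hence "norm (f x) \<le> 0" if "x \<in> vecs X" for x using dual_bound[OF f that] by simp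
  hence "f x = 0" for x using functionalD(1)[OF f] by (cases "x \<in> vecs X") auto
  thus "f = 0" by auto
 next
  assume "f = 0"
  hence "dnrm f \<le> 0" using f by (intro dual_least) auto
  thus "dnrm f = 0" using dual_nonneg[OF f] by simp
 qed
 have scale_le: "dnrm (fscale s f) \<le> norm s * dnrm f" if f: "functional f" for s f
 proof (rule dual_least)
  show "functional (fscale s f)" using sc f by (simp add: in_dual)
  fix x assume "x \<in> vecs X" "nrm X x \<le> 1"
  thus "norm (fscale s f x) \<le> norm s * dnrm f"
   using mult_left_mono[OF dual_upper[OF f], of x "norm s"] by (simp add: fscale_def norm_mult)
 qed
 have scale: "dnrm (fscale s f) = norm s * dnrm f" if f: "functional f" for s f
 proof (cases "s = 0")
  case True
  thus ?thesis using zero[of 0] f sc[of f 0] by (simp add: in_dual)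
 next
  case False
  have sf: "functional (fscale s f)" using sc f by (simp add: in_dual)
  have "f = fscale (inverse s) (fscale s f)" using False by (simp add: fscale_fscale)
  hence "dnrm f \<le> norm (inverse s) * dnrm (fscale s f)" using scale_le[OF sf, of "inverse s"] by simp
  hence "norm s * dnrm f \<le> norm s * (norm (inverse s) * dnrm (fscale s f))" by (intro mult_left_mono) auto
  also have "... = dnrm (fscale s f)" using False by (simp add: norm_inverse)
  finally show ?thesis using scale_le[OF f, of s] by simp
 qed
 have triangle: "dnrm (f + g) \<le> dnrm f + dnrm g" if f: "functional f" "functional g" for f g
 proof (rule dual_least)
  show "functional (f + g)" using add f by (simp add: in_dual)
  fix x assume "x \<in> vecs X" "nrm X x \<le> 1"
  thus "norm ((f + g) x) \<le> dnrm f + dnrm g"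
   using norm_triangle_ineq[of "f x" "g x"] dual_upper[OF f(1), of x] dual_upper[OF f(2), of x] by simp
 qed
 show "is_norm_on (vecs (dual_space X)) dnrm"
  unfolding is_norm_on_def in_dual using dual_nonneg zero scale triangle by (auto simp: in_dual)
qed

end

text \<open>If some functional is not approximated by its restrictions to the first coordinates, then a gliding
 hump yields blocks on which it is bounded below, and these blocks satisfy a lower \<open>\<ell>\<^sub>1\<close>-estimate.\<close>

lemma (in completed) functional_tail:
 assumes no_l1: "!!\<delta> C x. 0 < \<delta> ==> \<not> l1_blocks N \<delta> C x"
  and f: "normed_fspace.functional X f" and e: "0 < e"
 shows "\<exists>m. \<forall>x\<in>vecs X. nrm X x \<le> 1 --> norm (f (x - cut m x)) \<le> e"
proof (rule ccontr)
 interpret normed_fspace X by (rule normed)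
 assume "\<not> ?thesis"
 hence bad: "\<exists>x\<in>vecs X. nrm X x \<le> 1 \<and> e < norm (f (x - cut m x))" for m by (simp add: not_le)
 define F where "F = dnrm f"
 have F: "0 \<le> F" "!!x. x \<in> vecs X ==> norm (f x) \<le> F * nrm X x" using dual_nonneg[OF f] dual_bound[OF f] by (auto simp: F_def)
 define good where "good = (%(m :: nat, l :: nat, y). y \<in> c00 \<and> N y \<le> 1 \<and> (\<forall>n. y n \<noteq> 0 --> m \<le> n \<and> n < l) \<and>
  f y = of_real (norm (f y)) \<and> e \<le> norm (f y))"
 have step: "\<exists>l y. good (m, l, y)" for m
 proof -
  obtain x where x: "x \<in> vecs X" "nrm X x \<le> 1" "e < norm (f (x - cut m x))" using bad by blast
  \<comment> \<open>The excess over e; replacing x by a sufficiently long segment changes the value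
    of f by no more than this.\<close>
  define g where "g = norm (f (x - cut m x)) - e"
  have "0 < g / (F + 1)" using x(3) F(1) by (simp add: g_def)
  then obtain M where M: "!!l. M \<le> l ==> nrm X (x - cut l x) \<le> g / (F + 1)" using cut_approx[OF x(1)] by blast
  define l where "l = max M m"
  have "norm (f (x - cut l x)) \<le> F * (g / (F + 1))"
   using F(2)[of "x - cut l x"] mult_left_mono[OF M[of l] F(1)] x(1) by (simp add: l_def)
  also have "... \<le> g"
  proof -
   have "0 \<le> g" using x(3) by (simp add: g_def)
   thus ?thesis using F(1) by (simp add: divide_le_eq algebra_simps)
  qed
  finally have fl: "norm (f (x - cut l x)) \<le> g" .
  define y where "y = cut l x - cut m x"
  have y: "y \<in> c00" "N y \<le> 1" "!!n. y n \<noteq> 0 ==> m \<le> n \<and> n < l"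
  proof -
   show yc: "y \<in> c00" by (simp add: y_def)
   have "N y \<le> N (cut l x)" by (rule lat_mono[OF N cut_c00]) (auto simp: y_def restr_def l_def)
   thus "N y \<le> 1" using cut_le[OF x(1), of l] x(2) by simp
  qed (auto simp: y_def restr_def l_def split: if_splits)
  have "f (x - cut m x) = f (x - cut l x) + f y"
   using functionalD(2)[OF f, of "x - cut l x" y] x(1) y(1) by (simp add: y_def)
  hence "norm (f (x - cut m x)) \<le> norm (f (x - cut l x)) + norm (f y)" by (simp add: norm_triangle_ineq)
  hence fy: "e \<le> norm (f y)" using fl by (simp add: g_def)
  hence fy0: "f y \<noteq> 0" using e by auto
  \<comment> \<open>A scalar of modulus 1 makes the value on the block positive, so that the values
    add up on combinations with nonnegative coefficients.\<close>
  define c where "c = of_real (norm (f y)) / f y"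
  have c: "norm c = 1" using fy0 by (simp add: c_def norm_divide)
  have "f (fscale c y) = of_real (norm (f y))" using functionalD(3)[OF f, of y c] y(1) fy0 by (simp add: c_def)
  moreover have "N (fscale c y) \<le> 1"
   using lat_scale[OF N y(1), of c] y(2) c by (simp add: fscale_def)
  ultimately have "good (m, l, fscale c y)"
   using y fy unfolding good_def by (auto simp: fscale_def)
  thus ?thesis by blast
 qed
 have "\<exists>s. \<forall>i. good (s i) \<and> fst (s (Suc i)) = fst (snd (s i))"
 proof (rule dependent_nat_choice[where P = "%i. good" and Q = "%i s s'. fst s' = fst (snd s)"])
  show "\<exists>s. good s" using step[of 0] by blast
  show "\<exists>s'. good s' \<and> fst s' = fst (snd s)" for s using step[of "fst (snd s)"] by auto
 qed
 then obtain s where s: "!!i. good (s i)" "!!i. fst (s (Suc i)) = fst (snd (s i))" by blast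
 define p where "p i = fst (s i)" for i
 define y where "y i = snd (snd (s i))" for i
 have s_eq: "s i = (p i, p (Suc i), y i)" for i by (simp add: p_def y_def s(2))
 have y: "y i \<in> c00" "N (y i) \<le> 1" "y i n \<noteq> 0 ==> p i \<le> n \<and> n < p (Suc i)" "f (y i) = of_real (norm (f (y i)))" "e \<le> norm (f (y i))" for i n
  using s(1)[of i] unfolding s_eq good_def by auto
 have "p i \<le> p (Suc i)" for i
 proof -
  have "y i \<noteq> 0" using y(5)[of i] e functional_zero[OF f] by auto
  then obtain n where "y i n \<noteq> 0" by (auto simp: fun_eq_iff)
  thus ?thesis using y(3)[of i n] by simp
 qed
 hence p_mono: "i \<le> j ==> p i \<le> p j" for i j by (rule lift_Suc_mono_le)
 have "block_seq y"
  unfolding block_seq_def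
 proof (intro conjI allI impI)
  fix i j m n assume "i < j" "y i m \<noteq> 0" "y j n \<noteq> 0"
  thus "m < n" using y(3)[of i m] y(3)[of j n] p_mono[of "Suc i" j] by simp
 qed (rule y)
 moreover have "e / (F + 1) * (\<Sum>j<m. a j) \<le> N (%n. \<Sum>j<m. of_real (a j) * y j n)" if a: "\<forall>j. 0 \<le> a j" for m a
 proof -
  let ?z = "%n. \<Sum>j<m. of_real (a j) * y j n"
  have zc: "?z \<in> c00" using y(1) by (intro c00_sum c00_mult)
  have z: "?z = (\<Sum>j<m. fscale (of_real (a j)) (y j))" by (simp add: fun_sum fscale_def)
  have "f ?z = (\<Sum>j<m. of_real (a j) * f (y j))"
   unfolding z using y(1) by (subst functional_sum[OF f]) (auto simp: functionalD(3)[OF f])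
  also have "... = (\<Sum>j<m. of_real (a j * norm (f (y j))))" using y(4) by (metis (no_types, lifting) of_real_mult)
  also have "... = of_real (\<Sum>j<m. a j * norm (f (y j)))" by simp
  finally have "norm (f ?z) = (\<Sum>j<m. a j * norm (f (y j)))" using a by (simp only: norm_of_real) (simp add: sum_nonneg)
  moreover have "(\<Sum>j<m. a j * e) \<le> (\<Sum>j<m. a j * norm (f (y j)))" using a y(5) by (intro sum_mono mult_left_mono) auto
  ultimately have "e * (\<Sum>j<m. a j) \<le> norm (f ?z)" by (simp add: sum_distrib_left mult.commute)
  also have "... \<le> F * N ?z" using F(2)[of ?z] zc by (simp add: nrm_c00)
  also have "... \<le> (F + 1) * N ?z" using lat_nonneg[OF N zc] by (simp add: algebra_simps)
  finally show ?thesis using F(1) by (simp add: divide_le_eq mult.commute)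
 qed
 ultimately have "l1_blocks N (e / (F + 1)) 1 y" using y(2) by (simp add: l1_blocks_def)
 moreover have "0 < e / (F + 1)" using e F(1) by simp
 ultimately show False using no_l1 by blast
qed

lemma (in completed) dual_basis:
 assumes no_l1: "!!\<delta> C x. 0 < \<delta> ==> \<not> l1_blocks N \<delta> C x"
 shows "unc_basis (dual_space X) (%j x. if x \<in> vecs X then x j else 0) (%f n. f (unitv n))"
proof -
 interpret normed_fspace X by (rule normed)
 interpret D: normed_fspace "dual_space X" by (rule dual_normed)
 let ?b = "%j x. if x \<in> vecs X then x j else 0"
 have b: "functional (?b j)" for j
 proof -
  have "norm (?b j x) \<le> 1 * nrm X x" if "x \<in> vecs X" for x using coord_le[OF that, of j] that by simp
  moreover have "?b j (x + y) = ?b j x + ?b j y" if "x \<in> vecs X" "y \<in> vecs X" for x y using that by simp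
  moreover have "?b j (fscale a x) = a * ?b j x" if "x \<in> vecs X" for x a
   using that scale_in[OF that, of a] by (simp add: fscale_def[of a x])
  moreover have "?b j x = 0" if "x \<notin> vecs X" for x using that by simp
  ultimately show ?thesis unfolding functional_def by (intro conjI allI ballI impI exI[of _ 1])
 qed
 have lc: "lin_comb ?b a x = (\<Sum>n | a n \<noteq> 0. a n * x n)" if "x \<in> vecs X" for a x
  using that by (simp add: lin_comb_def fun_sum fscale_def)
 have lcf: "functional (lin_comb ?b a)" for a
  unfolding in_dual[symmetric] lin_comb_def using b by (intro D.sum_in D.scale_in) (simp add: in_dual)
 have unit_nrm: "nrm X (unitv n) = 1" for n using N by (simp add: nrm_c00 lattice_norm_def)
 show ?thesis
 proof unfold_locales
  show "?b j \<in> vecs (dual_space X)" for j using b by (simp add: in_dual)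
  show "dnrm (?b j) = 1" for j
  proof (rule antisym)
   show "dnrm (?b j) \<le> 1" using coord_le by (intro dual_least b) (auto intro: order_trans)
   show "1 \<le> dnrm (?b j)" using dual_upper[OF b, of "unitv j" j] unit_nrm by simp
  qed
  show "(f + g) (unitv n) = f (unitv n) + g (unitv n)" for f g :: "(nat => 'k) => 'k" and n by simp
  show "fscale s f (unitv n) = s * f (unitv n)" for f :: "(nat => 'k) => 'k" and s n by (simp add: fscale_def)
  show "(%n. ?b j (unitv n)) = unitv j" for j
  proof
   fix n show "?b j (unitv n) = unitv j n" by (cases "n = j") auto
  qed
  show "norm (f (unitv n)) \<le> dnrm f" if "f \<in> vecs (dual_space X)" for f n
   using that dual_upper[of f "unitv n"] unit_nrm by (simp add: in_dual)
  fix a a' :: "nat => 'k" assume a: "a \<in> c00" "a' \<in> c00" "!!n. norm (a n) \<le> norm (a' n)"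
  show "dnrm (lin_comb ?b a) \<le> dnrm (lin_comb ?b a')"
  proof (rule dual_least[OF lcf])
   fix x assume x: "x \<in> vecs X" "nrm X x \<le> 1"
   \<comment> \<open>The quotients a/a' have modulus at most 1: they are moved from the functional
     to the vector, whose norm does not grow.\<close>
   define x' where "x' n = (if a' n = 0 then 0 else a n / a' n * x n)" for n
   have supp: "a n \<noteq> 0 ==> a' n \<noteq> 0" for n using a(3)[of n] by auto
   have x'c: "x' \<in> c00" using c00_finite[OF a(2)] by (rule c00_supp[rotated]) (auto simp: x'_def split: if_splits)
   obtain m where m: "!!n. a' n \<noteq> 0 ==> n < m" using c00_finite[OF a(2)] finite_nat_set_iff_bounded by auto
   have "N x' \<le> N (cut m x)"
   proof (rule lat_mono[OF N cut_c00])
    fix n show "norm (x' n) \<le> norm (cut m x n)"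
     using m[of n] a(3)[of n] mult_right_mono[of "norm (a n) / norm (a' n)" 1 "norm (x n)"]
     by (auto simp: x'_def restr_def norm_mult norm_divide)
   qed
   hence "nrm X x' \<le> 1" using cut_le[OF x(1), of m] x(2) x'c by (simp add: nrm_c00)
   hence "norm (lin_comb ?b a' x') \<le> dnrm (lin_comb ?b a')" using x'c by (intro dual_upper lcf) auto
   moreover have "lin_comb ?b a' x' = lin_comb ?b a x"
   proof -
    have "lin_comb ?b a' x' = (\<Sum>n | a' n \<noteq> 0. a n * x n)"
     unfolding lc[OF c00_in[OF x'c]] by (intro sum.cong) (auto simp: x'_def)
    also have "... = (\<Sum>n | a n \<noteq> 0. a n * x n)"
     using c00_finite[OF a(2)] supp by (intro sum.mono_neutral_right) auto
    finally show ?thesis by (simp add: lc[OF x(1)])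
   qed
   ultimately show "norm (lin_comb ?b a x) \<le> dnrm (lin_comb ?b a')" by simp
  qed
 next
  fix f and e :: real assume "f \<in> vecs (dual_space X)" and e: "0 < e"
  hence f: "functional f" by (simp add: in_dual)
  obtain m where m: "!!x. x \<in> vecs X ==> nrm X x \<le> 1 ==> norm (f (x - cut m x)) \<le> e / 2"
   using functional_tail[OF no_l1 f, of "e / 2"] e by auto
  define a where "a n = (if n < m then f (unitv n) else 0)" for n
  have ac: "a \<in> c00" by (rule c00_supp[of _ "{..<m}"]) (auto simp: a_def split: if_splits)
  have "dnrm (f - lin_comb ?b a) \<le> e / 2"
  proof (rule dual_least)
   show "functional (f - lin_comb ?b a)" using D.diff_in f lcf by (simp add: in_dual)
   fix x assume x: "x \<in> vecs X" "nrm X x \<le> 1"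
   have "cut m x = (\<Sum>n<m. fscale (x n) (unitv n))"
   proof
    fix j
    have "(\<Sum>n<m. fscale (x n) (unitv n)) j = (\<Sum>n<m. if n = j then x j else 0)"
     unfolding fun_sum by (intro sum.cong) (auto simp: unitv_def fscale_def)
    thus "cut m x j = (\<Sum>n<m. fscale (x n) (unitv n)) j" by (simp add: restr_def)
   qed
   hence "f (cut m x) = (\<Sum>n<m. x n * f (unitv n))"
    by (simp only:) (subst functional_sum[OF f], auto simp: functionalD(3)[OF f])
   also have "... = (\<Sum>n<m. a n * x n)" by (intro sum.cong) (auto simp: a_def)
   also have "... = lin_comb ?b a x"
    unfolding lc[OF x(1)] by (intro sum.mono_neutral_right) (auto simp: a_def split: if_splits)
   finally have "(f - lin_comb ?b a) x = f (x - cut m x)" using functional_diff[OF f x(1), of "cut m x"] by simp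
   thus "norm ((f - lin_comb ?b a) x) \<le> e / 2" using m[OF x] by simp
  qed
  thus "\<exists>a\<in>c00. dnrm (f - lin_comb ?b a) < e" using ac e by (intro bexI[of _ a]) auto
 qed
qed

section \<open>Finite systems of almost \<open>\<ell>\<^sub>q\<close> type\<close>

definition pairing :: "(nat => 'k::real_normed_field) => (nat => 'k) => 'k"
 where "pairing g x = (\<Sum>n | g n \<noteq> 0. g n * x n)"

text \<open>A relation, like \<open>dbound\<close>, which says that the dual norm is at most r. This
  lets the definitions below apply to vectors and functionals alike.\<close>

definition nbound :: "((nat => 'k::real_normed_field) => real) => (nat => 'k) => real => bool"
 where "nbound N x r \<longleftrightarrow> N x \<le> r"

definition dbound :: "((nat => 'k::real_normed_field) => real) => (nat => 'k) => real => bool"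
 where "dbound N g r \<longleftrightarrow> (\<forall>x\<in>c00. norm (pairing g x) \<le> r * N x)"

definition comb :: "'i set => ('i => real) => ('i => nat => 'k::real_normed_field) => nat => 'k"
 where "comb B a f = (%n. \<Sum>i\<in>B. of_real (a i) * f i n)"

text \<open>An upper \<open>\<ell>\<^sub>s\<close>-estimate with \<open>\<sigma> = 1 / s > 1 / 2\<close>, weakened to a weighted \<open>\<ell>\<^sub>2\<close>-estimate, and an upper
 estimate for coefficients of constant modulus.\<close>

definition upper2 :: "((nat => 'k::real_normed_field) => real => bool) => real => real => 'i set => ('i => nat => 'k) => bool"
 where "upper2 Q \<sigma> C K f \<longleftrightarrow>
  (\<forall>B\<subseteq>K. \<forall>a. Q (comb B a f) (C * (real (card B) powr (\<sigma> - 1 / 2) * sqrt (\<Sum>i\<in>B. (a i)\<^sup>2))))"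

definition flat :: "((nat => 'k::real_normed_field) => real => bool) => real => real => 'i set => ('i => nat => 'k) => bool"
 where "flat Q \<kappa> C K f \<longleftrightarrow>
  (\<forall>B\<subseteq>K. \<forall>a s. (\<forall>i\<in>B. \<bar>a i\<bar> = s) --> Q (comb B a f) (C * (s * real (card B) powr \<kappa>)))"

text \<open>With \<open>low\<close> the vectors have the upper estimate of exponent 1/\<sigma> < 2
  and the functionals the conjugate one; without it the sides are exchanged. Passing to the dual
  space swaps f with g and negates \<open>low\<close>.\<close>

definition bi_system ::
  "((nat => 'k::real_normed_field) => real) => real => real => bool => 'i set => nat => ('i => nat => 'k) => ('i => nat => 'k) => bool"
 where "bi_system N \<sigma> C low K n0 f g \<longleftrightarrow>
  (\<forall>i\<in>K. f i \<in> c00 \<and> g i \<in> c00 \<and> (\<forall>n. f i n \<noteq> 0 \<or> g i n \<noteq> 0 --> n0 \<le> n)) \<and>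
  (\<forall>i\<in>K. \<forall>j\<in>K. pairing (g i) (f j) = (if i = j then 1 else 0)) \<and>
  (if low then upper2 (nbound N) \<sigma> C K f \<and> flat (dbound N) (1 - \<sigma>) C K g
   else flat (nbound N) (1 - \<sigma>) C K f \<and> upper2 (dbound N) \<sigma> C K g)"

definition has_systems :: "((nat => 'k::real_normed_field) => real) => real => real => bool => bool"
 where "has_systems N \<sigma> C low \<longleftrightarrow> (\<forall>k n0. \<exists>f g. bi_system N \<sigma> C low {..<k::nat} n0 f g)"

lemma pairing_finite: "finite F ==> {n. g n \<noteq> 0} \<subseteq> F ==> pairing g x = (\<Sum>n\<in>F. g n * x n)"
 unfolding pairing_def by (rule sum.mono_neutral_left) auto

lemma pairing_commute: "g \<in> c00 ==> x \<in> c00 ==> pairing g x = pairing x g"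
proof -
 assume "g \<in> c00" "x \<in> c00"
 hence F: "finite ({n. g n \<noteq> 0} \<union> {n. x n \<noteq> 0})" (is "finite ?F") by (simp add: c00_finite)
 have "pairing g x = (\<Sum>n\<in>?F. g n * x n)" by (rule pairing_finite[OF F]) auto
 also have "... = (\<Sum>n\<in>?F. x n * g n)" by (simp add: mult.commute)
 also have "... = pairing x g" by (rule pairing_finite[OF F, symmetric]) auto
 finally show ?thesis .
qed

lemma pairing_sum_right: "pairing g (%n. \<Sum>i\<in>I. a i * x i n) = (\<Sum>i\<in>I. a i * pairing g (x i))"
proof -
 have "pairing g (%n. \<Sum>i\<in>I. a i * x i n) = (\<Sum>n | g n \<noteq> 0. \<Sum>i\<in>I. a i * (g n * x i n))"
  by (simp add: pairing_def sum_distrib_left mult.left_commute)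
 also have "... = (\<Sum>i\<in>I. \<Sum>n | g n \<noteq> 0. a i * (g n * x i n))" by (rule sum.swap)
 finally show ?thesis by (simp add: pairing_def sum_distrib_left)
qed

lemma pairing_sum_left:
 assumes "!!i. i \<in> I ==> g i \<in> c00"
 shows "pairing (%n. \<Sum>i\<in>I. a i * g i n) x = (\<Sum>i\<in>I. a i * pairing (g i) x)"
proof (cases "finite I")
 case True
 let ?F = "\<Union>i\<in>I. {n. g i n \<noteq> 0}"
 have F: "finite ?F" using True assms c00_finite by blast
 have "pairing (%n. \<Sum>i\<in>I. a i * g i n) x = (\<Sum>n\<in>?F. (\<Sum>i\<in>I. a i * g i n) * x n)"
 proof (rule pairing_finite[OF F])
  show "{n. (\<Sum>i\<in>I. a i * g i n) \<noteq> 0} \<subseteq> ?F"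
  proof (rule subsetI, rule ccontr)
   fix n assume n: "n \<in> {n. (\<Sum>i\<in>I. a i * g i n) \<noteq> 0}" and "n \<notin> ?F"
   hence "(\<Sum>i\<in>I. a i * g i n) = 0" by (intro sum.neutral) auto
   thus False using n by simp
  qed
 qed
 also have "... = (\<Sum>i\<in>I. \<Sum>n\<in>?F. a i * (g i n * x n))"
  by (subst sum.swap) (simp add: sum_distrib_right mult.assoc)
 also have "... = (\<Sum>i\<in>I. a i * pairing (g i) x)"
 proof (rule sum.cong[OF refl])
  fix i assume "i \<in> I"
  hence "pairing (g i) x = (\<Sum>n\<in>?F. g i n * x n)" by (intro pairing_finite[OF F]) auto
  thus "(\<Sum>n\<in>?F. a i * (g i n * x n)) = a i * pairing (g i) x" by (simp add: sum_distrib_left)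
 qed
 finally show ?thesis .
qed (simp add: pairing_def)

lemma comb_c00: "(!!i. i \<in> B ==> f i \<in> c00) ==> comb B a f \<in> c00"
 unfolding comb_def by (intro c00_sum c00_mult)

lemma upper2D: "upper2 Q \<sigma> C K f ==> B \<subseteq> K ==> Q (comb B a f) (C * (real (card B) powr (\<sigma> - 1 / 2) * sqrt (\<Sum>i\<in>B. (a i)\<^sup>2)))"
 unfolding upper2_def by blast

lemma flatD: "flat Q \<kappa> C K f ==> B \<subseteq> K ==> (!!i. i \<in> B ==> \<bar>a i\<bar> = s) ==> Q (comb B a f) (C * (s * real (card B) powr \<kappa>))"
 by (simp add: flat_def)

lemma weighted_flat:
 fixes f :: "'i => nat => 'k::real_normed_field"
 assumes w: "!!B a w. B \<subseteq> K ==> (!!i. i \<in> B ==> 0 < w i \<and> \<bar>a i\<bar> = w i powr \<rho>) ==> Q (comb B a f) (C * (\<Sum>i\<in>B. w i) powr \<rho>)"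
  and hom: "!!x r s. Q x r ==> 0 \<le> s ==> Q (%n. of_real s * x n) (s * r)"
 shows "flat Q \<rho> C K f"
 unfolding flat_def
proof (intro allI impI)
 fix B and a :: "'i => real" and s :: real assume B: "B \<subseteq> K" and s: "\<forall>i\<in>B. \<bar>a i\<bar> = s"
 define a' where "a' i = (if 0 \<le> a i then 1 else - 1 :: real)" for i
 have "Q (comb B a' f) (C * (\<Sum>i\<in>B. 1) powr \<rho>)" by (rule w[OF B]) (auto simp: a'_def)
 hence q: "Q (comb B a' f) (C * real (card B) powr \<rho>)" by simp
 show "Q (comb B a f) (C * (s * real (card B) powr \<rho>))"
 \<comment> \<open>For empty B nothing is known about s, not even its sign; then the bound is 0,
   because \<open>0 powr \<rho> = 0\<close>.\<close>
 proof (cases "B = {}")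
  case True
  thus ?thesis using w[of "{}" "%_. 1" a] by simp
 next
  case False
  hence "0 \<le> s" using s by force
  moreover have "(%n. of_real s * comb B a' f n) = comb B a f"
  proof -
   have "a i = s * a' i" if "i \<in> B" for i using s that by (auto simp: a'_def abs_if split: if_splits)
   thus ?thesis unfolding comb_def sum_distrib_left by (intro ext sum.cong refl) (simp add: mult.assoc)
  qed
  ultimately show ?thesis using hom[OF q] by (metis mult.left_commute)
 qed
qed

text \<open>The weights are \<open>\<bar>a i\<bar> powr (1 / \<rho>)\<close> on the nonzero
  coefficients; then \<open>power_mean_sum\<close> passes to l_2.\<close>

lemma weighted_upper2:
 fixes f :: "'i => nat => 'k::real_normed_field"
 assumes w: "!!B a w. B \<subseteq> K ==> (!!i. i \<in> B ==> 0 < w i \<and> \<bar>a i\<bar> = w i powr \<rho>) ==> Q (comb B a f) (C * (\<Sum>i\<in>B. w i) powr \<rho>)"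
  and mono: "!!x r s. Q x r ==> r \<le> s ==> Q x s" and \<rho>: "1 / 2 < \<rho>" and C: "0 \<le> C" and K: "finite K"
 shows "upper2 Q \<rho> C K f"
 unfolding upper2_def
proof (intro allI impI)
 fix B and a :: "'i => real" assume B: "B \<subseteq> K"
 define B' where "B' = {i\<in>B. a i \<noteq> 0}"
 have fin: "finite B" using B K finite_subset by blast
 have "Q (comb B' a f) (C * (\<Sum>i\<in>B'. \<bar>a i\<bar> powr (1 / \<rho>)) powr \<rho>)"
  using B \<rho> by (intro w) (auto simp: B'_def powr_powr)
 moreover have "comb B' a f = comb B a f"
  unfolding comb_def B'_def using fin by (intro ext sum.mono_neutral_left) auto
 moreover have "(\<Sum>i\<in>B'. \<bar>a i\<bar> powr (1 / \<rho>)) = (\<Sum>i\<in>B. \<bar>a i\<bar> powr (1 / \<rho>))"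
  unfolding B'_def using fin by (intro sum.mono_neutral_left) auto
 moreover have "(\<Sum>i\<in>B. \<bar>a i\<bar> powr (1 / \<rho>)) powr \<rho> \<le> real (card B) powr (\<rho> - 1 / 2) * sqrt (\<Sum>i\<in>B. \<bar>a i\<bar>\<^sup>2)"
  by (rule power_mean_sum) (use \<rho> in auto)
 ultimately show "Q (comb B a f) (C * (real (card B) powr (\<rho> - 1 / 2) * sqrt (\<Sum>i\<in>B. (a i)\<^sup>2)))"
  using C by (auto elim!: mono intro!: mult_left_mono)
qed

lemma nbound_hom: "lattice_norm N ==> x \<in> c00 ==> nbound N x r ==> 0 \<le> s ==> nbound N (%n. of_real s * x n) (s * r)"
 by (simp add: nbound_def lat_scale mult_left_mono)

lemma dbound_hom:
 assumes "dbound N g r" "0 \<le> s" shows "dbound N (%n. of_real s * g n) (s * r)"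
 unfolding dbound_def
proof
 fix x assume x: "x \<in> (c00 :: (nat => 'a) set)"
 have "norm (pairing (%n. of_real s * g n) x) = s * norm (pairing g x)"
 proof (cases "s = 0")
  case True
  thus ?thesis by (simp add: pairing_def)
 next
  case False
  hence "pairing (%n. of_real s * g n) x = of_real s * pairing g x"
   by (simp add: pairing_def sum_distrib_left mult.assoc)
  thus ?thesis using assms(2) by (simp add: norm_mult)
 qed
 also have "... \<le> s * (r * N x)" using assms x by (intro mult_left_mono) (auto simp: dbound_def)
 finally show "norm (pairing (%n. of_real s * g n) x) \<le> s * r * N x" by (simp add: mult.assoc)
qed

lemma dbound_mono:
 assumes "lattice_norm N" "dbound N g r" "r \<le> s" shows "dbound N g s"
 unfolding dbound_def
proof
 fix x assume x: "x \<in> (c00 :: (nat => 'a) set)"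
 have "norm (pairing g x) \<le> r * N x" using assms(2) x by (simp add: dbound_def)
 also have "... \<le> s * N x" using assms(1,3) lat_nonneg x by (intro mult_right_mono) auto
 finally show "norm (pairing g x) \<le> s * N x" .
qed

theorem good_norm_systems:
 fixes N :: "(nat => 'k::real_normed_field) => real"
 assumes "good_norm N"
 obtains \<sigma> C low where "1 / 2 < \<sigma>" "\<sigma> \<le> 1" "0 < C" "has_systems N \<sigma> C low"
proof -
 have N: "lattice_norm N" using assms by (simp add: good_norm_def)
 obtain \<mu> C0 where \<mu>: "0 \<le> \<mu>" "\<mu> \<le> 1" "\<mu> \<noteq> 1 / 2" and sys0: "!!k n0. \<exists>A c d. block_sets k n0 A \<and>
   (\<forall>i<k. 0 < c i \<and> 0 < d i \<and> c i * d i * real (card (A i)) = 1) \<and> ell_system N \<mu> C0 k A c d"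
  using assms unfolding good_norm_def by blast
 define C where "C = max C0 1"
 have C: "0 < C" "C0 \<le> C" by (auto simp: C_def)
 define low where "low \<longleftrightarrow> 1 / 2 < \<mu>"
 define \<sigma> where "\<sigma> = (if low then \<mu> else 1 - \<mu>)"
 have \<sigma>: "1 / 2 < \<sigma>" "\<sigma> \<le> 1" using \<mu> by (auto simp: \<sigma>_def low_def)
 have "\<exists>f g. bi_system N \<sigma> C low {..<k} n0 f g" for k n0 :: nat
 proof -
  obtain A c d where A: "block_sets k n0 A" and cd: "!!i. i < k ==> 0 < c i \<and> 0 < d i \<and> c i * d i * real (card (A i)) = 1"
   and sys: "ell_system N \<mu> C0 k A c d" using sys0[of k n0] by blast
  define f where "f i = (%n. if n \<in> A i then of_real (c i) else 0 :: 'k)" for i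
  define g where "g i = (%n. if n \<in> A i then of_real (d i) else 0 :: 'k)" for i
  have Ai: "finite (A i)" "A i \<subseteq> {n0..}" if "i < k" for i using A that unfolding block_sets_def by blast+
  have disj: "A i \<inter> A j = {}" if "i < k" "j < k" "i \<noteq> j" for i j using A that unfolding block_sets_def by blast
  have fg: "f i \<in> c00" "g i \<in> c00" if "i < k" for i
   using Ai(1)[OF that] by (auto intro!: c00_supp[of _ "A i"] simp: f_def g_def split: if_splits)
  have pair: "pairing (g i) x = of_real (d i) * (\<Sum>n\<in>A i. x n)" if "i < k" for i x
  proof -
   have "pairing (g i) x = (\<Sum>n\<in>A i. g i n * x n)"
    using Ai(1)[OF that] by (intro pairing_finite) (auto simp: g_def split: if_splits)
   also have "... = (\<Sum>n\<in>A i. of_real (d i) * x n)" by (intro sum.cong) (auto simp: g_def)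
   finally show ?thesis by (simp add: sum_distrib_left)
  qed
  have bi: "pairing (g i) (f j) = (if i = j then 1 else 0)" if "i < k" "j < k" for i j
  proof (cases "i = j")
   case True
   have "pairing (g i) (f i) = of_real (c i * d i * real (card (A i)))"
    unfolding pair[OF that(1)] by (simp add: f_def)
   thus ?thesis using cd[OF that(1)] True by (simp only: if_True of_real_1 simp_thms)
  next
   case False
   hence "f j n = 0" if "n \<in> A i" for n using disj[OF \<open>i < k\<close> \<open>j < k\<close>] that by (auto simp: f_def)
   thus ?thesis using False unfolding pair[OF that(1)] by simp
  qed
  have prim: "nbound N (comb B a f) (C * (\<Sum>i\<in>B. w i) powr \<mu>)"
   if B: "B \<subseteq> {..<k}" and w: "!!i. i \<in> B ==> 0 < w i \<and> \<bar>a i\<bar> = w i powr \<mu>" for B a w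
  proof -
   let ?x = "%n. \<Sum>i\<in>B. if n \<in> A i then of_real (w i powr \<mu> * c i) else (0::'k)"
   have "N (comb B a f) \<le> N ?x"
   proof (rule lat_mono[OF N block_sum_c00[OF A B]])
    fix n
    have e: "comb B a f n = (\<Sum>i\<in>B. if n \<in> A i then of_real (a i * c i) else 0)"
     unfolding comb_def by (intro sum.cong) (auto simp: f_def)
    show "norm (comb B a f n) \<le> norm (?x n)"
    proof (cases "n \<in> (\<Union>i\<in>B. A i)")
     case True
     then obtain i where i: "i \<in> B" "n \<in> A i" by blast
     show ?thesis unfolding e block_sum_at[OF A B i] norm_of_real using w[OF i(1)] by (simp add: abs_mult)
    next
     case False
     show ?thesis unfolding e block_sum_out[OF False] by simp
    qed
   qed
   also have "... \<le> C0 * (\<Sum>i\<in>B. w i) powr \<mu>" using sys B w unfolding ell_system_def by blast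
   also have "... \<le> C * (\<Sum>i\<in>B. w i) powr \<mu>" using C by (intro mult_right_mono) auto
   finally show ?thesis by (simp add: nbound_def)
  qed
  have dual: "dbound N (comb B a g) (C * (\<Sum>i\<in>B. w i) powr (1 - \<mu>))"
   if B: "B \<subseteq> {..<k}" and w: "!!i. i \<in> B ==> 0 < w i \<and> \<bar>a i\<bar> = w i powr (1 - \<mu>)" for B a w
   unfolding dbound_def
  proof
   fix x :: "nat => 'k" assume x: "x \<in> c00"
   have "pairing (comb B a g) x = (\<Sum>i\<in>B. of_real (a i) * pairing (g i) x)"
    unfolding comb_def using B fg by (intro pairing_sum_left) auto
   also have "norm ... \<le> (\<Sum>i\<in>B. norm (of_real (a i) * pairing (g i) x))" by (rule norm_sum)
   also have "... \<le> (\<Sum>i\<in>B. \<Sum>n\<in>A i. w i powr (1 - \<mu>) * d i * norm (x n))"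
   proof (rule sum_mono)
    fix i assume i: "i \<in> B"
    hence ik: "i < k" using B by auto
    have "norm (of_real (a i) * pairing (g i) x) = w i powr (1 - \<mu>) * d i * norm (\<Sum>n\<in>A i. x n)"
     using w[OF i] cd[OF ik] by (simp add: pair[OF ik] norm_mult)
    also have "... \<le> w i powr (1 - \<mu>) * d i * (\<Sum>n\<in>A i. norm (x n))"
     using cd[OF ik] by (intro mult_left_mono norm_sum) auto
    finally show "norm (of_real (a i) * pairing (g i) x) \<le> (\<Sum>n\<in>A i. w i powr (1 - \<mu>) * d i * norm (x n))"
     by (simp add: sum_distrib_left)
   qed
   also have "... \<le> C0 * (\<Sum>i\<in>B. w i) powr (1 - \<mu>) * N x" using sys B w x unfolding ell_system_def by blast
   also have "... \<le> C * (\<Sum>i\<in>B. w i) powr (1 - \<mu>) * N x"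
    using C lat_nonneg[OF N x] by (intro mult_right_mono) auto
   finally show "norm (pairing (comb B a g) x) \<le> C * (\<Sum>i\<in>B. w i) powr (1 - \<mu>) * N x" .
  qed
  have up: "upper2 (nbound N) \<mu> C {..<k} f" if "1 / 2 < \<mu>"
  proof (rule weighted_upper2)
   fix B and a w :: "nat => real" assume "B \<subseteq> {..<k}" "!!i. i \<in> B ==> 0 < w i \<and> \<bar>a i\<bar> = w i powr \<mu>"
   thus "nbound N (comb B a f) (C * (\<Sum>i\<in>B. w i) powr \<mu>)" by (rule prim)
  qed (use C that in \<open>simp_all add: nbound_def\<close>)
  have up': "upper2 (dbound N) (1 - \<mu>) C {..<k} g" if "\<mu> < 1 / 2"
  proof (rule weighted_upper2)
   fix B and a w :: "nat => real" assume "B \<subseteq> {..<k}" "!!i. i \<in> B ==> 0 < w i \<and> \<bar>a i\<bar> = w i powr (1 - \<mu>)"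
   thus "dbound N (comb B a g) (C * (\<Sum>i\<in>B. w i) powr (1 - \<mu>))" by (rule dual)
  next
   fix x r s assume "dbound N x r" "r \<le> s"
   thus "dbound N x s" by (rule dbound_mono[OF N])
  qed (use C that in simp_all)
  have fl': "flat (dbound N) (1 - \<mu>) C {..<k} g"
  proof (rule weighted_flat)
   fix B and a w :: "nat => real" assume "B \<subseteq> {..<k}" "!!i. i \<in> B ==> 0 < w i \<and> \<bar>a i\<bar> = w i powr (1 - \<mu>)"
   thus "dbound N (comb B a g) (C * (\<Sum>i\<in>B. w i) powr (1 - \<mu>))" by (rule dual)
  qed (rule dbound_hom)
  have fl: "flat (nbound N) \<mu> C {..<k} f"
  proof -
   have "flat (%x r. x \<in> c00 \<and> nbound N x r) \<mu> C {..<k} f"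
   proof (rule weighted_flat)
    fix B and a w :: "nat => real" assume "B \<subseteq> {..<k}" "!!i. i \<in> B ==> 0 < w i \<and> \<bar>a i\<bar> = w i powr \<mu>"
    thus "comb B a f \<in> c00 \<and> nbound N (comb B a f) (C * (\<Sum>i\<in>B. w i) powr \<mu>)"
     using fg by (intro conjI prim comb_c00) auto
   next
    fix x r and s :: real assume "x \<in> c00 \<and> nbound N x r" "0 \<le> s"
    thus "(%n. of_real s * x n) \<in> c00 \<and> nbound N (%n. of_real s * x n) (s * r)"
     using nbound_hom[OF N] by (blast intro: c00_mult)
   qed
   thus ?thesis unfolding flat_def by blast
  qed
  have "bi_system N \<sigma> C low {..<k} n0 f g"
   unfolding bi_system_def
  proof (intro conjI ballI allI impI)
   fix i n assume "i \<in> {..<k}" "f i n \<noteq> 0 \<or> g i n \<noteq> 0"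
   thus "n0 \<le> n" using Ai(2)[of i] by (auto simp: f_def g_def split: if_splits)
  qed (use fg bi up up' fl fl' \<mu> in \<open>auto simp: \<sigma>_def low_def\<close>)
  thus ?thesis by blast
 qed
 hence "has_systems N \<sigma> C low" by (simp add: has_systems_def)
 thus thesis using that \<sigma> C by blast
qed

lemma bi_system_swap:
 assumes "bi_system N \<sigma> C low K n0 f g"
  and 1: "!!x r. x \<in> c00 ==> nbound N x r ==> dbound M x r" and 2: "!!g r. g \<in> c00 ==> dbound N g r ==> nbound M g r"
 shows "bi_system M \<sigma> C (\<not> low) K n0 g f"
proof -
 have c: "f i \<in> c00" "g i \<in> c00" if "i \<in> K" for i using assms(1) that by (auto simp: bi_system_def)
 have cc: "comb B a f \<in> c00" "comb B a g \<in> c00" if "B \<subseteq> K" for B a using c that by (auto intro!: comb_c00)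
 have "pairing (f i) (g j) = (if i = j then 1 else 0)" if "i \<in> K" "j \<in> K" for i j
  using assms(1) that pairing_commute[of "f i" "g j"] c by (auto simp: bi_system_def)
 moreover have "upper2 (nbound N) \<sigma> C K f ==> upper2 (dbound M) \<sigma> C K f"
  "upper2 (dbound N) \<sigma> C K g ==> upper2 (nbound M) \<sigma> C K g"
  "flat (nbound N) (1 - \<sigma>) C K f ==> flat (dbound M) (1 - \<sigma>) C K f"
  "flat (dbound N) (1 - \<sigma>) C K g ==> flat (nbound M) (1 - \<sigma>) C K g"
  unfolding upper2_def flat_def using cc 1 2 by auto
 ultimately show ?thesis using assms(1) unfolding bi_system_def by auto
qed

text \<open>On \<open>c00\<close> the pairing is the evaluation. A vector of norm at most r thus
  acts on the dual with norm at most r, and a bound for a finitely supported functional on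
  \<open>c00\<close> is a bound on the whole space, since initial segments have no larger
  norm.\<close>

lemma (in completed) dual_systems:
 assumes no_l1: "!!\<delta> C x. 0 < \<delta> ==> \<not> l1_blocks N \<delta> C x" and sys: "has_systems N \<sigma> C low"
 defines "b \<equiv> %j x. if x \<in> vecs X then x j else 0"
 shows "has_systems (unc_basis.N (dual_space X) b) \<sigma> C (\<not> low)"
proof -
 interpret normed_fspace X by (rule normed)
 interpret D: unc_basis "dual_space X" b "%f n. f (unitv n)"
  unfolding b_def by (rule dual_basis[OF no_l1])
 have lc: "D.lc a x = pairing a x" if "x \<in> vecs X" for a x
  using that by (simp add: lin_comb_def fun_sum fscale_def pairing_def b_def)
 have lcf: "functional (D.lc a)" for a using D.lc_in[of a] by (simp add: in_dual)
 have 1: "dbound D.N x r" if x: "x \<in> c00" and "nbound N x r" for x r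
  unfolding dbound_def
 proof
  fix y :: "nat => 'k" assume y: "y \<in> c00"
  have "norm (pairing x y) = norm (D.lc y x)" using x y by (simp add: lc pairing_commute)
  also have "... \<le> D.N y * N x" using dual_bound[OF lcf, of x y] x by (simp add: D.N_def nrm_c00)
  also have "... \<le> D.N y * r"
   using \<open>nbound N x r\<close> lat_nonneg[OF D.lattice_N y] by (intro mult_left_mono) (auto simp: nbound_def)
  finally show "norm (pairing x y) \<le> r * D.N y" by (simp add: mult.commute)
 qed
 have 2: "nbound D.N g r" if g: "g \<in> c00" and d: "dbound N g r" for g r
  unfolding nbound_def D.N_def
 proof (rule dual_least[OF lcf])
  fix x assume x: "x \<in> vecs X" "nrm X x \<le> 1"
  have r0: "0 \<le> r"
  proof -
   have "norm (pairing g (unitv 0)) \<le> r * N (unitv 0)" using d by (simp add: dbound_def)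
   hence "norm (pairing g (unitv 0)) \<le> r" using N by (simp add: lattice_norm_def)
   with norm_ge_zero show ?thesis by (rule order_trans)
  qed
  obtain m where m: "!!n. g n \<noteq> 0 ==> n < m" using c00_finite[OF g] finite_nat_set_iff_bounded by auto
  have "pairing g x = pairing g (cut m x)"
   unfolding pairing_def using m by (intro sum.cong) (auto simp: restr_def)
  hence "norm (D.lc g x) = norm (pairing g (cut m x))" by (simp add: lc[OF x(1)])
  also have "... \<le> r * N (cut m x)" using d by (simp add: dbound_def)
  also have "... \<le> r * 1" using r0 cut_le[OF x(1), of m] x(2) by (intro mult_left_mono) auto
  finally show "norm (D.lc g x) \<le> r" by simp
 qed
 show ?thesis
  unfolding has_systems_def
 proof (intro allI)
  fix k n0 :: nat
  obtain f g where "bi_system N \<sigma> C low {..<k} n0 f g" using sys unfolding has_systems_def by blast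
  hence "bi_system D.N \<sigma> C (\<not> low) {..<k} n0 g f" by (rule bi_system_swap[OF _ 1 2])
  thus "\<exists>f g. bi_system D.N \<sigma> C (\<not> low) {..<k} n0 f g" by blast
 qed
qed

section \<open>Spaces with such systems are not near Hilbert\<close>

lemma upper2_single: "upper2 Q \<sigma> C K f ==> i \<in> K ==> Q (f i) C"
 using upper2D[of Q \<sigma> C K f "{i}" "%_. 1"] by (simp add: comb_def)

lemma flat_single: "flat Q \<kappa> C K f ==> i \<in> K ==> Q (f i) C"
 using flatD[of Q \<kappa> C K f "{i}" "%_. 1" 1] by (simp add: comb_def)

lemma bi_system_single:
 assumes "bi_system N \<sigma> C low K n0 f g" "i \<in> K"
 shows "nbound N (f i) C" "dbound N (g i) C"
 using assms upper2_single[of _ _ C K] flat_single[of _ _ C K] by (auto simp: bi_system_def split: if_splits)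

lemma powr_not_bounded:
 assumes "0 < \<epsilon>" shows "\<not> (\<forall>k\<ge>1. real k powr \<epsilon> \<le> M)"
proof
 assume b: "\<forall>k\<ge>1. real k powr \<epsilon> \<le> M"
 hence "1 \<le> M" by (metis le_refl of_nat_1 powr_one_eq_one)
 define k where "k = nat \<lceil>(M + 1) powr (1 / \<epsilon>)\<rceil>"
 have "(M + 1) powr (1 / \<epsilon>) \<le> k" unfolding k_def by linarith
 hence "((M + 1) powr (1 / \<epsilon>)) powr \<epsilon> \<le> real k powr \<epsilon>" using assms by (intro powr_mono2) auto
 hence "M + 1 \<le> real k powr \<epsilon>" using assms \<open>1 \<le> M\<close> by (simp add: powr_powr)
 moreover have "1 \<le> k"
 proof -
  have "1 \<le> (M + 1) powr (1 / \<epsilon>)" using assms \<open>1 \<le> M\<close> by (intro ge_one_powr_ge_zero) auto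
  thus ?thesis using \<open>(M + 1) powr (1 / \<epsilon>) \<le> k\<close> by linarith
 qed
 ultimately show False using b by force
qed

context unc_basis
begin

lemma sign_mean_lc:
 fixes f :: "nat => nat => 'k"
 assumes f: "!!i. i < k ==> f i \<in> c00" and \<epsilon>: "\<epsilon> \<in> {..<k} \<rightarrow>\<^sub>E {-1, 1}"
 shows "\<exists>a. (\<forall>i<k. \<bar>a i\<bar> = 1) \<and> nrm X (\<Sum>i<k. fscale (\<epsilon> i) (lc (f i))) = N (comb {..<k} a f)"
proof -
 define a where "a i = (if \<epsilon> i = 1 then 1 else - 1 :: real)" for i
 have \<epsilon>a: "\<epsilon> i = of_real (a i)" if "i < k" for i using \<epsilon> that by (auto simp: a_def PiE_def Pi_def)
 have lcs: "(\<Sum>i\<in>I. fscale (c i) (lc (f i))) = lc (%n. \<Sum>i\<in>I. c i * f i n)" if "!!i. i \<in> I ==> f i \<in> c00" for I and c :: "nat => 'k"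
  using that
 proof (induction I rule: infinite_finite_induct)
  case (insert i I)
  have "(%n. \<Sum>i\<in>insert i I. c i * f i n) = fscale (c i) (f i) + (%n. \<Sum>i\<in>I. c i * f i n)"
   using insert(1,2) by (auto simp: fscale_def)
  hence "lc (%n. \<Sum>i\<in>insert i I. c i * f i n) = lc (fscale (c i) (f i)) + lc (%n. \<Sum>i\<in>I. c i * f i n)"
   using insert.prems by (simp only:) (intro lin_comb_add c00_fscale c00_sum c00_mult, auto)
  also have "lc (fscale (c i) (f i)) = fscale (c i) (lc (f i))" using insert.prems by (intro lin_comb_scale) auto
  also have "lc (%n. \<Sum>i\<in>I. c i * f i n) = (\<Sum>i\<in>I. fscale (c i) (lc (f i)))" using insert by simp
  finally show ?case by (simp only: sum.insert[OF insert(1,2)])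
 qed (auto simp: lin_comb_def)
 have "nrm X (\<Sum>i<k. fscale (\<epsilon> i) (lc (f i))) = N (%n. \<Sum>i<k. \<epsilon> i * f i n)" using lcs[of "{..<k}" \<epsilon>] f by (simp add: N_def)
 also have "(%n. \<Sum>i<k. \<epsilon> i * f i n) = comb {..<k} a f" unfolding comb_def by (intro ext sum.cong) (auto simp: \<epsilon>a)
 finally show ?thesis by (intro exI[of _ a]) (simp add: a_def)
qed

lemma card_signs: "card ({..<k::nat} \<rightarrow>\<^sub>E {-1, 1 :: 'k}) = 2 ^ k"
proof -
 have "(-1 :: 'k) \<noteq> 1" by (metis neg_equal_iff_equal one_neq_neg_one)
 hence "card {-1, 1 :: 'k} = 2" by simp
 hence "(\<Prod>i<k. card {-1, 1 :: 'k}) = (\<Prod>i<k. 2)" by (simp only:)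
 thus ?thesis by (simp only: card_PiE[OF finite_lessThan] prod_constant card_lessThan)
qed

lemma sign_mean_ge:
 assumes f: "!!i. i < k ==> f i \<in> c00" and low: "!!a. (!!i. i < k ==> \<bar>a i\<bar> = 1) ==> m \<le> N (comb {..<k} a f)"
  and "0 \<le> m" "0 < s"
 shows "m \<le> sign_mean s X k (%i. lc (f i))"
proof -
 have "m powr s = (\<Sum>\<epsilon>\<in>{..<k} \<rightarrow>\<^sub>E {-1, 1 :: 'k}. m powr s) / 2 ^ k" by (simp add: card_signs)
 also have "... \<le> (\<Sum>\<epsilon>\<in>{..<k} \<rightarrow>\<^sub>E {-1, 1}. nrm X (\<Sum>i<k. fscale (\<epsilon> i) (lc (f i))) powr s) / 2 ^ k"
 proof (intro divide_right_mono sum_mono powr_mono2)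
  fix \<epsilon> :: "nat => 'k" assume "\<epsilon> \<in> {..<k} \<rightarrow>\<^sub>E {-1, 1}"
  then obtain a where a: "!!i. i < k ==> \<bar>a i\<bar> = 1" "nrm X (\<Sum>i<k. fscale (\<epsilon> i) (lc (f i))) = N (comb {..<k} a f)"
   using sign_mean_lc[of k f \<epsilon>] f by blast
  thus "m \<le> nrm X (\<Sum>i<k. fscale (\<epsilon> i) (lc (f i)))" unfolding a(2) by (intro low a)
 qed (use assms(3,4) in auto)
 finally have "(m powr s) powr (1 / s) \<le> sign_mean s X k (%i. lc (f i))"
  unfolding sign_mean_def using assms(3,4) by (intro powr_mono2) auto
 thus ?thesis using assms(3,4) by (simp add: powr_powr)
qed

lemma sign_mean_le:
 assumes f: "!!i. i < k ==> f i \<in> c00" and up: "!!a. (!!i. i < k ==> \<bar>a i\<bar> = 1) ==> N (comb {..<k} a f) \<le> m"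
  and "0 \<le> m" "0 < s"
 shows "sign_mean s X k (%i. lc (f i)) \<le> m"
proof -
 have "(\<Sum>\<epsilon>\<in>{..<k} \<rightarrow>\<^sub>E {-1, 1}. nrm X (\<Sum>i<k. fscale (\<epsilon> i) (lc (f i))) powr s) / 2 ^ k
   \<le> (\<Sum>\<epsilon>\<in>{..<k} \<rightarrow>\<^sub>E {-1, 1 :: 'k}. m powr s) / 2 ^ k"
 proof (intro divide_right_mono sum_mono powr_mono2)
  fix \<epsilon> :: "nat => 'k" assume "\<epsilon> \<in> {..<k} \<rightarrow>\<^sub>E {-1, 1}"
  then obtain a where a: "!!i. i < k ==> \<bar>a i\<bar> = 1" "nrm X (\<Sum>i<k. fscale (\<epsilon> i) (lc (f i))) = N (comb {..<k} a f)"
   using sign_mean_lc[of k f \<epsilon>] f by blast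
  thus "nrm X (\<Sum>i<k. fscale (\<epsilon> i) (lc (f i))) \<le> m" unfolding a(2) by (intro up a)
  show "0 \<le> nrm X (\<Sum>i<k. fscale (\<epsilon> i) (lc (f i)))" by (intro nonneg sum_in scale_in lc_in)
 qed (use assms(3,4) in auto)
 also have "... = m powr s" by (simp add: card_signs)
 finally have le: "(\<Sum>\<epsilon>\<in>{..<k} \<rightarrow>\<^sub>E {-1, 1}. nrm X (\<Sum>i<k. fscale (\<epsilon> i) (lc (f i))) powr s) / 2 ^ k \<le> m powr s" .
 have "sign_mean s X k (%i. lc (f i)) \<le> (m powr s) powr (1 / s)"
  unfolding sign_mean_def by (rule powr_mono2[OF _ _ le]) (use assms(4) in \<open>simp_all add: sum_nonneg\<close>)
 thus ?thesis using assms(3,4) by (simp add: powr_powr)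
qed

text \<open>Pairing with the combination of the functionals under the same signs gives exactly k,
  and that functional has norm at most C k^\<kappa>.\<close>

lemma bi_system_lower:
 assumes sys: "bi_system N \<sigma> C low {..<k} n0 f g" and fl: "flat (dbound N) \<kappa> C {..<k} g" and a: "!!i. i < k ==> \<bar>a i\<bar> = 1"
  and C: "0 < C" and k: "1 \<le> k"
 shows "real k powr (1 - \<kappa>) / C \<le> N (comb {..<k} a f)"
proof -
 have c: "f i \<in> c00" "g i \<in> c00" if "i < k" for i using sys that by (auto simp: bi_system_def)
 have fc: "comb {..<k} a f \<in> c00" using c by (intro comb_c00) auto
 have "pairing (comb {..<k} a g) (comb {..<k} a f) = (\<Sum>i<k. of_real (a i) * (\<Sum>j<k. of_real (a j) * pairing (g i) (f j)))"
  unfolding comb_def using c by (subst pairing_sum_left) (auto simp: pairing_sum_right)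
 also have "... = (\<Sum>i<k. of_real (a i) * (\<Sum>j<k. if j = i then of_real (a i) else 0))"
  using sys by (intro sum.cong refl arg_cong2[of _ _ _ _ "(*)"]) (auto simp: bi_system_def)
 also have "... = (\<Sum>i<k. 1)"
 proof (rule sum.cong[OF refl])
  fix i assume i: "i \<in> {..<k}"
  have "(\<Sum>j<k. if j = i then of_real (a i) else (0::'k)) = of_real (a i)" using i by simp
  moreover have "a i * a i = 1" using a[of i] i abs_mult_self_eq[of "a i"] by simp
  ultimately show "of_real (a i) * (\<Sum>j<k. if j = i then of_real (a i) else 0) = (1::'k)"
   by (simp only: of_real_mult[symmetric] of_real_1)
 qed
 finally have "norm (pairing (comb {..<k} a g) (comb {..<k} a f)) = k" by simp
 moreover have "dbound N (comb {..<k} a g) (C * (1 * real (card {..<k}) powr \<kappa>))"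
  by (rule flatD[OF fl]) (use a in auto)
 ultimately have "k \<le> C * real k powr \<kappa> * N (comb {..<k} a f)" using fc unfolding dbound_def by force
 moreover have "real k = real k powr \<kappa> * real k powr (1 - \<kappa>)" using k by (simp add: powr_add[symmetric])
 ultimately have "real k powr \<kappa> * real k powr (1 - \<kappa>) \<le> real k powr \<kappa> * (C * N (comb {..<k} a f))" by (simp add: mult_ac)
 hence "real k powr (1 - \<kappa>) \<le> C * N (comb {..<k} a f)" using k by simp
 thus ?thesis using C by (simp add: divide_le_eq mult.commute)
qed

text \<open>With \<open>low\<close>, a type s > 1/\<sigma> would bound k^\<sigma> by a multiple of
  k^(1/s). Otherwise a cotype s with 1/s > 1 - \<sigma> would bound k^(1/s) by a multiple of
  k^(1-\<sigma>).\<close>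

theorem not_near_hilbert:
 assumes sys: "has_systems N \<sigma> C low" and \<sigma>: "1 / 2 < \<sigma>" "\<sigma> \<le> 1" and C: "0 < C"
 shows "\<not> near_hilbert X"
proof
 assume nh: "near_hilbert X"
 show False
 proof (cases low)
  case True
  have "ereal (1 / \<sigma>) < type_index X" using nh \<sigma> by (auto simp: near_hilbert_def field_simps)
  then obtain s where s: "has_type X s" "1 / \<sigma> < s" unfolding type_index_def less_Sup_iff by auto
  then obtain C' where C': "!!n x. (!!i. i < n ==> x i \<in> vecs X) ==> sign_mean s X n x \<le> C' * (\<Sum>i<n. nrm X (x i) powr s) powr (1 / s)"
   and s1: "1 \<le> s" unfolding has_type_def by blast
  have "real k powr (\<sigma> - 1 / s) \<le> \<bar>C'\<bar> * C * C" if k: "1 \<le> k" for k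
  proof -
   obtain f g where fg: "bi_system N \<sigma> C low {..<k} 0 f g" using sys unfolding has_systems_def by blast
   have c: "f i \<in> c00" if "i < k" for i using fg that by (auto simp: bi_system_def)
   have fl: "flat (dbound N) (1 - \<sigma>) C {..<k} g" using fg True by (simp add: bi_system_def)
   have "real k powr (1 - (1 - \<sigma>)) / C \<le> sign_mean s X k (%i. lc (f i))"
    using C s1 by (intro sign_mean_ge[OF c] bi_system_lower[OF fg fl _ C k]) auto
   also have "... \<le> C' * (\<Sum>i<k. nrm X (lc (f i)) powr s) powr (1 / s)" by (rule C') simp
   also have "... \<le> \<bar>C'\<bar> * (\<Sum>i<k. C powr s) powr (1 / s)"
   proof (intro mult_mono powr_mono2 sum_mono)
    fix i assume "i \<in> {..<k}"
    thus "nrm X (lc (f i)) \<le> C" using bi_system_single(1)[OF fg] by (simp add: nbound_def N_def)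
   qed (use s1 in \<open>auto intro!: sum_nonneg\<close>)
   also have "(\<Sum>i<k. C powr s) powr (1 / s) = real k powr (1 / s) * C" using C s1 by (simp add: powr_mult powr_powr)
   finally have "real k powr \<sigma> \<le> \<bar>C'\<bar> * C * C * real k powr (1 / s)" using C by (simp add: divide_le_eq mult_ac)
   thus ?thesis using k by (simp add: powr_diff divide_le_eq)
  qed
  moreover have "0 < \<sigma> - 1 / s" using s(2) s1 \<sigma> by (simp add: field_simps)
  ultimately show False using powr_not_bounded by blast
 next
  case False
  obtain s where s: "has_cotype X s" "1 - \<sigma> < 1 / s"
  \<comment> \<open>For \<sigma> = 1 there is no conjugate exponent 1/(1 - \<sigma>) to compare
    with, but every finite cotype will do.\<close>
  proof (cases "\<sigma> = 1")
   case True
   have "cotype_index X < \<infinity>" using nh by (auto simp: near_hilbert_def)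
   then obtain s where "has_cotype X s" unfolding cotype_index_def Inf_less_iff by auto
   thus thesis using that True by (auto simp: has_cotype_def)
  next
   case False
   have "cotype_index X < ereal (1 / (1 - \<sigma>))" using nh \<sigma> False by (auto simp: near_hilbert_def field_simps)
   then obtain s where "has_cotype X s" "s < 1 / (1 - \<sigma>)" unfolding cotype_index_def Inf_less_iff by auto
   thus thesis using that[of s] False \<sigma> by (auto simp: has_cotype_def field_simps)
  qed
  then obtain C' where C': "!!n x. (!!i. i < n ==> x i \<in> vecs X) ==> (\<Sum>i<n. nrm X (x i) powr s) powr (1 / s) \<le> C' * sign_mean s X n x"
   and s2: "2 \<le> s" unfolding has_cotype_def by blast
  have "real k powr (1 / s - (1 - \<sigma>)) \<le> \<bar>C'\<bar> * C * C" if k: "1 \<le> k" for k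
  proof -
   obtain f g where fg: "bi_system N \<sigma> C low {..<k} 0 f g" using sys unfolding has_systems_def by blast
   have c: "f i \<in> c00" if "i < k" for i using fg that by (auto simp: bi_system_def)
   have fl: "flat (nbound N) (1 - \<sigma>) C {..<k} f" using fg False by (simp add: bi_system_def)
   have "real k powr (1 / s) * (1 / C) = (\<Sum>i<k. (1 / C) powr s) powr (1 / s)" using C s2 by (simp add: powr_mult powr_powr)
   also have "... \<le> (\<Sum>i<k. nrm X (lc (f i)) powr s) powr (1 / s)"
   proof (intro powr_mono2 sum_mono)
    fix i assume i: "i \<in> {..<k}"
    have "norm (pairing (g i) (f i)) \<le> C * N (f i)" using bi_system_single(2)[OF fg i] c i by (simp add: dbound_def)
    thus "1 / C \<le> nrm X (lc (f i))" using fg i C by (simp add: bi_system_def N_def divide_le_eq mult.commute)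
   qed (use s2 C in \<open>auto intro!: sum_nonneg\<close>)
   also have "... \<le> C' * sign_mean s X k (%i. lc (f i))" by (rule C') simp
   also have "... \<le> \<bar>C'\<bar> * (C * real k powr (1 - \<sigma>))"
   proof (intro mult_mono)
    show "sign_mean s X k (%i. lc (f i)) \<le> C * real k powr (1 - \<sigma>)"
    proof (rule sign_mean_le[OF c])
     fix a assume "!!i. i < k ==> \<bar>a i\<bar> = (1::real)"
     thus "N (comb {..<k} a f) \<le> C * real k powr (1 - \<sigma>)"
      using flatD[OF fl order_refl, of a 1] by (simp add: nbound_def)
    qed (use C s2 in auto)
    show "0 \<le> sign_mean s X k (%i. lc (f i))" by (simp add: sign_mean_def)
   qed auto
   finally have "real k powr (1 / s) \<le> \<bar>C'\<bar> * C * C * real k powr (1 - \<sigma>)" using C by (simp add: divide_le_eq mult_ac)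
   thus ?thesis using k unfolding powr_diff[of "real k" "1 / s" "1 - \<sigma>"] by (simp add: divide_le_eq)
  qed
  moreover have "0 < 1 / s - (1 - \<sigma>)" using s(2) by simp
  ultimately show False using powr_not_bounded by blast
 qed
qed

end

section \<open>Reductions of \<open>E\<^sub>0\<close> to meager relations\<close>

definition agree :: "nat set => (nat => bool) => (nat => bool) => bool"
 where "agree I x y \<longleftrightarrow> (\<forall>i\<in>I. x i = y i)"

abbreviation nowhere_dense :: "((nat => bool) => (nat => bool) => bool) => bool"
 where "nowhere_dense P \<equiv> \<forall>s t m. \<exists>s' t' m'. m \<le> m' \<and> agree {..<m} s' s \<and> agree {..<m} t' t \<and>
  (\<forall>\<xi> \<eta>. agree {..<m'} \<xi> s' --> agree {..<m'} \<eta> t' --> \<not> P \<xi> \<eta>)"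

text \<open>Sequences that are false from p on stand for the prefixes of length p.\<close>

lemma finite_prefixes: "finite {u :: nat => bool. \<forall>i\<ge>p. \<not> u i}"
proof -
 have "{u :: nat => bool. \<forall>i\<ge>p. \<not> u i} \<subseteq> (%S i. i \<in> S) ` Pow {..<p}"
 proof
  fix u :: "nat => bool" assume "u \<in> {u. \<forall>i\<ge>p. \<not> u i}"
  hence "{i. u i} \<in> Pow {..<p}" by (auto simp: not_le[symmetric])
  moreover have "u = (%S i. i \<in> S) {i. u i}" by simp
  ultimately show "u \<in> (%S i. i \<in> S) ` Pow {..<p}" by blast
 qed
 thus ?thesis by (rule finite_subset) simp
qed

text \<open>The tasks are settled one after another, and each time the same two patterns are
  prolonged; a prolongation keeps what is already settled. Each task is settled for both orders of
  the pair.\<close>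

lemma meager_tasks:
 fixes M :: "nat => (nat => bool) => (nat => bool) => bool"
 assumes nd: "!!k. nowhere_dense (M k)"
  and "finite T"
 shows "\<exists>p' a0 a1. p < p' \<and> (\<forall>u v k \<xi> \<eta>. (u, v, k) \<in> T --> agree {..<p} \<xi> u --> agree {p..<p'} \<xi> a0 -->
   agree {..<p} \<eta> v --> agree {p..<p'} \<eta> a1 --> \<not> M k \<xi> \<eta> \<and> \<not> M k \<eta> \<xi>)"
 using assms(2)
proof (induction T)
 case empty
 show ?case by (intro exI[of _ "Suc p"]) auto
next
 case (insert w T)
 obtain u v k where w: "w = (u, v, k)" by (cases w)
 obtain p0 a0 a1 where p0: "p < p0" and IH: "!!u v k \<xi> \<eta>. (u, v, k) \<in> T ==> agree {..<p} \<xi> u ==> agree {p..<p0} \<xi> a0 ==>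
   agree {..<p} \<eta> v ==> agree {p..<p0} \<eta> a1 ==> \<not> M k \<xi> \<eta> \<and> \<not> M k \<eta> \<xi>"
  using insert.IH by metis
 define s where "s i = (if i < p then u i else a0 i)" for i
 define t where "t i = (if i < p then v i else a1 i)" for i
 obtain s1 t1 p1 where 1: "p0 \<le> p1" "agree {..<p0} s1 s" "agree {..<p0} t1 t"
  "!!\<xi> \<eta>. agree {..<p1} \<xi> s1 ==> agree {..<p1} \<eta> t1 ==> \<not> M k \<xi> \<eta>" using nd[rule_format, of p0 s t k] by blast
 obtain t2 s2 p2 where 2: "p1 \<le> p2" "agree {..<p1} t2 t1" "agree {..<p1} s2 s1"
  "!!\<xi> \<eta>. agree {..<p2} \<eta> t2 ==> agree {..<p2} \<xi> s2 ==> \<not> M k \<eta> \<xi>" using nd[rule_format, of p1 t1 s1 k] by blast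
 have old: "agree {p..<p0} \<xi> a0" if "agree {p..<p2} \<xi> s2" for \<xi>
  using that 1 2 unfolding agree_def s_def by auto
 have old': "agree {p..<p0} \<xi> a1" if "agree {p..<p2} \<xi> t2" for \<xi>
  using that 1 2 unfolding agree_def t_def by auto
 have new: "\<not> M k \<xi> \<eta> \<and> \<not> M k \<eta> \<xi>" if "agree {..<p} \<xi> u" "agree {p..<p2} \<xi> s2" "agree {..<p} \<eta> v" "agree {p..<p2} \<eta> t2" for \<xi> \<eta>
 proof -
  have "\<xi> i = s2 i" "\<eta> i = t2 i" if "i < p2" for i
  proof -
   have "s2 i = u i \<and> t2 i = v i" if "i < p" using that 1(1-3) 2(1-3) p0 unfolding agree_def s_def t_def by auto
   thus "\<xi> i = s2 i" "\<eta> i = t2 i" using that \<open>i < p2\<close> \<open>agree {..<p} \<xi> u\<close> \<open>agree {p..<p2} \<xi> s2\<close> \<open>agree {..<p} \<eta> v\<close> \<open>agree {p..<p2} \<eta> t2\<close>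
    unfolding agree_def by (cases "i < p"; simp)+
  qed
  hence ab: "agree {..<p2} \<xi> s2" "agree {..<p2} \<eta> t2" by (auto simp: agree_def)
  hence "agree {..<p1} \<xi> s1" "agree {..<p1} \<eta> t1" using 2(1-3) by (auto simp: agree_def)
  thus ?thesis using 1(4) 2(4) ab by blast
 qed
 have all: "\<not> M k' \<xi> \<eta> \<and> \<not> M k' \<eta> \<xi>" if "(u', v', k') \<in> insert w T" "agree {..<p} \<xi> u'" "agree {p..<p2} \<xi> s2" "agree {..<p} \<eta> v'" "agree {p..<p2} \<eta> t2" for u' v' k' \<xi> \<eta>
 proof (cases "(u', v', k') \<in> T")
  case True
  thus ?thesis using IH old old' that by blast
 next
  case False
  thus ?thesis using that w new by simp
 qed
 have "p < p2" using p0 1(1) 2(1) by simp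
 thus ?case by (intro exI[of _ p2] exI[of _ s2] exI[of _ t2] conjI allI impI) (use all in auto)
qed

lemma meager_step:
 fixes M :: "nat => (nat => bool) => (nat => bool) => bool"
 assumes nd: "!!k. nowhere_dense (M k)"
 shows "\<exists>p' a0 a1. p < p' \<and> (\<forall>k\<le>n. \<forall>\<xi> \<eta>. agree {p..<p'} \<xi> a0 --> agree {p..<p'} \<eta> a1 --> \<not> M k \<xi> \<eta> \<and> \<not> M k \<eta> \<xi>)"
proof -
 let ?W = "{u :: nat => bool. \<forall>i\<ge>p. \<not> u i}"
 have "finite (?W \<times> ?W \<times> {..n})" using finite_prefixes by simp
 from meager_tasks[of M, OF nd this, of p] obtain p' a0 a1 where H: "p < p' \<and> (\<forall>u v k \<xi> \<eta>. (u, v, k) \<in> ?W \<times> ?W \<times> {..n} -->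
   agree {..<p} \<xi> u --> agree {p..<p'} \<xi> a0 --> agree {..<p} \<eta> v --> agree {p..<p'} \<eta> a1 --> \<not> M k \<xi> \<eta> \<and> \<not> M k \<eta> \<xi>)"
  by (elim exE)
 note p' = H[THEN conjunct1] and M = H[THEN conjunct2, rule_format]
 have "\<not> M k \<xi> \<eta> \<and> \<not> M k \<eta> \<xi>" if "k \<le> n" "agree {p..<p'} \<xi> a0" "agree {p..<p'} \<eta> a1" for k \<xi> \<eta>
  by (rule M[of "%i. i < p \<and> \<xi> i" "%i. i < p \<and> \<eta> i"]) (use that in \<open>auto simp: agree_def\<close>)
 thus ?thesis using p' by (intro exI[of _ p'] exI[of _ a0] exI[of _ a1]) simp
qed

text \<open>Map x to the concatenation over n of the pattern that stage n provides for the value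
  \<open>x n\<close>. If x and y differ at n, the images avoid \<open>M k\<close> for all k \<le> n;
  if they agree from some point on, so do the images. Coordinate i of the image depends only on
  \<open>x (h i)\<close>, which makes the map continuous.\<close>

theorem E0_reduces_to_meager:
 fixes R :: "(nat => bool) => (nat => bool) => bool" and M :: "nat => (nat => bool) => (nat => bool) => bool"
 assumes E0: "!!\<xi> \<eta>. E0 \<xi> \<eta> ==> R \<xi> \<eta>" and cover: "!!\<xi> \<eta>. R \<xi> \<eta> ==> \<exists>k. M k \<xi> \<eta>"
  and nd: "!!k. nowhere_dense (M k)"
 shows "\<exists>h :: nat => nat. \<exists>A. \<forall>x y. E0 x y \<longleftrightarrow> R (%i. A i (x (h i))) (%i. A i (y (h i)))"
proof -
 have "\<exists>P B. \<forall>p n. p < P p n \<and> (\<forall>k\<le>n. \<forall>\<xi> \<eta>. agree {p..<P p n} \<xi> (B p n False) -->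
   agree {p..<P p n} \<eta> (B p n True) --> \<not> M k \<xi> \<eta> \<and> \<not> M k \<eta> \<xi>)"
 proof -
  have "\<exists>p' (B :: bool => nat => bool). p < p' \<and> (\<forall>k\<le>n. \<forall>\<xi> \<eta>. agree {p..<p'} \<xi> (B False) --> agree {p..<p'} \<eta> (B True) --> \<not> M k \<xi> \<eta> \<and> \<not> M k \<eta> \<xi>)" for p n
  proof -
   from meager_step[of M, OF nd, of p n] obtain p' a0 a1
    where "p < p' \<and> (\<forall>k\<le>n. \<forall>\<xi> \<eta>. agree {p..<p'} \<xi> a0 --> agree {p..<p'} \<eta> a1 --> \<not> M k \<xi> \<eta> \<and> \<not> M k \<eta> \<xi>)"
    by (elim exE)
   thus ?thesis by (intro exI[of _ p'] exI[of _ "%b. if b then a1 else a0"]) simp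
  qed
  hence "\<forall>p n. \<exists>p' (B :: bool => nat => bool). p < p' \<and> (\<forall>k\<le>n. \<forall>\<xi> \<eta>. agree {p..<p'} \<xi> (B False) --> agree {p..<p'} \<eta> (B True) --> \<not> M k \<xi> \<eta> \<and> \<not> M k \<eta> \<xi>)"
   by (intro allI)
  thus ?thesis by (simp only: choice_iff)
 qed
 then obtain P B where H: "\<forall>p n. p < P p n \<and> (\<forall>k\<le>n. \<forall>\<xi> \<eta>. agree {p..<P p n} \<xi> (B p n False) -->
   agree {p..<P p n} \<eta> (B p n True) --> \<not> M k \<xi> \<eta> \<and> \<not> M k \<eta> \<xi>)" by (elim exE)
 have P: "p < P p n" for p n using H by simp
 note M = H[rule_format, THEN conjunct2, rule_format]
 define q where "q = rec_nat 0 (%n p. P p n)"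
 have q: "q 0 = 0" "q (Suc n) = P (q n) n" for n by (simp_all add: q_def)
 have qm: "strict_mono q" by (rule strict_mono_Suc_iff[THEN iffD2]) (simp add: q P)
 define h where "h i = (LEAST n. i < q (Suc n))" for i
 have hi: "i < q (Suc (h i))" for i
  unfolding h_def by (rule LeastI[of _ i]) (use strict_mono_imp_increasing[OF qm, of "Suc i"] in simp)
 have h: "h i = n" if "q n \<le> i" "i < q (Suc n)" for i n
 proof -
  have "h i \<le> n" unfolding h_def by (rule Least_le) (rule that)
  moreover have "\<not> h i < n" using hi[of i] that(1) strict_mono_leD[OF qm, of "Suc (h i)" n] by auto
  ultimately show ?thesis by simp
 qed
 define A where "A i b = B (q (h i)) (h i) b i" for i b
 have "E0 x y \<longleftrightarrow> R (%i. A i (x (h i))) (%i. A i (y (h i)))" (is "_ \<longleftrightarrow> R (?f x) (?f y)") for x y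
 proof
  assume "E0 x y"
  then obtain n where n: "!!k. n \<le> k ==> x k = y k" by (auto simp: E0_def)
  have "n \<le> h i" if "q n \<le> i" for i
  proof (rule ccontr)
   assume "\<not> n \<le> h i"
   thus False using hi[of i] that strict_mono_leD[OF qm, of "Suc (h i)" n] by auto
  qed
  hence "E0 (?f x) (?f y)" unfolding E0_def by (intro exI[of _ "q n"]) (simp add: n)
  thus "R (?f x) (?f y)" by (rule E0)
 next
  assume "R (?f x) (?f y)"
  then obtain k where k: "M k (?f x) (?f y)" using cover by blast
  have "x n = y n" if "k \<le> n" for n
  proof (rule ccontr)
   assume ne: "x n \<noteq> y n"
   have ag: "agree {q n..<P (q n) n} (?f z) (B (q n) n (z n))" for z
    using h[of n] by (auto simp: agree_def A_def q(2))
   show False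
   proof (cases "x n")
    case True
    thus False using M[OF that, of "q n" "?f y" "?f x"] ag[of x] ag[of y] ne k by simp
   next
    case False
    thus False using M[OF that, of "q n" "?f x" "?f y"] ag[of x] ag[of y] ne k by simp
   qed
  qed
  thus "E0 x y" by (auto simp: E0_def)
 qed
 thus ?thesis by blast
qed

section \<open>Rademacher averages of finite systems\<close>

abbreviation signs :: "'i set => ('i => real) set"
 where "signs J \<equiv> J \<rightarrow>\<^sub>E {-1, 1}"

lemma finite_signs: "finite J ==> finite (signs J)"
 by (intro finite_PiE) auto

lemma card_signs_pos: "finite J ==> 0 < real (card (signs J))"
proof -
 assume "finite J"
 moreover have "signs J \<noteq> {}" by (simp add: PiE_eq_empty_iff)
 ultimately show ?thesis using finite_signs[of J] by (simp add: card_gt_0_iff)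
qed

lemma sign_cases: "\<omega> \<in> signs J ==> j \<in> J ==> \<omega> j = -1 \<or> \<omega> j = 1"
 by (auto dest: PiE_mem)

lemma signs_orthogonal:
 assumes "finite J" "i \<in> J" "j \<in> J"
 shows "(\<Sum>\<omega>\<in>signs J. \<omega> i * \<omega> j) = (if i = j then real (card (signs J)) else 0)"
proof (cases "i = j")
 case True
 have "(\<Sum>\<omega>\<in>signs J. \<omega> i * \<omega> j) = (\<Sum>\<omega>\<in>signs J. 1)"
  by (rule sum.cong[OF refl]) (use sign_cases assms True in fastforce)
 thus ?thesis using True by simp
next
 case False
 define f where "f = (%\<omega> :: 'a => real. fun_upd \<omega> i (- \<omega> i))"
 have f: "f \<omega> \<in> signs J" if "\<omega> \<in> signs J" for \<omega>
  using that assms(2) sign_cases[OF that assms(2)] by (auto simp: f_def PiE_iff extensional_def)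
 have "(\<Sum>\<omega>\<in>signs J. \<omega> i * \<omega> j) = (\<Sum>\<omega>\<in>signs J. - (\<omega> i * \<omega> j))"
  by (rule sum.reindex_bij_witness[where i = f and j = f]) (use f False in \<open>auto simp: f_def\<close>)
 thus ?thesis using False by (simp add: sum_negf)
qed

lemma signs_square:
 assumes "finite J" "B \<subseteq> J"
 shows "(\<Sum>\<omega>\<in>signs J. (\<Sum>j\<in>B. a j * \<omega> j)\<^sup>2) = real (card (signs J)) * (\<Sum>j\<in>B. (a j)\<^sup>2)"
proof -
 have B: "finite B" using assms finite_subset by blast
 have "(\<Sum>\<omega>\<in>signs J. (\<Sum>j\<in>B. a j * \<omega> j)\<^sup>2) = (\<Sum>\<omega>\<in>signs J. \<Sum>i\<in>B. \<Sum>j\<in>B. a i * a j * (\<omega> i * \<omega> j))"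
  by (simp add: power2_eq_square sum_product mult_ac)
 also have "... = (\<Sum>i\<in>B. \<Sum>\<omega>\<in>signs J. \<Sum>j\<in>B. a i * a j * (\<omega> i * \<omega> j))" by (rule sum.swap)
 also have "... = (\<Sum>i\<in>B. \<Sum>j\<in>B. a i * a j * (\<Sum>\<omega>\<in>signs J. \<omega> i * \<omega> j))"
  unfolding sum_distrib_left by (rule sum.cong[OF refl]) (rule sum.swap)
 also have "... = (\<Sum>i\<in>B. \<Sum>j\<in>B. if j = i then a i * a i * real (card (signs J)) else 0)"
 proof (intro sum.cong refl)
  fix i j assume "i \<in> B" "j \<in> B"
  hence "(\<Sum>\<omega>\<in>signs J. \<omega> i * \<omega> j) = (if i = j then real (card (signs J)) else 0)"
   using assms by (intro signs_orthogonal) auto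
  thus "a i * a j * (\<Sum>\<omega>\<in>signs J. \<omega> i * \<omega> j) = (if j = i then a i * a i * real (card (signs J)) else 0)" by auto
 qed
 also have "... = (\<Sum>i\<in>B. a i * a i * real (card (signs J)))"
  by (rule sum.cong[OF refl]) (simp add: B)
 also have "... = (\<Sum>i\<in>B. a i * a i) * real (card (signs J))" by (simp only: sum_distrib_right)
 finally show ?thesis by (simp only: power2_eq_square mult.commute)
qed

text \<open>Some choice of signs realises at least the average over all signs.\<close>

lemma diagonal_le_signs:
 fixes t :: "'i => 'i => 'k::real_normed_field"
 assumes "finite A" and b: "!!\<omega>. \<omega> \<in> signs A ==> norm (\<Sum>i\<in>A. \<Sum>j\<in>A. of_real (\<omega> i * \<omega> j) * t i j) \<le> m"
 shows "norm (\<Sum>i\<in>A. t i i) \<le> m"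
proof -
 let ?c = "real (card (signs A))"
 have c: "0 < ?c" by (rule card_signs_pos[OF assms(1)])
 have "(\<Sum>\<omega>\<in>signs A. \<Sum>i\<in>A. \<Sum>j\<in>A. of_real (\<omega> i * \<omega> j) * t i j)
   = (\<Sum>i\<in>A. \<Sum>\<omega>\<in>signs A. \<Sum>j\<in>A. of_real (\<omega> i * \<omega> j) * t i j)" by (rule sum.swap)
 also have "... = (\<Sum>i\<in>A. \<Sum>j\<in>A. \<Sum>\<omega>\<in>signs A. of_real (\<omega> i * \<omega> j) * t i j)"
  by (rule sum.cong[OF refl]) (rule sum.swap)
 also have "... = (\<Sum>i\<in>A. \<Sum>j\<in>A. of_real (\<Sum>\<omega>\<in>signs A. \<omega> i * \<omega> j) * t i j)"
  by (simp only: of_real_sum sum_distrib_right)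
 also have "... = (\<Sum>i\<in>A. \<Sum>j\<in>A. if j = i then of_real ?c * t i i else 0)"
  by (intro sum.cong refl) (simp add: signs_orthogonal[OF assms(1)])
 also have "... = (\<Sum>i\<in>A. of_real ?c * t i i)"
  by (rule sum.cong[OF refl]) (simp add: assms(1))
 also have "... = of_real ?c * (\<Sum>i\<in>A. t i i)" by (simp only: sum_distrib_left)
 finally have "?c * norm (\<Sum>i\<in>A. t i i) = norm (\<Sum>\<omega>\<in>signs A. \<Sum>i\<in>A. \<Sum>j\<in>A. of_real (\<omega> i * \<omega> j) * t i j)"
  by (simp add: norm_mult)
 also have "... \<le> (\<Sum>\<omega>\<in>signs A. m)" by (intro sum_norm_le b)
 also have "... = ?c * m" by simp
 finally show ?thesis using c by simp
qed

lemma comb_reindex: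
 assumes "inj_on h B" shows "comb B a (%i. f (h i)) = comb (h ` B) (%k. a (inv_into B h k)) f"
 unfolding comb_def by (intro ext) (simp add: sum.reindex[OF assms] inv_into_f_f[OF assms])

lemma upper2_reindex:
 assumes u: "upper2 Q \<sigma> C K f" and h: "inj_on h L" "h ` L \<subseteq> K"
 shows "upper2 Q \<sigma> C L (%i. f (h i))"
 unfolding upper2_def
proof (intro allI impI)
 fix B and a :: "_ => real" assume B: "B \<subseteq> L"
 hence i: "inj_on h B" using h(1) by (rule inj_on_subset[rotated])
 have "Q (comb (h ` B) (%k. a (inv_into B h k)) f)
  (C * (real (card (h ` B)) powr (\<sigma> - 1 / 2) * sqrt (\<Sum>k\<in>h ` B. (a (inv_into B h k))\<^sup>2)))"
  using B h(2) by (intro upper2D[OF u]) auto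
 thus "Q (comb B a (%i. f (h i))) (C * (real (card B) powr (\<sigma> - 1 / 2) * sqrt (\<Sum>i\<in>B. (a i)\<^sup>2)))"
  by (simp add: comb_reindex[OF i] card_image[OF i] sum.reindex[OF i] inv_into_f_f[OF i])
qed

lemma flat_reindex:
 assumes u: "flat Q \<kappa> C K f" and h: "inj_on h L" "h ` L \<subseteq> K"
 shows "flat Q \<kappa> C L (%i. f (h i))"
 unfolding flat_def
proof (intro allI impI)
 fix B and a :: "_ => real" and s assume B: "B \<subseteq> L" and s: "\<forall>i\<in>B. \<bar>a i\<bar> = s"
 have i: "inj_on h B" using h(1) B by (rule inj_on_subset)
 have "Q (comb (h ` B) (%k. a (inv_into B h k)) f) (C * (s * real (card (h ` B)) powr \<kappa>))"
  using B h(2) s i by (intro flatD[OF u]) (auto simp: inv_into_f_f[OF i])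
 thus "Q (comb B a (%i. f (h i))) (C * (s * real (card B) powr \<kappa>))"
  by (simp add: comb_reindex[OF i] card_image[OF i])
qed

lemma bi_system_exists:
 assumes sys: "has_systems N \<sigma> C low" and K: "finite K"
 obtains f g where "bi_system N \<sigma> C low K n0 f g"
proof -
 obtain h where h: "bij_betw h K {..<card K}" using K by (metis ex_bij_betw_finite_nat atLeast0LessThan)
 obtain f g where fg: "bi_system N \<sigma> C low {..<card K} n0 f g" using sys unfolding has_systems_def by blast
 have i: "inj_on h K" "h ` K \<subseteq> {..<card K}" using h by (auto simp: bij_betw_def)
 have hk: "h k \<in> {..<card K}" if "k \<in> K" for k using i(2) that by blast
 have "bi_system N \<sigma> C low K n0 (%k. f (h k)) (%k. g (h k))"
  unfolding bi_system_def
 proof (intro conjI ballI allI impI)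
  fix k k' assume "k \<in> K" "k' \<in> K"
  hence "h k = h k' \<longleftrightarrow> k = k'" using i(1) by (auto dest: inj_onD)
  thus "pairing (g (h k)) (f (h k')) = (if k = k' then 1 else 0)"
   using fg hk[OF \<open>k \<in> K\<close>] hk[OF \<open>k' \<in> K\<close>] by (simp add: bi_system_def)
 next
  show "if low then upper2 (nbound N) \<sigma> C K (%k. f (h k)) \<and> flat (dbound N) (1 - \<sigma>) C K (%k. g (h k))
   else flat (nbound N) (1 - \<sigma>) C K (%k. f (h k)) \<and> upper2 (dbound N) \<sigma> C K (%k. g (h k))"
   using fg by (auto simp: bi_system_def intro: upper2_reindex[OF _ i] flat_reindex[OF _ i] split: if_splits)
 qed (use fg hk in \<open>auto simp: bi_system_def\<close>)
 thus thesis by (rule that)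
qed

text \<open>The resulting vectors behave like an \<open>\<ell>\<^sub>2\<close>-basis within a class of equal keys and like the original
 system on strings with distinct keys.\<close>

definition rademacher :: "real => 'i set => ('i => 'c) => ('c \<times> ('i => real) => nat => 'k::real_normed_field) => 'i => nat => 'k"
 where "rademacher \<tau> J key F j = (%n. of_real (real (card (signs J)) powr - \<tau>) * (\<Sum>\<omega>\<in>signs J. of_real (\<omega> j) * F (key j, \<omega>) n))"

lemma rademacher_c00: "(!!\<omega>. \<omega> \<in> signs J ==> F (key j, \<omega>) \<in> c00) ==> rademacher \<tau> J key F j \<in> c00"
 unfolding rademacher_def by (intro c00_sum c00_mult)

lemma rademacher_supp: "rademacher \<tau> J key F j n \<noteq> 0 ==> \<exists>\<omega>\<in>signs J. F (key j, \<omega>) n \<noteq> 0"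
 unfolding rademacher_def by (rule ccontr) simp

text \<open>With distinct keys no vector of the system occurs twice. The combination then has
  coefficients of constant modulus, and the normalisation cancels the number of sign
  patterns.\<close>

lemma rademacher_inj:
 fixes key :: "'i => 'c" and F :: "'c \<times> ('i => real) => nat => 'k::real_normed_field"
 assumes fl: "flat Q \<tau> C (key ` J \<times> signs J) F" and J: "finite J" and B: "B \<subseteq> J" "inj_on key B"
  and a: "!!j. j \<in> B ==> \<bar>a j\<bar> = 1"
 shows "Q (comb B a (rademacher \<tau> J key F)) (C * real (card B) powr \<tau>)"
proof -
 let ?c = "real (card (signs J))"
 define h where "h = (%(j, \<omega>). (key j, \<omega> :: 'i => real))"
 define a' where "a' = (%(j, \<omega>). ?c powr - \<tau> * (a j * \<omega> j))"
 have c: "0 < ?c" by (rule card_signs_pos[OF J])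
 have fB: "finite B" using B(1) J by (rule finite_subset)
 have i: "inj_on h (B \<times> signs J)" using B(2) by (auto simp: inj_on_def h_def)
 have "flat Q \<tau> C (B \<times> signs J) (%p. F (h p))"
  by (rule flat_reindex[OF fl i]) (use B(1) in \<open>auto simp: h_def\<close>)
 hence "Q (comb (B \<times> signs J) a' (%p. F (h p))) (C * (?c powr - \<tau> * real (card (B \<times> signs J)) powr \<tau>))"
 proof (rule flatD[OF _ order_refl])
  fix p assume "p \<in> B \<times> signs J"
  then obtain j \<omega> where p: "p = (j, \<omega>)" "j \<in> B" "\<omega> \<in> signs J" by blast
  hence "\<omega> j = -1 \<or> \<omega> j = 1" using sign_cases[OF p(3)] p(2) B(1) by blast
  hence "\<bar>\<omega> j\<bar> = 1" by auto
  thus "\<bar>a' p\<bar> = ?c powr - \<tau>" using a[OF p(2)] by (simp add: a'_def p abs_mult)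
 qed
 also have "?c powr - \<tau> * real (card (B \<times> signs J)) powr \<tau> = real (card B) powr \<tau>"
  using c by (simp add: card_cartesian_product powr_mult powr_minus)
 also have "comb (B \<times> signs J) a' (%p. F (h p)) = comb B a (rademacher \<tau> J key F)"
 proof
  fix n
  have "comb (B \<times> signs J) a' (%p. F (h p)) n
    = (\<Sum>(j, \<omega>)\<in>B \<times> signs J. of_real (?c powr - \<tau> * (a j * \<omega> j)) * F (key j, \<omega>) n)"
   unfolding comb_def a'_def h_def by (intro sum.cong refl) auto
  also have "... = (\<Sum>j\<in>B. \<Sum>\<omega>\<in>signs J. of_real (?c powr - \<tau> * (a j * \<omega> j)) * F (key j, \<omega>) n)"
   by (simp only: sum.cartesian_product)
  also have "... = comb B a (rademacher \<tau> J key F) n"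
   by (simp add: comb_def rademacher_def sum_distrib_left mult_ac)
  finally show "comb (B \<times> signs J) a' (%p. F (h p)) n = comb B a (rademacher \<tau> J key F) n" .
 qed
 finally show ?thesis .
qed

text \<open>With a single key, the vector belonging to the sign pattern \<omega> gets as coefficient
  the sum of the a_j \<omega>_j. By orthogonality its mean square is \<open>card B\<close>, which
  gives the exponent 1/2 whatever \<tau> is.\<close>

lemma rademacher_const:
 fixes key :: "'i => 'c" and F :: "'c \<times> ('i => real) => nat => 'k::real_normed_field"
 assumes up: "upper2 Q \<tau> C (key ` J \<times> signs J) F" and J: "finite J" and B: "B \<subseteq> J" "!!i j. i \<in> B ==> j \<in> B ==> key i = key j"
  and a: "!!j. j \<in> B ==> \<bar>a j\<bar> = 1"
 shows "Q (comb B a (rademacher \<tau> J key F)) (C * real (card B) powr (1 / 2))"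
proof (cases "B = {}")
 case True
 thus ?thesis using upper2D[OF up, of "{}"] by (simp add: comb_def)
next
 case False
 then obtain i where i: "i \<in> B" by blast
 let ?c = "real (card (signs J))"
 define h where "h = (%\<omega>. (key i, \<omega> :: 'i => real))"
 define a' where "a' = (%\<omega>. ?c powr - \<tau> * (\<Sum>j\<in>B. a j * \<omega> j))"
 have c: "0 < ?c" by (rule card_signs_pos[OF J])
 have inj: "inj_on h (signs J)" by (auto simp: inj_on_def h_def)
 have "upper2 Q \<tau> C (signs J) (%p. F (h p))"
  by (rule upper2_reindex[OF up inj]) (use B(1) i in \<open>auto simp: h_def\<close>)
 hence q: "Q (comb (signs J) a' (%p. F (h p))) (C * (?c powr (\<tau> - 1 / 2) * sqrt (\<Sum>\<omega>\<in>signs J. (a' \<omega>)\<^sup>2)))"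
  by (rule upper2D) simp
 have "(\<Sum>\<omega>\<in>signs J. (a' \<omega>)\<^sup>2) = (?c powr - \<tau>)\<^sup>2 * (\<Sum>\<omega>\<in>signs J. (\<Sum>j\<in>B. a j * \<omega> j)\<^sup>2)"
  unfolding sum_distrib_left by (simp only: a'_def power_mult_distrib)
 also have "... = (?c powr - \<tau>)\<^sup>2 * (?c * (\<Sum>j\<in>B. (a j)\<^sup>2))" by (simp only: signs_square[OF J B(1)])
 also have "(\<Sum>j\<in>B. (a j)\<^sup>2) = (\<Sum>j\<in>B. 1)"
  by (rule sum.cong[OF refl]) (metis a power2_abs one_power2)
 finally have "sqrt (\<Sum>\<omega>\<in>signs J. (a' \<omega>)\<^sup>2) = ?c powr - \<tau> * (?c powr (1 / 2) * real (card B) powr (1 / 2))"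
  by (simp add: real_sqrt_mult powr_half_sqrt)
 hence "?c powr (\<tau> - 1 / 2) * sqrt (\<Sum>\<omega>\<in>signs J. (a' \<omega>)\<^sup>2) = (?c powr (\<tau> - 1 / 2) * ?c powr - \<tau> * ?c powr (1 / 2)) * real (card B) powr (1 / 2)"
  by (simp only: mult_ac)
 also have "?c powr (\<tau> - 1 / 2) * ?c powr - \<tau> * ?c powr (1 / 2) = 1"
  using c by (simp only: powr_add[symmetric]) simp
 finally have e: "?c powr (\<tau> - 1 / 2) * sqrt (\<Sum>\<omega>\<in>signs J. (a' \<omega>)\<^sup>2) = real (card B) powr (1 / 2)" by simp
 have "comb (signs J) a' (%p. F (h p)) = comb B a (rademacher \<tau> J key F)"
 proof
  fix n
  have "comb (signs J) a' (%p. F (h p)) n = (\<Sum>\<omega>\<in>signs J. \<Sum>j\<in>B. of_real (?c powr - \<tau> * (a j * \<omega> j)) * F (key i, \<omega>) n)"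
   by (simp only: comb_def a'_def h_def sum_distrib_left sum_distrib_right of_real_sum)
  also have "... = (\<Sum>j\<in>B. \<Sum>\<omega>\<in>signs J. of_real (?c powr - \<tau> * (a j * \<omega> j)) * F (key i, \<omega>) n)" by (rule sum.swap)
  also have "... = (\<Sum>j\<in>B. \<Sum>\<omega>\<in>signs J. of_real (?c powr - \<tau> * (a j * \<omega> j)) * F (key j, \<omega>) n)"
   by (rule sum.cong[OF refl]) (simp only: B(2)[OF i])
  also have "... = comb B a (rademacher \<tau> J key F) n"
   unfolding comb_def rademacher_def by (simp add: sum_distrib_left mult_ac)
  finally show "comb (signs J) a' (%p. F (h p)) n = comb B a (rademacher \<tau> J key F) n" .
 qed
 thus ?thesis using q unfolding e by simp
qed

text \<open>The normalisations with \<tau> and 1 - \<tau> multiply to the reciprocal of the number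
  of sign patterns, so what remains is the correlation of the i-th and the j-th sign.\<close>

lemma rademacher_pairing:
 assumes J: "finite J" "i \<in> J" "j \<in> J" and g: "!!\<omega>. \<omega> \<in> signs J ==> G (key i, \<omega>) \<in> c00"
  and bi: "!!p p'. p \<in> key ` J \<times> signs J ==> p' \<in> key ` J \<times> signs J ==> pairing (G p) (F p') = (if p = p' then 1 else 0)"
 shows "pairing (rademacher (1 - \<tau>) J key G i) (rademacher \<tau> J key F j) = (if i = j then 1 else (0::'k::real_normed_field))"
proof -
 let ?c = "real (card (signs J))"
 have c: "0 < ?c" by (rule card_signs_pos[OF J(1)])
 have r: "rademacher \<tau> J key F i = (%n. \<Sum>\<omega>\<in>signs J. of_real (?c powr - \<tau> * \<omega> i) * F (key i, \<omega>) n)"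
  for \<tau> i and F :: "_ => nat => 'k"
  by (simp add: rademacher_def sum_distrib_left mult.assoc)
 have "pairing (rademacher (1 - \<tau>) J key G i) (rademacher \<tau> J key F j)
   = (\<Sum>\<omega>\<in>signs J. of_real (?c powr - (1 - \<tau>) * \<omega> i) * (\<Sum>\<omega>'\<in>signs J. of_real (?c powr - \<tau> * \<omega>' j) * pairing (G (key i, \<omega>)) (F (key j, \<omega>'))))"
  unfolding r by (subst pairing_sum_left) (use g in \<open>simp_all add: pairing_sum_right\<close>)
 also have "... = (\<Sum>\<omega>\<in>signs J. of_real (?c powr - (1 - \<tau>) * \<omega> i) * (of_real (?c powr - \<tau> * \<omega> j) * (if key i = key j then 1 else 0)))"
 proof (intro sum.cong refl arg_cong2[of _ _ _ _ "(*)"])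
  fix \<omega> assume w: "\<omega> \<in> signs J"
  have "(\<Sum>\<omega>'\<in>signs J. of_real (?c powr - \<tau> * \<omega>' j) * pairing (G (key i, \<omega>)) (F (key j, \<omega>')))
    = (\<Sum>\<omega>'\<in>signs J. if \<omega>' = \<omega> then of_real (?c powr - \<tau> * \<omega> j) * (if key i = key j then 1 else 0) else 0)"
  proof (rule sum.cong[OF refl])
   fix \<omega>' assume w': "\<omega>' \<in> signs J"
   have "pairing (G (key i, \<omega>)) (F (key j, \<omega>')) = (if (key i, \<omega>) = (key j, \<omega>') then 1 else 0)"
    by (rule bi) (use w w' J in auto)
   thus "of_real (?c powr - \<tau> * \<omega>' j) * pairing (G (key i, \<omega>)) (F (key j, \<omega>'))
    = (if \<omega>' = \<omega> then of_real (?c powr - \<tau> * \<omega> j) * (if key i = key j then 1 else 0) else 0)" by auto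
  qed
  also have "... = of_real (?c powr - \<tau> * \<omega> j) * (if key i = key j then 1 else 0)"
   using w finite_signs[OF J(1)] by simp
  finally show "(\<Sum>\<omega>'\<in>signs J. of_real (?c powr - \<tau> * \<omega>' j) * pairing (G (key i, \<omega>)) (F (key j, \<omega>')))
    = of_real (?c powr - \<tau> * \<omega> j) * (if key i = key j then 1 else 0)" .
 qed
 also have "... = of_real (?c powr - (1 - \<tau>) * ?c powr - \<tau> * (\<Sum>\<omega>\<in>signs J. \<omega> i * \<omega> j)) * (if key i = key j then 1 else 0)"
  by (simp add: sum_distrib_left sum_distrib_right mult_ac)
 also have "?c powr - (1 - \<tau>) * ?c powr - \<tau> = 1 / ?c"
  using c by (simp only: powr_add[symmetric]) (simp add: powr_minus_divide)
 also have "1 / ?c * (\<Sum>\<omega>\<in>signs J. \<omega> i * \<omega> j) = (if i = j then 1 else 0)"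
  using c signs_orthogonal[OF J] by simp
 finally show ?thesis by simp
qed


section \<open>Szankowski's systems of strings\<close>

text \<open>The last two bits of a string of length \<open>N\<close> and the copy \<open>b\<close> select, together with \<open>N mod 3\<close>, one
 of 24 disjoint sets of free positions.\<close>

definition slots :: "nat => bool => bool => bool => nat set"
 where "slots N b c d = {p. p + 4 < N \<and> p mod 24 = 8 * (N mod 3) + 4 * of_bool c + 2 * of_bool d + of_bool b}"

definition slots_of :: "bool => bool list => nat set"
 where "slots_of b j = slots (length j) b (j ! (length j - 2)) (j ! (length j - 1))"

definition same_tail :: "bool list => bool list => bool"
 where "same_tail i j \<longleftrightarrow> length i = length j \<and> i ! (length i - 2) = j ! (length j - 2) \<and> i ! (length i - 1) = j ! (length j - 1)"

text \<open>On fibres, where only the free positions vary, the functionals will be estimated; on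
  spread sets, where the free positions are constant, the vectors.\<close>

definition fibre :: "bool => bool list set => bool"
 where "fibre b A \<longleftrightarrow> (\<forall>i\<in>A. \<forall>j\<in>A. same_tail i j \<and> (\<forall>p<length j. p \<notin> slots_of b j --> i ! p = j ! p))"

definition spread :: "bool => bool list set => bool"
 where "spread b A \<longleftrightarrow> (\<forall>i\<in>A. \<forall>j\<in>A. same_tail i j \<and> (\<forall>p\<in>slots_of b j. i ! p = j ! p))"

text \<open>With \<open>low\<close> the key records the free bits, otherwise the remaining ones, and
  in both cases the last two, which determine the slots. It is injective on fibres and constant on
  spread sets, or the other way round, so that the exponent below 1/2 falls on the side where the
  system has it.\<close>

definition key_of :: "bool => bool => bool list => bool list"
 where "key_of low b j = map (%p. (p \<in> slots_of b j \<longleftrightarrow> low) \<and> j ! p \<or> length j \<le> p + 2 \<and> j ! p) [0..<length j]"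

abbreviation strings :: "nat => bool list set"
 where "strings N \<equiv> {j. length j = N}"

lemma finite_strings: "finite (strings N)"
 using finite_lists_length_eq[of "UNIV :: bool set" N] by simp

lemma slots_of_tail: "same_tail i j ==> slots_of b i = slots_of b j"
 unfolding slots_of_def same_tail_def by (elim conjE) simp

lemma slots_of_less: "p \<in> slots_of b j ==> p + 4 < length j"
 by (simp add: slots_of_def slots_def)

lemma length_key_of: "length (key_of low b j) = length j"
 by (simp add: key_of_def)

lemma nth_key_of: "p < length j ==> key_of low b j ! p = ((p \<in> slots_of b j \<longleftrightarrow> low) \<and> j ! p \<or> length j \<le> p + 2 \<and> j ! p)"
 by (simp add: key_of_def)

lemma fibre_key:
 assumes "fibre b A" shows "low ==> inj_on (key_of low b) A" "\<not> low ==> i \<in> A ==> j \<in> A ==> key_of low b i = key_of low b j"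
proof -
 have A: "same_tail i j" "slots_of b i = slots_of b j" "length i = length j" "!!p. p < length j ==> p \<notin> slots_of b j ==> i ! p = j ! p"
  if "i \<in> A" "j \<in> A" for i j
 proof -
  show t: "same_tail i j" using assms that unfolding fibre_def by blast
  show "slots_of b i = slots_of b j" using t by (rule slots_of_tail)
  show "length i = length j" using t by (simp add: same_tail_def)
  show "!!p. p < length j ==> p \<notin> slots_of b j ==> i ! p = j ! p" using assms that unfolding fibre_def by blast
 qed
 {
  assume low
  show "inj_on (key_of low b) A"
  proof (rule inj_onI)
   fix i j assume ij: "i \<in> A" "j \<in> A" and k: "key_of low b i = key_of low b j"
   show "i = j"
   proof (rule nth_equalityI)
    fix p assume "p < length i"
    hence p: "p < length i" "p < length j" using A(3)[OF ij] by simp_all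
    have "key_of low b i ! p = key_of low b j ! p" by (simp only: k)
    thus "i ! p = j ! p"
     using A[OF ij] \<open>low\<close> slots_of_less[of p b j] p by (cases "p \<in> slots_of b j") (auto simp: nth_key_of)
   qed (rule A[OF ij])
  qed
 next
  assume low: "\<not> low" and ij: "i \<in> A" "j \<in> A"
  show "key_of low b i = key_of low b j"
  proof (rule nth_equalityI)
   fix p assume "p < length (key_of low b i)"
   hence p: "p < length i" "p < length j" using A(3)[OF ij] by (simp_all add: length_key_of)
   have "i ! p = j ! p" if "length j \<le> p + 2"
    using A(4)[OF ij p(2)] that slots_of_less[of p b j] by fastforce
   thus "key_of low b i ! p = key_of low b j ! p"
    using A[OF ij] p low by (cases "p \<in> slots_of b j") (auto simp: nth_key_of)
  qed (simp add: length_key_of A(3)[OF ij])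
 }
qed

lemma spread_key:
 assumes "spread b A" shows "\<not> low ==> inj_on (key_of low b) A" "low ==> i \<in> A ==> j \<in> A ==> key_of low b i = key_of low b j"
proof -
 have A: "slots_of b i = slots_of b j" "length i = length j" "!!p. p \<in> slots_of b j ==> i ! p = j ! p"
  "!!p. p < length j ==> length j \<le> p + 2 ==> i ! p = j ! p"
  if "i \<in> A" "j \<in> A" for i j
 proof -
  have t: "same_tail i j" using assms that unfolding spread_def by blast
  show "slots_of b i = slots_of b j" using t by (rule slots_of_tail)
  show "length i = length j" using t by (simp add: same_tail_def)
  show "!!p. p \<in> slots_of b j ==> i ! p = j ! p" using assms that unfolding spread_def by blast
  fix p assume "p < length j" "length j \<le> p + 2"
  hence "p = length j - 2 \<or> p = length j - 1" by linarith
  thus "i ! p = j ! p" using t by (auto simp: same_tail_def)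
 qed
 {
  assume "\<not> low"
  show "inj_on (key_of low b) A"
  proof (rule inj_onI)
   fix i j assume ij: "i \<in> A" "j \<in> A" and k: "key_of low b i = key_of low b j"
   show "i = j"
   proof (rule nth_equalityI)
    fix p assume "p < length i"
    hence p: "p < length i" "p < length j" using A(2)[OF ij] by simp_all
    have "key_of low b i ! p = key_of low b j ! p" by (simp only: k)
    thus "i ! p = j ! p"
     using A[OF ij] \<open>\<not> low\<close> slots_of_less[of p b j] p by (cases "p \<in> slots_of b j") (auto simp: nth_key_of)
   qed (rule A[OF ij])
  qed
 next
  assume low: low and ij: "i \<in> A" "j \<in> A"
  show "key_of low b i = key_of low b j"
  proof (rule nth_equalityI)
   fix p assume "p < length (key_of low b i)"
   hence p: "p < length i" "p < length j" using A(2)[OF ij] by (simp_all add: length_key_of)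
   show "key_of low b i ! p = key_of low b j ! p"
    using A[OF ij] p low by (cases "p \<in> slots_of b j") (auto simp: nth_key_of)
  qed (simp add: length_key_of A(2)[OF ij])
 }
qed

text \<open>The growth exponents are p for the functionals on fibres and q for the vectors on spread
  sets.\<close>

definition string_system ::
  "((nat => 'k::real_normed_field) => real) => real => real => real => nat => bool => (bool list => nat => 'k) => (bool list => nat => 'k) => bool"
 where "string_system N C p q L b E G \<longleftrightarrow>
  (\<forall>j\<in>strings L. E j \<in> c00 \<and> G j \<in> c00) \<and>
  (\<forall>i\<in>strings L. \<forall>j\<in>strings L. pairing (G i) (E j) = (if i = j then 1 else 0)) \<and>
  (\<forall>A\<subseteq>strings L. \<forall>a. (\<forall>j\<in>A. \<bar>a j\<bar> = 1) -->
   (fibre b A --> dbound N (comb A a G) (C * real (card A) powr p)) \<and>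
   (spread b A --> nbound N (comb A a E) (C * real (card A) powr q)))"

lemma string_system_exists:
 fixes N :: "(nat => 'k::real_normed_field) => real"
 assumes sys: "has_systems N \<sigma> C low"
 shows "\<exists>E G. string_system N C (if low then 1 - \<sigma> else 1 / 2) (if low then 1 / 2 else 1 - \<sigma>) L b E G \<and>
  (\<forall>j\<in>strings L. \<forall>n. E j n \<noteq> 0 \<or> G j n \<noteq> 0 --> n0 \<le> n)"
proof -
 let ?J = "strings L" and ?key = "key_of low b"
 define \<tau> where "\<tau> = (if low then \<sigma> else 1 - \<sigma>)"
 have "finite (?key ` ?J \<times> signs ?J)" using finite_strings finite_signs[of ?J] by blast
 then obtain f g where fg: "bi_system N \<sigma> C low (?key ` ?J \<times> signs ?J) n0 f g" by (rule bi_system_exists[OF sys])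
 define E where "E = rademacher \<tau> ?J ?key f"
 define G where "G = rademacher (1 - \<tau>) ?J ?key g"
 have fc: "f p \<in> c00" "g p \<in> c00" "f p n \<noteq> 0 \<or> g p n \<noteq> 0 ==> n0 \<le> n" if "p \<in> ?key ` ?J \<times> signs ?J" for p n
  using fg that unfolding bi_system_def by blast+
 have c: "E j \<in> c00" "G j \<in> c00" if "j \<in> ?J" for j
  unfolding E_def G_def using that fc by (auto intro!: rademacher_c00)
 have supp: "n0 \<le> n" if j: "j \<in> ?J" and ne: "E j n \<noteq> 0 \<or> G j n \<noteq> 0" for j n
 proof -
  obtain \<omega> where "\<omega> \<in> signs ?J" "f (?key j, \<omega>) n \<noteq> 0 \<or> g (?key j, \<omega>) n \<noteq> 0"
   using ne rademacher_supp[of \<tau> ?J ?key f j n] rademacher_supp[of "1 - \<tau>" ?J ?key g j n] unfolding E_def G_def by blast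
  thus ?thesis using fc(3)[of "(?key j, \<omega>)" n] j by auto
 qed
 have pair: "pairing (G i) (E j) = (if i = j then 1 else 0)" if "i \<in> ?J" "j \<in> ?J" for i j
  unfolding G_def E_def
 proof (rule rademacher_pairing[OF finite_strings that])
  show "!!\<omega>. \<omega> \<in> signs ?J ==> g (?key i, \<omega>) \<in> c00" using fc(2) that(1) by blast
  show "!!p p'. p \<in> ?key ` ?J \<times> signs ?J ==> p' \<in> ?key ` ?J \<times> signs ?J ==> pairing (g p) (f p') = (if p = p' then 1 else 0)"
   using fg unfolding bi_system_def by blast
 qed
 have est: "(fibre b A --> dbound N (comb A a G) (C * real (card A) powr (if low then 1 - \<sigma> else 1 / 2))) \<and>
   (spread b A --> nbound N (comb A a E) (C * real (card A) powr (if low then 1 / 2 else 1 - \<sigma>)))"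
  if A: "A \<subseteq> ?J" and a: "!!j. j \<in> A ==> \<bar>a j\<bar> = 1" for A a
 proof (cases low)
  case True
  have u: "upper2 (nbound N) \<tau> C (?key ` ?J \<times> signs ?J) f" "flat (dbound N) (1 - \<tau>) C (?key ` ?J \<times> signs ?J) g"
   using fg True by (simp_all add: bi_system_def \<tau>_def)
  show ?thesis
   using rademacher_const[OF u(1) finite_strings A spread_key(2)[OF _ True] a]
    rademacher_inj[OF u(2) finite_strings A fibre_key(1)[OF _ True] a] True
   by (simp add: E_def G_def \<tau>_def)
 next
  case False
  have u: "upper2 (dbound N) (1 - \<tau>) C (?key ` ?J \<times> signs ?J) g" "flat (nbound N) \<tau> C (?key ` ?J \<times> signs ?J) f"
   using fg False by (simp_all add: bi_system_def \<tau>_def)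
  show ?thesis
   using rademacher_const[OF u(1) finite_strings A fibre_key(2)[OF _ False] a]
    rademacher_inj[OF u(2) finite_strings A spread_key(1)[OF _ False] a] False
   by (simp add: E_def G_def \<tau>_def)
 qed
 have "string_system N C (if low then 1 - \<sigma> else 1 / 2) (if low then 1 / 2 else 1 - \<sigma>) L b E G"
  unfolding string_system_def using c pair est by blast
 thus ?thesis using supp by blast
qed

text \<open>The systems for all lengths and both copies are placed one behind the other, and
  disjoint supports give biorthogonality between different systems. The number m codes the length
  \<open>m div 2\<close> and the copy \<open>odd m\<close>.\<close>

theorem string_systems:
 fixes N :: "(nat => 'k::real_normed_field) => real"
 assumes sys: "has_systems N \<sigma> C low"
 shows "\<exists>E G. (\<forall>b j. E b j \<in> c00 \<and> G b j \<in> c00) \<and>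
  (\<forall>b i b' j. pairing (G b i) (E b' j) = (if b = b' \<and> i = j then 1 else 0)) \<and>
  (\<forall>L b. string_system N C (if low then 1 - \<sigma> else 1 / 2) (if low then 1 / 2 else 1 - \<sigma>) L b (E b) (G b))"
proof -
 let ?s = "string_system N C (if low then 1 - \<sigma> else 1 / 2) (if low then 1 / 2 else 1 - \<sigma>)"
 have "\<exists>n1 E G. n0 \<le> n1 \<and> ?s (m div 2) (odd m) E G \<and>
   (\<forall>j\<in>strings (m div 2). \<forall>n. E j n \<noteq> 0 \<or> G j n \<noteq> 0 --> n0 \<le> n \<and> n < n1)" for m n0
 proof -
  obtain E G where s: "?s (m div 2) (odd m) E G" and b: "\<forall>j\<in>strings (m div 2). \<forall>n. E j n \<noteq> 0 \<or> G j n \<noteq> 0 --> n0 \<le> n"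
   using string_system_exists[OF sys] by blast
  have "finite (\<Union>j\<in>strings (m div 2). {n. E j n \<noteq> 0} \<union> {n. G j n \<noteq> 0})"
   using s finite_strings[of "m div 2"] by (auto simp: string_system_def intro!: c00_finite)
  then obtain n1 where n1: "!!j n. j \<in> strings (m div 2) ==> E j n \<noteq> 0 \<or> G j n \<noteq> 0 ==> n < n1"
   unfolding finite_nat_set_iff_bounded by blast
  show ?thesis
   by (intro exI[of _ "max n0 n1"] exI[of _ E] exI[of _ G] conjI ballI allI impI) (use s b n1 in \<open>auto simp: less_max_iff_disj\<close>)
 qed
 hence "\<forall>m n0. \<exists>n1 E G. n0 \<le> n1 \<and> ?s (m div 2) (odd m) E G \<and>
   (\<forall>j\<in>strings (m div 2). \<forall>n. E j n \<noteq> 0 \<or> G j n \<noteq> 0 --> n0 \<le> n \<and> n < n1)" by (intro allI)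
 then obtain U E0 G0 where U: "\<forall>m n0. n0 \<le> U m n0 \<and> ?s (m div 2) (odd m) (E0 m n0) (G0 m n0) \<and>
   (\<forall>j\<in>strings (m div 2). \<forall>n. E0 m n0 j n \<noteq> 0 \<or> G0 m n0 j n \<noteq> 0 --> n0 \<le> n \<and> n < U m n0)"
  unfolding choice_iff by (elim exE)
 define q where "q = rec_nat 0 (%m n. U m n)"
 have q: "q (Suc m) = U m (q m)" for m by (simp add: q_def)
 have qm: "mono q" by (rule incseq_SucI) (simp add: q U)
 define m where "m b j = 2 * length j + of_bool b" for b and j :: "bool list"
 have m: "m b j div 2 = length j" "odd (m b j) = b" for b j by (auto simp: m_def)
 define E where "E b j = E0 (m b j) (q (m b j)) j" for b j
 define G where "G b j = G0 (m b j) (q (m b j)) j" for b j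
 have sys: "?s L b (E b) (G b)" for L b
 proof -
  define k where "k = 2 * L + of_bool b"
  have k: "k div 2 = L" "odd k = b" by (auto simp: k_def)
  have "?s L b (E0 k (q k)) (G0 k (q k))" using U[rule_format, of "q k" k] k by simp
  moreover have "E b j = E0 k (q k) j" "G b j = G0 k (q k) j" if "j \<in> strings L" for j
   using that by (auto simp: E_def G_def m_def k_def)
  ultimately show ?thesis unfolding string_system_def
   by (auto simp: comb_def subset_eq cong: sum.cong)
 qed
 have supp: "q (m b j) \<le> n \<and> n < q (Suc (m b j))" if "E b j n \<noteq> 0 \<or> G b j n \<noteq> 0" for b j n
  using U[rule_format, of "q (m b j)" "m b j"] that by (auto simp: E_def G_def q m)
 have c: "E b j \<in> c00" "G b j \<in> c00" for b j using sys[of "length j" b] by (auto simp: string_system_def)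
 have "pairing (G b i) (E b' j) = (if b = b' \<and> i = j then 1 else 0)" for b i b' j
 proof (cases "b = b' \<and> length i = length j")
  case True
  thus ?thesis using sys[of "length j" b] by (auto simp: string_system_def)
 next
  case False
  hence "m b i \<noteq> m b' j" using m by metis
  hence disj: "G b i n = 0 \<or> E b' j n = 0" for n
  proof (rule_tac ccontr)
   assume ne: "m b i \<noteq> m b' j" and "\<not> (G b i n = 0 \<or> E b' j n = 0)"
   hence "q (m b i) \<le> n" "n < q (Suc (m b i))" "q (m b' j) \<le> n" "n < q (Suc (m b' j))"
    using supp[of b i n] supp[of b' j n] by auto
   thus False using ne monoD[OF qm, of "Suc (m b i)" "m b' j"] monoD[OF qm, of "Suc (m b' j)" "m b i"]
    by (cases "m b i < m b' j") auto
  qed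
  have "pairing (G b i) (E b' j) = 0" unfolding pairing_def by (rule sum.neutral) (use disj in auto)
  thus ?thesis using False by auto
 qed
 thus ?thesis using c sys by (intro exI[of _ E] exI[of _ G]) blast
qed

section \<open>Systems indexed by strings in an abstract space\<close>

lemma fscale_sum_left: "fscale (\<Sum>i\<in>I. a i) x = (\<Sum>i\<in>I. fscale (a i) (x :: 'i => 'k::real_normed_field))"
 by (simp add: fun_eq_iff fun_sum fscale_def sum_distrib_right)

lemma fscale_diff_right: "fscale a (x - y) = fscale a x - fscale a (y :: 'i => 'k::real_normed_field)"
 by (simp add: fun_eq_iff fscale_def algebra_simps)

abbreviation signed_sum :: "'j set => ('j => real) => ('j => 'i => 'k::real_normed_field) => 'i => 'k"
 where "signed_sum A a x \<equiv> \<Sum>j\<in>A. fscale (of_real (a j)) (x j)"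

text \<open>What the construction of the subspaces uses of the space. The inequality
  \<open>p + q < 1\<close> makes the product of the two bounds negligible against the number of
  strings in a large fibre.\<close>

locale szankowski = normed_fspace X for X :: "('i, 'k::real_normed_field) fspace" +
 fixes V :: "bool => bool list => 'i => 'k" and ev :: "bool => bool list => ('i => 'k) => 'k" and D p q :: real
 assumes V_in [simp]: "V c j \<in> vecs X"
  and ev: "functional (ev c j)"
  and ev_V: "ev c i (V c' j) = (if c = c' \<and> i = j then 1 else 0)"
  and fibre_bound: "A \<subseteq> strings L ==> fibre c A ==> (!!j. j \<in> A ==> \<bar>a j\<bar> = 1) ==> x \<in> vecs X ==>
   norm (\<Sum>j\<in>A. of_real (a j) * ev c j x) \<le> D * real (card A) powr p * nrm X x"
  and spread_bound: "A \<subseteq> strings L ==> spread c A ==> (!!j. j \<in> A ==> \<bar>a j\<bar> = 1) ==>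
   nrm X (signed_sum A a (V c)) \<le> D * real (card A) powr q"
  and D: "0 < D" and pq: "p + q < 1"

lemma (in unc_basis) functional_pairing:
 assumes "g \<in> c00" shows "functional (%x. if x \<in> vecs X then pairing g (co x) else 0)"
proof -
 have "norm (pairing g (co x)) \<le> (\<Sum>n | g n \<noteq> 0. norm (g n)) * nrm X x" if "x \<in> vecs X" for x
 proof -
  have "norm (pairing g (co x)) \<le> (\<Sum>n | g n \<noteq> 0. norm (g n * co x n))" unfolding pairing_def by (rule norm_sum)
  also have "... \<le> (\<Sum>n | g n \<noteq> 0. norm (g n) * nrm X x)"
   using co_bdd[OF that] by (intro sum_mono) (simp add: norm_mult mult_left_mono)
  finally show ?thesis by (simp add: sum_distrib_right)
 qed
 moreover have "pairing g (co (x + y)) = pairing g (co x) + pairing g (co y)" if "x \<in> vecs X" "y \<in> vecs X" for x y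
  by (simp add: pairing_def co_add[OF that] distrib_left sum.distrib)
 moreover have "pairing g (co (fscale a x)) = a * pairing g (co x)" if "x \<in> vecs X" for a x
  by (simp add: pairing_def co_scale[OF that] sum_distrib_left mult.left_commute)
 ultimately show ?thesis unfolding functional_def by auto
qed

text \<open>Finite combinations are dense. The functional is already known to be bounded by some K,
  and K enters only the error term.\<close>

lemma (in unc_basis) dbound_extends:
 assumes g: "g \<in> c00" and d: "dbound N g r" and x: "x \<in> vecs X"
 shows "norm (pairing g (co x)) \<le> r * nrm X x"
proof -
 let ?f = "%x. if x \<in> vecs X then pairing g (co x) else 0"
 note f = functional_pairing[OF g]
 define K where "K = dnrm ?f"
 have K: "0 \<le> K" "!!x. x \<in> vecs X ==> norm (?f x) \<le> K * nrm X x"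
  unfolding K_def using dual_nonneg[OF f] dual_bound[OF f] by auto
 have "N (unitv 0) = 1" using lattice_N by (simp add: lattice_norm_def)
 moreover have "norm (pairing g (unitv 0)) \<le> r * N (unitv 0)" using d by (simp add: dbound_def)
 ultimately have "norm (pairing g (unitv 0)) \<le> r" by simp
 with norm_ge_zero have r: "0 \<le> r" by (rule order_trans)
 have "norm (?f x) \<le> r * nrm X x + e" if e: "0 < e" for e
 proof -
  define e' where "e' = e / (K + r + 1)"
  have e': "0 < e'" using e K(1) r by (simp add: e'_def)
  obtain a where a: "a \<in> c00" "nrm X (x - lc a) < e'" using dense[OF x e'] by blast
  have f_eq: "?f x = ?f (lc a) + ?f (x - lc a)" using functional_diff[OF f x, of "lc a"] by simp
  have "norm (?f x) \<le> norm (?f (lc a)) + norm (?f (x - lc a))" by (subst f_eq) (rule norm_triangle_ineq)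
  also have "norm (?f (lc a)) \<le> r * nrm X (lc a)" using d a(1) by (simp add: co_lc dbound_def N_def)
  also have "nrm X (lc a) \<le> nrm X x + e'" using nrm_reverse[of "lc a" x] nrm_diff_commute[of "lc a" x] x a(2) by simp
  also have "norm (?f (x - lc a)) \<le> K * nrm X (x - lc a)" using x by (intro K) simp
  also have "... \<le> K * e'" using a(2) K(1) by (intro mult_left_mono) auto
  also have "r * (nrm X x + e') + K * e' \<le> r * nrm X x + e"
  proof -
   have "(K + r) * e' \<le> (K + r + 1) * e'" using e' by simp
   also have "... = e" using K(1) r by (simp add: e'_def)
   finally show ?thesis by (simp add: algebra_simps)
  qed
  finally show ?thesis using r by (simp add: mult_left_mono)
 qed
 hence "norm (?f x) \<le> r * nrm X x" by (rule field_le_epsilon)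
 thus ?thesis using x by simp
qed

theorem (in unc_basis) szankowski_exists:
 assumes sys: "has_systems N \<sigma> C low" and \<sigma>: "1 / 2 < \<sigma>" and C: "0 < C"
 shows "\<exists>V ev p q. szankowski X V ev C p q"
proof -
 let ?p = "if low then 1 - \<sigma> else 1 / 2" and ?q = "if low then 1 / 2 else 1 - \<sigma>"
 obtain E G where c: "!!c j. E c j \<in> c00" "!!c j. G c j \<in> c00"
  and pair: "!!c i c' j. pairing (G c i) (E c' j) = (if c = c' \<and> i = j then 1 else 0)"
  and sys: "!!L c. string_system N C ?p ?q L c (E c) (G c)" using string_systems[OF sys] by blast
 define V where "V c j = lc (E c j)" for c j
 define ev where "ev c j = (%x. if x \<in> vecs X then pairing (G c j) (co x) else 0)" for c j
 have "szankowski X V ev C ?p ?q"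
 proof unfold_locales
  show "functional (ev c j)" for c j unfolding ev_def by (rule functional_pairing[OF c(2)])
  show "ev c i (V c' j) = (if c = c' \<and> i = j then 1 else 0)" for c i c' j
   by (simp add: ev_def V_def co_lc c pair)
  show "?p + ?q < 1" using \<sigma> by simp
  fix A L c and a :: "bool list => real" assume A: "A \<subseteq> strings L" and a: "!!j. j \<in> A ==> \<bar>a j\<bar> = 1"
  have fin: "finite A" using A finite_strings by (rule finite_subset)
  have sysA: "fibre c A ==> dbound N (comb A a (G c)) (C * real (card A) powr ?p)"
   "spread c A ==> nbound N (comb A a (E c)) (C * real (card A) powr ?q)"
   using sys[of L c] A a unfolding string_system_def by blast+
  show "norm (\<Sum>j\<in>A. of_real (a j) * ev c j x) \<le> C * real (card A) powr ?p * nrm X x" if "fibre c A" "x \<in> vecs X" for x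
  proof -
   have "pairing (comb A a (G c)) (co x) = (\<Sum>j\<in>A. of_real (a j) * ev c j x)"
    unfolding comb_def by (subst pairing_sum_left) (use c that(2) in \<open>simp_all add: ev_def\<close>)
   moreover have "norm (pairing (comb A a (G c)) (co x)) \<le> C * real (card A) powr ?p * nrm X x"
    using c sysA(1) that by (intro dbound_extends comb_c00) auto
   ultimately show ?thesis by simp
  qed
  show "nrm X (signed_sum A a (V c)) \<le> C * real (card A) powr ?q" if "spread c A"
  proof -
   have "lc (comb B a (E c)) = (\<Sum>j\<in>B. fscale (of_real (a j)) (V c j))" if "finite B" for B
    using that
   proof (induction B)
    case empty
    thus ?case by (simp add: comb_def lin_comb_def)
   next
    case (insert j B)
    have "comb (insert j B) a (E c) = fscale (of_real (a j)) (E c j) + comb B a (E c)"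
     using insert(1,2) by (auto simp: comb_def fscale_def)
    hence "lc (comb (insert j B) a (E c)) = lc (fscale (of_real (a j)) (E c j)) + lc (comb B a (E c))"
     using c by (simp only:) (intro lin_comb_add c00_fscale comb_c00, auto)
    also have "lc (fscale (of_real (a j)) (E c j)) = fscale (of_real (a j)) (V c j)"
     unfolding V_def by (rule lin_comb_scale[OF c(1)])
    finally show ?case by (simp only: sum.insert[OF insert(1,2)] insert.IH)
   qed
   thus ?thesis using sysA(2)[OF that] fin by (simp add: nbound_def N_def)
  qed
 qed (simp_all add: V_def C)
 thus ?thesis by blast
qed

section \<open>Sums over strings\<close>

lemma sum_strings_append: "(\<Sum>j\<in>strings (n + m). h j) = (\<Sum>i\<in>strings n. \<Sum>w\<in>strings m. h (i @ w))"
proof -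
 have "(\<Sum>i\<in>strings n. \<Sum>w\<in>strings m. h (i @ w)) = (\<Sum>(i, w)\<in>strings n \<times> strings m. h (i @ w))"
  by (rule sum.cartesian_product)
 also have "... = (\<Sum>j\<in>strings (n + m). h j)"
  by (rule sum.reindex_bij_witness[where i = "%j. (take n j, drop n j)" and j = "%(i, w). i @ w"]) auto
 finally show ?thesis by simp
qed

lemma strings_1: "strings 1 = {[False], [True]}"
 by (auto simp: length_Suc_conv)

lemma strings_2: "strings 2 = {[False, False], [False, True], [True, False], [True, True]}"
 by (auto simp: length_Suc_conv numeral_2_eq_2)

lemma card_strings: "card (strings n) = 2 ^ n"
 using card_lists_length_eq[of "UNIV :: bool set" n] by simp

lemma binary_digits:
 fixes a b c d :: nat
 assumes "8 * a + 4 * c + 2 * d + b = 8 * a' + 4 * c' + 2 * d' + b'"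
  and "b \<le> 1" "c \<le> 1" "d \<le> 1" "b' \<le> 1" "c' \<le> 1" "d' \<le> 1"
 shows "a = a'" "b = b'" "c = c'" "d = d'"
proof -
 have bit: "k = k' \<and> e = e'" if "2 * k + e = 2 * k' + e'" "e \<le> 1" "e' \<le> 1" for k k' e e' :: nat
  using that by presburger
 have 1: "4 * a + 2 * c + d = 4 * a' + 2 * c' + d' \<and> b = b'"
  by (rule bit) (use assms in simp_all)
 have 2: "2 * a + c = 2 * a' + c' \<and> d = d'"
  by (rule bit) (use 1 assms in simp_all)
 have 3: "a = a' \<and> c = c'"
  by (rule bit) (use 2 assms in simp_all)
 show "a = a'" "b = b'" "c = c'" "d = d'" using 1 2 3 by simp_all
qed

lemma slots_disjoint:
 assumes "x \<in> slots N b c d" "x \<in> slots N' b' c' d'"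
 shows "N mod 3 = N' mod 3" "b = b'" "c = c'" "d = d'"
proof -
 have e: "8 * (N mod 3) + 4 * of_bool c + 2 * of_bool d + of_bool b = 8 * (N' mod 3) + 4 * of_bool c' + 2 * of_bool d' + (of_bool b' :: nat)"
  using assms by (simp add: slots_def)
 have "of_bool P \<le> (1 :: nat)" for P by simp
 note digits = binary_digits[OF e this this this this this this]
 show "N mod 3 = N' mod 3" by (rule digits(1))
 show "b = b'" "c = c'" "d = d'" using digits(2-4) by (simp_all only: of_bool_eq_iff)
qed

lemma card_slots: "(N - 4) div 24 \<le> card (slots N b c d)"
proof -
 define r :: nat where "r = 8 * (N mod 3) + 4 * of_bool c + 2 * of_bool d + of_bool b"
 have r: "r < 24"
 proof -
  have "N mod 3 \<le> 2" by simp
  thus ?thesis unfolding r_def by (cases b; cases c; cases d) simp_all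
 qed
 have "card ((%k. 24 * k + r) ` {..<(N - 4) div 24}) \<le> card (slots N b c d)"
 proof (rule card_mono)
  show "finite (slots N b c d)" by (rule finite_subset[of _ "{..<N}"]) (auto simp: slots_def)
  show "(%k. 24 * k + r) ` {..<(N - 4) div 24} \<subseteq> slots N b c d"
  proof
   fix x assume "x \<in> (%k. 24 * k + r) ` {..<(N - 4) div 24}"
   then obtain k where k: "x = 24 * k + r" "k < (N - 4) div 24" by auto
   have "24 * k + 24 \<le> 24 * ((N - 4) div 24)" using k(2) by simp
   also have "... \<le> N - 4" by simp
   finally have "x + 4 < N" using k(1) r by linarith
   moreover have "x mod 24 = r" using k(1) r by simp
   ultimately show "x \<in> slots N b c d" by (simp add: slots_def r_def)
  qed
 qed
 moreover have "inj_on (%k. 24 * k + r) {..<(N - 4) div 24}" by (auto simp: inj_on_def)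
 ultimately show ?thesis by (simp add: card_image)
qed

text \<open>The strings of one length are partitioned into fibres by the key that forgets the free
  bits, irrespective of the kind of system. The next lemma makes each class exponentially large, as
  every residue modulo 24 supplies about L/24 free positions.\<close>

lemma key_class_fibre: "fibre b {j \<in> strings L. key_of False b j = y}"
 unfolding fibre_def
proof (intro ballI conjI allI impI)
 fix i j assume ij: "i \<in> {j \<in> strings L. key_of False b j = y}" "j \<in> {j \<in> strings L. key_of False b j = y}"
 hence l: "length i = length j" and k: "!!p. key_of False b i ! p = key_of False b j ! p" by auto
 have "i ! p = j ! p" if p: "p < length j" "length j \<le> p + 2" for p
  using k[of p] p l by (simp add: nth_key_of) blast
 from this[of "length j - 2"] this[of "length j - 1"] show t: "same_tail i j"
  using l by (cases "j = []") (simp_all add: same_tail_def)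
 fix p assume p: "p < length j" "p \<notin> slots_of b j"
 thus "i ! p = j ! p" using k[of p] l slots_of_tail[OF t, of b] by (auto simp: nth_key_of)
qed

lemma key_class_card:
 assumes "j \<in> strings L" shows "2 ^ ((L - 4) div 24) \<le> card {i \<in> strings L. key_of False b i = key_of False b j}"
proof -
 let ?S = "slots_of b j"
 have S: "finite ?S" by (rule finite_subset[of _ "{..<length j}"]) (use slots_of_less[of _ b j] in force)+
 define h where "h T = map (%p. if p \<in> ?S then p \<in> T else j ! p) [0..<L]" for T
 have l: "length j = L" using assms by simp
 have hl: "length (h T) = L" "!!p. p < L ==> h T ! p = (if p \<in> ?S then p \<in> T else j ! p)" for T
  by (simp_all add: h_def)
 have "card (h ` Pow ?S) \<le> card {i \<in> strings L. key_of False b i = key_of False b j}"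
 proof (rule card_mono)
  show "h ` Pow ?S \<subseteq> {i \<in> strings L. key_of False b i = key_of False b j}"
  proof
   fix i assume "i \<in> h ` Pow ?S"
   then obtain T where T: "i = h T" by blast
   have tail: "h T ! p = j ! p" if "p < L" "L \<le> p + 4" for p
    using hl(2)[OF that(1), of T] slots_of_less[of p b j] that l by auto
   have "same_tail (h T) j"
    unfolding same_tail_def using hl(1)[of T] l tail[of "L - 2"] tail[of "L - 1"] by (cases "L = 0") auto
   hence s: "slots_of b (h T) = ?S" by (rule slots_of_tail)
   have "key_of False b (h T) = key_of False b j"
   proof (rule nth_equalityI)
    fix p assume "p < length (key_of False b (h T))"
    hence p: "p < L" by (simp add: length_key_of hl)
    show "key_of False b (h T) ! p = key_of False b j ! p"
     using p l hl(1)[of T] hl(2)[OF p, of T] tail[OF p] by (auto simp: nth_key_of s)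
   qed (simp add: length_key_of hl l)
   thus "i \<in> {i \<in> strings L. key_of False b i = key_of False b j}" using hl T by simp
  qed
 qed (rule finite_subset[OF _ finite_strings[of L]], blast)
 moreover have "inj_on h (Pow ?S)"
 proof (rule inj_onI)
  fix T T' assume T: "T \<in> Pow ?S" "T' \<in> Pow ?S" "h T = h T'"
  have "p \<in> T \<longleftrightarrow> p \<in> T'" for p
  proof (cases "p \<in> ?S")
   case True
   hence "p < L" using slots_of_less[OF True] l by simp
   thus ?thesis using hl(2)[of p T] hl(2)[of p T'] T(3) True by simp
  next
   case False
   thus ?thesis using T by blast
  qed
  thus "T = T'" by blast
 qed
 ultimately have "2 ^ card ?S \<le> card {i \<in> strings L. key_of False b i = key_of False b j}"
  by (simp add: card_image card_Pow S)
 moreover have "(2::nat) ^ ((L - 4) div 24) \<le> 2 ^ card ?S"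
  using card_slots[of L b] l by (intro power_increasing) (auto simp: slots_of_def)
 ultimately show ?thesis by linarith
qed

section \<open>The subspaces indexed by the Cantor space\<close>

abbreviation upto_len :: "nat => bool list set"
 where "upto_len L \<equiv> {i. length i \<le> L}"

lemma finite_upto_len: "finite (upto_len L)"
 using finite_lists_length_le[of "UNIV :: bool set" L] by simp

lemma collect_indices:
 fixes R :: "'j => 'i => 'k::real_normed_field"
 assumes "finite A" "finite I" "f ` A \<subseteq> I"
 shows "(\<Sum>j\<in>A. fscale (c j) (R (f j))) = (\<Sum>i\<in>I. fscale (\<Sum>j | j \<in> A \<and> f j = i. c j) (R i))"
proof -
 have "(\<Sum>i\<in>I. fscale (\<Sum>j | j \<in> A \<and> f j = i. c j) (R i)) = (\<Sum>i\<in>I. \<Sum>j | j \<in> A \<and> f j = i. fscale (c j) (R (f j)))"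
  unfolding fscale_sum_left by (intro sum.cong refl) auto
 also have "... = (\<Sum>j\<in>A. fscale (c j) (R (f j)))" by (rule sum.group[OF assms])
 finally show ?thesis by simp
qed

text \<open>Strings are mapped to their initial parts, many to one. Collecting coefficients turns
  sums over strings into combinations over the index set, where the bound of the operator is
  assumed.\<close>

lemma (in normed_fspace) collect_bound:
 fixes R Z :: "'j => 'i => 'k"
 assumes lin: "!!a. nrm X (\<Sum>i\<in>I. fscale (a i) (R i)) \<le> K * nrm X (\<Sum>i\<in>I. fscale (a i) (Z i))"
  and A: "finite A" "finite I" "f ` A \<subseteq> I" "g ` A \<subseteq> I"
 shows "nrm X (\<Sum>j\<in>A. fscale (c j) (R (f j)) + fscale (d j) (R (g j))) \<le>
  K * nrm X (\<Sum>j\<in>A. fscale (c j) (Z (f j)) + fscale (d j) (Z (g j)))"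
proof -
 have e: "(\<Sum>j\<in>A. fscale (c j) (W (f j)) + fscale (d j) (W (g j)))
   = (\<Sum>i\<in>I. fscale ((\<Sum>j | j \<in> A \<and> f j = i. c j) + (\<Sum>j | j \<in> A \<and> g j = i. d j)) (W i))" for W :: "'j => 'i => 'k"
  unfolding sum.distrib collect_indices[OF A(1,2,3)] collect_indices[OF A(1,2,4)] fscale_add_left by (rule refl)
 show ?thesis unfolding e by (rule lin)
qed

context szankowski
begin

lemma ev_add: "x \<in> vecs X ==> y \<in> vecs X ==> ev c j (x + y) = ev c j x + ev c j y"
 by (rule functionalD(2)[OF ev])

text \<open>A difference one level up plus a sum two levels up, each in the copy that \<xi> selects
  for the level. Both functionals \<open>u\<close> (a difference) and \<open>v\<close> (a sum) are
  therefore biorthogonal to the generators: a neighbouring generator contributes equal terms to the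
  difference and opposite terms to the sum.\<close>

definition Z :: "(nat => bool) => bool list => 'i => 'k"
 where "Z \<xi> i = V (\<xi> (length i + 1)) (i @ [False]) - V (\<xi> (length i + 1)) (i @ [True]) +
  (\<Sum>w\<in>strings 2. V (\<xi> (length i + 2)) (i @ w))"

definition u :: "(nat => bool) => bool list => ('i => 'k) => 'k"
 where "u \<xi> i x = (ev (\<xi> (length i + 1)) (i @ [False]) x - ev (\<xi> (length i + 1)) (i @ [True]) x) / 2"

definition v :: "(nat => bool) => bool list => ('i => 'k) => 'k"
 where "v \<xi> i x = (\<Sum>w\<in>strings 2. ev (\<xi> (length i + 2)) (i @ w) x) / 4"

definition Zs :: "(nat => bool) => nat => (bool list => 'k) => 'i => 'k"
 where "Zs \<xi> L a = (\<Sum>i\<in>upto_len L. fscale (a i) (Z \<xi> i))"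

definition Y :: "(nat => bool) => ('i => 'k) set"
 where "Y \<xi> = {y \<in> vecs X. \<forall>e>0. \<exists>L a. nrm X (y - Zs \<xi> L a) < e}"

lemma Z_in [simp]: "Z \<xi> i \<in> vecs X"
 by (simp add: Z_def)

lemma Zs_in [simp]: "Zs \<xi> L a \<in> vecs X"
 by (simp add: Zs_def)

lemma Y_vecs: "y \<in> Y \<xi> ==> y \<in> vecs X"
 by (simp add: Y_def)

lemma u_functional: "functional (u \<xi> i)"
proof -
 interpret D: normed_fspace "dual_space X" by (rule dual_normed)
 have "fscale (1 / 2) (ev (\<xi> (length i + 1)) (i @ [False]) - ev (\<xi> (length i + 1)) (i @ [True])) \<in> vecs (dual_space X)"
  by (intro D.scale_in D.diff_in) (simp_all add: in_dual ev)
 moreover have "fscale (1 / 2) (ev (\<xi> (length i + 1)) (i @ [False]) - ev (\<xi> (length i + 1)) (i @ [True])) = u \<xi> i"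
  by (simp add: fun_eq_iff fscale_def u_def)
 ultimately show ?thesis by (simp add: in_dual)
qed

lemma v_functional: "functional (v \<xi> i)"
proof -
 interpret D: normed_fspace "dual_space X" by (rule dual_normed)
 have "fscale (1 / 4) (\<Sum>w\<in>strings 2. ev (\<xi> (length i + 2)) (i @ w)) \<in> vecs (dual_space X)"
  by (intro D.scale_in D.sum_in) (simp_all add: in_dual ev)
 moreover have "fscale (1 / 4) (\<Sum>w\<in>strings 2. ev (\<xi> (length i + 2)) (i @ w)) = v \<xi> i"
  by (simp add: fun_eq_iff fscale_def v_def fun_sum)
 ultimately show ?thesis by (simp add: in_dual)
qed

lemma ev_Z: "ev c j (Z \<xi> k) = of_bool (c = \<xi> (length k + 1) \<and> j = k @ [False]) - of_bool (c = \<xi> (length k + 1) \<and> j = k @ [True])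
 + (\<Sum>w\<in>strings 2. of_bool (c = \<xi> (length k + 2) \<and> j = k @ w))"
proof -
 have "ev c j (Z \<xi> k) = ev c j (V (\<xi> (length k + 1)) (k @ [False])) - ev c j (V (\<xi> (length k + 1)) (k @ [True]))
  + (\<Sum>w\<in>strings 2. ev c j (V (\<xi> (length k + 2)) (k @ w)))"
  unfolding Z_def by (simp add: ev_add functional_diff[OF ev] functional_sum[OF ev])
 thus ?thesis by (simp add: ev_V of_bool_def)
qed

lemma u_Z: "u \<xi> i (Z \<xi> k) = (if i = k then 1 else 0)"
proof -
 have e: "(\<Sum>w\<in>strings 2. of_bool (\<xi> (length i + 1) = \<xi> (length k + 2) \<and> i @ [s] = k @ w))
   = (of_bool (\<xi> (length i + 1) = \<xi> (length k + 2) \<and> (\<exists>d. i = k @ [d])) :: 'k)" for s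
  unfolding strings_2 by (auto simp: of_bool_def)
 have 2: "ev (\<xi> (length i + 1)) (i @ [s]) (Z \<xi> k) = (if i = k then (if s then -1 else 1) else 0)
   + of_bool (\<xi> (length i + 1) = \<xi> (length k + 2) \<and> (\<exists>d. i = k @ [d]))" for s
  unfolding ev_Z e by (cases s) auto
 show ?thesis unfolding u_def 2 by simp
qed

lemma v_Z: "v \<xi> i (Z \<xi> k) = (if i = k then 1 else 0)"
proof -
 have e1: "(\<Sum>w\<in>strings 2. of_bool (\<xi> (length i + 2) = \<xi> (length k + 1) \<and> i @ w = k @ [s]))
   = (of_bool (\<xi> (length i + 2) = \<xi> (length k + 1) \<and> (\<exists>d. k = i @ [d])) :: 'k)" for s
  unfolding strings_2 by (auto simp: of_bool_def)
 have e2: "(\<Sum>w\<in>strings 2. \<Sum>w'\<in>strings 2. of_bool (\<xi> (length i + 2) = \<xi> (length k + 2) \<and> i @ w = k @ w'))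
   = (if i = k then 4 else 0 :: 'k)"
 proof (cases "i = k")
  case True
  have "(\<Sum>w\<in>strings 2. \<Sum>w'\<in>strings 2. of_bool (\<xi> (length i + 2) = \<xi> (length k + 2) \<and> i @ w = k @ w'))
    = (\<Sum>w\<in>strings 2. \<Sum>w'\<in>strings 2. if w' = w then 1 else 0 :: 'k)"
   using True by (intro sum.cong refl) auto
  also have "... = (\<Sum>w\<in>strings 2. 1)" by (rule sum.cong[OF refl]) (simp add: finite_strings)
  finally show ?thesis using True by (simp add: card_strings)
 next
  case False
  have "of_bool (\<xi> (length i + 2) = \<xi> (length k + 2) \<and> i @ w = k @ w') = (0 :: 'k)" if "w \<in> strings 2" "w' \<in> strings 2" for w w'
   using False that by simp
  hence "(\<Sum>w\<in>strings 2. \<Sum>w'\<in>strings 2. of_bool (\<xi> (length i + 2) = \<xi> (length k + 2) \<and> i @ w = k @ w')) = (0 :: 'k)"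
   by (intro sum.neutral ballI) auto
  thus ?thesis using False by simp
 qed
 show ?thesis unfolding v_def by (simp only: ev_Z sum.distrib sum_subtractf e1 e2) simp
qed

lemma functional_Zs: "functional f ==> f (Zs \<xi> L a) = (\<Sum>i\<in>upto_len L. a i * f (Z \<xi> i))"
 unfolding Zs_def by (simp add: functional_sum functionalD(3))

lemma functionals_eq_on_Y:
 assumes f: "functional f" and g: "functional g" and eq: "!!i. f (Z \<xi> i) = g (Z \<xi> i)" and y: "y \<in> Y \<xi>"
 shows "f y = g y"
proof -
 interpret D: normed_fspace "dual_space X" by (rule dual_normed)
 have fg: "functional (f - g)" using D.diff_in[of f g] f g by (simp add: in_dual)
 define K where "K = dnrm (f - g)"
 have K: "0 \<le> K" unfolding K_def by (rule dual_nonneg[OF fg])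
 have "norm (f y - g y) \<le> 0 + e" if e: "0 < e" for e
 proof -
  have "0 < e / (K + 1)" using e K by simp
  then obtain L a where La: "nrm X (y - Zs \<xi> L a) < e / (K + 1)" using y unfolding Y_def by blast
  have "(f - g) y = (f - g) (y - Zs \<xi> L a)"
   using functional_diff[OF fg Y_vecs[OF y], of "Zs \<xi> L a"] functional_Zs[OF fg, of \<xi> L a] eq by simp
  hence "norm (f y - g y) \<le> K * nrm X (y - Zs \<xi> L a)"
   using dual_bound[OF fg, of "y - Zs \<xi> L a"] Y_vecs[OF y] by (simp add: K_def)
  also have "... \<le> K * (e / (K + 1))" using La K by (intro mult_left_mono) auto
  also have "... \<le> e" using K e by (simp add: field_simps)
  finally show ?thesis by simp
 qed
 hence "norm (f y - g y) \<le> 0" by (rule field_le_epsilon)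
 thus ?thesis by simp
qed

lemma u_eq_v: "y \<in> Y \<xi> ==> u \<xi> i y = v \<xi> i y"
 by (rule functionals_eq_on_Y[OF u_functional v_functional]) (simp_all add: u_Z v_Z)

text \<open>The value at the identity is 1. The functionals \<open>u\<close> involve one level of strings and the functionals \<open>v\<close> the
 next one; as they agree on \<open>Y\<close>, the means of consecutive levels can be compared on a single level.\<close>

definition lmean :: "(nat => bool) => nat => (bool list => 'i => 'k) => 'k"
 where "lmean \<xi> n R = (\<Sum>i\<in>strings n. u \<xi> i (R i)) / 2 ^ n"

definition sg :: "bool => 'k" where "sg d = (if d then - 1 else 1)"

lemma beta_v:
 assumes "!!i. length i = n ==> R i \<in> Y \<xi>"
 shows "lmean \<xi> n R = (\<Sum>j\<in>strings (n + 2). ev (\<xi> (n + 2)) j (R (take n j))) / 2 ^ (n + 2)"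
proof -
 have "(\<Sum>i\<in>strings n. u \<xi> i (R i)) = (\<Sum>i\<in>strings n. v \<xi> i (R i))"
  by (intro sum.cong refl u_eq_v assms) simp
 also have "... = (\<Sum>i\<in>strings n. \<Sum>w\<in>strings 2. ev (\<xi> (n + 2)) (i @ w) (R (take n (i @ w)))) / 4"
  unfolding v_def sum_divide_distrib by (intro sum.cong refl) simp
 also have "... = (\<Sum>j\<in>strings (n + 2). ev (\<xi> (n + 2)) j (R (take n j))) / 4"
  by (simp only: sum_strings_append)
 finally have e: "(\<Sum>i\<in>strings n. u \<xi> i (R i)) = (\<Sum>j\<in>strings (n + 2). ev (\<xi> (n + 2)) j (R (take n j))) / 4" .
 show ?thesis unfolding lmean_def e by simp
qed

lemma beta_u:
 "lmean \<xi> (n + 1) R = (\<Sum>j\<in>strings (n + 2). ev (\<xi> (n + 2)) j (R (take (n + 1) j)) * sg (j ! (n + 1))) / 2 ^ (n + 2)"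
proof -
 have "(\<Sum>j\<in>strings (n + 2). ev (\<xi> (n + 2)) j (R (take (n + 1) j)) * sg (j ! (n + 1)))
  = (\<Sum>j\<in>strings (n + 1 + 1). ev (\<xi> (n + 2)) j (R (take (n + 1) j)) * sg (j ! (n + 1)))" by simp
 also have "... = (\<Sum>i\<in>strings (n + 1). \<Sum>w\<in>strings 1. ev (\<xi> (n + 2)) (i @ w) (R (take (n + 1) (i @ w))) * sg ((i @ w) ! (n + 1)))"
  by (rule sum_strings_append)
 also have "... = (\<Sum>i\<in>strings (n + 1). 2 * u \<xi> i (R i))"
  unfolding strings_1 by (intro sum.cong refl) (simp add: u_def sg_def nth_append)
 finally show ?thesis by (simp add: lmean_def sum_distrib_left[symmetric])
qed

lemma beta_step:
 assumes "!!i. length i = n \<or> length i = n + 1 ==> R i \<in> Y \<xi>"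
 shows "lmean \<xi> (n + 1) R - lmean \<xi> n R = (\<Sum>j\<in>strings (n + 2).
  ev (\<xi> (n + 2)) j (fscale (sg (j ! (n + 1))) (R (take (n + 1) j)) + fscale (- 1) (R (take n j)))) / 2 ^ (n + 2)"
proof -
 have "lmean \<xi> (n + 1) R - lmean \<xi> n R = (\<Sum>j\<in>strings (n + 2). ev (\<xi> (n + 2)) j (R (take (n + 1) j)) * sg (j ! (n + 1))
   - ev (\<xi> (n + 2)) j (R (take n j))) / 2 ^ (n + 2)"
  unfolding beta_u by (subst beta_v) (use assms in \<open>auto simp: sum_subtractf diff_divide_distrib\<close>)
 also have "... = (\<Sum>j\<in>strings (n + 2).
  ev (\<xi> (n + 2)) j (fscale (sg (j ! (n + 1))) (R (take (n + 1) j)) + fscale (- 1) (R (take n j)))) / 2 ^ (n + 2)"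
 proof (intro arg_cong2[of _ _ _ _ "(/)"] sum.cong refl)
  fix j :: "bool list" assume "j \<in> strings (n + 2)"
  hence "R (take (n + 1) j) \<in> vecs X" "R (take n j) \<in> vecs X"
   using Y_vecs[OF assms[of "take (n + 1) j"]] Y_vecs[OF assms[of "take n j"]] by simp_all
  thus "ev (\<xi> (n + 2)) j (R (take (n + 1) j)) * sg (j ! (n + 1)) - ev (\<xi> (n + 2)) j (R (take n j)) =
   ev (\<xi> (n + 2)) j (fscale (sg (j ! (n + 1))) (R (take (n + 1) j)) + fscale (- 1) (R (take n j)))"
   by (simp add: ev_add functionalD(3)[OF ev] mult.commute)
 qed
 finally show ?thesis .
qed

section \<open>Signed sums of vectors along fibres\<close>

definition spn :: "bool list set => (bool list => 'i => 'k) => real => bool"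
 where "spn A x r \<longleftrightarrow> (\<forall>a. (\<forall>j\<in>A. \<bar>a j\<bar> = 1) --> nrm X (signed_sum A a x) \<le> r)"

lemma spnI: "(!!a. (!!j. j \<in> A ==> \<bar>a j\<bar> = 1) ==> nrm X (signed_sum A a x) \<le> r) ==> spn A x r"
 unfolding spn_def by simp

lemma spnD: "spn A x r ==> (!!j. j \<in> A ==> \<bar>a j\<bar> = 1) ==> nrm X (signed_sum A a x) \<le> r"
 unfolding spn_def by simp

lemma spn_add:
 assumes "spn A x r" "spn A y s" "!!j. j \<in> A ==> x j \<in> vecs X \<and> y j \<in> vecs X"
 shows "spn A (%j. x j + y j) (r + s)"
proof (rule spnI)
 fix a :: "bool list => real" assume a: "!!j. j \<in> A ==> \<bar>a j\<bar> = 1"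
 have "nrm X (signed_sum A a x + signed_sum A a y)
  \<le> nrm X (signed_sum A a x) + nrm X (signed_sum A a y)"
  using assms(3) by (intro triangle sum_in scale_in) auto
 also have "... \<le> r + s" by (intro add_mono spnD[OF assms(1)] spnD[OF assms(2)] a)
 finally show "nrm X (\<Sum>j\<in>A. fscale (of_real (a j)) (x j + y j)) \<le> r + s"
  by (simp only: fscale_add_right sum.distrib)
qed

lemma spn_scale:
 assumes "spn A x r" "norm s \<le> 1" "!!j. j \<in> A ==> x j \<in> vecs X"
 shows "spn A (%j. fscale s (x j)) r"
proof (rule spnI)
 fix a :: "bool list => real" assume a: "!!j. j \<in> A ==> \<bar>a j\<bar> = 1"
 have in': "signed_sum A a x \<in> vecs X" using assms(3) by (intro sum_in scale_in) auto
 have "(\<Sum>j\<in>A. fscale (of_real (a j)) (fscale s (x j))) = fscale s (signed_sum A a x)"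
  by (simp add: fscale_sum fscale_fscale mult.commute)
 hence "nrm X (\<Sum>j\<in>A. fscale (of_real (a j)) (fscale s (x j))) = norm s * nrm X (signed_sum A a x)"
  using scale[OF in'] by simp
 also have "... \<le> 1 * nrm X (signed_sum A a x)" using assms(2) in' by (intro mult_right_mono) auto
 also have "... \<le> r" using spnD[OF assms(1) a] by simp
 finally show "nrm X (\<Sum>j\<in>A. fscale (of_real (a j)) (fscale s (x j))) \<le> r" .
qed

lemma spn_cong: "spn A x r ==> (!!j. j \<in> A ==> y j = x j) ==> spn A y r"
 unfolding spn_def by (simp cong: sum.cong)

lemma spn_sum:
 assumes "finite W" "!!w. w \<in> W ==> spn A (x w) r" "!!w j. w \<in> W ==> j \<in> A ==> x w j \<in> vecs X"
 shows "spn A (%j. \<Sum>w\<in>W. x w j) (real (card W) * r)"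
 using assms
proof (induction W)
 case empty
 thus ?case
  by (intro spnI) (simp only: sum.empty fscale_zero sum.neutral_const nrm_zero card.empty of_nat_0 mult_zero_left order_refl)
next
 case (insert w W)
 have "spn A (%j. x w j + (\<Sum>w\<in>W. x w j)) (r + real (card W) * r)"
  using insert by (intro spn_add) auto
 hence "spn A (%j. x w j + (\<Sum>w\<in>W. x w j)) (real (card (insert w W)) * r)"
  using insert(1,2) by (simp add: algebra_simps)
 thus ?case by (rule spn_cong) (simp only: sum.insert[OF insert(1,2)])
qed

text \<open>Replacing the tail of the strings in a fibre moves the free positions of the fibre outside the slots of the
 new strings.\<close>

lemma spn_V:
 assumes A: "A \<subseteq> strings L" "fibre c A" and L: "6 \<le> L" and m: "m = L - 1 \<or> m = L - 2" and w: "w \<noteq> []" "length w \<le> 2"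
  and disj: "!!j. j \<in> A ==> slots_of c' (take m j @ w) \<inter> slots_of c j = {}"
 shows "spn A (%j. V c' (take m j @ w)) (D * real (card A) powr q)"
proof (rule spnI)
 fix a :: "bool list => real" assume a: "!!j. j \<in> A ==> \<bar>a j\<bar> = 1"
 define \<psi> where "\<psi> j = take m j @ w" for j
 have len: "length j = L" if "j \<in> A" for j using A(1) that by blast
 have off: "i ! p = j ! p" if "i \<in> A" "j \<in> A" "p < L" "p \<notin> slots_of c j" for i j p
  using A(2) that len[OF that(2)] unfolding fibre_def by blast
 \<comment> \<open>Slots stop four places before the end, so the strings of a fibre agree on all
   places that the new tail replaces and on the last two places of the new strings.\<close>
 have late: "i ! p = j ! p" if "i \<in> A" "j \<in> A" "p < L" "L \<le> p + 4" for i j p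
  by (rule off[OF that(1-3)]) (use slots_of_less[of p c j] len[OF that(2)] that(4) in auto)
 have mL: "m \<le> L" "L \<le> m + 2" using m L by auto
 have inj: "inj_on \<psi> A"
 proof (rule inj_onI)
  fix i j assume ij: "i \<in> A" "j \<in> A" "\<psi> i = \<psi> j"
  show "i = j"
  proof (rule nth_equalityI)
   show "length i = length j" using len ij by simp
   fix p assume "p < length i"
   hence p: "p < L" using len ij by simp
   show "i ! p = j ! p"
   proof (cases "p < m")
    case True
    have "\<psi> i ! p = \<psi> j ! p" using ij(3) by simp
    thus ?thesis using True len[OF ij(1)] len[OF ij(2)] mL by (simp add: \<psi>_def nth_append)
   next
    case False
    thus ?thesis using mL p by (intro late[OF ij(1,2)]) auto
   qed
  qed
 qed
 define L' where "L' = m + length w"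
 have len': "length (\<psi> j) = L'" if "j \<in> A" for j using len[OF that] mL by (simp add: \<psi>_def L'_def)
 have L': "L' \<le> L + 1" "m + 1 \<le> L'" "L' \<le> m + 2" using m w L by (auto simp: L'_def Suc_le_eq)
 have nth: "\<psi> i ! p = \<psi> j ! p" if "i \<in> A" "j \<in> A" "p < L'" "p < m ==> i ! p = j ! p" for i j p
  using that len[OF that(1)] len[OF that(2)] mL by (cases "p < m") (auto simp: \<psi>_def nth_append)
 have "spread c' (\<psi> ` A)"
  unfolding spread_def
 proof (intro ballI conjI)
  fix i' j' assume "i' \<in> \<psi> ` A" "j' \<in> \<psi> ` A"
  then obtain i j where i: "i' = \<psi> i" "i \<in> A" and j: "j' = \<psi> j" "j \<in> A" by blast
  have "\<psi> i ! (L' - 2) = \<psi> j ! (L' - 2)" "\<psi> i ! (L' - 1) = \<psi> j ! (L' - 1)"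
   by (rule nth[OF i(2) j(2)]; (rule late[OF i(2) j(2)])?; use L' mL L in linarith)+
  thus "same_tail i' j'" by (simp add: same_tail_def i(1) j(1) len'[OF i(2)] len'[OF j(2)])
  fix p assume p: "p \<in> slots_of c' j'"
  have p': "p + 4 < L'" using slots_of_less[OF p] len'[OF j(2)] j(1) by simp
  have "p \<notin> slots_of c j" using disj[OF j(2)] p j(1) by (auto simp: \<psi>_def)
  thus "i' ! p = j' ! p" unfolding i(1) j(1) using p' L' mL by (intro nth off i(2) j(2)) auto
 qed
 moreover have "\<psi> ` A \<subseteq> strings L'" using len' by auto
 ultimately have "nrm X (\<Sum>k\<in>\<psi> ` A. fscale (of_real (a (inv_into A \<psi> k))) (V c' k)) \<le> D * real (card (\<psi> ` A)) powr q"
  by (intro spread_bound) (use a inj in \<open>auto simp: inv_into_f_f\<close>)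
 thus "nrm X (\<Sum>j\<in>A. fscale (of_real (a j)) (V c' (take m j @ w))) \<le> D * real (card A) powr q"
  by (simp add: sum.reindex[OF inj] card_image[OF inj] inv_into_f_f[OF inj] \<psi>_def[symmetric])
qed

end

lemma slots_of_disjoint:
 assumes "length i mod 3 \<noteq> length j mod 3 \<or> c' \<noteq> c \<or> i ! (length i - 2) \<noteq> j ! (length j - 2) \<or> i ! (length i - 1) \<noteq> j ! (length j - 1)"
 shows "slots_of c' i \<inter> slots_of c j = {}"
proof (rule ccontr)
 assume "\<not> ?thesis"
 then obtain x where "x \<in> slots_of c' i" "x \<in> slots_of c j" by blast
 thus False using assms unfolding slots_of_def by (metis slots_disjoint)
qed

context szankowski
begin

abbreviation unit_bound :: "bool list set => real"
 where "unit_bound A \<equiv> D * real (card A) powr q"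

text \<open>Strings of the lengths n + 1, n + 2 and n + 3 have slots of different residues
  \<open>N mod 3\<close>, so a new tail that changes the length always spreads the fibre. At equal
  length another copy or other last bits are required.\<close>

lemma spn_above:
 assumes "A \<subseteq> strings (n + 2)" "fibre c A" "4 \<le> n" "w \<in> strings 2"
 shows "spn A (%j. V c' (take (n + 1) j @ w)) (unit_bound A)"
proof (rule spn_V[OF assms(1,2)])
 fix j assume "j \<in> A"
 hence l: "length j = n + 2" using assms(1) by blast
 have "(n + 3) mod 3 \<noteq> (n + 2) mod 3" by presburger
 thus "slots_of c' (take (n + 1) j @ w) \<inter> slots_of c j = {}"
  using l assms(4) by (intro slots_of_disjoint disjI1) simp
qed (use assms in auto)

lemma spn_below:
 assumes "A \<subseteq> strings (n + 2)" "fibre c A" "4 \<le> n"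
 shows "spn A (%j. V c' (take n j @ [d])) (unit_bound A)"
proof (rule spn_V[OF assms(1,2)])
 fix j assume "j \<in> A"
 hence l: "length j = n + 2" using assms(1) by blast
 have "(n + 1) mod 3 \<noteq> (n + 2) mod 3" by presburger
 thus "slots_of c' (take n j @ [d]) \<inter> slots_of c j = {}"
  using l by (intro slots_of_disjoint disjI1) simp
qed (use assms in auto)

lemma spn_same:
 assumes A: "A \<subseteq> strings (n + 2)" "fibre c A" "4 \<le> n" and w: "w \<in> strings 2"
  and ne: "c' \<noteq> c \<or> (\<forall>j\<in>A. w \<noteq> [j ! n, j ! (n + 1)])"
 shows "spn A (%j. V c' (take n j @ w)) (unit_bound A)"
proof (rule spn_V[OF A(1,2)])
 fix j assume j: "j \<in> A"
 hence l: "length j = n + 2" using A(1) by blast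
 obtain w0 w1 where w': "w = [w0, w1]" using w by (auto simp: length_Suc_conv numeral_2_eq_2)
 show "slots_of c' (take n j @ w) \<inter> slots_of c j = {}"
  by (rule slots_of_disjoint) (use ne j l w' in \<open>auto simp: nth_append\<close>)
qed (use A w in auto)

lemma spn_mono: "spn A x r ==> r \<le> s ==> spn A x s"
 unfolding spn_def by (meson order_trans)

lemma unit_bound_nonneg: "0 \<le> unit_bound A"
 using D by simp

text \<open>The six vectors of the generator avoid the string j in the copy c, because \<xi> selects
  the other copy at this length. So the generator is small by itself, without a cancellation. The
  constant 10 is that of \<open>spn_step\<close>, where 4 + 1 + 1 + 1 + 3 vectors occur.\<close>

lemma spn_split:
 assumes A: "A \<subseteq> strings (n + 2)" "fibre c A" "4 \<le> n" and c: "c \<noteq> \<xi> (n + 2)"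
 shows "spn A (%j. Z \<xi> (take n j)) (10 * unit_bound A)"
proof -
 have 1: "spn A (%j. V (\<xi> (n + 1)) (take n j @ [False])) (unit_bound A)" by (rule spn_below[OF A])
 have 2: "spn A (%j. fscale (- 1) (V (\<xi> (n + 1)) (take n j @ [True]))) (unit_bound A)"
  by (intro spn_scale spn_below[OF A]) auto
 have 3: "spn A (%j. \<Sum>w\<in>strings 2. V (\<xi> (n + 2)) (take n j @ w)) (real (card (strings 2)) * unit_bound A)"
  using c by (intro spn_sum finite_strings spn_same[OF A]) auto
 have "spn A (%j. V (\<xi> (n + 1)) (take n j @ [False]) + fscale (- 1) (V (\<xi> (n + 1)) (take n j @ [True]))
   + (\<Sum>w\<in>strings 2. V (\<xi> (n + 2)) (take n j @ w))) (unit_bound A + unit_bound A + real (card (strings 2)) * unit_bound A)"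
  by (intro spn_add 1 2 3) auto
 hence "spn A (%j. V (\<xi> (n + 1)) (take n j @ [False]) + fscale (- 1) (V (\<xi> (n + 1)) (take n j @ [True]))
   + (\<Sum>w\<in>strings 2. V (\<xi> (n + 2)) (take n j @ w))) (10 * unit_bound A)"
  by (rule spn_mono) (use unit_bound_nonneg[of A] in \<open>simp add: card_strings\<close>)
 thus ?thesis
 proof (rule spn_cong)
  fix j assume "j \<in> A"
  hence "length (take n j) = n" using A(1) by auto
  thus "Z \<xi> (take n j) = V (\<xi> (n + 1)) (take n j @ [False]) + fscale (- 1) (V (\<xi> (n + 1)) (take n j @ [True]))
   + (\<Sum>w\<in>strings 2. V (\<xi> (n + 2)) (take n j @ w))" by (simp only: Z_def fscale_minus_one add_uminus_conv_diff)
 qed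
qed

text \<open>The basis vector of the string \<open>j\<close> itself cancels in this difference.\<close>

lemma spn_step:
 assumes A: "A \<subseteq> strings (n + 2)" "fibre (\<xi> (n + 2)) A" "4 \<le> n"
 shows "spn A (%j. fscale (sg (j ! (n + 1))) (Z \<xi> (take (n + 1) j)) + fscale (- 1) (Z \<xi> (take n j))) (10 * unit_bound A)"
proof (cases "A = {}")
 case True
 thus ?thesis using unit_bound_nonneg[of A] by (intro spnI) simp
next
 case False
 then obtain j0 where j0: "j0 \<in> A" by blast
 define c d where "c = j0 ! n" and "d = j0 ! (n + 1)"
 have cd: "length j = n + 2" "j ! n = c" "j ! (n + 1) = d" if "j \<in> A" for j
 proof -
  show l: "length j = n + 2" using that A(1) by blast
  have "same_tail j j0" using A(2) that j0 unfolding fibre_def by blast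
  moreover have "length j0 = n + 2" using j0 A(1) by blast
  ultimately show "j ! n = c" "j ! (n + 1) = d" using l by (simp_all add: same_tail_def c_def d_def)
 qed
 let ?W = "strings 2 - {[c, d]}"
 have W: "finite ?W" "card ?W = 3" using finite_strings by (simp_all add: card_strings card_Diff_singleton)
 have sgd: "norm (sg d) \<le> 1" by (simp add: sg_def)
 have 1: "spn A (%j. fscale (sg d) (\<Sum>w\<in>strings 2. V (\<xi> (n + 3)) (take (n + 1) j @ w))) (real (card (strings 2)) * unit_bound A)"
  by (intro spn_scale sgd spn_sum finite_strings spn_above[OF A]) auto
 have 2: "spn A (%j. fscale (- 1) (V (\<xi> (n + 1)) (take n j @ [False]))) (unit_bound A)"
  by (intro spn_scale spn_below[OF A]) auto
 have 3: "spn A (%j. V (\<xi> (n + 1)) (take n j @ [True])) (unit_bound A)" by (rule spn_below[OF A])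
 have 4: "spn A (%j. fscale (- 1) (V (\<xi> (n + 2)) (take n j @ [c, \<not> d]))) (unit_bound A)"
  using cd by (intro spn_scale spn_same[OF A]) auto
 have 5: "spn A (%j. fscale (- 1) (\<Sum>w\<in>?W. V (\<xi> (n + 2)) (take n j @ w))) (real (card ?W) * unit_bound A)"
  using cd W by (intro spn_scale spn_sum spn_same[OF A]) auto
 let ?x = "%j. fscale (sg d) (\<Sum>w\<in>strings 2. V (\<xi> (n + 3)) (take (n + 1) j @ w))
  + fscale (- 1) (V (\<xi> (n + 1)) (take n j @ [False])) + V (\<xi> (n + 1)) (take n j @ [True])
  + fscale (- 1) (V (\<xi> (n + 2)) (take n j @ [c, \<not> d])) + fscale (- 1) (\<Sum>w\<in>?W. V (\<xi> (n + 2)) (take n j @ w))"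
 have "spn A ?x (real (card (strings 2)) * unit_bound A + unit_bound A + unit_bound A + unit_bound A + real (card ?W) * unit_bound A)"
  by (intro spn_add 1 2 3 4 5) auto
 hence "spn A ?x (10 * unit_bound A)"
  by (rule spn_mono) (simp add: card_strings W(2))
 thus ?thesis
 proof (rule spn_cong)
  fix j assume j: "j \<in> A"
  note jl = cd[OF j]
  have t: "take (n + 1) j = take n j @ [c]" using jl by (simp add: take_Suc_conv_app_nth)
  have l: "length (take n j) = n" "length (take (n + 1) j) = n + 1" using jl by simp_all
  define S where "S = (\<Sum>w\<in>strings 2. V (\<xi> (n + 3)) (take (n + 1) j @ w))"
  define T where "T = (\<Sum>w\<in>?W. V (\<xi> (n + 2)) (take n j @ w))"
  define e where "e s = V (\<xi> (n + 2)) (take n j @ [c, s])" for s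
  define f where "f s = V (\<xi> (n + 1)) (take n j @ [s])" for s
  have "(\<Sum>w\<in>strings 2. V (\<xi> (n + 2)) (take n j @ w)) = e d + T"
   unfolding T_def e_def by (rule sum.remove) (use finite_strings in auto)
  hence z0: "Z \<xi> (take n j) = f False - f True + (e d + T)" unfolding Z_def l by (simp only: f_def)
  have "n + 1 + 1 = n + 2" "n + 1 + 2 = n + 3" by simp_all
  hence "Z \<xi> (take (n + 1) j) = V (\<xi> (n + 2)) (take (n + 1) j @ [False]) - V (\<xi> (n + 2)) (take (n + 1) j @ [True]) + S"
   unfolding Z_def l S_def by (simp only:)
  hence z1: "Z \<xi> (take (n + 1) j) = e False - e True + S"
   by (simp only: t e_def append_assoc append_Cons append_Nil)
  have "fscale (sg d) (Z \<xi> (take (n + 1) j)) + fscale (- 1) (Z \<xi> (take n j))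
   = fscale (sg d) S + fscale (- 1) (f False) + f True + fscale (- 1) (e (\<not> d)) + fscale (- 1) T"
   unfolding z0 z1 by (cases d) (simp_all add: sg_def fscale_minus_one algebra_simps)
  thus "fscale (sg (j ! (n + 1))) (Z \<xi> (take (n + 1) j)) + fscale (- 1) (Z \<xi> (take n j)) = ?x j"
   unfolding jl(3) S_def T_def e_def f_def .
 qed
qed

section \<open>Decay of the means over the levels\<close>

definition eps :: "nat => real" where "eps L = (2 ^ ((L - 4) div 24)) powr (p + q - 1)"

text \<open>Think of \<open>r j\<close> as the image of \<open>x j\<close> under an operator of norm
  K. For each choice of signs, the functionals cost card^p, and the signed sum of the r_j has norm
  at most a multiple of card^q; averaging over the signs leaves the diagonal.\<close>

lemma fibre_estimate:
 assumes A: "A \<subseteq> strings L" "fibre c A" and sp: "spn A x (10 * unit_bound A)" and K: "0 \<le> K"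
  and r: "!!a. (!!j. j \<in> A ==> \<bar>a j\<bar> = 1) ==>
   nrm X (signed_sum A a r) \<le> K * nrm X (signed_sum A a x)"
  and r_in: "!!j. j \<in> A ==> r j \<in> vecs X"
 shows "norm (\<Sum>j\<in>A. ev c j (r j)) \<le> K * (10 * D\<^sup>2) * real (card A) powr (p + q)"
proof (rule diagonal_le_signs[where t = "%i j. ev c i (r j)"])
 show fin: "finite A" using A(1) finite_strings by (rule finite_subset)
 fix \<omega> assume \<omega>: "\<omega> \<in> signs A"
 have a: "\<bar>\<omega> j\<bar> = 1" if "j \<in> A" for j using sign_cases[OF \<omega> that] by auto
 define w where "w = signed_sum A \<omega> r"
 have w: "w \<in> vecs X" unfolding w_def using r_in by (intro sum_in scale_in) auto
 have "ev c i w = (\<Sum>j\<in>A. of_real (\<omega> j) * ev c i (r j))" for i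
  unfolding w_def using r_in by (subst functional_sum[OF ev]) (auto simp: functionalD(3)[OF ev])
 hence "(\<Sum>i\<in>A. \<Sum>j\<in>A. of_real (\<omega> i * \<omega> j) * ev c i (r j)) = (\<Sum>i\<in>A. of_real (\<omega> i) * ev c i w)"
  by (simp add: sum_distrib_left mult.assoc)
 also have "norm ... \<le> D * real (card A) powr p * nrm X w" by (rule fibre_bound[OF A a w])
 also have "... \<le> D * real (card A) powr p * (K * (10 * unit_bound A))"
 proof (rule mult_left_mono)
  have "nrm X w \<le> K * nrm X (signed_sum A \<omega> x)" unfolding w_def by (rule r[OF a])
  also have "... \<le> K * (10 * unit_bound A)" by (intro mult_left_mono spnD[OF sp] a K)
  finally show "nrm X w \<le> K * (10 * unit_bound A)" .
 qed (use D in simp)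
 also have "... = K * (10 * D\<^sup>2) * real (card A) powr (p + q)"
  by (simp add: powr_add power2_eq_square)
 finally show "norm (\<Sum>i\<in>A. \<Sum>j\<in>A. of_real (\<omega> i * \<omega> j) * ev c i (r j)) \<le> K * (10 * D\<^sup>2) * real (card A) powr (p + q)" .
qed

text \<open>A fibre contributes its cardinality times card^(p+q-1). The exponent is negative and
  fibres have at least 2^((L-4) div 24) strings, so the mean over the level gains the factor
  \<open>eps L\<close>.\<close>

lemma level_estimate:
 assumes sp: "!!A. A \<subseteq> strings L ==> fibre c A ==> spn A x (10 * unit_bound A)" and K: "0 \<le> K"
  and r: "!!A a. A \<subseteq> strings L ==> (!!j. j \<in> A ==> \<bar>a j\<bar> = 1) ==>
   nrm X (signed_sum A a r) \<le> K * nrm X (signed_sum A a x)"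
  and r_in: "!!j. j \<in> strings L ==> r j \<in> vecs X"
 shows "norm ((\<Sum>j\<in>strings L. ev c j (r j)) / 2 ^ L) \<le> K * (10 * D\<^sup>2) * eps L"
proof -
 let ?k = "key_of False c" and ?B = "K * (10 * D\<^sup>2)"
 let ?A = "%y. {j \<in> strings L. ?k j = y}"
 have B: "0 \<le> ?B" using K by simp
 have est: "norm (\<Sum>j\<in>?A y. ev c j (r j)) \<le> ?B * eps L * real (card (?A y))" if y: "y \<in> ?k ` strings L" for y
 proof -
  have sub: "?A y \<subseteq> strings L" by blast
  obtain j where j: "j \<in> strings L" "y = ?k j" using y by blast
  have "2 ^ ((L - 4) div 24) \<le> card (?A y)" unfolding j(2) by (rule key_class_card[OF j(1)])
  from of_nat_mono[OF this, where 'a = real] have M: "2 ^ ((L - 4) div 24) \<le> real (card (?A y))"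
   by (simp only: of_nat_power of_nat_numeral)
  hence pos: "0 < real (card (?A y))" by (rule less_le_trans[rotated]) simp
  have "norm (\<Sum>j\<in>?A y. ev c j (r j)) \<le> ?B * real (card (?A y)) powr (p + q)"
   by (rule fibre_estimate[OF sub key_class_fibre sp[OF sub key_class_fibre] K]) (use r[OF sub] r_in in auto)
  also have "real (card (?A y)) powr (p + q) = real (card (?A y)) powr (p + q - 1) * real (card (?A y))"
   using pos by (simp add: powr_diff)
  also have "?B * ... \<le> ?B * (eps L * real (card (?A y)))"
   unfolding eps_def by (intro mult_left_mono mult_right_mono powr_mono2' M B) (use pq in auto)
  finally show ?thesis by (simp add: mult.assoc)
 qed
 have "(\<Sum>j\<in>strings L. ev c j (r j)) = (\<Sum>y\<in>?k ` strings L. \<Sum>j\<in>?A y. ev c j (r j))"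
  by (rule sum.image_gen[OF finite_strings])
 also have "norm ... \<le> (\<Sum>y\<in>?k ` strings L. ?B * eps L * real (card (?A y)))"
  by (rule sum_norm_le[OF est])
 also have "... = ?B * eps L * (\<Sum>y\<in>?k ` strings L. \<Sum>j\<in>?A y. 1)" by (simp add: sum_distrib_left)
 also have "(\<Sum>y\<in>?k ` strings L. \<Sum>j\<in>?A y. 1) = (\<Sum>j\<in>strings L. 1 :: real)"
  by (rule sum.image_gen[OF finite_strings, symmetric])
 also have "... = 2 ^ L" by (simp add: card_strings)
 finally show ?thesis by (simp add: norm_divide norm_power divide_le_eq)
qed

lemma summable_eps: "summable eps"
proof -
 define s where "s = p + q - 1"
 have s: "s < 0" using pq by (simp add: s_def)
 have "eps L \<le> 2 powr (- (28 / 24) * s) * (2 powr (s / 24)) ^ L" for L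
 proof -
  \<comment> \<open>The 28 absorbs the remainder of the division and the four places without
    slots.\<close>
  have "L \<le> 24 * ((L - 4) div 24) + 28" by presburger
  from of_nat_mono[OF this, where 'a = real] have "real L \<le> 24 * real ((L - 4) div 24) + 28"
   by (simp only: of_nat_add of_nat_mult of_nat_numeral)
  hence "real ((L - 4) div 24) * s \<le> (real L - 28) / 24 * s" using s by (intro mult_right_mono_neg) auto
  hence "2 powr (real ((L - 4) div 24) * s) \<le> 2 powr ((real L - 28) / 24 * s)" by simp
  also have "... = 2 powr (- (28 / 24) * s + s / 24 * real L)" by (rule arg_cong[of _ _ "(powr) 2"]) (simp add: field_simps)
  also have "... = 2 powr (- (28 / 24) * s) * (2 powr (s / 24)) ^ L"
   by (simp only: powr_add powr_powr[symmetric]) (simp add: powr_realpow)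
  finally show ?thesis by (simp add: eps_def s_def powr_realpow[symmetric] powr_powr)
 qed
 hence le: "norm (eps L) \<le> 2 powr (- (28 / 24) * s) * (2 powr (s / 24)) ^ L" for L by (simp add: eps_def)
 have "summable (%L. 2 powr (- (28 / 24) * s) * (2 powr (s / 24)) ^ L)"
 proof -
  have "2 powr (s / 24) < 2 powr (0 :: real)" using s by (intro powr_less_mono) auto
  thus ?thesis by (intro summable_mult summable_geometric) simp
 qed
 thus ?thesis by (rule summable_comparison_test') (rule le)
qed

text \<open>\<open>R i\<close> stands for the image of \<open>Z \<xi> i\<close> under an operator of
  norm at most K into the other subspace. It is needed only for generators of length at most M, the
  place where \<xi> and \<xi>' split.\<close>

definition small :: "real => nat => bool"
 where "small \<delta> n0 \<longleftrightarrow> (\<forall>K M \<xi> \<xi>' R. 0 \<le> K --> n0 + 2 \<le> M --> agree {..<M} \<xi> \<xi>' --> \<xi> M \<noteq> \<xi>' M -->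
  (\<forall>i. length i \<le> M --> R i \<in> Y \<xi>') -->
  (\<forall>a. nrm X (\<Sum>i\<in>upto_len M. fscale (a i) (R i)) \<le> K * nrm X (Zs \<xi> M a)) --> norm (lmean \<xi>' n0 R) \<le> K * \<delta>)"

text \<open>At M the copies differ, so \<open>spn_split\<close> bounds the mean of level M - 2
  outright. Below that, down to n0, consecutive means differ by terms controlled by
  \<open>spn_step\<close>. Everything adds up to a section of the convergent series of
  \<open>eps\<close>, taken from n0 + 2 on.\<close>

theorem small_exists:
 assumes "0 < \<delta>"
 shows "\<exists>n0. small \<delta> n0"
proof -
 let ?B = "10 * D\<^sup>2"
 have B: "0 < ?B" using D by simp
 have "0 < \<delta> / ?B" using assms B by simp
 then obtain n1 where n1: "!!m n. n1 \<le> m ==> norm (\<Sum>L\<in>{m..<n}. eps L) < \<delta> / ?B"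
  using summable_eps unfolding summable_Cauchy by blast
 define n0 where "n0 = max n1 4"
 have main: "norm (lmean \<xi>' n0 R) \<le> K * \<delta>"
  if K: "0 \<le> K" and M: "n0 + 2 \<le> M" and ag: "agree {..<M} \<xi> \<xi>'" and ne: "\<xi> M \<noteq> \<xi>' M"
   and R: "!!i. length i \<le> M ==> R i \<in> Y \<xi>'"
   and bd: "!!a. nrm X (\<Sum>i\<in>upto_len M. fscale (a i) (R i)) \<le> K * nrm X (Zs \<xi> M a)"
  for K M \<xi> \<xi>' R
 proof -
  have lin: "nrm X (\<Sum>i\<in>upto_len M. fscale (a i) (R i)) \<le> K * nrm X (\<Sum>i\<in>upto_len M. fscale (a i) (Z \<xi> i))" for a
   using bd[of a] unfolding Zs_def .
  have Rv: "R i \<in> vecs X" if "length i \<le> M" for i using R[OF that] by (rule Y_vecs)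
  have last: "norm (lmean \<xi>' (M - 2) R) \<le> K * ?B * eps M"
  proof -
   have M2: "M = (M - 2) + 2" "4 \<le> M - 2" using M by (auto simp: n0_def)
   have e: "lmean \<xi>' (M - 2) R = (\<Sum>j\<in>strings M. ev (\<xi>' M) j (R (take (M - 2) j))) / 2 ^ M"
   proof -
    have "lmean \<xi>' (M - 2) R = (\<Sum>j\<in>strings (M - 2 + 2). ev (\<xi>' (M - 2 + 2)) j (R (take (M - 2) j))) / 2 ^ (M - 2 + 2)"
     by (rule beta_v) (use R in auto)
    thus ?thesis by (simp only: M2(1)[symmetric])
   qed
   show ?thesis
    unfolding e
   proof (rule level_estimate[OF _ K, where x = "%j. Z \<xi> (take (M - 2) j)"])
    fix A assume A: "A \<subseteq> strings M" "fibre (\<xi>' M) A"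
    show "spn A (%j. Z \<xi> (take (M - 2) j)) (10 * unit_bound A)"
     by (rule spn_split[of A "M - 2" "\<xi>' M"]) (use A M2 ne in auto)
   next
    fix A and a :: "bool list => real" assume A: "A \<subseteq> strings M"
    have fin: "finite A" using A finite_strings by (rule finite_subset)
    have im: "take (M - 2) ` A \<subseteq> upto_len M" by auto
    show "nrm X (\<Sum>j\<in>A. fscale (of_real (a j)) (R (take (M - 2) j))) \<le> K * nrm X (\<Sum>j\<in>A. fscale (of_real (a j)) (Z \<xi> (take (M - 2) j)))"
     using collect_bound[OF lin fin finite_upto_len im im, of "%j. of_real (a j)" "%_. 0"] by simp
   qed (use Rv in auto)
  qed
  have incr: "norm (lmean \<xi>' (n + 1) R - lmean \<xi>' n R) \<le> K * ?B * eps (n + 2)" if n: "n0 \<le> n" "n + 2 < M" for n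
  proof -
   have e: "lmean \<xi>' (n + 1) R - lmean \<xi>' n R = (\<Sum>j\<in>strings (n + 2).
    ev (\<xi>' (n + 2)) j (fscale (sg (j ! (n + 1))) (R (take (n + 1) j)) + fscale (- 1) (R (take n j)))) / 2 ^ (n + 2)"
    by (rule beta_step) (use R n in auto)
   show ?thesis
    unfolding e
   proof (rule level_estimate[OF _ K,
     where x = "%j. fscale (sg (j ! (n + 1))) (Z \<xi> (take (n + 1) j)) + fscale (- 1) (Z \<xi> (take n j))"])
    fix A assume A: "A \<subseteq> strings (n + 2)" "fibre (\<xi>' (n + 2)) A"
    have "\<xi> (n + 2) = \<xi>' (n + 2)" using ag n by (simp add: agree_def)
    thus "spn A (%j. fscale (sg (j ! (n + 1))) (Z \<xi> (take (n + 1) j)) + fscale (- 1) (Z \<xi> (take n j))) (10 * unit_bound A)"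
     using A n by (intro spn_step) (auto simp: n0_def)
   next
    fix A and a :: "bool list => real" assume A: "A \<subseteq> strings (n + 2)"
    have fin: "finite A" using A finite_strings by (rule finite_subset)
    have im: "take (n + 1) ` A \<subseteq> upto_len M" "take n ` A \<subseteq> upto_len M" using n by auto
    show "nrm X (\<Sum>j\<in>A. fscale (of_real (a j)) (fscale (sg (j ! (n + 1))) (R (take (n + 1) j)) + fscale (- 1) (R (take n j))))
     \<le> K * nrm X (\<Sum>j\<in>A. fscale (of_real (a j)) (fscale (sg (j ! (n + 1))) (Z \<xi> (take (n + 1) j)) + fscale (- 1) (Z \<xi> (take n j))))"
     unfolding fscale_add_right fscale_fscale by (rule collect_bound[OF lin fin finite_upto_len im])
   qed (use Rv n in auto)
  qed
  have "norm (lmean \<xi>' n R) \<le> K * ?B * (\<Sum>L\<in>{n + 2..<Suc M}. eps L)" if "n \<le> M - 2" "n0 \<le> n" for n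
   using that
  proof (induction n rule: inc_induct)
   case base
   have "{M - 2 + 2..<Suc M} = {M}" using M by auto
   thus ?case using last by simp
  next
   case (step n)
   have s: "norm (lmean \<xi>' (n + 1) R - lmean \<xi>' n R) \<le> K * ?B * eps (n + 2)"
    by (rule incr) (use step.hyps step.prems in auto)
   have "norm (lmean \<xi>' n R) \<le> norm (lmean \<xi>' (n + 1) R) + norm (lmean \<xi>' (n + 1) R - lmean \<xi>' n R)"
    using norm_triangle_sub[of "lmean \<xi>' n R" "lmean \<xi>' (n + 1) R"] by (simp add: norm_minus_commute)
   also have "... \<le> K * ?B * (\<Sum>L\<in>{Suc n + 2..<Suc M}. eps L) + K * ?B * eps (n + 2)"
    using step.IH step.prems s by simp
   also have "... = K * ?B * (\<Sum>L\<in>{n + 2..<Suc M}. eps L)"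
   proof -
    have "n + 2 < Suc M" using step.hyps M by simp
    hence "(\<Sum>L\<in>{n + 2..<Suc M}. eps L) = eps (n + 2) + (\<Sum>L\<in>{Suc n + 2..<Suc M}. eps L)"
     using sum.atLeast_Suc_lessThan[of "n + 2" "Suc M" eps] by (simp only: add_Suc)
    thus ?thesis by (simp only: distrib_left add.commute)
   qed
   finally show ?case .
  qed
  from this[of n0] have "norm (lmean \<xi>' n0 R) \<le> K * ?B * (\<Sum>L\<in>{n0 + 2..<Suc M}. eps L)" using M by simp
  also have "... \<le> K * ?B * (\<delta> / ?B)"
  proof (rule mult_left_mono)
   have "norm (\<Sum>L\<in>{n0 + 2..<Suc M}. eps L) < \<delta> / ?B" by (rule n1) (simp add: n0_def)
   thus "(\<Sum>L\<in>{n0 + 2..<Suc M}. eps L) \<le> \<delta> / ?B" unfolding real_norm_def by linarith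
  qed (use K in simp)
  also have "... = K * \<delta>" using B by simp
  finally show ?thesis .
 qed
 have "small \<delta> n0"
  unfolding small_def
 proof (intro allI impI)
  fix K M \<xi> \<xi>' R
  assume a: "0 \<le> K" "n0 + 2 \<le> M" "agree {..<M} \<xi> \<xi>'" "\<xi> M \<noteq> \<xi>' M" and R: "\<forall>i. length i \<le> M --> R i \<in> Y \<xi>'"
   and bd: "\<forall>a. nrm X (\<Sum>i\<in>upto_len M. fscale (a i) (R i)) \<le> K * nrm X (Zs \<xi> M a)"
  show "norm (lmean \<xi>' n0 R) \<le> K * \<delta>"
  proof (rule main[OF a])
   show "R i \<in> Y \<xi>'" if "length i \<le> M" for i using R that by blast
   show "nrm X (\<Sum>i\<in>upto_len M. fscale (c i) (R i)) \<le> K * nrm X (Zs \<xi> M c)" for c using bd by blast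
  qed
 qed
 thus ?thesis ..
qed

section \<open>The subspaces are closed and infinite-dimensional\<close>

lemma Zs_extend: "L \<le> M ==> Zs \<xi> L a = Zs \<xi> M (%i. if length i \<le> L then a i else 0)"
 unfolding Zs_def by (rule sum.mono_neutral_cong_left) (use finite_upto_len in auto)

lemma Zs_add: "Zs \<xi> L a + Zs \<xi> L a' = Zs \<xi> L (%i. a i + a' i)"
 by (simp only: Zs_def fscale_add_left sum.distrib)

lemma Zs_scale: "fscale s (Zs \<xi> L a) = Zs \<xi> L (%i. s * a i)"
 by (simp only: Zs_def fscale_sum fscale_fscale)

lemma Zs_in_Y: "Zs \<xi> L a \<in> Y \<xi>"
proof -
 have "\<exists>L' a'. nrm X (Zs \<xi> L a - Zs \<xi> L' a') < e" if "0 < e" for e :: real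
  using that by (intro exI[of _ L] exI[of _ a]) simp
 thus ?thesis by (simp add: Y_def)
qed

lemma Z_single: "Z \<xi> i = Zs \<xi> (length i) (%j. if j = i then 1 else 0)"
proof -
 have "Zs \<xi> (length i) (%j. if j = i then 1 else 0) = (\<Sum>j\<in>upto_len (length i). if j = i then Z \<xi> i else 0)"
  unfolding Zs_def by (intro sum.cong refl) simp
 also have "... = Z \<xi> i" by (simp add: finite_upto_len)
 finally show ?thesis by simp
qed

lemma Z_in_Y: "Z \<xi> i \<in> Y \<xi>"
 unfolding Z_single by (rule Zs_in_Y)

lemma Y_add: "x \<in> Y \<xi> ==> y \<in> Y \<xi> ==> x + y \<in> Y \<xi>"
proof -
 assume xy: "x \<in> Y \<xi>" "y \<in> Y \<xi>"
 note v = Y_vecs[OF xy(1)] Y_vecs[OF xy(2)]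
 have "\<exists>L a. nrm X (x + y - Zs \<xi> L a) < e" if e: "0 < e" for e
 proof -
  have e2: "0 < e / 2" using e by simp
  obtain L a where a: "nrm X (x - Zs \<xi> L a) < e / 2" using xy(1) e2 unfolding Y_def by blast
  obtain L' a' where a': "nrm X (y - Zs \<xi> L' a') < e / 2" using xy(2) e2 unfolding Y_def by blast
  obtain M c where M: "Zs \<xi> L a + Zs \<xi> L' a' = Zs \<xi> M c"
   unfolding Zs_extend[OF max.cobounded1[of L L']] Zs_extend[OF max.cobounded2[of L' L]] Zs_add by blast
  have "nrm X ((x - Zs \<xi> L a) + (y - Zs \<xi> L' a')) \<le> nrm X (x - Zs \<xi> L a) + nrm X (y - Zs \<xi> L' a')"
   using v by (intro triangle) auto
  also have "... < e" using a a' by simp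
  also have "(x - Zs \<xi> L a) + (y - Zs \<xi> L' a') = x + y - Zs \<xi> M c" unfolding M[symmetric] by (simp add: algebra_simps)
  finally show ?thesis by blast
 qed
 thus ?thesis using v by (simp add: Y_def)
qed

lemma Y_scale: "y \<in> Y \<xi> ==> fscale s y \<in> Y \<xi>"
proof -
 assume y: "y \<in> Y \<xi>"
 note v = Y_vecs[OF y]
 have "\<exists>L a. nrm X (fscale s y - Zs \<xi> L a) < e" if e: "0 < e" for e
 proof -
  have "0 < e / (norm s + 1)" using e by (simp add: add_nonneg_pos)
  then obtain L a where a: "nrm X (y - Zs \<xi> L a) < e / (norm s + 1)" using y unfolding Y_def by blast
  have "nrm X (fscale s y - Zs \<xi> L (%i. s * a i)) = norm s * nrm X (y - Zs \<xi> L a)"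
   unfolding Zs_scale[symmetric] fscale_diff_right[symmetric] using v by (intro scale) auto
  also have "... \<le> norm s * (e / (norm s + 1))" using a by (intro mult_left_mono) auto
  also have "... < e"
  proof -
   have "0 < norm s + 1" by (simp add: add_nonneg_pos)
   thus ?thesis using e by (simp add: field_simps)
  qed
  finally show ?thesis by blast
 qed
 thus ?thesis using v by (simp add: Y_def)
qed

lemma Y_zero: "0 \<in> Y \<xi>"
 using Y_scale[OF Z_in_Y, of 0] by simp

lemma Y_closed: "closedin (norm_topology X) (Y \<xi>)"
 unfolding topology_eq closedin_metric
proof (intro conjI allI impI)
 show "Y \<xi> \<subseteq> vecs X" using Y_vecs by blast
 fix x assume x: "x \<in> vecs X - Y \<xi>"
 then obtain e where e: "0 < e" "!!L a. e \<le> nrm X (x - Zs \<xi> L a)" unfolding Y_def by (auto simp: not_less)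
 have "disjnt (Y \<xi>) (mball x (e / 2))"
  unfolding disjnt_iff
 proof (intro allI notI, elim conjE)
  fix y assume y: "y \<in> Y \<xi>" "y \<in> mball x (e / 2)"
  have e2: "0 < e / 2" using e by simp
  obtain L a where a: "nrm X (y - Zs \<xi> L a) < e / 2" using y(1) e2 unfolding Y_def by blast
  have "nrm X (x - y) < e / 2" using y(2) by (auto simp: norm_dist_def split: if_splits)
  hence "nrm X (x - Zs \<xi> L a) < e" using nrm_diff_triangle[of x y "Zs \<xi> L a"] x Y_vecs[OF y(1)] a by simp
  thus False using e(2)[of L a] by simp
 qed
 thus "\<exists>r>0. disjnt (Y \<xi>) (mball x r)" using e(1) by (intro exI[of _ "e / 2"]) simp
qed

lemma Y_infinite_dimensional: "\<not> (\<exists>B. finite B \<and> Y \<xi> \<subseteq> module.span fscale B)"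
proof
 assume "\<exists>B. finite B \<and> Y \<xi> \<subseteq> module.span fscale B"
 then obtain B where B: "finite B" "Y \<xi> \<subseteq> module.span fscale B" by blast
 interpret VS: vector_space "fscale :: 'k => ('i => 'k) => 'i => 'k" by (rule fscale_vector_space)
 have inj: "inj (Z \<xi>)"
 proof (rule injI)
  fix i k assume "Z \<xi> i = Z \<xi> k"
  hence "u \<xi> i (Z \<xi> i) = u \<xi> i (Z \<xi> k)" by simp
  thus "i = k" by (simp add: u_Z split: if_splits)
 qed
 have "VS.independent (range (Z \<xi>))"
  unfolding VS.dependent_def
 proof
  assume "\<exists>a\<in>range (Z \<xi>). a \<in> VS.span (range (Z \<xi>) - {a})"
  then obtain i where i: "Z \<xi> i \<in> VS.span (range (Z \<xi>) - {Z \<xi> i})" by blast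
  have "VS.span (range (Z \<xi>) - {Z \<xi> i}) \<subseteq> {x \<in> vecs X. u \<xi> i x = 0}"
  proof (rule VS.span_minimal)
   show "range (Z \<xi>) - {Z \<xi> i} \<subseteq> {x \<in> vecs X. u \<xi> i x = 0}" by (auto simp: u_Z)
   show "VS.subspace {x \<in> vecs X. u \<xi> i x = 0}"
    using functionalD(2,3)[OF u_functional] functional_zero[OF u_functional] by (auto simp: VS.subspace_def)
  qed
  hence "u \<xi> i (Z \<xi> i) = 0" using i by blast
  thus False by (simp add: u_Z)
 qed
 moreover have "range (Z \<xi>) \<subseteq> VS.span B" using B(2) Z_in_Y by blast
 ultimately have "finite (range (Z \<xi>))" using VS.independent_span_bound[OF B(1)] by blast
 hence "finite (UNIV :: bool list set)" using inj by (rule finite_imageD)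
 thus False by (simp add: infinite_UNIV_listI)
qed

lemma Y_SB: "Y \<xi> \<in> SB X"
proof -
 interpret VS: vector_space "fscale :: 'k => ('i => 'k) => 'i => 'k" by (rule fscale_vector_space)
 have "VS.subspace (Y \<xi>)" using Y_add Y_scale Y_zero by (simp add: VS.subspace_def)
 thus ?thesis using Y_closed Y_infinite_dimensional Y_vecs by (auto simp: SB_def)
qed

section \<open>Subspaces with \<open>E\<^sub>0\<close>-equivalent indices\<close>

definition blin :: "(('i => 'k) => 'i => 'k) => bool"
 where "blin T \<longleftrightarrow> (\<forall>x\<in>vecs X. T x \<in> vecs X) \<and> (\<forall>x\<in>vecs X. \<forall>y\<in>vecs X. T (x + y) = T x + T y) \<and>
  (\<forall>x\<in>vecs X. \<forall>a. T (fscale a x) = fscale a (T x)) \<and> (\<exists>K\<ge>0. \<forall>x\<in>vecs X. nrm X (T x) \<le> K * nrm X x)"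

lemma blinD:
 assumes "blin T"
 shows "x \<in> vecs X ==> T x \<in> vecs X" "x \<in> vecs X ==> y \<in> vecs X ==> T (x + y) = T x + T y"
  "x \<in> vecs X ==> T (fscale a x) = fscale a (T x)" "\<exists>K\<ge>0. \<forall>x\<in>vecs X. nrm X (T x) \<le> K * nrm X x"
 using assms by (simp_all add: blin_def)

lemma blin_diff: "blin T ==> x \<in> vecs X ==> y \<in> vecs X ==> T (x - y) = T x - T y"
 using blinD(2)[of T x "- y"] blinD(3)[of T y "- 1"] by (simp add: fscale_minus_one)

lemma blin_zero: "blin T ==> T 0 = 0"
 using blinD(3)[of T 0 0] by simp

lemma blin_sum: "blin T ==> (!!i. i \<in> I ==> x i \<in> vecs X) ==> T (\<Sum>i\<in>I. x i) = (\<Sum>i\<in>I. T (x i))"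
proof (induction I rule: infinite_finite_induct)
 case (insert i I)
 have "T (x i + sum x I) = T (x i) + T (sum x I)" using insert.prems by (intro blinD(2) sum_in) auto
 moreover have "T (sum x I) = (\<Sum>i\<in>I. T (x i))" using insert by blast
 ultimately show ?case by (simp only: sum.insert[OF insert(1,2)])
qed (auto simp: blin_zero)

lemma blin_Y:
 assumes T: "blin T" and Z: "!!i. T (Z \<xi> i) = Z \<eta> i" and y: "y \<in> Y \<xi>"
 shows "T y \<in> Y \<eta>"
proof -
 obtain K where K: "0 \<le> K" "!!x. x \<in> vecs X ==> nrm X (T x) \<le> K * nrm X x" using blinD(4)[OF T] by blast
 have TZ: "T (Zs \<xi> L a) = Zs \<eta> L a" for L a
  unfolding Zs_def by (subst blin_sum[OF T]) (auto simp: blinD(3)[OF T] Z)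
 have "\<exists>L a. nrm X (T y - Zs \<eta> L a) < e" if e: "0 < e" for e
 proof -
  have "0 < e / (K + 1)" using e K by simp
  then obtain L a where a: "nrm X (y - Zs \<xi> L a) < e / (K + 1)" using y unfolding Y_def by blast
  have "nrm X (T y - Zs \<eta> L a) = nrm X (T (y - Zs \<xi> L a))"
   using blin_diff[OF T, of y "Zs \<xi> L a"] Y_vecs[OF y] by (simp add: TZ)
  also have "... \<le> K * nrm X (y - Zs \<xi> L a)" using Y_vecs[OF y] by (intro K) simp
  also have "... \<le> K * (e / (K + 1))" using a K by (intro mult_left_mono) auto
  also have "... < e" using K e by (simp add: field_simps)
  finally show ?thesis by blast
 qed
 thus ?thesis using blinD(1)[OF T] Y_vecs[OF y] by (simp add: Y_def)
qed

lemma blin_id_on_Y: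
 assumes T: "blin T" and Z: "!!i. T (Z \<xi> i) = Z \<xi> i" and y: "y \<in> Y \<xi>"
 shows "T y = y"
proof -
 obtain K where K: "0 \<le> K" "!!x. x \<in> vecs X ==> nrm X (T x) \<le> K * nrm X x" using blinD(4)[OF T] by blast
 have TZ: "T (Zs \<xi> L a) = Zs \<xi> L a" for L a
  unfolding Zs_def by (subst blin_sum[OF T]) (auto simp: blinD(3)[OF T] Z)
 have yv: "y \<in> vecs X" "T y \<in> vecs X" using Y_vecs[OF y] blinD(1)[OF T] by auto
 have "nrm X (T y - y) \<le> 0 + e" if e: "0 < e" for e
 proof -
  have "0 < e / (K + 1)" using e K by simp
  then obtain L a where a: "nrm X (y - Zs \<xi> L a) < e / (K + 1)" using y unfolding Y_def by blast
  have eq: "T y - y = T (y - Zs \<xi> L a) - (y - Zs \<xi> L a)" using blin_diff[OF T yv(1), of "Zs \<xi> L a"] by (simp add: TZ)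
  have "nrm X (T y - y) \<le> nrm X (T (y - Zs \<xi> L a)) + nrm X (y - Zs \<xi> L a)"
   unfolding eq using blinD(1)[OF T] yv by (intro nrm_diff) auto
  also have "... \<le> K * nrm X (y - Zs \<xi> L a) + nrm X (y - Zs \<xi> L a)" using yv by (intro add_right_mono K) simp
  also have "... = (K + 1) * nrm X (y - Zs \<xi> L a)" by (simp add: algebra_simps)
  also have "... \<le> (K + 1) * (e / (K + 1))" using a K by (intro mult_left_mono) auto
  also have "... = e" using K by simp
  finally show ?thesis by simp
 qed
 hence "nrm X (T y - y) \<le> 0" by (rule field_le_epsilon)
 hence "T y - y = 0" using eq_0[of "T y - y"] nonneg[of "T y - y"] yv by (metis antisym diff_in)
 thus ?thesis by simp
qed

definition swap :: "nat => (nat => bool) => (nat => bool) => ('i => 'k) => 'i => 'k"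
 where "swap M \<xi> \<eta> x = x + (\<Sum>j\<in>upto_len M. fscale (ev (\<xi> (length j)) j x) (V (\<eta> (length j)) j - V (\<xi> (length j)) j))"

lemma swap_blin: "blin (swap M \<xi> \<eta>)"
 unfolding blin_def
proof (intro conjI ballI allI)
 fix x assume x: "x \<in> vecs X"
 show "swap M \<xi> \<eta> x \<in> vecs X" using x by (simp add: swap_def)
 show "swap M \<xi> \<eta> (x + y) = swap M \<xi> \<eta> x + swap M \<xi> \<eta> y" if y: "y \<in> vecs X" for y
  unfolding swap_def by (simp add: ev_add[OF x y] fscale_add_left sum.distrib algebra_simps)
 show "swap M \<xi> \<eta> (fscale a x) = fscale a (swap M \<xi> \<eta> x)" for a
  unfolding swap_def by (simp add: functionalD(3)[OF ev x] fscale_add_right fscale_sum fscale_fscale)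
next
 let ?d = "%j. V (\<eta> (length j)) j - V (\<xi> (length j)) j"
 let ?n = "%j. dnrm (ev (\<xi> (length j)) j)"
 show "\<exists>K\<ge>0. \<forall>x\<in>vecs X. nrm X (swap M \<xi> \<eta> x) \<le> K * nrm X x"
 proof (intro exI[of _ "1 + (\<Sum>j\<in>upto_len M. ?n j * nrm X (?d j))"] conjI ballI)
  show "0 \<le> 1 + (\<Sum>j\<in>upto_len M. ?n j * nrm X (?d j))"
   by (intro add_nonneg_nonneg sum_nonneg mult_nonneg_nonneg dual_nonneg ev nonneg) auto
  fix x assume x: "x \<in> vecs X"
  have "nrm X (swap M \<xi> \<eta> x) \<le> nrm X x + nrm X (\<Sum>j\<in>upto_len M. fscale (ev (\<xi> (length j)) j x) (?d j))"
   unfolding swap_def using x by (intro triangle) auto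
  also have "... \<le> nrm X x + (\<Sum>j\<in>upto_len M. nrm X (fscale (ev (\<xi> (length j)) j x) (?d j)))"
   by (intro add_left_mono nrm_sum) auto
  also have "... \<le> nrm X x + (\<Sum>j\<in>upto_len M. ?n j * nrm X (?d j) * nrm X x)"
  proof (intro add_left_mono sum_mono)
   fix j
   have "nrm X (fscale (ev (\<xi> (length j)) j x) (?d j)) = norm (ev (\<xi> (length j)) j x) * nrm X (?d j)" by (intro scale) auto
   also have "... \<le> (?n j * nrm X x) * nrm X (?d j)" using dual_bound[OF ev x] by (intro mult_right_mono) auto
   finally show "nrm X (fscale (ev (\<xi> (length j)) j x) (?d j)) \<le> ?n j * nrm X (?d j) * nrm X x" by (simp add: mult_ac)
  qed
  also have "... = (1 + (\<Sum>j\<in>upto_len M. ?n j * nrm X (?d j))) * nrm X x" by (simp add: distrib_right sum_distrib_right)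
  finally show "nrm X (swap M \<xi> \<eta> x) \<le> (1 + (\<Sum>j\<in>upto_len M. ?n j * nrm X (?d j))) * nrm X x" .
 qed
qed

text \<open>Strings longer than M are not touched by the operator; there \<xi> and \<eta> already
  select the same copy.\<close>

lemma swap_V:
 assumes "!!n. M \<le> n ==> \<xi> n = \<eta> n" and c: "c = \<xi> (length j)"
 shows "swap M \<xi> \<eta> (V c j) = V (\<eta> (length j)) j"
proof -
 have "(\<Sum>k\<in>upto_len M. fscale (ev (\<xi> (length k)) k (V c j)) (V (\<eta> (length k)) k - V (\<xi> (length k)) k))
  = (\<Sum>k\<in>upto_len M. if k = j then V (\<eta> (length j)) j - V (\<xi> (length j)) j else 0)"
  by (intro sum.cong refl) (simp add: ev_V c)
 also have "... = (if length j \<le> M then V (\<eta> (length j)) j - V (\<xi> (length j)) j else 0)"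
  by (simp add: finite_upto_len)
 also have "... = V (\<eta> (length j)) j - V (\<xi> (length j)) j" using assms(1)[of "length j"] by simp
 finally show ?thesis by (simp add: swap_def c)
qed

lemma swap_Z:
 assumes "!!n. M \<le> n ==> \<xi> n = \<eta> n"
 shows "swap M \<xi> \<eta> (Z \<xi> i) = Z \<eta> i"
proof -
 note T = swap_blin[of M \<xi> \<eta>]
 have "swap M \<xi> \<eta> (Z \<xi> i) = swap M \<xi> \<eta> (V (\<xi> (length i + 1)) (i @ [False])) - swap M \<xi> \<eta> (V (\<xi> (length i + 1)) (i @ [True]))
  + (\<Sum>w\<in>strings 2. swap M \<xi> \<eta> (V (\<xi> (length i + 2)) (i @ w)))"
  unfolding Z_def by (simp add: blinD(2)[OF T] blin_diff[OF T] blin_sum[OF T])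
 also have "... = Z \<eta> i" unfolding Z_def
  by (intro arg_cong2[of _ _ _ _ "(+)"] arg_cong2[of _ _ _ _ "(-)"] sum.cong refl) (subst swap_V[OF assms], simp_all)+
 finally show ?thesis .
qed

text \<open>The operators \<open>swap\<close> in the two directions need not be inverse to each
  other on the whole space, but their compositions fix the generators and hence the closed
  subspaces.\<close>

theorem E0_isomorphic:
 assumes "E0 \<xi> \<eta>" shows "isomorphic_subspaces X (Y \<xi>) (Y \<eta>)"
proof -
 obtain M where M: "!!n. M \<le> n ==> \<xi> n = \<eta> n" using assms by (auto simp: E0_def)
 define T where "T = swap M \<xi> \<eta>"
 define S where "S = swap M \<eta> \<xi>"
 have T: "blin T" "!!i. T (Z \<xi> i) = Z \<eta> i" and S: "blin S" "!!i. S (Z \<eta> i) = Z \<xi> i"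
  unfolding T_def S_def using swap_blin swap_Z M by simp_all
 have comp: "blin (%x. A (B x))" if A: "blin A" and B: "blin B" for A B
 proof -
  obtain K where K: "0 \<le> K" "!!x. x \<in> vecs X ==> nrm X (A x) \<le> K * nrm X x" using blinD(4)[OF A] by blast
  obtain K' where K': "0 \<le> K'" "!!x. x \<in> vecs X ==> nrm X (B x) \<le> K' * nrm X x" using blinD(4)[OF B] by blast
  have "nrm X (A (B x)) \<le> K * K' * nrm X x" if "x \<in> vecs X" for x
   using K(2)[OF blinD(1)[OF B that]] mult_left_mono[OF K'(2)[OF that] K(1)] by (simp add: mult.assoc)
  hence "\<exists>K\<ge>0. \<forall>x\<in>vecs X. nrm X (A (B x)) \<le> K * nrm X x" using K(1) K'(1) by (intro exI[of _ "K * K'"]) simp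
  thus ?thesis using blinD(1-3)[OF A] blinD(1-3)[OF B] unfolding blin_def by simp
 qed
 have ST: "S (T y) = y" if "y \<in> Y \<xi>" for y by (rule blin_id_on_Y[OF comp[OF S(1) T(1)] _ that]) (simp add: S T)
 have TS: "T (S y) = y" if "y \<in> Y \<eta>" for y by (rule blin_id_on_Y[OF comp[OF T(1) S(1)] _ that]) (simp add: S T)
 have TY: "T y \<in> Y \<eta>" if "y \<in> Y \<xi>" for y by (rule blin_Y[OF T that])
 have SY: "S y \<in> Y \<xi>" if "y \<in> Y \<eta>" for y by (rule blin_Y[OF S that])
 obtain K where K: "0 \<le> K" "!!x. x \<in> vecs X ==> nrm X (T x) \<le> K * nrm X x" using blinD(4)[OF T(1)] by blast
 obtain K' where K': "0 \<le> K'" "!!x. x \<in> vecs X ==> nrm X (S x) \<le> K' * nrm X x" using blinD(4)[OF S(1)] by blast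
 show ?thesis
  unfolding isomorphic_subspaces_def
 proof (intro exI[of _ T] conjI ballI allI exI[of _ "max K K'"])
  show "bij_betw T (Y \<xi>) (Y \<eta>)" by (rule bij_betw_byWitness[where f' = S]) (use ST TS TY SY in auto)
  fix x assume x: "x \<in> Y \<xi>"
  note v = Y_vecs[OF x]
  show "T (x + y) = T x + T y" if "y \<in> Y \<xi>" for y using blinD(2)[OF T(1) v Y_vecs[OF that]] .
  show "T (fscale a x) = fscale a (T x)" for a by (rule blinD(3)[OF T(1) v])
  have "nrm X (T x) \<le> K * nrm X x" by (rule K(2)[OF v])
  also have "... \<le> max K K' * nrm X x" using v by (intro mult_right_mono) auto
  finally show "nrm X (T x) \<le> max K K' * nrm X x" .
  have "nrm X x \<le> K' * nrm X (T x)" using K'(2)[of "T x"] ST[OF x] blinD(1)[OF T(1) v] by simp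
  also have "... \<le> max K K' * nrm X (T x)" using blinD(1)[OF T(1) v] by (intro mult_right_mono) auto
  finally show "nrm X x \<le> max K K' * nrm X (T x)" .
 qed
qed

section \<open>Measurability\<close>

text \<open>Generators of length at most L look at \<xi> up to the place L + 2, hence at a prefix of
  length L + 3.\<close>

lemma Zs_agree: "agree {..<L + 3} \<xi> \<xi>' ==> Zs \<xi> L a = Zs \<xi>' L a"
 unfolding Zs_def Z_def agree_def by (intro sum.cong refl) auto

text \<open>A point of the open set can be chosen among the finite combinations of generators, and
  these depend on a prefix of \<xi> only. So the generators of the Effros structure will have open
  preimages.\<close>

lemma Y_meets_open:
 assumes U: "openin (norm_topology X) U" and meets: "Y \<xi> \<inter> U \<noteq> {}"
 shows "\<exists>m. \<forall>\<xi>'. agree {..<m} \<xi> \<xi>' --> Y \<xi>' \<inter> U \<noteq> {}"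
proof -
 obtain y where y: "y \<in> Y \<xi>" "y \<in> U" using meets by blast
 obtain r where r: "0 < r" "mball y r \<subseteq> U" using U y(2) unfolding topology_eq openin_mtopology by blast
 obtain L a where a: "nrm X (y - Zs \<xi> L a) < r" using y(1) r(1) unfolding Y_def by blast
 have "Zs \<xi> L a \<in> mball y r" using a Y_vecs[OF y(1)] by (simp add: norm_dist_def)
 hence "Zs \<xi> L a \<in> U" using r(2) by blast
 hence "Y \<xi>' \<inter> U \<noteq> {}" if "agree {..<L + 3} \<xi> \<xi>'" for \<xi>'
  using Zs_agree[OF that, of a] Zs_in_Y[of \<xi>' L a] by auto
 thus ?thesis by blast
qed

end

lemma open_bool_sequences:
 fixes S :: "(nat => bool) set"
 assumes "!!x. x \<in> S ==> \<exists>F. finite F \<and> (\<forall>y. agree F x y --> y \<in> S)"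
 shows "open S"
proof (subst open_subopen, intro ballI)
 fix x assume "x \<in> S"
 then obtain F where F: "finite F" "!!y. agree F x y ==> y \<in> S" using assms by blast
 let ?T = "Pi\<^sub>E UNIV (%i. if i \<in> F then {x i} else UNIV)"
 have "open ?T"
 proof (rule open_PiE)
  show "finite {i. (if i \<in> F then {x i} else UNIV) \<noteq> UNIV}" by (rule finite_subset[OF _ F(1)]) auto
 qed (simp add: open_discrete)
 moreover have "x \<in> ?T" by (auto simp: PiE_iff)
 moreover have "?T \<subseteq> S"
 proof
  fix y assume "y \<in> ?T"
  hence y: "y i \<in> (if i \<in> F then {x i} else UNIV)" for i by (rule PiE_mem) simp
  have "agree F x y" unfolding agree_def
  proof
   fix i assume "i \<in> F"
   thus "x i = y i" using y[of i] by simp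
  qed
  thus "y \<in> S" by (rule F(2))
 qed
 ultimately show "\<exists>T. open T \<and> x \<in> T \<and> T \<subseteq> S" by blast
qed

theorem (in szankowski) Y_measurable:
 fixes A :: "nat => bool => bool" and h :: "nat => nat"
 shows "(%x. Y (%i. A i (x (h i)))) \<in> borel \<rightarrow>\<^sub>M effros X"
 unfolding effros_def
proof (rule measurable_measure_of)
 fix G assume "G \<in> {{F \<in> SB X. F \<inter> U \<noteq> {}} | U. openin (norm_topology X) U}"
 then obtain U where U: "G = {F \<in> SB X. F \<inter> U \<noteq> {}}" "openin (norm_topology X) U" by blast
 let ?f = "%x i. A i (x (h i))"
 have "open {x. Y (?f x) \<inter> U \<noteq> {}}"
 proof (rule open_bool_sequences)
  fix x assume "x \<in> {x. Y (?f x) \<inter> U \<noteq> {}}"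
  then obtain m where m: "!!\<xi>'. agree {..<m} (?f x) \<xi>' ==> Y \<xi>' \<inter> U \<noteq> {}"
   using Y_meets_open[OF U(2), of "?f x"] by auto
  have "Y (?f y) \<inter> U \<noteq> {}" if "agree (h ` {..<m}) x y" for y
   using that by (intro m) (auto simp: agree_def)
  thus "\<exists>F. finite F \<and> (\<forall>y. agree F x y --> y \<in> {x. Y (?f x) \<inter> U \<noteq> {}})"
   by (intro exI[of _ "h ` {..<m}"]) auto
 qed
 moreover have "(%x. Y (?f x)) -` G \<inter> space borel = {x. Y (?f x) \<inter> U \<noteq> {}}" using Y_SB by (auto simp: U(1))
 ultimately show "(%x. Y (?f x)) -` G \<inter> space borel \<in> sets borel" by simp
qed (use Y_SB in auto)

section \<open>The isomorphism relation is meager\<close>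

context szankowski
begin

definition iso :: "real => (nat => bool) => (nat => bool) => (('i => 'k) => 'i => 'k) => bool"
 where "iso C \<xi> \<eta> T \<longleftrightarrow> bij_betw T (Y \<xi>) (Y \<eta>) \<and> (\<forall>x\<in>Y \<xi>. \<forall>y\<in>Y \<xi>. T (x + y) = T x + T y) \<and>
  (\<forall>x\<in>Y \<xi>. \<forall>a. T (fscale a x) = fscale a (T x)) \<and> (\<forall>x\<in>Y \<xi>. nrm X (T x) \<le> C * nrm X x \<and> nrm X x \<le> C * nrm X (T x))"

lemma isomorphic_iso:
 assumes "isomorphic_subspaces X (Y \<xi>) (Y \<eta>)"
 obtains C :: nat and T where "iso (real (Suc C)) \<xi> \<eta> T"
proof -
 obtain T C0 where T: "bij_betw T (Y \<xi>) (Y \<eta>)" "!!x y. x \<in> Y \<xi> ==> y \<in> Y \<xi> ==> T (x + y) = T x + T y"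
  "!!x a. x \<in> Y \<xi> ==> T (fscale a x) = fscale a (T x)"
  and C0: "!!x. x \<in> Y \<xi> ==> nrm X (T x) \<le> C0 * nrm X x \<and> nrm X x \<le> C0 * nrm X (T x)"
  using assms unfolding isomorphic_subspaces_def by blast
 obtain C :: nat where C: "C0 \<le> real C" using real_arch_simple by blast
 have "nrm X (T x) \<le> real (Suc C) * nrm X x \<and> nrm X x \<le> real (Suc C) * nrm X (T x)" if x: "x \<in> Y \<xi>" for x
 proof -
  have "T x \<in> Y \<eta>" using T(1) x by (auto simp: bij_betw_def)
  hence "C0 * nrm X x \<le> real (Suc C) * nrm X x" "C0 * nrm X (T x) \<le> real (Suc C) * nrm X (T x)"
   using C Y_vecs x by (auto intro!: mult_right_mono)
  thus ?thesis using C0[OF x] by linarith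
 qed
 hence "iso (real (Suc C)) \<xi> \<eta> T" using T unfolding iso_def by blast
 thus thesis by (rule that)
qed

lemma Y_sum: "(!!i. i \<in> I ==> x i \<in> Y \<xi>) ==> (\<Sum>i\<in>I. x i) \<in> Y \<xi>"
proof (induction I rule: infinite_finite_induct)
 case (insert i I)
 thus ?case using Y_add[of "x i" \<xi> "sum x I"] by (simp only: sum.insert[OF insert(1,2)]) blast
qed (simp_all only: sum.infinite sum.empty not_False_eq_True Y_zero)

lemma Y_diff: "x \<in> Y \<xi> ==> y \<in> Y \<xi> ==> x - y \<in> Y \<xi>"
 using Y_add[of x \<xi> "fscale (- 1) y"] Y_scale[of y \<xi> "- 1"] by (simp add: fscale_minus_one)

lemma iso_sum:
 assumes T: "iso C \<xi> \<eta> T" and x: "!!i. i \<in> I ==> x i \<in> Y \<xi>"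
 shows "T (\<Sum>i\<in>I. fscale (a i) (x i)) = (\<Sum>i\<in>I. fscale (a i) (T (x i)))"
proof -
 have sc: "T (fscale c y) = fscale c (T y)" if "y \<in> Y \<xi>" for c y using T that unfolding iso_def by blast
 have zero: "T 0 = 0" using sc[OF Y_zero, of 0] by simp
 show ?thesis
  using x
 proof (induction I rule: infinite_finite_induct)
  case (insert i I)
  have "T (fscale (a i) (x i) + (\<Sum>i\<in>I. fscale (a i) (x i))) = T (fscale (a i) (x i)) + T (\<Sum>i\<in>I. fscale (a i) (x i))"
  proof -
   have "fscale (a i) (x i) \<in> Y \<xi>" "(\<Sum>i\<in>I. fscale (a i) (x i)) \<in> Y \<xi>" using insert.prems by (auto intro!: Y_sum Y_scale)
   thus ?thesis using T unfolding iso_def by blast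
  qed
  moreover have "T (fscale (a i) (x i)) = fscale (a i) (T (x i))" using insert.prems by (intro sc) simp
  moreover have "T (\<Sum>i\<in>I. fscale (a i) (x i)) = (\<Sum>i\<in>I. fscale (a i) (T (x i)))" using insert by blast
  ultimately show ?case by (simp only: sum.insert[OF insert(1,2)])
 qed (simp_all only: sum.infinite sum.empty not_False_eq_True zero)
qed

lemma iso_inverse:
 assumes T: "iso C \<xi> \<eta> T"
 obtains S where "iso C \<eta> \<xi> S" "!!y. y \<in> Y \<eta> ==> T (S y) = y" "!!x. x \<in> Y \<xi> ==> S (T x) = x"
proof -
 define S where "S = inv_into (Y \<xi>) T"
 have bij: "bij_betw T (Y \<xi>) (Y \<eta>)" using T by (simp add: iso_def)
 have S: "bij_betw S (Y \<eta>) (Y \<xi>)" unfolding S_def by (rule bij_betw_inv_into[OF bij])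
 have TS: "T (S y) = y" if "y \<in> Y \<eta>" for y unfolding S_def by (rule bij_betw_inv_into_right[OF bij that])
 have ST: "S (T x) = x" if "x \<in> Y \<xi>" for x unfolding S_def by (rule bij_betw_inv_into_left[OF bij that])
 have Sin: "S y \<in> Y \<xi>" if "y \<in> Y \<eta>" for y using S that by (auto simp: bij_betw_def)
 have add: "S (x + y) = S x + S y" if "x \<in> Y \<eta>" "y \<in> Y \<eta>" for x y
 proof -
  have "T (S x + S y) = x + y" using T Sin that TS unfolding iso_def by simp
  thus ?thesis using ST[OF Y_add[OF Sin[OF that(1)] Sin[OF that(2)]]] by simp
 qed
 have scl: "S (fscale a y) = fscale a (S y)" if "y \<in> Y \<eta>" for a y
 proof -
  have "T (fscale a (S y)) = fscale a y" using T Sin that TS unfolding iso_def by simp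
  thus ?thesis using ST[OF Y_scale[OF Sin[OF that], of a]] by simp
 qed
 have "nrm X (S y) \<le> C * nrm X y \<and> nrm X y \<le> C * nrm X (S y)" if "y \<in> Y \<eta>" for y
  using T Sin[OF that] TS[OF that] unfolding iso_def by metis
 hence "iso C \<eta> \<xi> S" using S add scl unfolding iso_def by blast
 thus thesis by (rule that[OF _ TS ST])
qed

text \<open>At a fixed level \<open>u \<xi> i\<close> depends on \<xi> through a single bit, so only
  finitely many functionals occur.\<close>

lemma u_bound: "\<exists>U\<ge>0. \<forall>\<xi>. \<forall>i\<in>strings n. \<forall>x\<in>vecs X. norm (u \<xi> i x) \<le> U * nrm X x"
proof -
 let ?n = "%c i. dnrm (u (%_. c) i)"
 define U where "U = (\<Sum>i\<in>strings n. ?n True i + ?n False i)"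
 have n0: "0 \<le> ?n c i" for c i by (rule dual_nonneg[OF u_functional])
 have "norm (u \<xi> i x) \<le> U * nrm X x" if i: "i \<in> strings n" and x: "x \<in> vecs X" for \<xi> i x
 proof -
  have "u \<xi> i x = u (%_. \<xi> (length i + 1)) i x" by (simp add: u_def)
  also have "norm ... \<le> ?n (\<xi> (length i + 1)) i * nrm X x" by (rule dual_bound[OF u_functional x])
  also have "... \<le> (?n True i + ?n False i) * nrm X x"
   using n0[of True i] n0[of False i] x by (intro mult_right_mono) (cases "\<xi> (length i + 1)"; simp)+
  also have "... \<le> U * nrm X x"
  proof (rule mult_right_mono)
   show "?n True i + ?n False i \<le> U"
    unfolding U_def by (rule member_le_sum[OF i _ finite_strings]) (use n0 in \<open>simp add: add_nonneg_nonneg\<close>)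
  qed (use x in simp)
  finally show ?thesis .
 qed
 moreover have "0 \<le> U" unfolding U_def using n0 by (intro sum_nonneg add_nonneg_nonneg)
 ultimately show ?thesis by blast
qed

text \<open>Suppose that P meets every refinement of a pair of prefixes. Take (\<xi>1, \<eta>1) in
  P, and then (\<xi>2, \<eta>2) in P such that \<xi>2 leaves \<xi>1 exactly at M, while \<eta>2
  follows \<eta>1 so long that approximations t' of the vectors \<open>T1 (Z \<xi>1 i)\<close>
  belong to both target subspaces. The inverse of T2 carries them to vectors R in
  \<open>Y \<xi>2\<close>, and as a map of the generators of \<open>Y \<xi>1\<close> this is bounded
  by C (C + 1); so the mean at n0 is at most 1/4. But at level n0 both isomorphisms send the
  generators close to the same points w, so R is close to the generators of \<open>Y \<xi>2\<close>
  and the mean is within 1/2 of 1.\<close>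

lemma close_pairs_nowhere_dense:
 assumes C: "1 \<le> C" and n0: "small \<delta>1 n0" and \<delta>1: "C * (C + 1) * \<delta>1 \<le> 1 / 4"
  and U: "!!\<xi> i x. i \<in> strings n0 ==> x \<in> vecs X ==> norm (u \<xi> i x) \<le> U * nrm X x" "0 \<le> U"
  and \<delta>: "0 < \<delta>" "U * (C * (3 * \<delta>)) \<le> 1 / 2" and w: "!!i. i \<in> strings n0 ==> w i \<in> vecs X"
 defines "P \<equiv> %\<xi> \<eta>. \<exists>T. iso C \<xi> \<eta> T \<and> (\<forall>i\<in>strings n0. nrm X (T (Z \<xi> i) - w i) < \<delta>)"
 shows "nowhere_dense P" (is "\<forall>s t m. ?P s t m")
proof (intro allI, rule ccontr)
 fix s t m assume "\<not> ?P s t m"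
 hence H: "\<exists>\<xi> \<eta>. agree {..<m'} \<xi> s' \<and> agree {..<m'} \<eta> t' \<and> P \<xi> \<eta>"
  if "m \<le> m'" "agree {..<m} s' s" "agree {..<m} t' t" for s' t' m' using that by blast
 define M where "M = max m (n0 + 2)"
 define s1 where "s1 i = (if i = M then False else s i)" for i
 define s2 where "s2 i = (if i = M then True else s i)" for i
 obtain \<xi>1 \<eta>1 T1 where 1: "agree {..<Suc M} \<xi>1 s1" "agree {..<Suc M} \<eta>1 t" "iso C \<xi>1 \<eta>1 T1"
  "!!i. i \<in> strings n0 ==> nrm X (T1 (Z \<xi>1 i) - w i) < \<delta>"
 proof -
  have "agree {..<m} s1 s" "agree {..<m} t t" by (auto simp: agree_def M_def s1_def)
  moreover have "m \<le> Suc M" by (simp add: M_def)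
  ultimately obtain \<xi> \<eta> where "agree {..<Suc M} \<xi> s1" "agree {..<Suc M} \<eta> t" "P \<xi> \<eta>"
   using H[of "Suc M" s1 t] by blast
  thus thesis using that unfolding P_def by blast
 qed
 let ?K = "%i. dnrm (u \<xi>1 i)"
 define k where "k = (\<Sum>i\<in>upto_len M. ?K i)"
 have k: "0 \<le> k" unfolding k_def by (intro sum_nonneg dual_nonneg u_functional)
 \<comment> \<open>The i-th coefficient of a combination z of the generators is at most the norm of
   \<open>u \<xi>1 i\<close> times the norm of z, and k is the sum of these norms. Replacing the
   images by t' thus changes the image of z by at most the norm of z, which is the 1 in C +
   1.\<close>
 define \<delta>' where "\<delta>' = min \<delta> (1 / (k + 1))"
 have \<delta>': "0 < \<delta>'" "\<delta>' \<le> \<delta>" "\<delta>' * k \<le> 1"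
 proof -
  show "0 < \<delta>'" "\<delta>' \<le> \<delta>" using \<delta> k by (auto simp: \<delta>'_def)
  have "\<delta>' * k \<le> 1 / (k + 1) * k" using k by (intro mult_right_mono) (auto simp: \<delta>'_def)
  also have "... \<le> 1" using k by (simp add: field_simps)
  finally show "\<delta>' * k \<le> 1" .
 qed
 have T1Y: "T1 y \<in> Y \<eta>1" if "y \<in> Y \<xi>1" for y using 1(3) that unfolding iso_def bij_betw_def by blast
 have "\<forall>i. \<exists>L a. nrm X (T1 (Z \<xi>1 i) - Zs \<eta>1 L a) < \<delta>'"
  using T1Y[OF Z_in_Y] \<delta>'(1) unfolding Y_def by blast
 then obtain L a where La: "!!i. nrm X (T1 (Z \<xi>1 i) - Zs \<eta>1 (L i) (a i)) < \<delta>'" by metis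
 define t' where "t' i = Zs \<eta>1 (L i) (a i)" for i
 define m' where "m' = Suc M + (\<Sum>i\<in>upto_len M. L i + 3)"
 have m': "Suc M \<le> m'" "L i + 3 \<le> m'" if "length i \<le> M" for i
 proof -
  show "Suc M \<le> m'" by (simp add: m'_def)
  have "L i + 3 \<le> (\<Sum>i\<in>upto_len M. L i + 3)" by (rule member_le_sum) (use that finite_upto_len in auto)
  thus "L i + 3 \<le> m'" by (simp add: m'_def)
 qed
 have mM: "m \<le> M" "n0 + 2 \<le> M" "Suc M \<le> m'" by (auto simp: M_def m'_def)
 obtain \<xi>2 \<eta>2 T2 where 2: "agree {..<m'} \<xi>2 s2" "agree {..<m'} \<eta>2 \<eta>1" "iso C \<xi>2 \<eta>2 T2"
  "!!i. i \<in> strings n0 ==> nrm X (T2 (Z \<xi>2 i) - w i) < \<delta>"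
 proof -
  have "agree {..<m} s2 s" using mM by (auto simp: agree_def s2_def)
  moreover have "agree {..<m} \<eta>1 t" using 1(2) mM by (auto simp: agree_def)
  moreover have "m \<le> m'" using mM by simp
  ultimately obtain \<xi> \<eta> where "agree {..<m'} \<xi> s2" "agree {..<m'} \<eta> \<eta>1" "P \<xi> \<eta>" using H[of m' s2 \<eta>1] by blast
  thus thesis using that unfolding P_def by blast
 qed
 have split: "agree {..<M} \<xi>1 \<xi>2" "\<xi>1 M \<noteq> \<xi>2 M"
  using 1(1) 2(1) mM by (auto simp: agree_def s1_def s2_def)
 have t'Y: "t' i \<in> Y \<eta>2" if "length i \<le> M" for i
 proof -
  have "agree {..<L i + 3} \<eta>2 \<eta>1" using 2(2) m'(2)[OF that] by (auto simp: agree_def)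
  hence "Zs \<eta>2 (L i) (a i) = t' i" unfolding t'_def by (rule Zs_agree)
  thus ?thesis using Zs_in_Y[of \<eta>2 "L i" "a i"] by simp
 qed
 obtain S where S: "iso C \<eta>2 \<xi>2 S" "!!x. x \<in> Y \<xi>2 ==> S (T2 x) = x" by (rule iso_inverse[OF 2(3)]) blast
 have SC: "nrm X (S y) \<le> C * nrm X y" "S y \<in> Y \<xi>2" if "y \<in> Y \<eta>2" for y
  using S(1) that unfolding iso_def bij_betw_def by blast+
 define R where "R i = S (t' i)" for i
 have RY: "R i \<in> Y \<xi>2" if "length i \<le> M" for i unfolding R_def by (rule SC(2)[OF t'Y[OF that]])
 have "nrm X (\<Sum>i\<in>upto_len M. fscale (c i) (R i)) \<le> C * (C + 1) * nrm X (Zs \<xi>1 M c)" for c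
 proof -
  let ?z = "Zs \<xi>1 M c" and ?I = "upto_len M"
  have tv: "t' i \<in> vecs X" "T1 (Z \<xi>1 i) \<in> vecs X" for i using Y_vecs[OF T1Y[OF Z_in_Y]] by (simp_all add: t'_def)
  have ci: "norm (c i) \<le> ?K i * nrm X ?z" if "i \<in> ?I" for i
  proof -
   have "u \<xi>1 i ?z = (\<Sum>k\<in>?I. if k = i then c i else 0)"
    unfolding functional_Zs[OF u_functional] by (intro sum.cong refl) (auto simp: u_Z)
   also have "... = c i" using that by (simp add: finite_upto_len)
   finally show ?thesis using dual_bound[OF u_functional Zs_in, of \<xi>1 i \<xi>1 M c] by simp
  qed
  have Sum: "(\<Sum>i\<in>?I. fscale (c i) (R i)) = S (\<Sum>i\<in>?I. fscale (c i) (t' i))"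
   unfolding R_def by (rule iso_sum[OF S(1), symmetric]) (use t'Y in auto)
  have le: "nrm X (\<Sum>i\<in>?I. fscale (c i) (R i)) \<le> C * nrm X (\<Sum>i\<in>?I. fscale (c i) (t' i))"
   unfolding Sum by (intro SC(1) Y_sum Y_scale t'Y) auto
  have "nrm X (\<Sum>i\<in>?I. fscale (c i) (t' i)) \<le> nrm X (T1 ?z) + nrm X (\<Sum>i\<in>?I. fscale (c i) (t' i - T1 (Z \<xi>1 i)))"
  proof -
   have T1z: "T1 ?z = (\<Sum>i\<in>?I. fscale (c i) (T1 (Z \<xi>1 i)))" unfolding Zs_def by (rule iso_sum[OF 1(3) Z_in_Y])
   have e: "(\<Sum>i\<in>?I. fscale (c i) (t' i)) = T1 ?z + (\<Sum>i\<in>?I. fscale (c i) (t' i - T1 (Z \<xi>1 i)))"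
    unfolding T1z fscale_diff_right sum_subtractf by simp
   show ?thesis unfolding e using tv by (intro triangle sum_in scale_in diff_in) (auto simp: Y_vecs[OF T1Y[OF Zs_in_Y]])
  qed
  also have "nrm X (T1 ?z) \<le> C * nrm X ?z" using 1(3) Zs_in_Y unfolding iso_def by blast
  also have "nrm X (\<Sum>i\<in>?I. fscale (c i) (t' i - T1 (Z \<xi>1 i))) \<le> (\<Sum>i\<in>?I. \<delta>' * (?K i * nrm X ?z))"
  proof -
   have "nrm X (\<Sum>i\<in>?I. fscale (c i) (t' i - T1 (Z \<xi>1 i))) \<le> (\<Sum>i\<in>?I. nrm X (fscale (c i) (t' i - T1 (Z \<xi>1 i))))"
    using tv by (intro nrm_sum scale_in diff_in)
   also have "... \<le> (\<Sum>i\<in>?I. \<delta>' * (?K i * nrm X ?z))"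
   proof (rule sum_mono)
    fix i assume i: "i \<in> ?I"
    have "nrm X (fscale (c i) (t' i - T1 (Z \<xi>1 i))) = nrm X (t' i - T1 (Z \<xi>1 i)) * norm (c i)"
     using tv by (subst scale) (auto simp: mult.commute)
    also have "... \<le> \<delta>' * (?K i * nrm X ?z)"
     using La[of i] nrm_diff_commute[OF tv(1)[of i] tv(2)[of i]] ci[OF i] \<delta>'(1)
     by (intro mult_mono) (auto simp: t'_def)
    finally show "nrm X (fscale (c i) (t' i - T1 (Z \<xi>1 i))) \<le> \<delta>' * (?K i * nrm X ?z)" .
   qed
   finally show ?thesis .
  qed
  also have "(\<Sum>i\<in>?I. \<delta>' * (?K i * nrm X ?z)) = \<delta>' * k * nrm X ?z"
   by (simp add: k_def sum_distrib_left sum_distrib_right mult.assoc)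
  also have "... \<le> 1 * nrm X ?z" using \<delta>'(3) by (intro mult_right_mono) auto
  finally have "nrm X (\<Sum>i\<in>?I. fscale (c i) (t' i)) \<le> C * nrm X ?z + 1 * nrm X ?z" by simp
  hence "C * nrm X (\<Sum>i\<in>?I. fscale (c i) (t' i)) \<le> C * (C * nrm X ?z + 1 * nrm X ?z)"
   using C by (intro mult_left_mono) auto
  with le have "nrm X (\<Sum>i\<in>?I. fscale (c i) (R i)) \<le> C * (C * nrm X ?z + 1 * nrm X ?z)" by (rule order_trans)
  thus ?thesis by (simp add: algebra_simps)
 qed
 moreover have "0 \<le> C * (C + 1)" using C by simp
 ultimately have "norm (lmean \<xi>2 n0 R) \<le> C * (C + 1) * \<delta>1"
  using n0[unfolded small_def, rule_format, of "C * (C + 1)" M \<xi>1 \<xi>2 R] mM(2) split RY by blast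
 hence up: "norm (lmean \<xi>2 n0 R) \<le> 1 / 4" using \<delta>1 by linarith
 have near: "norm (u \<xi>2 i (R i) - 1) \<le> 1 / 2" if i: "i \<in> strings n0" for i
 proof -
  have iM: "length i \<le> M" using i mM by simp
  have T2v: "T2 (Z \<xi>2 i) \<in> Y \<eta>2" using 2(3) Z_in_Y unfolding iso_def bij_betw_def by blast
  have d: "t' i - T2 (Z \<xi>2 i) \<in> Y \<eta>2" by (rule Y_diff[OF t'Y[OF iM] T2v])
  have v: "t' i \<in> vecs X" "T1 (Z \<xi>1 i) \<in> vecs X" "T2 (Z \<xi>2 i) \<in> vecs X"
   using Y_vecs[OF t'Y[OF iM]] Y_vecs[OF T1Y[OF Z_in_Y]] Y_vecs[OF T2v] by auto
  have "R i = S (t' i - T2 (Z \<xi>2 i)) + Z \<xi>2 i"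
  proof -
   have "S ((t' i - T2 (Z \<xi>2 i)) + T2 (Z \<xi>2 i)) = S (t' i - T2 (Z \<xi>2 i)) + S (T2 (Z \<xi>2 i))"
    using S(1) d T2v unfolding iso_def by blast
   thus ?thesis using S(2)[OF Z_in_Y] by (simp add: R_def)
  qed
  hence "u \<xi>2 i (R i) - 1 = u \<xi>2 i (S (t' i - T2 (Z \<xi>2 i)))"
   using functionalD(2)[OF u_functional Y_vecs[OF SC(2)[OF d]] Z_in, of \<xi>2 i \<xi>2 i] by (simp add: u_Z)
  also have "norm ... \<le> U * nrm X (S (t' i - T2 (Z \<xi>2 i)))" by (rule U(1)[OF i Y_vecs[OF SC(2)[OF d]]])
  also have "... \<le> U * (C * (3 * \<delta>))"
  proof (rule mult_left_mono[OF _ U(2)])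
   have "nrm X (t' i - T2 (Z \<xi>2 i)) \<le> nrm X (t' i - T1 (Z \<xi>1 i)) + nrm X (T1 (Z \<xi>1 i) - T2 (Z \<xi>2 i))"
    by (rule nrm_diff_triangle[OF v])
   moreover have "nrm X (T1 (Z \<xi>1 i) - T2 (Z \<xi>2 i)) \<le> nrm X (T1 (Z \<xi>1 i) - w i) + nrm X (w i - T2 (Z \<xi>2 i))"
    by (rule nrm_diff_triangle[OF v(2) w[OF i] v(3)])
   ultimately have "nrm X (t' i - T2 (Z \<xi>2 i)) \<le> 3 * \<delta>"
    using La[of i, folded t'_def] nrm_diff_commute[OF v(1,2)] 1(4)[OF i] 2(4)[OF i] nrm_diff_commute[OF w[OF i] v(3)] \<delta>'(2)
    by linarith
   hence "C * nrm X (t' i - T2 (Z \<xi>2 i)) \<le> C * (3 * \<delta>)" using C by (intro mult_left_mono) auto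
   thus "nrm X (S (t' i - T2 (Z \<xi>2 i))) \<le> C * (3 * \<delta>)" using SC(1)[OF d] by linarith
  qed
  also have "... \<le> 1 / 2" by (rule \<delta>(2))
  finally show ?thesis .
 qed
 have "norm (\<Sum>i\<in>strings n0. u \<xi>2 i (R i) - 1) \<le> (\<Sum>i\<in>strings n0. 1 / 2)" by (rule sum_norm_le[OF near])
 hence "norm ((\<Sum>i\<in>strings n0. u \<xi>2 i (R i)) - 2 ^ n0) \<le> 2 ^ n0 * (1 / 2)"
  by (simp add: sum_subtractf card_strings)
 hence "norm (((\<Sum>i\<in>strings n0. u \<xi>2 i (R i)) - 2 ^ n0) / 2 ^ n0) \<le> 1 / 2"
  by (simp add: norm_divide norm_power divide_le_eq mult.commute)
 hence "norm (lmean \<xi>2 n0 R - 1) \<le> 1 / 2" by (simp add: lmean_def diff_divide_distrib)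
 moreover have "1 \<le> norm (lmean \<xi>2 n0 R) + norm (lmean \<xi>2 n0 R - 1)"
  using norm_triangle_ineq4[of "lmean \<xi>2 n0 R" "lmean \<xi>2 n0 R - 1"] by simp
 ultimately show False using up by linarith
qed

theorem ergodic:
 assumes Q: "countable Q" "Q \<subseteq> vecs X" "!!x e. x \<in> vecs X ==> 0 < e ==> \<exists>d\<in>Q. nrm X (x - d) < e"
 shows "ergodic X"
proof -
 have sep: "separable_space (norm_topology X)"
  unfolding separable_space_def topology_eq
 proof (intro exI[of _ Q] conjI)
  show "mtopology closure_of Q = topspace mtopology"
   unfolding metric_closure_of using Q(2,3) by (force simp: norm_dist_def)
 qed (use Q in auto)
 \<comment> \<open>The order of choice: n0 depends on C, U on n0, and \<delta> on C and U.\<close>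
 have "\<exists>n0 U \<delta>. small (1 / (4 * (real (Suc C) * (real (Suc C) + 1)))) n0 \<and> 0 \<le> U \<and> 0 < \<delta> \<and> U * (real (Suc C) * (3 * \<delta>)) \<le> 1 / 2 \<and>
  (\<forall>\<xi>. \<forall>i\<in>strings n0. \<forall>x\<in>vecs X. norm (u \<xi> i x) \<le> U * nrm X x)" for C :: nat
 proof -
  obtain n0 where n0: "small (1 / (4 * (real (Suc C) * (real (Suc C) + 1)))) n0"
   using small_exists[of "1 / (4 * (real (Suc C) * (real (Suc C) + 1)))"] by (auto simp: add_pos_pos)
  obtain U where U: "0 \<le> U" "\<forall>\<xi>. \<forall>i\<in>strings n0. \<forall>x\<in>vecs X. norm (u \<xi> i x) \<le> U * nrm X x" using u_bound[of n0] by blast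
  define c where "c = real (Suc C)"
  have c: "0 < c" by (simp add: c_def)
  define \<delta> where "\<delta> = 1 / (6 * c * (U + 1))"
  have "0 < \<delta>" using U(1) c by (simp add: \<delta>_def)
  moreover have "U * (c * (3 * \<delta>)) \<le> 1 / 2"
  proof -
   have "c * (3 * \<delta>) = 1 / (2 * (U + 1))" using c U(1) by (simp add: \<delta>_def divide_simps)
   thus ?thesis using U(1) by (simp add: divide_le_eq)
  qed
  ultimately show ?thesis using n0 U unfolding c_def[symmetric] by (intro exI[of _ n0] exI[of _ U] exI[of _ \<delta>] conjI)
 qed
 then obtain n0 U \<delta> where n0: "!!C :: nat. small (1 / (4 * (real (Suc C) * (real (Suc C) + 1)))) (n0 C)"
  and U: "!!C. 0 \<le> U C" "!!C \<xi> i x. i \<in> strings (n0 C) ==> x \<in> vecs X ==> norm (u \<xi> i x) \<le> U C * nrm X x"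
  and \<delta>: "!!C. 0 < \<delta> C" "!!C. U C * (real (Suc C) * (3 * \<delta> C)) \<le> 1 / 2"
  by metis
 \<comment> \<open>A countable index set for the cover: C bounds the isomorphism, and w approximates
   the images of the generators of level n0 by points of the dense set.\<close>
 define I where "I = (SIGMA C:UNIV. strings (n0 C) \<rightarrow>\<^sub>E Q)"
 have I: "countable I" unfolding I_def by (intro countable_SIGMA countable_PiE finite_strings Q) auto
 obtain q0 where q0: "q0 \<in> Q" using Q(3)[of 0 1] by auto
 have Ine: "I \<noteq> {}"
 proof -
  have "(0, restrict (%_. q0) (strings (n0 0))) \<in> I" using q0 by (auto simp: I_def)
  thus ?thesis by blast
 qed
 define P where "P = (%(C, w) \<xi> \<eta>. \<exists>T. iso (real (Suc C)) \<xi> \<eta> T \<and> (\<forall>i\<in>strings (n0 C). nrm X (T (Z \<xi> i) - w i) < \<delta> C))"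
 have cover: "\<exists>k. P (from_nat_into I k) \<xi> \<eta>" if isom: "isomorphic_subspaces X (Y \<xi>) (Y \<eta>)" for \<xi> \<eta>
 proof -
  obtain C T where T: "iso (real (Suc C)) \<xi> \<eta> T" by (rule isomorphic_iso[OF isom])
  have "\<exists>d\<in>Q. nrm X (T (Z \<xi> i) - d) < \<delta> C" for i
  proof (rule Q(3)[OF _ \<delta>(1)])
   show "T (Z \<xi> i) \<in> vecs X" using T Z_in_Y Y_vecs unfolding iso_def bij_betw_def by blast
  qed
  then obtain d where d: "!!i. d i \<in> Q" "!!i. nrm X (T (Z \<xi> i) - d i) < \<delta> C" by metis
  define x where "x = (C, restrict d (strings (n0 C)))"
  have "x \<in> I" using d(1) by (auto simp: x_def I_def)
  moreover have "P x \<xi> \<eta>" using T d(2) unfolding P_def x_def by auto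
  ultimately show ?thesis using from_nat_into_to_nat_on[OF I] by metis
 qed
 have nd: "nowhere_dense (P (from_nat_into I k))" for k
 proof -
  obtain C w where Cw: "from_nat_into I k = (C, w)" by fastforce
  have "(C, w) \<in> I" using from_nat_into[OF Ine, of k] Cw by simp
  hence w: "w i \<in> vecs X" if "i \<in> strings (n0 C)" for i using that Q(2) by (auto simp: I_def PiE_iff)
  have "real (Suc C) * (real (Suc C) + 1) * (1 / (4 * (real (Suc C) * (real (Suc C) + 1)))) \<le> 1 / 4"
  proof -
   have "0 < real (Suc C) * (real (Suc C) + 1)" by (intro mult_pos_pos) auto
   thus ?thesis by simp
  qed
  from close_pairs_nowhere_dense[OF _ n0 this U(2) U(1) \<delta>(1) \<delta>(2) w] show ?thesis unfolding Cw P_def by simp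
 qed
 obtain h A where red: "!!x y. E0 x y \<longleftrightarrow> isomorphic_subspaces X (Y (%i. A i (x (h i)))) (Y (%i. A i (y (h i))))"
  using E0_reduces_to_meager[of "%\<xi> \<eta>. isomorphic_subspaces X (Y \<xi>) (Y \<eta>)" "%k. P (from_nat_into I k)", OF E0_isomorphic cover nd]
  by metis
 show ?thesis
  unfolding ergodic_def by (intro conjI sep bexI[of _ "%x. Y (%i. A i (x (h i)))"] allI red Y_measurable)
qed

end

section \<open>Separability and conclusion\<close>

lemma countable_dense_subset:
 fixes X :: "('i, 'k::{real_normed_field, euclidean_space}) fspace"
 assumes "unc_basis X b co"
 shows "\<exists>Q. countable Q \<and> Q \<subseteq> vecs X \<and> (\<forall>x\<in>vecs X. \<forall>e>0. \<exists>d\<in>Q. nrm X (x - d) < e)"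
proof -
 interpret unc_basis X b co by (rule assms)
 \<comment> \<open>Here the scalars have to be separable, which \<open>euclidean_space\<close>
   guarantees; \<open>real\<close> and \<open>complex\<close> are instances.\<close>
 obtain K :: "'k set" where K: "countable K" "!!S. open S ==> S \<noteq> {} ==> \<exists>d\<in>K. d \<in> S"
  by (rule countable_dense_setE) blast
 define v where "v xs = (\<Sum>n<length xs. fscale (xs ! n) (b n))" for xs
 have vv: "v xs \<in> vecs X" for xs by (simp add: v_def)
 have "\<exists>d\<in>v ` lists K. nrm X (x - d) < e" if x: "x \<in> vecs X" and e: "0 < e" for x e
 proof -
  obtain a where a: "a \<in> c00" "nrm X (x - lc a) < e / 2" using dense[OF x, of "e / 2"] e by auto
  obtain m where m: "!!n. a n \<noteq> 0 ==> n < m" using c00_finite[OF a(1)] finite_nat_set_iff_bounded by auto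
  define r where "r = e / (2 * (real m + 1))"
  have r: "0 < r" using e by (simp add: r_def add_nonneg_pos)
  have "\<exists>d\<in>K. d \<in> ball (a n) r" for n using r by (intro K(2)) auto
  then obtain d where d: "!!n. d n \<in> K" "!!n. dist (a n) (d n) < r" by (metis mem_ball)
  have "lc a = (\<Sum>n<m. fscale (a n) (b n))" by (rule lin_comb_finite) (use m in auto)
  moreover have "v (map d [0..<m]) = (\<Sum>n<m. fscale (d n) (b n))" by (simp add: v_def)
  ultimately have "lc a - v (map d [0..<m]) = (\<Sum>n<m. fscale (a n - d n) (b n))"
   by (simp add: sum_subtractf[symmetric] fscale_def fun_eq_iff fun_sum algebra_simps)
  hence "nrm X (lc a - v (map d [0..<m])) \<le> (\<Sum>n<m. nrm X (fscale (a n - d n) (b n)))"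
   by (simp only:) (intro nrm_sum scale_in b_in)
  also have "... \<le> (\<Sum>n<m. r)"
   using d(2) by (intro sum_mono) (simp add: scale b_norm dist_norm less_imp_le)
  also have "... < e / 2"
  proof -
   have "real m * e < (real m + 1) * e" using e by simp
   thus ?thesis by (simp add: r_def field_simps)
  qed
  finally have "nrm X (x - v (map d [0..<m])) < e"
   using nrm_diff_triangle[OF x lc_in[of a] vv[of "map d [0..<m]"]] a(2) by simp
  moreover have "map d [0..<m] \<in> lists K" using d(1) by auto
  ultimately show ?thesis by blast
 qed
 moreover have "countable (v ` lists K)" using K(1) by simp
 ultimately show ?thesis using vv by (intro exI[of _ "v ` lists K"]) auto
qed

lemma has_systems_cong:
 assumes eq: "!!x. x \<in> c00 ==> M x = N x" and sys: "has_systems N \<sigma> C low"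
 shows "has_systems M \<sigma> C low"
proof -
 have d: "dbound N g r ==> dbound M g r" for g r by (simp add: dbound_def eq)
 have "bi_system M \<sigma> C low {..<k} n0 f g" if s: "bi_system N \<sigma> C low {..<k} n0 f g" for k n0 f g
 proof -
  have c: "comb B a f \<in> c00" if "B \<subseteq> {..<k}" for B a using s that by (intro comb_c00) (auto simp: bi_system_def)
  have n: "nbound N (comb B a f) r ==> nbound M (comb B a f) r" if "B \<subseteq> {..<k}" for B a r
   using c[OF that] by (simp add: nbound_def eq)
  have "upper2 (nbound N) \<sigma> C {..<k} f ==> upper2 (nbound M) \<sigma> C {..<k} f"
   "flat (nbound N) (1 - \<sigma>) C {..<k} f ==> flat (nbound M) (1 - \<sigma>) C {..<k} f"
   "upper2 (dbound N) \<sigma> C {..<k} g ==> upper2 (dbound M) \<sigma> C {..<k} g"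
   "flat (dbound N) (1 - \<sigma>) C {..<k} g ==> flat (dbound M) (1 - \<sigma>) C {..<k} g"
   unfolding upper2_def flat_def using n d by auto
  thus ?thesis using s unfolding bi_system_def by auto
 qed
 thus ?thesis using sys unfolding has_systems_def by metis
qed

theorem (in unc_basis) szankowski_ergodic:
 assumes sys: "has_systems N \<sigma> C low" "1 / 2 < \<sigma>" "0 < C"
  and Q: "\<exists>Q. countable Q \<and> Q \<subseteq> vecs X \<and> (\<forall>x\<in>vecs X. \<forall>e>0. \<exists>d\<in>Q. nrm X (x - d) < e)"
 shows "ergodic X"
proof -
 obtain V ev p q where "szankowski X V ev C p q" using szankowski_exists[OF sys] by blast
 thus ?thesis using szankowski.ergodic Q by blast
qed

theorem proposition23:
 fixes p r :: ereal and S :: "(nat, 'k::{real_normed_field, euclidean_space}) fspace"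
 assumes "1 \<le> p" and "p < r" and "S = schlumprecht_type_space p r"
 shows "\<not> near_hilbert S \<and> \<not> near_hilbert (dual_space S) \<and>
     ergodic S \<and> ergodic (dual_space S)"
proof -
 define N :: "(nat => 'k) => real" where "N = schlumprecht_type_norm p r"
 have good: "good_norm N" unfolding N_def by (rule schlumprecht_type_norm_good[OF assms(1,2)])
 hence lat: "lattice_norm N" and no_l1: "!!\<delta> C x. 0 < \<delta> ==> \<not> l1_blocks N \<delta> C x"
  by (simp_all add: good_norm_def)
 obtain \<sigma> C low where par: "1 / 2 < \<sigma>" "\<sigma> \<le> 1" "0 < C" and sys: "has_systems N \<sigma> C low"
  by (rule good_norm_systems[OF good])
 have S: "S = completion N" by (simp add: assms(3) schlumprecht_type_space_def N_def)
 interpret completed N by standard (rule lat)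
 let ?b = "%j x. if x \<in> vecs (completion N) then x j else 0"
 interpret B: unc_basis "completion N" unitv "%x. x" by (rule completion_basis)
 interpret D: unc_basis "dual_space (completion N)" ?b "%f n. f (unitv n)" by (rule dual_basis[OF no_l1])
 have "B.N x = N x" if "x \<in> c00" for x
 proof -
  have "B.lc x = x" using B.co_lc[OF that] by simp
  thus ?thesis using nrm_c00[OF that] by (simp add: B.N_def)
 qed
 hence sysB: "has_systems B.N \<sigma> C low" by (rule has_systems_cong[OF _ sys])
 have sysD: "has_systems D.N \<sigma> C (\<not> low)" by (rule dual_systems[OF no_l1 sys])
 have "ergodic S" unfolding S
  by (rule B.szankowski_ergodic[OF sysB par(1,3) countable_dense_subset[OF B.unc_basis_axioms]])
 moreover have "ergodic (dual_space S)" unfolding S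
  by (rule D.szankowski_ergodic[OF sysD par(1,3) countable_dense_subset[OF D.unc_basis_axioms]])
 ultimately show ?thesis
  using B.not_near_hilbert[OF sysB par] D.not_near_hilbert[OF sysD par] by (simp add: S)
qed

end
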